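(* Under the standing assumptions (L1) and (L2) listed in the context, the partially observed linear-quadratic zero-sum game described in the context has at least one saddle point, i.e. there exists $(\bar u_1(\cdot),\bar u_2(\cdot))\in\mathcal A_1^S\times\mathcal A_2^S$ with $J(\bar u_1,u_2)\le J(\bar u_1,\bar u_2)\le J(u_1,\bar u_2)$ for all $(u_1,u_2)\in\mathcal A_1^S\times\mathcal A_2^S$, and $$\sup_{u_2(\cdot)\in\mathcal A_2^S}\Big(\inf_{u_1(\cdot)\in\mathcal A_1^S}J(u_1(\cdot),u_2(\cdot))\Big)=\inf_{u_1(\cdot)\in\mathcal A_1^S}\Big(\sup_{u_2(\cdot)\in\mathcal A_2^S}J(u_1(\cdot),u_2(\cdot))\Big).$$
   Context: **Setting.** $0<T<\infty$; $(\Omega,\mathscr F,\mathbb P)$ is a complete probability space with two independent one-dimensional standard Brownian motions $W,Y$; $\mathscr F^W_t,\mathscr F^Y_t$ are their $\mathbb P$-completed natural filtrations, $\mathscr F_t=\mathscr F^W_t\vee\mathscr F^Y_t$, $\mathscr F=\mathscr F_T$; $\mathbb E$ is expectation under $\mathbb P$. For $i=1,2$, $\mathcal A_i^S=M^2_{\mathscr F^Y}(0,T;\mathbb R^{k_i})$ is the space of $\{\mathscr F^Y_t\}$-adapted $\mathbb R^{k_i}$-valued processes $u$ with $\|u\|^2=\mathbb E\int_0^T|u(t)|^2dt<\infty$. **Assumption (L1).** $A_1,A_2,C_1,C_2,F_1,F_2:[0,T]\to\mathbb R^{n\times n}$; $B_{11},B_{12},D_{11},D_{12},G_{11},G_{12}:[0,T]\to\mathbb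 R^{n\times k_1}$; $B_{21},B_{22},D_{21},D_{22},G_{21},G_{22}:[0,T]\to\mathbb R^{n\times k_2}$; $N_{11},N_{12}:[0,T]\to\mathbb R^{k_1\times k_1}$; $N_{21},N_{22}:[0,T]\to\mathbb R^{k_2\times k_2}$; $Q:[0,T]\to\mathbb R^n$; $h:[0,T]\to\mathbb R$ are uniformly bounded measurable (deterministic) functions, and $M\in\mathbb R^n$ is a vector. **Assumption (L2).** There is $\delta>0$ such that for a.e. $t\in[0,T]$: for all $u_1\in\mathbb R^{k_1}$, $\langle N_{11}(t)u_1,u_1\rangle\ge\delta|u_1|^2$ and $\langle(N_{11}(t)+N_{12}(t))u_1,u_1\rangle\ge\delta|u_1|^2$; for all $u_2\in\mathbb R^{k_2}$, $\langle N_{21}(t)u_2,u_2\rangle\le-\delta|u_2|^2$ and $\langle(N_{21}(t)+N_{22}(t))u_2,u_2\rangle\le-\delta|u_2|^2$. **State.** Let $x_0\in\mathbb R^n$. For $(u_1,u_2)\in\mathcal A_1^S\times\mathcal A_2^S$ the state $X$ solves $$\begin{aligned}dX(t)=&\big(A_1X+A_2\mathbb E[X]+B_{11}u_1+B_{12}\mathbb E[u_1]+B_{21}u_2+B_{22}\mathbb E[u_2]\big)(t)\,dt\\&+\big(C_1X+C_2\mathbb E[X]+D_{11}u_1+D_{12}\mathbb E[u_1]+D_{21}u_2+D_{22}\mathbb E[u_2]\big)(t)\,dW(t)\\&+\big(F_1X+F_2\mathbb E[X]+G_{11}u_1+G_{12}\mathbb E[u_1]+G_{21}u_2+G_{22}\mathbb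 E[u_2]\big)(t)\,dW^{(u_1,u_2)}(t),\quad X(0)=x_0,\end{aligned}$$ where $W^{(u_1,u_2)}$ is determined by the observation equation $dY(t)=h(t)dt+dW^{(u_1,u_2)}(t)$, $Y(0)=0$; i.e. $dW^{(u_1,u_2)}(t)=dY(t)-h(t)dt$, with $Y$ a Brownian motion under $\mathbb P$. **Cost.** (Player 1 minimizes, Player 2 maximizes; expectations are under $\mathbb P$.) $$\begin{aligned}J(u_1,u_2)=\mathbb E\Big[&\langle M,X(T)\rangle+\int_0^T\langle Q(s),X(s)\rangle ds\\&+\int_0^T\big(\langle N_{11}(s)u_1(s),u_1(s)\rangle+\langle N_{12}(s)\mathbb E[u_1(s)],\mathbb E[u_1(s)]\rangle\big)ds\\&+\int_0^T\big(\langle N_{21}(s)u_2(s),u_2(s)\rangle+\langle N_{22}(s)\mathbb E[u_2(s)],\mathbb E[u_2(s)]\rangle\big)ds\Big].\end{aligned}$$ *)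

theory Defs
  imports "HOL-Probability.Probability"
begin

section \<open>Brownian motion, filtrations and square-integrable processes\<close>

definition brownian_motion_on :: "'w measure \<Rightarrow> real \<Rightarrow> (real \<Rightarrow> 'w \<Rightarrow> real) \<Rightarrow> bool" where
  "brownian_motion_on P T B \<longleftrightarrow>
     (\<forall>t\<in>{0..T}. B t \<in> borel_measurable P) \<and>
     (AE \<omega> in P. B 0 \<omega> = 0) \<and>
     (AE \<omega> in P. continuous_on {0..T} (\<lambda>t. B t \<omega>)) \<and>
     (\<forall>s t. 0 \<le> s \<and> s < t \<and> t \<le> T \<longrightarrow>
        distributed P lborel (\<lambda>\<omega>. B t \<omega> - B s \<omega>) (normal_density 0 (sqrt (t - s)))) \<and>
     (\<forall>m \<tau>. (\<forall>i\<le>m. \<tau> i \<in> {0..T}) \<and> (\<forall>i<m. \<tau> i < \<tau> (Suc i)) \<longrightarrow>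
        prob_space.indep_vars P (\<lambda>_. borel) (\<lambda>i \<omega>. B (\<tau> (Suc i)) \<omega> - B (\<tau> i) \<omega>) {..<m})"

text \<open>A sigma-algebra on the space of \<open>P\<close> is represented by a measure of which only the
  \<open>sets\<close> component matters.\<close>

definition completed_natural_filtration ::
    "'w measure \<Rightarrow> (real \<Rightarrow> 'w \<Rightarrow> real) \<Rightarrow> real \<Rightarrow> 'w measure" where
  "completed_natural_filtration P B t =
     sigma (space P)
       ((\<Union>s\<in>{0..t}. {B s -` E \<inter> space P | E. E \<in> sets borel}) \<union> null_sets P)"

definition joint_filtration ::
    "'w measure \<Rightarrow> (real \<Rightarrow> 'w \<Rightarrow> real) \<Rightarrow> (real \<Rightarrow> 'w \<Rightarrow> real) \<Rightarrow> real \<Rightarrow> 'w measure" where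
  "joint_filtration P W Y t =
     sigma (space P)
       (sets (completed_natural_filtration P W t) \<union> sets (completed_natural_filtration P Y t))"

locale two_brownian_basis = prob_space P + complete_measure P
  for P :: "'w measure" +
  fixes T :: real and W Y :: "real \<Rightarrow> 'w \<Rightarrow> real"
  assumes T_pos: "0 < T"
    and brownian_W: "brownian_motion_on P T W"
    and brownian_Y: "brownian_motion_on P T Y"
    and indep_WY:
      "indep_var (Pi\<^sub>M {0..T} (\<lambda>_. borel)) (\<lambda>\<omega>. \<lambda>t\<in>{0..T}. W t \<omega>)
                 (Pi\<^sub>M {0..T} (\<lambda>_. borel)) (\<lambda>\<omega>. \<lambda>t\<in>{0..T}. Y t \<omega>)"
    and sets_terminal: "sets P = sets (joint_filtration P W Y T)"

text \<open>Processes are jointly measurable functions, not equivalence classes; their values at times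
  outside \<open>{0..T}\<close> are irrelevant.\<close>

definition M2_space ::
    "'w measure \<Rightarrow> (real \<Rightarrow> 'w measure) \<Rightarrow> real \<Rightarrow> (real \<Rightarrow> 'w \<Rightarrow> 'a::euclidean_space) set" where
  "M2_space P \<F> T = {u.
     (\<lambda>(t, \<omega>). u t \<omega>) \<in> borel_measurable (restrict_space borel {0..T} \<Otimes>\<^sub>M P) \<and>
     (\<forall>t\<in>{0..T}. u t \<in> borel_measurable (\<F> t)) \<and>
     (\<integral>\<^sup>+\<omega>. (\<integral>\<^sup>+t\<in>{0..T}. ennreal ((norm (u t \<omega>))\<^sup>2) \<partial>lborel) \<partial>P) < \<infinity>}"

section \<open>The Ito integral\<close>

definition simple_integrand ::
    "'w measure \<Rightarrow> (real \<Rightarrow> 'w measure) \<Rightarrow> real \<Rightarrow> nat \<Rightarrow> (nat \<Rightarrow> real)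
       \<Rightarrow> (nat \<Rightarrow> 'w \<Rightarrow> 'a::euclidean_space) \<Rightarrow> bool" where
  "simple_integrand P \<F> T m \<tau> \<xi> \<longleftrightarrow>
     \<tau> 0 = 0 \<and> \<tau> m = T \<and> (\<forall>i<m. \<tau> i < \<tau> (Suc i)) \<and>
     (\<forall>i<m. \<xi> i \<in> borel_measurable (\<F> (\<tau> i)) \<and> integrable P (\<lambda>\<omega>. (norm (\<xi> i \<omega>))\<^sup>2))"

definition simple_process ::
    "nat \<Rightarrow> (nat \<Rightarrow> real) \<Rightarrow> (nat \<Rightarrow> 'w \<Rightarrow> 'a::euclidean_space) \<Rightarrow> real \<Rightarrow> 'w \<Rightarrow> 'a" where
  "simple_process m \<tau> \<xi> t \<omega> = (\<Sum>i<m. indicator {\<tau> i<..\<tau> (Suc i)} t *\<^sub>R \<xi> i \<omega>)"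

definition simple_ito_integral ::
    "(real \<Rightarrow> 'w \<Rightarrow> real) \<Rightarrow> nat \<Rightarrow> (nat \<Rightarrow> real) \<Rightarrow> (nat \<Rightarrow> 'w \<Rightarrow> 'a::euclidean_space)
       \<Rightarrow> real \<Rightarrow> 'w \<Rightarrow> 'a" where
  "simple_ito_integral B m \<tau> \<xi> t \<omega> =
     (\<Sum>i<m. (B (min (\<tau> (Suc i)) t) \<omega> - B (min (\<tau> i) t) \<omega>) *\<^sub>R \<xi> i \<omega>)"

text \<open>The process \<open>I\<close> is (a version of) the indefinite integral of \<open>\<phi>\<close> against \<open>B\<close>: the
  \<open>L\<^sup>2\<close>-limit of integrals of simple adapted processes approximating \<open>\<phi>\<close>
  in \<open>L\<^sup>2([0,T] \<times> \<Omega>)\<close>.\<close>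

definition has_ito_integral ::
    "'w measure \<Rightarrow> (real \<Rightarrow> 'w measure) \<Rightarrow> real \<Rightarrow> (real \<Rightarrow> 'w \<Rightarrow> real)
       \<Rightarrow> (real \<Rightarrow> 'w \<Rightarrow> 'a::euclidean_space) \<Rightarrow> (real \<Rightarrow> 'w \<Rightarrow> 'a) \<Rightarrow> bool" where
  "has_ito_integral P \<F> T B \<phi> I \<longleftrightarrow>
     \<phi> \<in> M2_space P \<F> T \<and>
     (\<forall>t\<in>{0..T}. I t \<in> borel_measurable P) \<and>
     (\<exists>m \<tau> \<xi>.
        (\<forall>j. simple_integrand P \<F> T (m j) (\<tau> j) (\<xi> j)) \<and>
        (\<lambda>j::nat. \<integral>\<^sup>+\<omega>. (\<integral>\<^sup>+t\<in>{0..T}.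
            ennreal ((norm (simple_process (m j) (\<tau> j) (\<xi> j) t \<omega> - \<phi> t \<omega>))\<^sup>2) \<partial>lborel) \<partial>P)
          \<longlonglongrightarrow> 0 \<and>
        (\<forall>t\<in>{0..T}.
          (\<lambda>j. \<integral>\<^sup>+\<omega>.
            ennreal ((norm (simple_ito_integral B (m j) (\<tau> j) (\<xi> j) t \<omega> - I t \<omega>))\<^sup>2) \<partial>P)
          \<longlonglongrightarrow> 0))"

section \<open>The linear-quadratic mean-field game\<close>

text \<open>The fields \<open>Q_run\<close>, \<open>h_obs\<close>, \<open>M_term\<close>, \<open>x_init\<close> are the data \<open>Q\<close>, \<open>h\<close>, \<open>M\<close>, \<open>x\<^sub>0\<close>.\<close>

record ('n, 'k1, 'k2) lq_data =
  A1 :: "real \<Rightarrow> real ^ 'n ^ 'n"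
  A2 :: "real \<Rightarrow> real ^ 'n ^ 'n"
  C1 :: "real \<Rightarrow> real ^ 'n ^ 'n"
  C2 :: "real \<Rightarrow> real ^ 'n ^ 'n"
  F1 :: "real \<Rightarrow> real ^ 'n ^ 'n"
  F2 :: "real \<Rightarrow> real ^ 'n ^ 'n"
  B11 :: "real \<Rightarrow> real ^ 'k1 ^ 'n"
  B12 :: "real \<Rightarrow> real ^ 'k1 ^ 'n"
  D11 :: "real \<Rightarrow> real ^ 'k1 ^ 'n"
  D12 :: "real \<Rightarrow> real ^ 'k1 ^ 'n"
  G11 :: "real \<Rightarrow> real ^ 'k1 ^ 'n"
  G12 :: "real \<Rightarrow> real ^ 'k1 ^ 'n"
  B21 :: "real \<Rightarrow> real ^ 'k2 ^ 'n"
  B22 :: "real \<Rightarrow> real ^ 'k2 ^ 'n"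
  D21 :: "real \<Rightarrow> real ^ 'k2 ^ 'n"
  D22 :: "real \<Rightarrow> real ^ 'k2 ^ 'n"
  G21 :: "real \<Rightarrow> real ^ 'k2 ^ 'n"
  G22 :: "real \<Rightarrow> real ^ 'k2 ^ 'n"
  N11 :: "real \<Rightarrow> real ^ 'k1 ^ 'k1"
  N12 :: "real \<Rightarrow> real ^ 'k1 ^ 'k1"
  N21 :: "real \<Rightarrow> real ^ 'k2 ^ 'k2"
  N22 :: "real \<Rightarrow> real ^ 'k2 ^ 'k2"
  Q_run :: "real \<Rightarrow> real ^ 'n"
  h_obs :: "real \<Rightarrow> real"
  M_term :: "real ^ 'n"
  x_init :: "real ^ 'n"

definition bounded_measurable_on :: "real \<Rightarrow> (real \<Rightarrow> 'a::euclidean_space) \<Rightarrow> bool" where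
  "bounded_measurable_on T f \<longleftrightarrow>
     f \<in> borel_measurable (restrict_space borel {0..T}) \<and> bounded (f ` {0..T})"

definition assumption_L1 ::
    "real \<Rightarrow> ('n::finite, 'k1::finite, 'k2::finite) lq_data \<Rightarrow> bool" where
  "assumption_L1 T c \<longleftrightarrow>
     bounded_measurable_on T (A1 c) \<and> bounded_measurable_on T (A2 c) \<and>
     bounded_measurable_on T (C1 c) \<and> bounded_measurable_on T (C2 c) \<and>
     bounded_measurable_on T (F1 c) \<and> bounded_measurable_on T (F2 c) \<and>
     bounded_measurable_on T (B11 c) \<and> bounded_measurable_on T (B12 c) \<and>
     bounded_measurable_on T (D11 c) \<and> bounded_measurable_on T (D12 c) \<and>
     bounded_measurable_on T (G11 c) \<and> bounded_measurable_on T (G12 c) \<and>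
     bounded_measurable_on T (B21 c) \<and> bounded_measurable_on T (B22 c) \<and>
     bounded_measurable_on T (D21 c) \<and> bounded_measurable_on T (D22 c) \<and>
     bounded_measurable_on T (G21 c) \<and> bounded_measurable_on T (G22 c) \<and>
     bounded_measurable_on T (N11 c) \<and> bounded_measurable_on T (N12 c) \<and>
     bounded_measurable_on T (N21 c) \<and> bounded_measurable_on T (N22 c) \<and>
     bounded_measurable_on T (Q_run c) \<and> bounded_measurable_on T (h_obs c)"

definition assumption_L2 ::
    "real \<Rightarrow> ('n::finite, 'k1::finite, 'k2::finite) lq_data \<Rightarrow> bool" where
  "assumption_L2 T c \<longleftrightarrow>
     (\<exists>\<delta>>0. AE t in lborel. t \<in> {0..T} \<longrightarrow>
        (\<forall>v::real ^ 'k1.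
            (N11 c t *v v) \<bullet> v \<ge> \<delta> * (norm v)\<^sup>2 \<and>
            ((N11 c t + N12 c t) *v v) \<bullet> v \<ge> \<delta> * (norm v)\<^sup>2) \<and>
        (\<forall>v::real ^ 'k2.
            (N21 c t *v v) \<bullet> v \<le> - \<delta> * (norm v)\<^sup>2 \<and>
            ((N21 c t + N22 c t) *v v) \<bullet> v \<le> - \<delta> * (norm v)\<^sup>2))"

text \<open>The common shape
  \<open>K\<^sub>1 X + K\<^sub>2 E[X] + L\<^sub>1\<^sub>1 u\<^sub>1 + L\<^sub>1\<^sub>2 E[u\<^sub>1] + L\<^sub>2\<^sub>1 u\<^sub>2 + L\<^sub>2\<^sub>2 E[u\<^sub>2]\<close>
  of the three coefficients of the state equation.\<close>

definition mf_linear ::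
    "'w measure \<Rightarrow> (real \<Rightarrow> real ^ 'n ^ 'n) \<Rightarrow> (real \<Rightarrow> real ^ 'n ^ 'n)
       \<Rightarrow> (real \<Rightarrow> real ^ 'k1 ^ 'n) \<Rightarrow> (real \<Rightarrow> real ^ 'k1 ^ 'n)
       \<Rightarrow> (real \<Rightarrow> real ^ 'k2 ^ 'n) \<Rightarrow> (real \<Rightarrow> real ^ 'k2 ^ 'n)
       \<Rightarrow> (real \<Rightarrow> 'w \<Rightarrow> real ^ 'n) \<Rightarrow> (real \<Rightarrow> 'w \<Rightarrow> real ^ 'k1) \<Rightarrow> (real \<Rightarrow> 'w \<Rightarrow> real ^ 'k2)
       \<Rightarrow> real \<Rightarrow> 'w \<Rightarrow> real ^ 'n" where
  "mf_linear P K1 K2 L11 L12 L21 L22 X u1 u2 t \<omega> =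
     K1 t *v X t \<omega> + K2 t *v (\<integral>\<omega>'. X t \<omega>' \<partial>P) +
     L11 t *v u1 t \<omega> + L12 t *v (\<integral>\<omega>'. u1 t \<omega>' \<partial>P) +
     L21 t *v u2 t \<omega> + L22 t *v (\<integral>\<omega>'. u2 t \<omega>' \<partial>P)"

definition drift where
  "drift P c = mf_linear P (A1 c) (A2 c) (B11 c) (B12 c) (B21 c) (B22 c)"

definition diffusion_W where
  "diffusion_W P c = mf_linear P (C1 c) (C2 c) (D11 c) (D12 c) (D21 c) (D22 c)"

definition diffusion_obs where
  "diffusion_obs P c = mf_linear P (F1 c) (F2 c) (G11 c) (G12 c) (G21 c) (G22 c)"

text \<open>Since \<open>dW\<^sup>u = dY - h dt\<close>, the integral of \<open>\<phi>\<close> against the observation noise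
  \<open>W\<^sup>u\<close> up to \<open>t\<close> is the Ito integral of \<open>\<phi>\<close> against \<open>Y\<close> minus the Lebesgue integral
  of \<open>h \<phi>\<close> over \<open>{0..t}\<close>.\<close>

definition has_obs_noise_integral ::
    "'w measure \<Rightarrow> (real \<Rightarrow> 'w measure) \<Rightarrow> real \<Rightarrow> (real \<Rightarrow> 'w \<Rightarrow> real) \<Rightarrow> (real \<Rightarrow> real)
       \<Rightarrow> (real \<Rightarrow> 'w \<Rightarrow> 'a::euclidean_space) \<Rightarrow> (real \<Rightarrow> 'w \<Rightarrow> 'a) \<Rightarrow> bool" where
  "has_obs_noise_integral P \<F> T Y h \<phi> I \<longleftrightarrow>
     (\<exists>I_Y. has_ito_integral P \<F> T Y \<phi> I_Y \<and>
        (\<forall>t\<in>{0..T}. AE \<omega> in P. I t \<omega> = I_Y t \<omega> - (LBINT s:{0..t}. h s *\<^sub>R \<phi> s \<omega>)))"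

definition is_state ::
    "'w measure \<Rightarrow> real \<Rightarrow> (real \<Rightarrow> 'w \<Rightarrow> real) \<Rightarrow> (real \<Rightarrow> 'w \<Rightarrow> real)
       \<Rightarrow> ('n::finite, 'k1::finite, 'k2::finite) lq_data
       \<Rightarrow> (real \<Rightarrow> 'w \<Rightarrow> real ^ 'k1) \<Rightarrow> (real \<Rightarrow> 'w \<Rightarrow> real ^ 'k2)
       \<Rightarrow> (real \<Rightarrow> 'w \<Rightarrow> real ^ 'n) \<Rightarrow> bool" where
  "is_state P T W Y c u1 u2 X \<longleftrightarrow>
     X \<in> M2_space P (joint_filtration P W Y) T \<and>
     (AE \<omega> in P. continuous_on {0..T} (\<lambda>t. X t \<omega>)) \<and>
     (\<exists>I_W I_obs.
        has_ito_integral P (joint_filtration P W Y) T W (diffusion_W P c X u1 u2) I_W \<and>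
        has_obs_noise_integral P (joint_filtration P W Y) T Y (h_obs c)
          (diffusion_obs P c X u1 u2) I_obs \<and>
        (\<forall>t\<in>{0..T}. AE \<omega> in P.
           X t \<omega> = x_init c + (LBINT s:{0..t}. drift P c X u1 u2 s \<omega>) + I_W t \<omega> + I_obs t \<omega>))"

text \<open>The state equation determines its solution up to indistinguishability, so the choice made
  here does not affect the cost. For the choice to be a solution, one has to exist; this is not
  assumed anywhere, as it is a consequence of assumption (L1).\<close>

definition state where
  "state P T W Y c u1 u2 = (SOME X. is_state P T W Y c u1 u2 X)"

definition cost_of ::
    "'w measure \<Rightarrow> real \<Rightarrow> ('n::finite, 'k1::finite, 'k2::finite) lq_data
       \<Rightarrow> (real \<Rightarrow> 'w \<Rightarrow> real ^ 'n) \<Rightarrow> (real \<Rightarrow> 'w \<Rightarrow> real ^ 'k1) \<Rightarrow> (real \<Rightarrow> 'w \<Rightarrow> real ^ 'k2)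
       \<Rightarrow> real" where
  "cost_of P T c X u1 u2 =
     (\<integral>\<omega>.
        M_term c \<bullet> X T \<omega> +
        (LBINT s:{0..T}. Q_run c s \<bullet> X s \<omega>) +
        (LBINT s:{0..T}.
           (N11 c s *v u1 s \<omega>) \<bullet> u1 s \<omega> +
           (N12 c s *v (\<integral>\<omega>'. u1 s \<omega>' \<partial>P)) \<bullet> (\<integral>\<omega>'. u1 s \<omega>' \<partial>P)) +
        (LBINT s:{0..T}.
           (N21 c s *v u2 s \<omega>) \<bullet> u2 s \<omega> +
           (N22 c s *v (\<integral>\<omega>'. u2 s \<omega>' \<partial>P)) \<bullet> (\<integral>\<omega>'. u2 s \<omega>' \<partial>P)) \<partial>P)"

definition J ::
    "'w measure \<Rightarrow> real \<Rightarrow> (real \<Rightarrow> 'w \<Rightarrow> real) \<Rightarrow> (real \<Rightarrow> 'w \<Rightarrow> real)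
       \<Rightarrow> ('n::finite, 'k1::finite, 'k2::finite) lq_data
       \<Rightarrow> (real \<Rightarrow> 'w \<Rightarrow> real ^ 'k1) \<Rightarrow> (real \<Rightarrow> 'w \<Rightarrow> real ^ 'k2) \<Rightarrow> real" where
  "J P T W Y c u1 u2 = cost_of P T c (state P T W Y c u1 u2) u1 u2"

text \<open>Controls of either player are adapted to the observation filtration only; the codomain
  dimension is fixed by the type.\<close>

definition admissible ::
    "'w measure \<Rightarrow> real \<Rightarrow> (real \<Rightarrow> 'w \<Rightarrow> real) \<Rightarrow> (real \<Rightarrow> 'w \<Rightarrow> real ^ 'k) set" where
  "admissible P T Y = M2_space P (completed_natural_filtration P Y) T"

end

theory Submission
  imports Defs
begin

text \<open>The state enters the cost linearly, so the cost depends on the state only through its mean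
  \<open>m t = E[X t]\<close>. Ito integrals have mean zero; taking expectations in the state equation and
  writing \<open>dY - h dt\<close> for the observation noise therefore leaves a deterministic linear equation
  \<open>m' = A m + \<Gamma>\<^sub>1 E[u\<^sub>1] + \<Gamma>\<^sub>2 E[u\<^sub>2]\<close>, in which \<open>h\<close> contributes the terms
  \<open>- h (F\<^sub>1 + F\<^sub>2)\<close> to \<open>A\<close> and \<open>- h (G\<^sub>i\<^sub>1 + G\<^sub>i\<^sub>2)\<close> to \<open>\<Gamma>\<^sub>i\<close> (\<open>state_mean\<close>). If \<open>p\<close> solves the adjoint equation
  \<open>p' = - A\<^sup>T p - Q\<close>, \<open>p T = M\<close> (\<open>adjoint_exists\<close>), integration by parts (\<open>linear_duality\<close>)
  replaces the state in the cost by \<open>x\<^sub>0 \<bullet> p 0 + \<integral> p \<bullet> (\<Gamma>\<^sub>1 E[u\<^sub>1] + \<Gamma>\<^sub>2 E[u\<^sub>2])\<close>. Hence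
  \<open>J u\<^sub>1 u\<^sub>2 = x\<^sub>0 \<bullet> p 0 + J\<^sub>1 u\<^sub>1 + J\<^sub>2 u\<^sub>2\<close> (\<open>cost_separates\<close>): the players do not interact, and a
  saddle point is a minimiser of \<open>J\<^sub>1\<close> paired with a maximiser of \<open>J\<^sub>2\<close>.

  Each \<open>J\<^sub>i\<close> is an integral over time that can be optimised at every instant separately
  (\<open>player_optimum\<close>). For Player 1, positivity of \<open>N\<^sub>1\<^sub>1\<close> and Jensen's inequality bound the integrand at
  time \<open>s\<close> from below by \<open>\<beta> \<bullet> e + (R e) \<bullet> e\<close> with \<open>R = N\<^sub>1\<^sub>1 + N\<^sub>1\<^sub>2\<close>, \<open>\<beta> = \<Gamma>\<^sub>1\<^sup>T p\<close> and \<open>e = E[u\<^sub>1 s]\<close>.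
  Coercivity of \<open>R\<close> gives this quadratic a unique minimiser, the solution of
  \<open>(R + R\<^sup>T) e = - \<beta>\<close>. As a function of time it is bounded, measurable and deterministic, hence an
  admissible control, and it attains the bound. Player 2 is the same problem with all signs reversed.
  Equality of the two values is a formal consequence of a saddle point.

  The cost is evaluated at a solution of the state equation picked by the choice operator. The
  computation of the mean applies to every solution, so it is immaterial which one is picked, but
  one has to exist. Most of the text proves this. Averages over the preceding dyadic interval turn
  a square-integrable adapted process into adapted step processes converging to it in \<open>L\<^sup>2\<close>
  (\<open>lagged_step_tendsto\<close>, \<open>lagged_process_tendsto\<close>); the Ito isometry (\<open>simple_ito_isometry\<close>)
  makes their stochastic integrals a Cauchy sequence; a maximal inequality and the Borel-Cantelli
  lemma make a subsequence converge uniformly on almost every path, so that the limit is a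
  continuous version of the integral (\<open>ito_integral_exists\<close>). Picard iteration
  (\<open>picard_fixed_point\<close>) then solves the equation (\<open>sde_solution_exists\<close>, \<open>state_exists\<close>). That the
  increments of \<open>W\<close> and of \<open>Y\<close> are independent of the past of the joint filtration is derived from
  the independence of the two motions on cylinder events (\<open>brownian_filtration_joint\<close>).\<close>

section \<open>Square-integrable functions\<close>

lemma norm_add_sq_le: "(norm (a + b :: 'a::real_normed_vector))\<^sup>2 \<le> 2 * (norm a)\<^sup>2 + 2 * (norm b)\<^sup>2"
proof -
  have "(norm (a + b))\<^sup>2 \<le> (norm a + norm b)\<^sup>2"
    by (intro power_mono norm_triangle_ineq) auto
  also have "\<dots> \<le> 2 * (norm a)\<^sup>2 + 2 * (norm b)\<^sup>2"
    using sum_squares_bound[of "norm a" "norm b"] by (simp add: power2_sum)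
  finally show ?thesis .
qed

text \<open>The squared \<open>L\<^sup>2\<close>-norm. With values in \<open>ennreal\<close>, an infinite norm is a value like any other, and the
  squares match the Ito isometry; the triangle inequality takes the form \<open>norm_add_sq_le\<close>, whose
  factor 2 recurs in the estimates below.\<close>

definition l2sq :: "'b measure \<Rightarrow> ('b \<Rightarrow> 'a::real_normed_vector) \<Rightarrow> ennreal" where
  "l2sq M f = (\<integral>\<^sup>+x. ennreal ((norm (f x))\<^sup>2) \<partial>M)"

lemma l2sq_cong: "(\<And>x. x \<in> space M \<Longrightarrow> f x = g x) \<Longrightarrow> l2sq M f = l2sq M g"
  unfolding l2sq_def by (intro nn_integral_cong) simp

lemma l2sq_cong_AE: "AE x in M. f x = g x \<Longrightarrow> l2sq M f = l2sq M g"
  unfolding l2sq_def by (intro nn_integral_cong_AE) auto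

lemma l2sq_zero [simp]: "l2sq M (\<lambda>x. 0) = 0"
  unfolding l2sq_def by simp

lemma l2sq_uminus [simp]: "l2sq M (\<lambda>x. - f x) = l2sq M f"
  unfolding l2sq_def by simp

lemma l2sq_minus_commute: "l2sq M (\<lambda>x. f x - g x) = l2sq M (\<lambda>x. g x - f x)"
  unfolding l2sq_def by (simp add: norm_minus_commute)

lemma l2sq_mono_AE: "AE x in M. norm (f x) \<le> norm (g x) \<Longrightarrow> l2sq M f \<le> l2sq M g"
  unfolding l2sq_def by (intro nn_integral_mono_AE) (auto intro!: ennreal_leI power_mono)

lemma l2sq_scaleR:
  assumes [measurable]: "f \<in> borel_measurable M"
  shows "l2sq M (\<lambda>x. c *\<^sub>R f x) = ennreal (c\<^sup>2) * l2sq M f"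
  unfolding l2sq_def
  by (subst nn_integral_cmult[symmetric]) (auto simp: power_mult_distrib ennreal_mult)

lemma l2sq_add:
  assumes [measurable]: "f \<in> borel_measurable M" "g \<in> borel_measurable M"
  shows "l2sq M (\<lambda>x. f x + g x) \<le> 2 * l2sq M f + 2 * l2sq M g"
proof -
  have "l2sq M (\<lambda>x. f x + g x)
      \<le> (\<integral>\<^sup>+x. 2 * ennreal ((norm (f x))\<^sup>2) + 2 * ennreal ((norm (g x))\<^sup>2) \<partial>M)"
    unfolding l2sq_def
  proof (intro nn_integral_mono)
    fix x
    have "ennreal ((norm (f x + g x))\<^sup>2) \<le> ennreal (2 * (norm (f x))\<^sup>2 + 2 * (norm (g x))\<^sup>2)"
      by (intro ennreal_leI norm_add_sq_le)
    also have "\<dots> = 2 * ennreal ((norm (f x))\<^sup>2) + 2 * ennreal ((norm (g x))\<^sup>2)"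
      by (simp add: ennreal_plus ennreal_mult)
    finally show "ennreal ((norm (f x + g x))\<^sup>2)
       \<le> 2 * ennreal ((norm (f x))\<^sup>2) + 2 * ennreal ((norm (g x))\<^sup>2)" .
  qed
  also have "\<dots> = 2 * l2sq M f + 2 * l2sq M g"
    unfolding l2sq_def by (simp add: nn_integral_add nn_integral_cmult)
  finally show ?thesis .
qed

lemma l2sq_diff_triangle:
  fixes f g k :: "'b \<Rightarrow> 'a::{real_normed_vector, second_countable_topology}"
  assumes [measurable]: "f \<in> borel_measurable M" "g \<in> borel_measurable M" "k \<in> borel_measurable M"
  shows "l2sq M (\<lambda>x. f x - g x) \<le> 2 * l2sq M (\<lambda>x. f x - k x) + 2 * l2sq M (\<lambda>x. k x - g x)"
proof -
  have "l2sq M (\<lambda>x. (f x - k x) + (k x - g x)) \<le> 2 * l2sq M (\<lambda>x. f x - k x) + 2 * l2sq M (\<lambda>x. k x - g x)"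
    by (intro l2sq_add) measurable
  then show ?thesis by simp
qed

lemma l2sq_finite_iff:
  fixes f :: "'b \<Rightarrow> 'a::{banach, second_countable_topology}"
  assumes [measurable]: "f \<in> borel_measurable M"
  shows "l2sq M f < \<infinity> \<longleftrightarrow> integrable M (\<lambda>x. (norm (f x))\<^sup>2)"
  unfolding l2sq_def by (simp add: integrable_iff_bounded)

lemma l2sq_eq_integral:
  fixes f :: "'b \<Rightarrow> 'a::{banach, second_countable_topology}"
  assumes "integrable M (\<lambda>x. (norm (f x))\<^sup>2)"
  shows "l2sq M f = ennreal (\<integral>x. (norm (f x))\<^sup>2 \<partial>M)"
  unfolding l2sq_def using assms by (intro nn_integral_eq_integral) auto

lemma l2sq_eq_0_iff:
  fixes f :: "'b \<Rightarrow> 'a::{banach, second_countable_topology}"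
  assumes [measurable]: "f \<in> borel_measurable M"
  shows "l2sq M f = 0 \<longleftrightarrow> (AE x in M. f x = 0)"
  unfolding l2sq_def by (subst nn_integral_0_iff_AE) auto

text \<open>The Cauchy-Schwarz inequality against the constant 1; a non-integrable \<open>f\<close> has integral 0.\<close>

lemma norm_integral_sq_le:
  fixes f :: "'b \<Rightarrow> 'a::{banach, second_countable_topology}"
  shows "ennreal ((norm (\<integral>x. f x \<partial>M))\<^sup>2) \<le> emeasure M (space M) * l2sq M f"
proof (cases "integrable M f")
  case True
  then have [measurable]: "f \<in> borel_measurable M" by auto
  have "ennreal ((norm (\<integral>x. f x \<partial>M))\<^sup>2) = (ennreal (norm (\<integral>x. f x \<partial>M)))\<^sup>2"
    by (simp add: ennreal_power)
  also have "\<dots> \<le> (\<integral>\<^sup>+x. ennreal (norm (f x)) * 1 \<partial>M)\<^sup>2"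
    using integral_norm_bound_ennreal[OF True] by (intro power_mono) auto
  also have "\<dots> \<le> (\<integral>\<^sup>+x. (ennreal (norm (f x)))\<^sup>2 \<partial>M) * (\<integral>\<^sup>+x. 1\<^sup>2 \<partial>M)"
    by (intro Cauchy_Schwarz_nn_integral) auto
  also have "\<dots> = emeasure M (space M) * l2sq M f"
    unfolding l2sq_def by (simp add: ennreal_power mult.commute)
  finally show ?thesis .
qed (simp add: not_integrable_integral_eq)

lemma norm_set_integral_sq_le:
  fixes f :: "'b \<Rightarrow> 'a::{banach, second_countable_topology}"
  assumes [measurable]: "A \<in> sets M"
  shows "ennreal ((norm (LINT x:A|M. f x))\<^sup>2)
    \<le> emeasure M A * (\<integral>\<^sup>+x\<in>A. ennreal ((norm (f x))\<^sup>2) \<partial>M)"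
proof -
  have "(LINT x:A|M. f x) = (\<integral>x. f x \<partial>restrict_space M A)"
    unfolding set_lebesgue_integral_def by (simp add: integral_restrict_space)
  moreover have "l2sq (restrict_space M A) f = (\<integral>\<^sup>+x\<in>A. ennreal ((norm (f x))\<^sup>2) \<partial>M)"
    unfolding l2sq_def by (simp add: nn_integral_restrict_space)
  ultimately show ?thesis
    using norm_integral_sq_le[of "restrict_space M A" f]
    by (simp add: emeasure_restrict_space space_restrict_space)
qed

lemma l2sq_Fatou:
  fixes f :: "'b \<Rightarrow> 'a::{banach, second_countable_topology}"
  assumes [measurable]: "\<And>k. u k \<in> borel_measurable M"
    and lim: "AE x in M. (\<lambda>k. u k x) \<longlonglongrightarrow> f x"
    and le: "\<And>k. k \<ge> K \<Longrightarrow> l2sq M (u k) \<le> C"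
  shows "l2sq M f \<le> C"
proof -
  have "l2sq M f = (\<integral>\<^sup>+x. liminf (\<lambda>k. ennreal ((norm (u (k + K) x))\<^sup>2)) \<partial>M)"
    unfolding l2sq_def
  proof (intro nn_integral_cong_AE, use lim in eventually_elim)
    case (elim x)
    then have "(\<lambda>k. u (k + K) x) \<longlonglongrightarrow> f x" by (rule LIMSEQ_ignore_initial_segment)
    then have "(\<lambda>k. ennreal ((norm (u (k + K) x))\<^sup>2)) \<longlonglongrightarrow> ennreal ((norm (f x))\<^sup>2)"
      by (intro tendsto_intros)
    then show ?case by (simp add: lim_imp_Liminf del: tendsto_ennreal_iff)
  qed
  also have "\<dots> \<le> liminf (\<lambda>k. l2sq M (u (k + K)))"
    unfolding l2sq_def by (intro nn_integral_liminf) auto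
  also have "\<dots> \<le> liminf (\<lambda>k. C)"
    by (intro Liminf_mono always_eventually) (auto intro: le)
  finally show ?thesis by (simp add: Liminf_const)
qed

abbreviation lborel_upto :: "real \<Rightarrow> real measure" where
  "lborel_upto T \<equiv> restrict_space lborel {0..T}"

lemma l2sq_lborel_upto:
  "l2sq (lborel_upto T) f = (\<integral>\<^sup>+t\<in>{0..T}. ennreal ((norm (f t))\<^sup>2) \<partial>lborel)"
  unfolding l2sq_def by (simp add: nn_integral_restrict_space)

lemma finite_measure_lborel_upto: "finite_measure (lborel_upto T)"
  by (intro finite_measureI) (simp add: emeasure_restrict_space space_restrict_space emeasure_lborel_Icc_eq)

lemma emeasure_lborel_upto: "0 \<le> T \<Longrightarrow> emeasure (lborel_upto T) (space (lborel_upto T)) = ennreal T"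
  by (simp add: emeasure_restrict_space space_restrict_space)

lemma norm_sum_indicator_sq:
  assumes "disjoint_family_on A I" "finite I"
  shows "(norm (\<Sum>i\<in>I. indicator (A i) s *\<^sub>R (x i :: 'a::real_normed_vector)))\<^sup>2
    = (\<Sum>i\<in>I. indicator (A i) s * (norm (x i))\<^sup>2)"
proof (cases "\<exists>i\<in>I. s \<in> A i")
  case True
  then obtain k where k: "k \<in> I" "s \<in> A k" by auto
  then have *: "indicator (A i) s = (if i = k then 1 else 0 :: real)" if "i \<in> I" for i
    using assms(1) that by (auto simp: disjoint_family_on_def indicator_def)
  have "(\<Sum>i\<in>I. indicator (A i) s *\<^sub>R x i) = (\<Sum>i\<in>I. if i = k then x i else 0)"
    by (intro sum.cong) (auto simp: *)
  moreover have "(\<Sum>i\<in>I. indicator (A i) s * (norm (x i))\<^sup>2) = (\<Sum>i\<in>I. if i = k then (norm (x i))\<^sup>2 else 0)"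
    by (intro sum.cong) (auto simp: *)
  ultimately show ?thesis using k assms(2) by simp
next
  case False
  then have "indicator (A i) s = (0::real)" if "i \<in> I" for i using that by auto
  then show ?thesis by simp
qed

lemma disjoint_partition_intervals:
  fixes \<tau> :: "nat \<Rightarrow> real"
  assumes "\<And>i. i < m \<Longrightarrow> \<tau> i \<le> \<tau> (Suc i)"
  shows "disjoint_family_on (\<lambda>i. {\<tau> i<..\<tau> (Suc i)}) {..<m}"
proof -
  have mono: "\<tau> (Suc i) \<le> \<tau> k" if "i < k" "k < m" for i k
    using that
  proof (induction k)
    case (Suc k)
    then show ?case using assms[of k] by (cases "i = k") auto
  qed simp
  have "{\<tau> i<..\<tau> (Suc i)} \<inter> {\<tau> k<..\<tau> (Suc k)} = {}" if "i < k" "k < m" for i k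
    using mono[OF that] by auto
  then show ?thesis
    unfolding disjoint_family_on_def by (metis inf_commute lessThan_iff linorder_neqE_nat)
qed

lemma partition_mono:
  fixes \<tau> :: "nat \<Rightarrow> real"
  assumes "\<And>i. i < m \<Longrightarrow> \<tau> i \<le> \<tau> (Suc i)" "i \<le> k" "k \<le> m"
  shows "\<tau> i \<le> \<tau> k"
  using assms(2,3)
proof (induction k)
  case (Suc k)
  then show ?case using assms(1)[of k] by (cases "i = Suc k") auto
qed simp

text \<open>On each cell at most one summand is nonzero, so the square of the sum is the sum of the squares.
  The truncation at \<open>t\<close> is built into the weights.\<close>

lemma nn_integral_step_sq:
  fixes \<tau> :: "nat \<Rightarrow> real" and x :: "nat \<Rightarrow> 'a::real_normed_vector"
  assumes mono: "\<And>i. i < m \<Longrightarrow> \<tau> i \<le> \<tau> (Suc i)" and "0 \<le> \<tau> 0"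
  shows "l2sq (lborel_upto t) (\<lambda>s. \<Sum>i<m. indicator {\<tau> i<..\<tau> (Suc i)} s *\<^sub>R x i)
    = (\<Sum>i<m. ennreal (min (\<tau> (Suc i)) t - min (\<tau> i) t) * ennreal ((norm (x i))\<^sup>2))"
proof -
  have pos: "0 \<le> \<tau> i" if "i \<le> m" for i
    using partition_mono[of m \<tau> 0 i] mono \<open>0 \<le> \<tau> 0\<close> that by force
  have disj: "disjoint_family_on (\<lambda>i. {\<tau> i<..\<tau> (Suc i)}) {..<m}"
    using mono by (rule disjoint_partition_intervals)
  have "l2sq (lborel_upto t) (\<lambda>s. \<Sum>i<m. indicator {\<tau> i<..\<tau> (Suc i)} s *\<^sub>R x i)
     = (\<integral>\<^sup>+s. (\<Sum>i<m. ennreal ((norm (x i))\<^sup>2) * indicator ({\<tau> i<..\<tau> (Suc i)} \<inter> {0..t}) s) \<partial>lborel)"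
    unfolding l2sq_lborel_upto
  proof (intro nn_integral_cong)
    fix s :: real
    have "ennreal ((norm (\<Sum>i<m. indicator {\<tau> i<..\<tau> (Suc i)} s *\<^sub>R x i))\<^sup>2)
      = ennreal (\<Sum>i<m. indicator {\<tau> i<..\<tau> (Suc i)} s * (norm (x i))\<^sup>2)"
      by (subst norm_sum_indicator_sq[OF disj]) simp_all
    also have "\<dots> = (\<Sum>i<m. ennreal ((norm (x i))\<^sup>2) * indicator {\<tau> i<..\<tau> (Suc i)} s)"
      by (subst sum_ennreal[symmetric])
         (simp_all add: ennreal_mult' ennreal_indicator[symmetric] mult.commute del: ennreal_indicator)
    finally show "ennreal ((norm (\<Sum>i<m. indicator {\<tau> i<..\<tau> (Suc i)} s *\<^sub>R x i))\<^sup>2) * indicator {0..t} s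
      = (\<Sum>i<m. ennreal ((norm (x i))\<^sup>2) * indicator ({\<tau> i<..\<tau> (Suc i)} \<inter> {0..t}) s)"
      by (simp only: sum_distrib_right indicator_inter_arith mult.assoc)
  qed
  also have "\<dots> = (\<Sum>i<m. ennreal ((norm (x i))\<^sup>2) * emeasure lborel ({\<tau> i<..\<tau> (Suc i)} \<inter> {0..t}))"
    by (subst nn_integral_sum) (auto intro!: sum.cong simp: nn_integral_cmult_indicator)
  also have "\<dots> = (\<Sum>i<m. ennreal (min (\<tau> (Suc i)) t - min (\<tau> i) t) * ennreal ((norm (x i))\<^sup>2))"
  proof (intro sum.cong refl)
    fix i assume "i \<in> {..<m}"
    then have i: "i < m" by simp
    have "{\<tau> i<..\<tau> (Suc i)} \<inter> {0..t} = {min (\<tau> i) t<..min (\<tau> (Suc i)) t}"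
      using pos[of i] i mono[OF i] by (auto simp: min_def)
    moreover have "min (\<tau> i) t \<le> min (\<tau> (Suc i)) t" using mono[OF i] by auto
    ultimately show "ennreal ((norm (x i))\<^sup>2) * emeasure lborel ({\<tau> i<..\<tau> (Suc i)} \<inter> {0..t})
      = ennreal (min (\<tau> (Suc i)) t - min (\<tau> i) t) * ennreal ((norm (x i))\<^sup>2)"
      by (simp add: mult.commute)
  qed
  finally show ?thesis .
qed

section \<open>Lagged dyadic averages\<close>

definition dyadic :: "real \<Rightarrow> nat \<Rightarrow> nat \<Rightarrow> real" where
  "dyadic T j i = T * real i / 2 ^ j"

text \<open>The mean over the interval preceding the one labelled \<open>i\<close>. The delay makes the mean of a path
  known at the left end point of interval \<open>i\<close>, so that averaging preserves adaptedness. There is no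
  interval before the first, whence the value 0.\<close>

definition lagged_mean :: "real \<Rightarrow> nat \<Rightarrow> (real \<Rightarrow> 'a::euclidean_space) \<Rightarrow> nat \<Rightarrow> 'a" where
  "lagged_mean T j f i =
     (if i = 0 then 0 else (2 ^ j / T) *\<^sub>R (LBINT s:{dyadic T j (i - 1)<..dyadic T j i}. f s))"

definition lagged_step :: "real \<Rightarrow> nat \<Rightarrow> (real \<Rightarrow> 'a::euclidean_space) \<Rightarrow> real \<Rightarrow> 'a" where
  "lagged_step T j f t =
     (\<Sum>i<2 ^ j. indicator {dyadic T j i<..dyadic T j (Suc i)} t *\<^sub>R lagged_mean T j f i)"

lemma dyadic_0 [simp]: "dyadic T j 0 = 0" and dyadic_top [simp]: "dyadic T j (2 ^ j) = T"
  by (auto simp: dyadic_def)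

lemma dyadic_le: "0 < T \<Longrightarrow> i \<le> k \<Longrightarrow> dyadic T j i \<le> dyadic T j k"
  by (auto simp: dyadic_def divide_right_mono)

lemma dyadic_less: "0 < T \<Longrightarrow> i < k \<Longrightarrow> dyadic T j i < dyadic T j k"
  by (auto simp: dyadic_def divide_strict_right_mono)

lemma dyadic_Suc: "dyadic T j (Suc i) = dyadic T j i + T / 2 ^ j"
  by (simp add: dyadic_def field_simps)

lemma dyadic_in: "0 < T \<Longrightarrow> i \<le> 2 ^ j \<Longrightarrow> dyadic T j i \<in> {0..T}"
  using dyadic_le[of T 0 i j] dyadic_le[of T i "2 ^ j" j] by simp

lemma dyadic_cell_exists:
  assumes "0 < T" "0 < t" "t \<le> T"
  obtains i where "i < 2 ^ j" "t \<in> {dyadic T j i<..dyadic T j (Suc i)}"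
proof -
  define i where "i = (LEAST i. t \<le> dyadic T j i)"
  have ex: "t \<le> dyadic T j (2 ^ j)" using assms by simp
  have le: "t \<le> dyadic T j i" unfolding i_def by (rule LeastI[of "\<lambda>i. t \<le> dyadic T j i"]) (rule ex)
  have "i \<noteq> 0" using le assms by (metis dyadic_0 not_le)
  then obtain k where k: "i = Suc k" by (cases i) auto
  have "dyadic T j k < t" using not_less_Least[of k "\<lambda>i. t \<le> dyadic T j i"] k i_def by auto
  moreover have "i \<le> 2 ^ j" unfolding i_def by (rule Least_le) (rule ex)
  ultimately show ?thesis using that[of k] le k by auto
qed

lemma disjoint_dyadic: "0 < T \<Longrightarrow> disjoint_family_on (\<lambda>i. {dyadic T j i<..dyadic T j (Suc i)}) {..<m}"
  by (intro disjoint_partition_intervals dyadic_le) auto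

lemma lagged_step_eq:
  assumes "0 < T" "i < 2 ^ j" "t \<in> {dyadic T j i<..dyadic T j (Suc i)}"
  shows "lagged_step T j f t = lagged_mean T j f i"
proof -
  have *: "indicator {dyadic T j k<..dyadic T j (Suc k)} t = (if k = i then 1 else 0 :: real)"
    if "k < 2 ^ j" for k
    using disjoint_dyadic[OF assms(1), of j "2 ^ j"] assms that
    by (fastforce simp: disjoint_family_on_def indicator_def)
  have "lagged_step T j f t = (\<Sum>k<2 ^ j. if k = i then lagged_mean T j f k else 0)"
    unfolding lagged_step_def by (intro sum.cong) (auto simp: *)
  then show ?thesis using assms(2) by simp
qed

lemma lagged_step_measurable [measurable]: "lagged_step T j f \<in> borel_measurable borel"
  unfolding lagged_step_def[abs_def] by measurable

lemma lagged_mean_cong: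
  assumes "0 < T" "i \<le> 2 ^ j" "\<And>t. t \<in> {0..T} \<Longrightarrow> f t = g t"
  shows "lagged_mean T j f i = lagged_mean T j g i"
proof -
  have "t \<in> {0..T}" if "t \<in> {dyadic T j (i - 1)<..dyadic T j i}" for t
    using that dyadic_in[OF assms(1,2)] dyadic_le[OF assms(1), of 0 "i - 1" j] by auto
  then show ?thesis
    unfolding lagged_mean_def using assms(3) by (auto intro!: set_lebesgue_integral_cong)
qed

lemma lagged_step_cong:
  assumes "0 < T" "\<And>t. t \<in> {0..T} \<Longrightarrow> f t = g t"
  shows "lagged_step T j f t = lagged_step T j g t"
  unfolding lagged_step_def using lagged_mean_cong[OF assms(1) _ assms(2), of _ j]
  by (intro sum.cong) auto

text \<open>By the Cauchy-Schwarz inequality, averaging over an interval does not increase the \<open>L\<^sup>2\<close>-norm,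
  and the shift by one interval merely loses the mass on the last one. This uniform bound lets
  convergence pass from a dense class of functions to all of \<open>L\<^sup>2\<close>.\<close>

lemma l2sq_lagged_step_le:
  fixes f :: "real \<Rightarrow> 'a::euclidean_space"
  assumes T: "0 < T" and f[measurable]: "f \<in> borel_measurable borel"
  shows "l2sq (lborel_upto T) (lagged_step T j f) \<le> l2sq (lborel_upto T) f"
proof -
  let ?I = "\<lambda>i. {dyadic T j i<..dyadic T j (Suc i)}"
  have "l2sq (lborel_upto T) (lagged_step T j f)
     = (\<Sum>i<2^j. ennreal (min (dyadic T j (Suc i)) T - min (dyadic T j i) T)
            * ennreal ((norm (lagged_mean T j f i))\<^sup>2))"
    unfolding lagged_step_def[abs_def]
    by (rule nn_integral_step_sq) (auto intro: dyadic_le T)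
  also have "\<dots> \<le> (\<Sum>i<2^j. if i = 0 then 0 else
                    (\<integral>\<^sup>+t\<in>?I (i - 1). ennreal ((norm (f t))\<^sup>2) \<partial>lborel))"
  proof (intro sum_mono)
    fix i assume "i \<in> {..<(2::nat)^j}"
    then have i: "i < 2 ^ j" by simp
    have len: "min (dyadic T j (Suc i)) T - min (dyadic T j i) T = T / 2 ^ j"
      using dyadic_in[OF T, of i j] dyadic_in[OF T, of "Suc i" j] i by (simp add: dyadic_Suc)
    show "ennreal (min (dyadic T j (Suc i)) T - min (dyadic T j i) T)
            * ennreal ((norm (lagged_mean T j f i))\<^sup>2)
      \<le> (if i = 0 then 0 else (\<integral>\<^sup>+t\<in>?I (i - 1). ennreal ((norm (f t))\<^sup>2) \<partial>lborel))"
    proof (cases "i = 0")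
      case True then show ?thesis by (simp add: lagged_mean_def)
    next
      case False
      then obtain k where k: "i = Suc k" by (cases i) auto
      let ?h = "T / 2 ^ j"
      have h: "?h > 0" using T by simp
      let ?z = "norm (LBINT s:?I k. f s)" and ?R = "(\<integral>\<^sup>+t\<in>?I k. ennreal ((norm (f t))\<^sup>2) \<partial>lborel)"
      have "ennreal (?z\<^sup>2) \<le> ennreal ?h * ?R"
        using norm_set_integral_sq_le[of "?I k" lborel f] h by (simp add: dyadic_Suc)
      then have "ennreal (1 / ?h) * ennreal (?z\<^sup>2) \<le> ennreal (1 / ?h) * (ennreal ?h * ?R)"
        by (intro mult_left_mono) auto
      also have "\<dots> = ?R"
        by (simp only: mult.assoc[symmetric] ennreal_mult[symmetric] less_imp_le[OF h] zero_le_divide_1_iff)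
           (use h T in simp)
      finally have *: "ennreal (1 / ?h) * ennreal (?z\<^sup>2) \<le> ?R" .
      have "ennreal ?h * ennreal ((norm (lagged_mean T j f i))\<^sup>2) = ennreal (1 / ?h) * ennreal (?z\<^sup>2)"
        using h T by (simp add: lagged_mean_def k ennreal_mult[symmetric] power_mult_distrib power_divide
            power2_eq_square field_simps)
      then show ?thesis using * len k by simp
    qed
  qed
  also have "\<dots> \<le> (\<Sum>i<2^j. (\<integral>\<^sup>+t\<in>?I i. ennreal ((norm (f t))\<^sup>2) \<partial>lborel))"
  proof -
    obtain n where n: "(2::nat) ^ j = Suc n" by (metis not0_implies_Suc power_not_zero zero_neq_numeral)
    show ?thesis unfolding n by (subst sum.lessThan_Suc_shift) simp
  qed
  also have "\<dots> = (\<integral>\<^sup>+t. (\<Sum>i<2^j. ennreal ((norm (f t))\<^sup>2) * indicator (?I i) t) \<partial>lborel)"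
    by (subst nn_integral_sum) auto
  also have "\<dots> \<le> (\<integral>\<^sup>+t. ennreal ((norm (f t))\<^sup>2) * indicator {0..T} t \<partial>lborel)"
  proof (intro nn_integral_mono)
    fix t :: real
    have "(\<Sum>i<2^j. indicator (?I i) t) = (indicator (\<Union>i<2^j. ?I i) t :: ennreal)"
      using disjoint_dyadic[OF T, of j "2^j"] by (intro indicator_UN_disjoint[symmetric]) auto
    also have "\<dots> \<le> indicator {0..T} t"
    proof -
      have "?I i \<subseteq> {0..T}" if "i < 2 ^ j" for i
        using dyadic_in[OF T, of i j] dyadic_in[OF T, of "Suc i" j] that by auto
      then have sub: "(\<Union>i<2^j. ?I i) \<subseteq> {0..T}" by blast
      have "indicator A t \<le> (indicator B t :: ennreal)" if "A \<subseteq> B" for A B :: "real set"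
        using that by (auto simp: indicator_def)
      from this[OF sub] show ?thesis .
    qed
    finally show "(\<Sum>i<2^j. ennreal ((norm (f t))\<^sup>2) * indicator (?I i) t)
       \<le> ennreal ((norm (f t))\<^sup>2) * indicator {0..T} t"
      by (simp add: sum_distrib_left[symmetric] mult_left_mono)
  qed
  finally show ?thesis by (simp add: l2sq_lborel_upto)
qed

lemma ennreal_tendsto_0I:
  assumes "\<And>e. 0 < e \<Longrightarrow> eventually (\<lambda>j. X j \<le> ennreal e) F"
  shows "(X \<longlongrightarrow> 0) F"
proof (rule order_tendstoI)
  fix a :: ennreal assume "0 < a"
  then obtain b where b: "0 < b" "b < a" using dense by blast
  then obtain r where r: "b = ennreal r" "0 < r" by (cases b) (auto simp: ennreal_zero_less_top top_unique)
  from assms[OF r(2)] show "eventually (\<lambda>j. X j < a) F"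
    by eventually_elim (use b r in auto)
qed simp

lemma ennreal_tendsto_0D:
  assumes "(X \<longlongrightarrow> (0::ennreal)) F" "0 < e"
  shows "eventually (\<lambda>j. X j \<le> ennreal e) F"
  using order_tendstoD(2)[OF assms(1), of "ennreal e"] assms(2) by (auto elim: eventually_mono)

lemma ennreal_tendsto_0_le:
  assumes "\<And>j. X j \<le> Y j" "(Y \<longlongrightarrow> (0::ennreal)) F"
  shows "(X \<longlongrightarrow> 0) F"
  by (rule tendsto_sandwich[OF _ _ tendsto_const assms(2)]) (auto simp: assms(1))

text \<open>The good class for a density argument: bounded continuous functions belong to it, and it is
  closed under limits in \<open>L\<^sup>2\<close> because the averaging operators are contractions.\<close>

definition lagged_convergent :: "real \<Rightarrow> (real \<Rightarrow> 'a::euclidean_space) \<Rightarrow> bool" where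
  "lagged_convergent T f \<longleftrightarrow> f \<in> borel_measurable borel \<and> l2sq (lborel_upto T) f < \<infinity> \<and>
     (\<lambda>j. l2sq (lborel_upto T) (\<lambda>t. lagged_step T j f t - f t)) \<longlonglongrightarrow> 0"

lemma l2_imp_set_integrable:
  fixes f :: "real \<Rightarrow> 'a::euclidean_space"
  assumes f: "f \<in> borel_measurable borel" and fin: "l2sq (lborel_upto T) f < \<infinity>" and "A \<subseteq> {0..T}" "A \<in> sets borel"
  shows "set_integrable lborel A f"
proof -
  interpret finite_measure "lborel_upto T" by (rule finite_measure_lborel_upto)
  have [measurable]: "f \<in> borel_measurable (lborel_upto T)"
    using f by (intro measurable_restrict_space1) simp
  have "integrable (lborel_upto T) f"
  proof (rule Bochner_Integration.integrable_bound)
    have "integrable (lborel_upto T) (\<lambda>t. (norm (f t))\<^sup>2)" using fin l2sq_finite_iff[of f "lborel_upto T"] by simp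
    then show "integrable (lborel_upto T) (\<lambda>t. norm (f t))"
      by (rule square_integrable_imp_integrable[rotated]) measurable
  qed simp_all
  then have "set_integrable lborel {0..T} f"
    unfolding set_integrable_def by (simp add: integrable_restrict_space)
  then show ?thesis by (rule set_integrable_subset) (use assms in auto)
qed

lemma lagged_mean_linear:
  fixes f g :: "real \<Rightarrow> 'a::euclidean_space"
  assumes T: "0 < T" and f: "f \<in> borel_measurable borel" "l2sq (lborel_upto T) f < \<infinity>"
    and g: "g \<in> borel_measurable borel" "l2sq (lborel_upto T) g < \<infinity>" and i: "i \<le> 2 ^ j"
  shows "lagged_mean T j (\<lambda>s. f s - g s) i = lagged_mean T j f i - lagged_mean T j g i"
proof -
  have "{dyadic T j (i - 1)<..dyadic T j i} \<subseteq> {0..T}"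
    using dyadic_in[OF T i] dyadic_le[OF T, of 0 "i - 1" j] by auto
  from l2_imp_set_integrable[OF f this] l2_imp_set_integrable[OF g this] show ?thesis
    unfolding lagged_mean_def by (auto simp: set_integral_diff scaleR_diff_right)
qed

lemma lagged_step_diff:
  fixes f g :: "real \<Rightarrow> 'a::euclidean_space"
  assumes "0 < T" and "f \<in> borel_measurable borel" "l2sq (lborel_upto T) f < \<infinity>"
    and "g \<in> borel_measurable borel" "l2sq (lborel_upto T) g < \<infinity>"
  shows "lagged_step T j (\<lambda>s. f s - g s) t = lagged_step T j f t - lagged_step T j g t"
  unfolding lagged_step_def sum_subtractf[symmetric]
  by (intro sum.cong refl) (use lagged_mean_linear[OF assms] in \<open>auto simp: scaleR_diff_right\<close>)

lemma borel_measurable_lborel_upto: "f \<in> borel_measurable borel \<Longrightarrow> f \<in> borel_measurable (lborel_upto T)"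
  by (intro measurable_restrict_space1) simp

lemma l2sq_finite_diff:
  fixes f g :: "'b \<Rightarrow> 'a::{banach, second_countable_topology}"
  assumes "f \<in> borel_measurable M" "g \<in> borel_measurable M" "l2sq M f < \<infinity>" "l2sq M g < \<infinity>"
  shows "l2sq M (\<lambda>x. f x - g x) < \<infinity>"
proof -
  have "l2sq M (\<lambda>x. f x + - g x) \<le> 2 * l2sq M f + 2 * l2sq M (\<lambda>x. - g x)"
    using assms by (intro l2sq_add) auto
  also have "\<dots> < \<infinity>" using assms by (simp add: ennreal_mult_less_top ennreal_add_less_top)
  finally show ?thesis by simp
qed

text \<open>A standard three-term estimate: \<open>f\<close> is compared with some \<open>g n\<close>, and the averages of \<open>f - g n\<close>
  are controlled by \<open>l2sq_lagged_step_le\<close>.\<close>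

lemma lagged_convergent_limit:
  fixes f :: "real \<Rightarrow> 'a::euclidean_space"
  assumes T: "0 < T" and f: "f \<in> borel_measurable borel" "l2sq (lborel_upto T) f < \<infinity>"
    and good: "\<And>n. lagged_convergent T (g n)"
    and lim: "(\<lambda>n. l2sq (lborel_upto T) (\<lambda>t. f t - g n t)) \<longlonglongrightarrow> 0"
  shows "lagged_convergent T f"
proof -
  let ?N = "l2sq (lborel_upto T)"
  have "(\<lambda>j. ?N (\<lambda>t. lagged_step T j f t - f t)) \<longlonglongrightarrow> 0"
  proof (rule ennreal_tendsto_0I)
    fix e :: real assume "0 < e"
    \<comment> \<open>The factors of 2 in the two uses of the triangle inequality add up to 10.\<close>
    obtain n where n: "?N (\<lambda>t. f t - g n t) \<le> ennreal (e / 12)"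
      using ennreal_tendsto_0D[OF lim, of "e / 12"] \<open>0 < e\<close> by (auto simp: eventually_sequentially)
    have g: "g n \<in> borel_measurable borel" "?N (g n) < \<infinity>" and
      g_lim: "(\<lambda>j. ?N (\<lambda>t. lagged_step T j (g n) t - g n t)) \<longlonglongrightarrow> 0"
      using good[of n] by (auto simp: lagged_convergent_def)
    note [measurable] = borel_measurable_lborel_upto[OF f(1)] borel_measurable_lborel_upto[OF g(1)]
      borel_measurable_lborel_upto[OF lagged_step_measurable]
    show "eventually (\<lambda>j. ?N (\<lambda>t. lagged_step T j f t - f t) \<le> ennreal e) sequentially"
      using ennreal_tendsto_0D[OF g_lim divide_pos_pos[OF \<open>0 < e\<close> zero_less_numeral[of "num.Bit0 (num.Bit0 (num.Bit1 num.One))"]]]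
    proof (eventually_elim)
      case (elim j)
      then have gj: "?N (\<lambda>t. lagged_step T j (g n) t - g n t) \<le> ennreal (e / 12)" by simp
      have "?N (\<lambda>t. lagged_step T j f t - lagged_step T j (g n) t) = ?N (lagged_step T j (\<lambda>t. f t - g n t))"
        using lagged_step_diff[OF T f g] by (intro l2sq_cong) simp
      also have "\<dots> \<le> ?N (\<lambda>t. f t - g n t)"
        using f g by (intro l2sq_lagged_step_le T) auto
      finally have 1: "?N (\<lambda>t. lagged_step T j f t - lagged_step T j (g n) t) \<le> ennreal (e / 12)"
        using n by simp
      have "?N (\<lambda>t. lagged_step T j (g n) t - f t)
          \<le> 2 * ?N (\<lambda>t. lagged_step T j (g n) t - g n t) + 2 * ?N (\<lambda>t. g n t - f t)"
        by (intro l2sq_diff_triangle) measurable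
      also have "\<dots> \<le> 2 * ennreal (e / 12) + 2 * ennreal (e / 12)"
        using gj n by (intro add_mono mult_left_mono) (auto simp: l2sq_minus_commute[of _ "g n"])
      finally have 2: "?N (\<lambda>t. lagged_step T j (g n) t - f t) \<le> 2 * ennreal (e / 12) + 2 * ennreal (e / 12)" .
      have "?N (\<lambda>t. lagged_step T j f t - f t) \<le>
          2 * ?N (\<lambda>t. lagged_step T j f t - lagged_step T j (g n) t) + 2 * ?N (\<lambda>t. lagged_step T j (g n) t - f t)"
        by (intro l2sq_diff_triangle) measurable
      also have "\<dots> \<le> 2 * ennreal (e / 12) + 2 * (2 * ennreal (e / 12) + 2 * ennreal (e / 12))"
        using 1 2 by (intro add_mono mult_left_mono) auto
      also have "\<dots> = ennreal (2 * (e / 12) + 2 * (2 * (e / 12) + 2 * (e / 12)))"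
        using \<open>0 < e\<close> by (simp only: ennreal_plus ennreal_mult'' ennreal_numeral
            mult_nonneg_nonneg add_nonneg_nonneg divide_nonneg_nonneg less_imp_le zero_le_numeral)
      also have "\<dots> \<le> ennreal e" using \<open>0 < e\<close> by (intro ennreal_leI) simp
      finally show ?case .
    qed
  qed
  then show ?thesis using f by (simp add: lagged_convergent_def)
qed

text \<open>Used with \<open>v = 0\<close> for a uniform bound on the averages and with \<open>v = f t\<close> for their convergence.\<close>

lemma lagged_mean_near:
  fixes f :: "real \<Rightarrow> 'a::euclidean_space"
  assumes T: "0 < T" and f: "f \<in> borel_measurable borel" "l2sq (lborel_upto T) f < \<infinity>" and i: "Suc k \<le> 2 ^ j"
    and near: "\<And>s. s \<in> {dyadic T j k<..dyadic T j (Suc k)} \<Longrightarrow> norm (f s - v) \<le> e"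
  shows "norm (lagged_mean T j f (Suc k) - v) \<le> e"
proof -
  let ?A = "{dyadic T j k<..dyadic T j (Suc k)}"
  define h where "h = T / 2 ^ j"
  have h: "0 < h" using T by (simp add: h_def)
  have A: "emeasure lborel ?A = ennreal h" "measure lborel ?A = h"
    using h by (simp_all add: dyadic_Suc h_def)
  have "?A \<subseteq> {0..T}" using dyadic_in[OF T i] dyadic_le[OF T, of 0 k j] by auto
  from l2_imp_set_integrable[OF f this] have fi: "set_integrable lborel ?A f" by simp
  have ci: "set_integrable lborel ?A (\<lambda>_. c)" for c :: "'b::euclidean_space"
    unfolding set_integrable_def using A(1) by (intro integrable_indicator) auto
  have const: "(LBINT s:?A. c) = h *\<^sub>R c" for c :: "'b::euclidean_space"
    using A by (subst set_integral_const) auto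
  have inv: "2 ^ j / T = 1 / h" by (simp add: h_def)
  have "lagged_mean T j f (Suc k) - v = (1 / h) *\<^sub>R (LBINT s:?A. f s - v)"
    using h by (simp add: inv lagged_mean_def set_integral_diff(2)[OF fi ci] const scaleR_diff_right)
  moreover have "norm (LBINT s:?A. f s - v) \<le> (LBINT s:?A. e)"
    unfolding set_lebesgue_integral_def
  proof (rule Bochner_Integration.integral_norm_bound_integral)
    show "integrable lborel (\<lambda>s. indicat_real ?A s *\<^sub>R (f s - v))"
      using set_integral_diff(1)[OF fi ci] by (simp add: set_integrable_def)
    show "integrable lborel (\<lambda>s. indicat_real ?A s *\<^sub>R e)" using ci[of e] unfolding set_integrable_def .
  qed (use near in \<open>auto simp: indicator_def\<close>)
  ultimately show ?thesis using h const[of e] by (simp add: divide_le_eq mult.commute)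
qed

lemma l2sq_dominated_convergence:
  fixes f :: "'b \<Rightarrow> 'a::{banach, second_countable_topology}" and w :: "'b \<Rightarrow> real"
  assumes [measurable]: "f \<in> borel_measurable M" "\<And>k. u k \<in> borel_measurable M" "w \<in> borel_measurable M"
    and lim: "AE x in M. (\<lambda>k. u k x) \<longlonglongrightarrow> f x" and le: "\<And>k. AE x in M. norm (u k x) \<le> w x"
    and fin: "l2sq M w < \<infinity>"
  shows "(\<lambda>k. l2sq M (\<lambda>x. u k x - f x)) \<longlonglongrightarrow> 0"
proof -
  have le': "AE x in M. \<forall>k. norm (u k x) \<le> w x" using le by (simp add: AE_all_countable)
  have "(\<lambda>k. l2sq M (\<lambda>x. u k x - f x)) \<longlonglongrightarrow> (\<integral>\<^sup>+x. 0 \<partial>M)"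
    unfolding l2sq_def
  proof (rule nn_integral_dominated_convergence[where w = "\<lambda>x. ennreal ((norm (2 *\<^sub>R w x))\<^sup>2)"])
    have "l2sq M (\<lambda>x. 2 *\<^sub>R w x) < \<infinity>" using fin by (subst l2sq_scaleR) (simp_all add: ennreal_mult_less_top)
    then show "(\<integral>\<^sup>+x. ennreal ((norm (2 *\<^sub>R w x))\<^sup>2) \<partial>M) < \<infinity>" by (simp only: l2sq_def)
    show "AE x in M. ennreal ((norm (u k x - f x))\<^sup>2) \<le> ennreal ((norm (2 *\<^sub>R w x))\<^sup>2)" for k
      using lim le'
    proof eventually_elim
      case (elim x)
      have "norm (f x) \<le> w x"
        using elim(2) by (intro LIMSEQ_le_const2[OF tendsto_norm[OF elim(1)]]) auto
      moreover have "norm (u k x - f x) \<le> norm (u k x) + norm (f x)" by (rule norm_triangle_ineq4)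
      ultimately have "norm (u k x - f x) \<le> norm (2 *\<^sub>R w x)" using elim(2)[rule_format, of k] by simp
      then show ?case by (intro ennreal_leI power_mono) auto
    qed
    show "AE x in M. (\<lambda>k. ennreal ((norm (u k x - f x))\<^sup>2)) \<longlonglongrightarrow> 0"
      using lim
    proof eventually_elim
      case (elim x)
      then have "(\<lambda>k. ennreal ((norm (u k x - f x))\<^sup>2)) \<longlonglongrightarrow> ennreal ((norm (f x - f x))\<^sup>2)"
        by (intro tendsto_intros)
      then show ?case by simp
    qed
  qed measurable
  then show ?thesis by simp
qed

lemma l2sq_bounded:
  assumes "\<And>t. norm (f t) \<le> C"
  shows "l2sq (lborel_upto T) f < \<infinity>"
proof -
  have "l2sq (lborel_upto T) f \<le> l2sq (lborel_upto T) (\<lambda>_. C)"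
    using assms by (intro l2sq_mono_AE AE_I2) (auto intro: order_trans[OF _ abs_ge_self])
  also have "\<dots> < \<infinity>"
    using finite_measure.emeasure_finite[OF finite_measure_lborel_upto[of T]]
    by (auto simp: l2sq_def ennreal_mult_less_top top.not_eq_extremum)
  finally show ?thesis .
qed

text \<open>For \<open>t > 0\<close> and a fine mesh, the interval preceding the one that contains \<open>t\<close> lies within two
  mesh widths of \<open>t\<close>; hence the averages converge pointwise by continuity, and boundedness turns this
  into convergence in \<open>L\<^sup>2\<close>.\<close>

lemma lagged_convergent_continuous:
  fixes f :: "real \<Rightarrow> 'a::euclidean_space"
  assumes T: "0 < T" and cont: "continuous_on UNIV f" and bd: "\<And>t. norm (f t) \<le> C"
  shows "lagged_convergent T f"
proof -
  have f: "f \<in> borel_measurable borel" using cont by (rule borel_measurable_continuous_onI)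
  note fin = l2sq_bounded[OF bd, of T]
  have "0 \<le> C" using bd[of 0] norm_ge_zero order_trans by blast
  have mean_le: "norm (lagged_mean T j f i) \<le> C" if "i \<le> 2 ^ j" for i j
  proof (cases i)
    case 0
    then show ?thesis using \<open>0 \<le> C\<close> by (simp add: lagged_mean_def)
  next
    case (Suc k)
    then show ?thesis using lagged_mean_near[OF T f fin, of k j 0 C] that bd by simp
  qed
  have step_le: "norm (lagged_step T j f t) \<le> C" if t: "t \<in> {0<..T}" for j t
  proof -
    obtain i where i: "i < 2 ^ j" "t \<in> {dyadic T j i<..dyadic T j (Suc i)}"
      by (rule dyadic_cell_exists[OF T, of t j]) (use t in auto)
    then show ?thesis using lagged_step_eq[OF T i, of f] mean_le[of i j] by simp
  qed
  have lim: "(\<lambda>j. lagged_step T j f t) \<longlonglongrightarrow> f t" if t: "t \<in> {0<..T}" for t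
  proof (rule tendsto_norm_zero_cancel[THEN LIM_zero_cancel], rule tendstoI)
    fix e :: real assume "0 < e"
    then obtain d where d: "0 < d" "\<And>s. dist s t < d \<Longrightarrow> dist (f s) (f t) < e / 2"
      using cont unfolding continuous_on_iff by (metis UNIV_I half_gt_zero)
    have "(\<lambda>j. T / 2 ^ j) \<longlonglongrightarrow> 0" using LIMSEQ_divide_realpow_zero[of 2 T] by simp
    then have "eventually (\<lambda>j. T / 2 ^ j < min t (d / 2)) sequentially"
      by (rule order_tendstoD) (use t d in auto)
    then show "eventually (\<lambda>j. dist (norm (lagged_step T j f t - f t)) 0 < e) sequentially"
    proof eventually_elim
      case (elim j)
      obtain i where i: "i < 2 ^ j" "t \<in> {dyadic T j i<..dyadic T j (Suc i)}"
        by (rule dyadic_cell_exists[OF T, of t j]) (use t in auto)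
      have "i \<noteq> 0" using i elim by (intro notI) (simp add: dyadic_Suc)
      then obtain k where k: "i = Suc k" by (cases i) auto
      have "norm (lagged_mean T j f (Suc k) - f t) \<le> e / 2"
      proof (rule lagged_mean_near[OF T f fin])
        fix s assume "s \<in> {dyadic T j k<..dyadic T j (Suc k)}"
        then have "\<bar>s - t\<bar> \<le> 2 * (T / 2 ^ j)" using i(2) unfolding k dyadic_Suc by auto
        then have "dist s t < d" using elim unfolding dist_real_def by linarith
        then show "norm (f s - f t) \<le> e / 2" using d(2)[of s] by (simp add: dist_norm)
      qed (use i k in simp)
      then show ?case using lagged_step_eq[OF T i, of f] k \<open>0 < e\<close> by simp
    qed
  qed
  have ae: "AE t in lborel_upto T. t \<in> {0<..T}"
    using AE_lborel_singleton[of "0::real"] by (auto simp: AE_restrict_space_iff elim: eventually_mono)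
  have "(\<lambda>j. l2sq (lborel_upto T) (\<lambda>t. lagged_step T j f t - f t)) \<longlonglongrightarrow> 0"
  proof (rule l2sq_dominated_convergence[where w = "\<lambda>_. C"])
    show "AE t in lborel_upto T. (\<lambda>j. lagged_step T j f t) \<longlonglongrightarrow> f t"
      using ae by eventually_elim (rule lim)
    show "AE t in lborel_upto T. norm (lagged_step T j f t) \<le> C" for j
      using ae by eventually_elim (rule step_le)
    show "l2sq (lborel_upto T) (\<lambda>_. C) < \<infinity>" by (rule l2sq_bounded[of _ "\<bar>C\<bar>"]) simp
  qed (use f in \<open>auto intro: borel_measurable_lborel_upto\<close>)
  then show ?thesis using f fin by (simp add: lagged_convergent_def)
qed

text \<open>A measurable function is almost everywhere a limit of continuous functions. Projecting these to
  the ball that contains the values of \<open>f\<close> makes them uniformly bounded, so that the limit also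
  holds in \<open>L\<^sup>2\<close>.\<close>

lemma lagged_convergent_bounded:
  fixes f :: "real \<Rightarrow> 'a::euclidean_space"
  assumes T: "0 < T" and f: "f \<in> borel_measurable borel" and bd: "\<And>t. norm (f t) \<le> C"
  shows "lagged_convergent T f"
proof -
  have "0 \<le> C" using bd[of 0] norm_ge_zero order_trans by blast
  have "f measurable_on UNIV"
    using f by (intro lebesgue_measurable_imp_measurable_on measurable_completion) auto
  then obtain N g where N: "negligible N" and g: "\<And>n. continuous_on UNIV (g n)"
    and lim: "\<And>x. x \<notin> N \<Longrightarrow> (\<lambda>n. g n x) \<longlonglongrightarrow> f x"
    unfolding measurable_on_def by auto
  define r where "r = closest_point (cball (0::'a) C)"
  have r: "continuous_on UNIV r" "r v \<in> cball 0 C" "v \<in> cball 0 C \<Longrightarrow> r v = v" for v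
    unfolding r_def using \<open>0 \<le> C\<close>
    by (intro continuous_on_closest_point closest_point_in_set closest_point_self; simp)+
  have rg: "continuous_on UNIV (\<lambda>t. r (g n t))" for n
    by (rule continuous_on_compose2[OF r(1) g]) simp
  have rg_le: "norm (r (g n t)) \<le> C" for n t using r(2)[of "g n t"] by simp
  have ae: "AE t in lborel. t \<notin> N"
  proof -
    obtain N' where "N' \<in> null_sets lborel" "N \<subseteq> N'"
      using N by (auto simp: negligible_iff_null_sets null_sets_completion_iff2)
    then show ?thesis using AE_not_in[of N' lborel] by (auto elim: eventually_mono)
  qed
  have "(\<lambda>n. l2sq (lborel_upto T) (\<lambda>t. r (g n t) - f t)) \<longlonglongrightarrow> 0"
  proof (rule l2sq_dominated_convergence[where w = "\<lambda>_. C"])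
    have "AE t in lborel_upto T. t \<notin> N" using ae by (auto simp: AE_restrict_space_iff elim: eventually_mono)
    then show "AE t in lborel_upto T. (\<lambda>n. r (g n t)) \<longlonglongrightarrow> f t"
    proof eventually_elim
      case (elim t)
      have "(\<lambda>n. r (g n t)) \<longlonglongrightarrow> r (f t)"
        by (rule continuous_on_tendsto_compose[OF r(1) lim[OF elim]]) auto
      then show ?case using r(3)[of "f t"] bd[of t] by simp
    qed
    show "l2sq (lborel_upto T) (\<lambda>_. C) < \<infinity>" by (rule l2sq_bounded[of _ "\<bar>C\<bar>"]) simp
  qed (use f rg rg_le in \<open>auto intro!: borel_measurable_lborel_upto borel_measurable_continuous_onI\<close>)
  then show ?thesis
    by (intro lagged_convergent_limit[OF T f l2sq_bounded[OF bd], of "\<lambda>n t. r (g n t)"] lagged_convergent_continuous[OF T rg rg_le])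
       (simp add: l2sq_minus_commute[of _ f])
qed

theorem lagged_step_tendsto:
  fixes f :: "real \<Rightarrow> 'a::euclidean_space"
  assumes T: "0 < T" and f: "f \<in> borel_measurable borel" and fin: "l2sq (lborel_upto T) f < \<infinity>"
  shows "(\<lambda>j. l2sq (lborel_upto T) (\<lambda>t. lagged_step T j f t - f t)) \<longlonglongrightarrow> 0"
proof -
  let ?g = "\<lambda>n t. if norm (f t) \<le> real n then f t else 0"
  have g: "?g n \<in> borel_measurable borel" for n using f by measurable
  have "(\<lambda>n. l2sq (lborel_upto T) (\<lambda>t. ?g n t - f t)) \<longlonglongrightarrow> 0"
  proof (rule l2sq_dominated_convergence[where w = "\<lambda>t. norm (f t)"])
    show "AE t in lborel_upto T. (\<lambda>n. ?g n t) \<longlonglongrightarrow> f t"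
    proof (rule AE_I2)
      fix t
      obtain n0 where "norm (f t) \<le> real n0" using real_arch_simple by blast
      then show "(\<lambda>n. ?g n t) \<longlonglongrightarrow> f t"
        by (intro tendsto_eventually eventually_sequentiallyI[of n0]) auto
    qed
    show "l2sq (lborel_upto T) (\<lambda>t. norm (f t)) < \<infinity>" using fin by (simp add: l2sq_def)
  qed (use f g in \<open>auto intro!: borel_measurable_lborel_upto borel_measurable_norm\<close>)
  then have "lagged_convergent T f"
    by (intro lagged_convergent_limit[OF T f fin, of ?g] lagged_convergent_bounded[OF T g])
       (auto simp: l2sq_minus_commute[of _ f])
  then show ?thesis by (simp add: lagged_convergent_def)
qed

section \<open>Square-integrable sequences and processes\<close>

lemma l2_imp_integrable:
  fixes f :: "'b \<Rightarrow> 'a::euclidean_space"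
  assumes "finite_measure M" and [measurable]: "f \<in> borel_measurable M" and fin: "l2sq M f < \<infinity>"
  shows "integrable M f"
proof -
  interpret finite_measure M by fact
  show ?thesis
  proof (rule Bochner_Integration.integrable_bound)
    have "integrable M (\<lambda>t. (norm (f t))\<^sup>2)" using fin l2sq_finite_iff[of f M] by simp
    then show "integrable M (\<lambda>t. norm (f t))"
      by (rule square_integrable_imp_integrable[rotated]) measurable
  qed simp_all
qed

text \<open>If the squared distances of consecutive terms are summable with weights \<open>2 ^ k\<close>, then so are the
  distances themselves at almost every point, because
  \<open>2 * \<bar>d\<bar> \<le> (1/2) ^ k + 2 ^ k * d\<^sup>2\<close>. The same weights absorb the factors of 2 that accumulate
  when the triangle inequality is applied repeatedly, which gives a rate for the limit.\<close>

lemma l2_fast_Cauchy: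
  fixes f :: "nat \<Rightarrow> 'b \<Rightarrow> 'a::euclidean_space"
  assumes f[measurable]: "\<And>k. f k \<in> borel_measurable M"
    and le: "\<And>k. l2sq M (\<lambda>x. f (Suc k) x - f k x) \<le> ennreal (a k)"
    and a: "\<And>k. 0 \<le> a k" and sum: "summable (\<lambda>k. 2 ^ k * a k)"
  shows "AE x in M. convergent (\<lambda>k. f k x)"
    and "l2sq M (\<lambda>x. lim (\<lambda>k. f k x) - f k x) \<le> ennreal (2 * (\<Sum>i. 2 ^ (i + k) * a (i + k)))"
proof -
  let ?d = "\<lambda>k x. f (Suc k) x - f k x"
  have "(\<integral>\<^sup>+x. (\<Sum>k. ennreal (2 ^ k * (norm (?d k x))\<^sup>2)) \<partial>M)
     = (\<Sum>k. ennreal (2 ^ k) * l2sq M (?d k))"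
    unfolding l2sq_def
    by (subst nn_integral_suminf) (auto simp: nn_integral_cmult ennreal_mult)
  also have "\<dots> \<le> (\<Sum>k. ennreal (2 ^ k * a k))"
    using a by (intro suminf_le) (auto simp: ennreal_mult intro!: mult_left_mono le)
  also have "\<dots> = ennreal (\<Sum>k. 2 ^ k * a k)"
    using a sum by (intro suminf_ennreal2) auto
  finally have "(\<integral>\<^sup>+x. (\<Sum>k. ennreal (2 ^ k * (norm (?d k x))\<^sup>2)) \<partial>M) < \<infinity>"
    by (simp add: order_le_less_trans)
  then have "AE x in M. (\<Sum>k. ennreal (2 ^ k * (norm (?d k x))\<^sup>2)) \<noteq> \<infinity>"
    by (intro nn_integral_PInf_AE) auto
  then show conv: "AE x in M. convergent (\<lambda>k. f k x)"
  proof eventually_elim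
    case (elim x)
    then have s: "summable (\<lambda>k. 2 ^ k * (norm (?d k x))\<^sup>2)"
      by (intro summable_suminf_not_top) auto
    have "summable (\<lambda>k. norm (?d k x))"
    proof (rule summable_comparison_test')
      show "summable (\<lambda>k. (1/2) ^ k + 2 ^ k * (norm (?d k x))\<^sup>2)"
        using s by (intro summable_add summable_geometric) auto
      fix k :: nat
      have "0 \<le> ((1/2) ^ k - norm (?d k x))\<^sup>2" by simp
      then have "2 * (1/2) ^ k * norm (?d k x) \<le> ((1/2) ^ k)\<^sup>2 + (norm (?d k x))\<^sup>2"
        by (simp add: power2_diff)
      then have "2 ^ k * (2 * (1/2) ^ k * norm (?d k x)) \<le> 2 ^ k * (((1/2) ^ k)\<^sup>2 + (norm (?d k x))\<^sup>2)"
        by (intro mult_left_mono) auto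
      moreover have "2 ^ k * (1/2) ^ k = (1::real)" by (simp flip: power_mult_distrib)
      ultimately have "2 * norm (?d k x) \<le> (1/2) ^ k + 2 ^ k * (norm (?d k x))\<^sup>2"
        by (simp add: distrib_left power2_eq_square mult.assoc[symmetric])
           (simp add: mult.commute mult.left_commute)
      then show "norm (norm (?d k x)) \<le> (1/2) ^ k + 2 ^ k * (norm (?d k x))\<^sup>2"
        using norm_ge_zero[of "?d k x"] unfolding real_norm_def abs_norm_cancel by linarith
    qed
    then have "summable (\<lambda>k. ?d k x)" by (rule summable_norm_cancel)
    then have "convergent (\<lambda>n. f n x - f 0 x)"
      unfolding summable_iff_convergent by (simp add: sum_lessThan_telescope[of "\<lambda>k. f k x"])
    then have "convergent (\<lambda>n. (f n x - f 0 x) + f 0 x)"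
      by (intro convergent_add convergent_const)
    then show ?case by simp
  qed
  have step: "l2sq M (\<lambda>x. f m x - f k x) \<le> ennreal (2 * (\<Sum>i = k..<m. 2 ^ (i - k) * a i))" if "k \<le> m" for k m
    using that
  proof (induction k rule: inc_induct)
    case base
    show ?case by simp
  next
    case (step k)
    have eq: "(\<Sum>i = k..<m. 2 ^ (i - k) * a i) = a k + 2 * (\<Sum>i = Suc k..<m. 2 ^ (i - Suc k) * a i)"
    proof -
      have "(\<Sum>i = k..<m. 2 ^ (i - k) * a i) = a k + (\<Sum>i = Suc k..<m. 2 ^ (i - k) * a i)"
        using step by (subst sum.atLeast_Suc_lessThan) auto
      also have "(\<Sum>i = Suc k..<m. 2 ^ (i - k) * a i) = (\<Sum>i = Suc k..<m. 2 * (2 ^ (i - Suc k) * a i))"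
      proof (intro sum.cong refl)
        fix i assume "i \<in> {Suc k..<m}"
        then have "i - k = Suc (i - Suc k)" by auto
        then show "2 ^ (i - k) * a i = 2 * (2 ^ (i - Suc k) * a i)" by simp
      qed
      finally show ?thesis by (simp add: sum_distrib_left)
    qed
    have nn: "0 \<le> (\<Sum>i = Suc k..<m. 2 ^ (i - Suc k) * a i)" using a by (intro sum_nonneg) auto
    have "l2sq M (\<lambda>x. f m x - f k x) \<le> 2 * l2sq M (\<lambda>x. f m x - f (Suc k) x) + 2 * l2sq M (?d k)"
      by (intro l2sq_diff_triangle) measurable
    also have "\<dots> \<le> 2 * ennreal (2 * (\<Sum>i = Suc k..<m. 2 ^ (i - Suc k) * a i)) + 2 * ennreal (a k)"
      by (intro add_mono mult_left_mono le step.IH) auto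
    also have "\<dots> = ennreal (2 * (\<Sum>i = k..<m. 2 ^ (i - k) * a i))"
      unfolding eq using nn a[of k]
      by (simp add: ennreal_mult' ennreal_plus distrib_left mult.assoc add.commute)
    finally show ?case .
  qed
  have tail: "l2sq M (\<lambda>x. f m x - f k x) \<le> ennreal (2 * (\<Sum>i. 2 ^ (i + k) * a (i + k)))" if "k \<le> m" for m
  proof -
    have "(\<Sum>i = k..<m. 2 ^ (i - k) * a i) \<le> (\<Sum>i = k..<m. 2 ^ i * a i)"
      using a by (intro sum_mono mult_right_mono power_increasing) auto
    also have "\<dots> = (\<Sum>i<m - k. 2 ^ (i + k) * a (i + k))"
      using sum.shift_bounds_nat_ivl[of "\<lambda>i. 2 ^ i * a i" 0 k "m - k"] that
      by (simp add: atLeast0LessThan)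
    also have "\<dots> \<le> (\<Sum>i. 2 ^ (i + k) * a (i + k))"
      using a by (intro sum_le_suminf summable_ignore_initial_segment[OF sum]) auto
    finally show ?thesis by (intro order_trans[OF step[OF that]] ennreal_leI) simp
  qed
  show "l2sq M (\<lambda>x. lim (\<lambda>k. f k x) - f k x) \<le> ennreal (2 * (\<Sum>i. 2 ^ (i + k) * a (i + k)))"
  proof (rule l2sq_Fatou[where u = "\<lambda>m x. f m x - f k x" and K = k])
    show "AE x in M. (\<lambda>m. f m x - f k x) \<longlonglongrightarrow> lim (\<lambda>k. f k x) - f k x"
      using conv by eventually_elim (auto simp: convergent_LIMSEQ_iff intro!: tendsto_intros)
  qed (auto intro: tail)
qed

text \<open>The squared norm of \<open>L\<^sup>2([0,t] \<times> \<Omega>)\<close>, integrated over \<open>\<Omega>\<close> first. This order suits estimates that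
  are uniform in time; \<open>energy_swap\<close> recovers the opposite order.\<close>

definition energy :: "'w measure \<Rightarrow> real \<Rightarrow> (real \<Rightarrow> 'w \<Rightarrow> 'a::real_normed_vector) \<Rightarrow> ennreal" where
  "energy P t \<phi> = (\<integral>\<^sup>+s. l2sq P (\<phi> s) \<partial>lborel_upto t)"

definition joint_measurable :: "'w measure \<Rightarrow> real \<Rightarrow> (real \<Rightarrow> 'w \<Rightarrow> 'a::euclidean_space) \<Rightarrow> bool" where
  "joint_measurable P T \<phi> \<longleftrightarrow> case_prod \<phi> \<in> borel_measurable (lborel_upto T \<Otimes>\<^sub>M P)"

lemma joint_measurable_iff:
  "joint_measurable P T \<phi> \<longleftrightarrow> (\<lambda>(t, \<omega>). \<phi> t \<omega>) \<in> borel_measurable (restrict_space borel {0..T} \<Otimes>\<^sub>M P)"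
proof -
  have "sets (lborel_upto T \<Otimes>\<^sub>M P) = sets (restrict_space borel {0..T} \<Otimes>\<^sub>M P)"
    by (intro sets_pair_measure_cong sets_restrict_space_cong) simp_all
  then show ?thesis
    unfolding joint_measurable_def using measurable_cong_sets by blast
qed

lemma joint_measurable_upto:
  assumes "joint_measurable P T \<phi>" "t \<le> T"
  shows "joint_measurable P t \<phi>"
proof -
  have "(\<lambda>x. x) \<in> measurable (lborel_upto t) (lborel_upto T)"
    using assms(2) by (intro measurable_restrict_space3) auto
  then have "(\<lambda>z. (fst z, snd z)) \<in> measurable (lborel_upto t \<Otimes>\<^sub>M P) (lborel_upto T \<Otimes>\<^sub>M P)"
    by (intro measurable_Pair measurable_compose[OF measurable_fst] measurable_snd)
  from measurable_compose[OF this] assms(1) show ?thesis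
    unfolding joint_measurable_def by simp
qed

lemma joint_measurable_section:
  assumes "joint_measurable P T \<phi>" "t \<in> {0..T}"
  shows "\<phi> t \<in> borel_measurable P"
proof -
  have "(\<lambda>\<omega>. case_prod \<phi> (t, \<omega>)) \<in> borel_measurable P"
    using assms unfolding joint_measurable_def
    by (intro measurable_compose[OF measurable_Pair1']) (auto simp: space_restrict_space)
  then show ?thesis by simp
qed

lemma joint_measurable_path:
  assumes "joint_measurable P T \<phi>" "\<omega> \<in> space P"
  shows "(\<lambda>t. \<phi> t \<omega>) \<in> borel_measurable (lborel_upto T)"
proof -
  have "(\<lambda>t. case_prod \<phi> (t, \<omega>)) \<in> borel_measurable (lborel_upto T)"
    using assms unfolding joint_measurable_def
    by (intro measurable_compose[OF measurable_Pair2']) auto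
  then show ?thesis by simp
qed

lemma joint_measurable_deterministic:
  assumes "f \<in> borel_measurable (lborel_upto T)"
  shows "joint_measurable P T (\<lambda>t \<omega>. f t)"
  unfolding joint_measurable_def using assms by (simp add: case_prod_beta')

lemma joint_measurable_add:
  assumes "joint_measurable P T \<phi>" "joint_measurable P T \<psi>"
  shows "joint_measurable P T (\<lambda>t \<omega>. \<phi> t \<omega> + \<psi> t \<omega>)"
    and "joint_measurable P T (\<lambda>t \<omega>. \<phi> t \<omega> - \<psi> t \<omega>)"
  using assms unfolding joint_measurable_def case_prod_beta' by simp_all

lemma energy_mono: "s \<le> t \<Longrightarrow> energy P s \<phi> \<le> energy P t \<phi>"
  unfolding energy_def nn_integral_restrict_space[of _ lborel, simplified]
  by (simp add: nn_integral_restrict_space) (intro nn_integral_mono, auto simp: indicator_def)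

lemma energy_cong:
  "(\<And>s. s \<in> {0..t} \<Longrightarrow> l2sq P (\<phi> s) = l2sq P (\<psi> s)) \<Longrightarrow> energy P t \<phi> = energy P t \<psi>"
  unfolding energy_def by (intro nn_integral_cong) (auto simp: space_restrict_space)

lemma energy_le:
  "(\<And>s. s \<in> {0..t} \<Longrightarrow> l2sq P (\<phi> s) \<le> g s) \<Longrightarrow> energy P t \<phi> \<le> (\<integral>\<^sup>+s. g s \<partial>lborel_upto t)"
  unfolding energy_def by (intro nn_integral_mono) (auto simp: space_restrict_space)

lemma (in sigma_finite_measure) l2sq_section_measurable:
  assumes "joint_measurable M T \<phi>"
  shows "(\<lambda>s. l2sq M (\<phi> s)) \<in> borel_measurable (lborel_upto T)"
proof -
  have [measurable]: "case_prod \<phi> \<in> borel_measurable (lborel_upto T \<Otimes>\<^sub>M M)"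
    using assms by (simp add: joint_measurable_def)
  have "(\<lambda>s. l2sq M (\<lambda>\<omega>. case_prod \<phi> (s, \<omega>))) \<in> borel_measurable (lborel_upto T)"
    unfolding l2sq_def by (rule borel_measurable_nn_integral) measurable
  then show ?thesis by simp
qed

lemma (in finite_measure) energy_swap:
  assumes "joint_measurable M T \<phi>"
  shows "(\<integral>\<^sup>+\<omega>. l2sq (lborel_upto T) (\<lambda>s. \<phi> s \<omega>) \<partial>M) = energy M T \<phi>"
proof -
  interpret L: finite_measure "lborel_upto T" by (rule finite_measure_lborel_upto)
  interpret pair_sigma_finite "lborel_upto T" M ..
  have [measurable]: "case_prod \<phi> \<in> borel_measurable (lborel_upto T \<Otimes>\<^sub>M M)"
    using assms by (simp add: joint_measurable_def)
  have "(\<integral>\<^sup>+\<omega>. (\<integral>\<^sup>+s. (\<lambda>z. ennreal ((norm (case_prod \<phi> z))\<^sup>2)) (s, \<omega>) \<partial>lborel_upto T) \<partial>M)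
     = (\<integral>\<^sup>+s. (\<integral>\<^sup>+\<omega>. (\<lambda>z. ennreal ((norm (case_prod \<phi> z))\<^sup>2)) (s, \<omega>) \<partial>M) \<partial>lborel_upto T)"
    by (rule Fubini) measurable
  then show ?thesis by (simp add: energy_def l2sq_def)
qed

lemma (in sigma_finite_measure) energy_add:
  assumes "joint_measurable M T \<phi>" "joint_measurable M T \<psi>" "t \<le> T"
  shows "energy M t (\<lambda>s \<omega>. \<phi> s \<omega> + \<psi> s \<omega>) \<le> 2 * energy M t \<phi> + 2 * energy M t \<psi>"
proof -
  have j: "joint_measurable M t \<phi>" "joint_measurable M t \<psi>"
    using assms joint_measurable_upto by blast+
  note [measurable] = l2sq_section_measurable[OF j(1)] l2sq_section_measurable[OF j(2)]
  have "energy M t (\<lambda>s \<omega>. \<phi> s \<omega> + \<psi> s \<omega>) \<le> (\<integral>\<^sup>+s. 2 * l2sq M (\<phi> s) + 2 * l2sq M (\<psi> s) \<partial>lborel_upto t)"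
    using joint_measurable_section[OF j(1)] joint_measurable_section[OF j(2)]
    by (intro energy_le l2sq_add) auto
  also have "\<dots> = 2 * energy M t \<phi> + 2 * energy M t \<psi>"
    unfolding energy_def by (simp add: nn_integral_add nn_integral_cmult)
  finally show ?thesis .
qed

lemma energy_uminus [simp]: "energy M t (\<lambda>s \<omega>. - \<phi> s \<omega>) = energy M t \<phi>"
  unfolding energy_def by simp

lemma energy_minus_commute: "energy M t (\<lambda>s \<omega>. \<phi> s \<omega> - \<psi> s \<omega>) = energy M t (\<lambda>s \<omega>. \<psi> s \<omega> - \<phi> s \<omega>)"
  by (intro energy_cong l2sq_minus_commute)

lemma (in sigma_finite_measure) energy_diff_triangle:
  assumes "joint_measurable M T \<phi>" "joint_measurable M T \<psi>" "joint_measurable M T \<theta>" "t \<le> T"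
  shows "energy M t (\<lambda>s \<omega>. \<phi> s \<omega> - \<psi> s \<omega>)
    \<le> 2 * energy M t (\<lambda>s \<omega>. \<phi> s \<omega> - \<theta> s \<omega>) + 2 * energy M t (\<lambda>s \<omega>. \<theta> s \<omega> - \<psi> s \<omega>)"
  using energy_add[OF joint_measurable_add(2)[OF assms(1,3)] joint_measurable_add(2)[OF assms(3,2)] assms(4)]
  by simp

lemma set_integral_upto:
  fixes f :: "real \<Rightarrow> 'a::euclidean_space"
  assumes "t \<le> T"
  shows "(LBINT s:{0..t}. f s) = (\<integral>s. (if s \<le> t then f s else 0) \<partial>lborel_upto T)"
  using assms
  by (auto simp: set_lebesgue_integral_def integral_restrict_space indicator_def intro!: Bochner_Integration.integral_cong)

section \<open>Processes adapted to a complete filtration\<close>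

locale filtered_prob_space = prob_space P + complete_measure P for P :: "'w measure" +
  fixes F :: "real \<Rightarrow> 'w measure" and T :: real
  assumes T_pos: "0 < T"
    and space_F: "t \<in> {0..T} \<Longrightarrow> space (F t) = space P"
    and sets_F: "t \<in> {0..T} \<Longrightarrow> sets (F t) \<subseteq> sets P"
    and F_mono: "0 \<le> s \<Longrightarrow> s \<le> t \<Longrightarrow> t \<le> T \<Longrightarrow> sets (F s) \<subseteq> sets (F t)"
    and null_F: "t \<in> {0..T} \<Longrightarrow> null_sets P \<subseteq> sets (F t)"
begin

lemma subalgebra_F: "t \<in> {0..T} \<Longrightarrow> subalgebra P (F t)"
  using space_F sets_F by (simp add: subalgebra_def)

lemma measurable_F_imp_P: "t \<in> {0..T} \<Longrightarrow> f \<in> borel_measurable (F t) \<Longrightarrow> f \<in> borel_measurable P"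
  using measurable_from_subalg[OF subalgebra_F] .

lemma measurable_F_mono:
  assumes "0 \<le> s" "s \<le> t" "t \<le> T" "f \<in> borel_measurable (F s)"
  shows "f \<in> borel_measurable (F t)"
  using assms F_mono[OF assms(1-3)] space_F[of s] space_F[of t]
  by (intro measurable_from_subalg[of "F t" "F s" f borel]) (auto simp: subalgebra_def)

text \<open>Here completeness of the filtration is essential: sets of measure zero are events at every time.\<close>

lemma measurable_F_AE_cong:
  fixes f g :: "'w \<Rightarrow> 'a::topological_space"
  assumes t: "t \<in> {0..T}" and f: "f \<in> borel_measurable (F t)" and ae: "AE \<omega> in P. f \<omega> = g \<omega>"
  shows "g \<in> borel_measurable (F t)"
proof (rule measurableI)
  fix A :: "'a set" assume A: "A \<in> sets borel"
  obtain N where N: "N \<in> null_sets P" "{\<omega>\<in>space P. f \<omega> \<noteq> g \<omega>} \<subseteq> N"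
    using ae by (auto elim!: AE_E simp: null_sets_def)
  have null: "N \<inter> B \<in> sets (F t)" for B
    using N(1) complete2[of "N \<inter> B" N] null_F[OF t] by (auto simp: null_sets_def)
  have "g -` A \<inter> space (F t) = ((f -` A \<inter> space (F t)) - N) \<union> (N \<inter> (g -` A \<inter> space P))"
    using N(2) space_F[OF t] by auto
  also have "\<dots> \<in> sets (F t)"
    using measurable_sets[OF f A] null null_F[OF t] N(1) by auto
  finally show "g -` A \<inter> space (F t) \<in> sets (F t)" .
qed simp

abbreviation M2 :: "(real \<Rightarrow> 'w \<Rightarrow> 'a::euclidean_space) set" where
  "M2 \<equiv> M2_space P F T"

lemma M2_iff: "\<phi> \<in> M2 \<longleftrightarrow>
    joint_measurable P T \<phi> \<and> (\<forall>t\<in>{0..T}. \<phi> t \<in> borel_measurable (F t)) \<and> energy P T \<phi> < \<infinity>"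
  using energy_swap[of T \<phi>]
  unfolding M2_space_def by (auto simp: joint_measurable_iff[symmetric] l2sq_lborel_upto)

lemma M2D:
  assumes "\<phi> \<in> M2"
  shows "joint_measurable P T \<phi>" "\<And>t. t \<in> {0..T} \<Longrightarrow> \<phi> t \<in> borel_measurable (F t)"
    "energy P T \<phi> < \<infinity>" "\<And>t. t \<in> {0..T} \<Longrightarrow> \<phi> t \<in> borel_measurable P"
proof -
  show *: "joint_measurable P T \<phi>" "\<And>t. t \<in> {0..T} \<Longrightarrow> \<phi> t \<in> borel_measurable (F t)"
    "energy P T \<phi> < \<infinity>"
    using assms unfolding M2_iff by auto
  show "\<And>t. t \<in> {0..T} \<Longrightarrow> \<phi> t \<in> borel_measurable P"
    using joint_measurable_section[OF *(1)] .
qed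

lemma M2_add:
  assumes "\<phi> \<in> M2" "\<psi> \<in> M2"
  shows "(\<lambda>t \<omega>. \<phi> t \<omega> + \<psi> t \<omega>) \<in> M2"
proof -
  have "energy P T (\<lambda>t \<omega>. \<phi> t \<omega> + \<psi> t \<omega>) \<le> 2 * energy P T \<phi> + 2 * energy P T \<psi>"
    using assms by (intro energy_add[of T]) (auto dest: M2D)
  also have "\<dots> < \<infinity>"
    using M2D(3)[OF assms(1)] M2D(3)[OF assms(2)] by (simp add: ennreal_mult_less_top)
  finally show ?thesis
    using M2D(1,2)[OF assms(1)] M2D(1,2)[OF assms(2)]
    by (simp add: M2_iff joint_measurable_add borel_measurable_add)
qed

lemma M2_uminus: "\<phi> \<in> M2 \<Longrightarrow> (\<lambda>t \<omega>. - \<phi> t \<omega>) \<in> M2"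
  unfolding M2_iff by (auto simp: joint_measurable_def case_prod_beta')

lemma M2_diff: "\<phi> \<in> M2 \<Longrightarrow> \<psi> \<in> M2 \<Longrightarrow> (\<lambda>t \<omega>. \<phi> t \<omega> - \<psi> t \<omega>) \<in> M2"
  using M2_add[OF _ M2_uminus, of \<phi> \<psi>] by simp

lemma AE_path_l2:
  assumes "joint_measurable P T \<phi>" "energy P T \<phi> < \<infinity>"
  shows "AE \<omega> in P. l2sq (lborel_upto T) (\<lambda>s. \<phi> s \<omega>) < \<infinity>"
proof -
  interpret L: finite_measure "lborel_upto T" by (rule finite_measure_lborel_upto)
  interpret LP: pair_sigma_finite P "lborel_upto T" ..
  have [measurable]: "case_prod \<phi> \<in> borel_measurable (lborel_upto T \<Otimes>\<^sub>M P)"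
    using assms by (simp add: joint_measurable_def)
  have "(\<lambda>\<omega>. l2sq (lborel_upto T) (\<lambda>s. case_prod \<phi> (s, \<omega>))) \<in> borel_measurable P"
    unfolding l2sq_def by (rule L.borel_measurable_nn_integral) measurable
  then have "AE \<omega> in P. l2sq (lborel_upto T) (\<lambda>s. \<phi> s \<omega>) \<noteq> \<infinity>"
    using assms energy_swap[OF assms(1)] by (intro nn_integral_PInf_AE) auto
  then show ?thesis by eventually_elim (auto simp: top.not_eq_extremum)
qed

text \<open>A process that is jointly measurable and adapted need not be progressively measurable, so that
  Fubini's theorem cannot be applied on \<open>F b\<close> itself. Instead \<open>Z\<close>, the time integral, is
  shown to agree almost surely with its conditional expectation \<open>Y\<close> given \<open>F b\<close>. For an event
  \<open>D\<close> with conditional probability \<open>g\<close>, each \<open>\<phi> s\<close> gives \<open>E[1\<^sub>D \<phi> s] = E[g \<phi> s]\<close> by adaptedness, and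
  integration over \<open>s\<close> yields \<open>E[1\<^sub>D Z] = E[g Z] = E[g Y] = E[1\<^sub>D Y]\<close>. Completeness of the filtration
  finishes the argument.\<close>

lemma adapted_time_integral_real:
  fixes \<phi> :: "real \<Rightarrow> 'w \<Rightarrow> real"
  assumes b: "b \<in> {0..T}" and A: "A \<in> sets borel" "A \<subseteq> {0..b}"
    and int: "integrable (restrict_space lborel A \<Otimes>\<^sub>M P) (case_prod \<phi>)"
    and adapted: "\<And>s. s \<in> A \<Longrightarrow> \<phi> s \<in> borel_measurable (F b)"
  shows "(\<lambda>\<omega>. \<integral>s. \<phi> s \<omega> \<partial>restrict_space lborel A) \<in> borel_measurable (F b)"
proof -
  let ?L = "restrict_space lborel A"
  have "emeasure lborel A \<le> emeasure lborel {0..b}" using A by (intro emeasure_mono) auto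
  then interpret L: finite_measure ?L
    using A b by (intro finite_measureI) (auto simp: emeasure_restrict_space space_restrict_space top_unique)
  interpret LP: pair_sigma_finite ?L P ..
  interpret Fb: finite_measure_subalgebra P "F b"
    by unfold_locales (rule subalgebra_F[OF b])
  interpret PP: finite_measure_subalgebra P P
    by unfold_locales (simp add: subalgebra_def)
  define Z where "Z = (\<lambda>\<omega>. \<integral>s. \<phi> s \<omega> \<partial>?L)"
  define Y where "Y = real_cond_exp P (F b) Z"
  have intZ: "integrable P Z"
    unfolding Z_def using LP.integrable_snd[OF int] .
  have intY: "integrable P Y" unfolding Y_def by (rule Fb.real_cond_exp_int(1)[OF intZ])
  have Y: "Y \<in> borel_measurable (F b)" unfolding Y_def by simp
  have weighted: "integrable (?L \<Otimes>\<^sub>M P) (\<lambda>(s, \<omega>). g \<omega> * \<phi> s \<omega>)"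
    if g[measurable]: "g \<in> borel_measurable P" and bound: "AE \<omega> in P. \<bar>g \<omega>\<bar> \<le> 1" for g
  proof (rule Bochner_Integration.integrable_bound[OF int])
    have [measurable]: "case_prod \<phi> \<in> borel_measurable (?L \<Otimes>\<^sub>M P)" using int by auto
    have "(\<lambda>z. g (snd z) * case_prod \<phi> z) \<in> borel_measurable (?L \<Otimes>\<^sub>M P)" by measurable
    then show "(\<lambda>(s, \<omega>). g \<omega> * \<phi> s \<omega>) \<in> borel_measurable (?L \<Otimes>\<^sub>M P)" by (simp add: case_prod_beta')
    have "AE z in ?L \<Otimes>\<^sub>M P. \<bar>g (snd z)\<bar> \<le> 1"
      by (subst LP.AE_pair_iff[symmetric, of "\<lambda>s \<omega>. \<bar>g \<omega>\<bar> \<le> 1", unfolded case_prod_beta'])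
         (use bound in auto)
    then show "AE z in ?L \<Otimes>\<^sub>M P. norm (case z of (s, \<omega>) \<Rightarrow> g \<omega> * \<phi> s \<omega>) \<le> norm (case_prod \<phi> z)"
      by eventually_elim (auto simp: abs_mult mult_left_le_one_le)
  qed
  have swap: "(\<integral>\<omega>. g \<omega> * Z \<omega> \<partial>P) = (\<integral>s. (\<integral>\<omega>. g \<omega> * \<phi> s \<omega> \<partial>P) \<partial>?L)"
    "integrable P (\<lambda>\<omega>. g \<omega> * Z \<omega>)" "AE s in ?L. integrable P (\<lambda>\<omega>. g \<omega> * \<phi> s \<omega>)"
    if g: "g \<in> borel_measurable P" "AE \<omega> in P. \<bar>g \<omega>\<bar> \<le> 1" for g
  proof -
    note w = weighted[OF g]
    show "(\<integral>\<omega>. g \<omega> * Z \<omega> \<partial>P) = (\<integral>s. (\<integral>\<omega>. g \<omega> * \<phi> s \<omega> \<partial>P) \<partial>?L)"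
      using LP.Fubini_integral[OF w] by (simp add: Z_def)
    show "integrable P (\<lambda>\<omega>. g \<omega> * Z \<omega>)" using LP.integrable_snd[OF w] by (simp add: Z_def)
    show "AE s in ?L. integrable P (\<lambda>\<omega>. g \<omega> * \<phi> s \<omega>)" using LP.AE_integrable_fst[OF w] .
  qed
  \<comment> \<open>Testing against an event and moving the conditional expectation onto the indicator.\<close>
  have test: "(\<integral>\<omega>. indicator D \<omega> * Z \<omega> \<partial>P) = (\<integral>\<omega>. indicator D \<omega> * Y \<omega> \<partial>P)"
    if D[measurable]: "D \<in> sets P" for D
  proof -
    define g where "g = real_cond_exp P (F b) (indicator D)"
    have gF: "g \<in> borel_measurable (F b)" and gP: "g \<in> borel_measurable P" unfolding g_def by simp_all
    have intD: "integrable P (indicator D :: 'w \<Rightarrow> real)"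
      using D by (intro integrable_real_indicator) (simp_all add: less_top[symmetric])
    have "AE \<omega> in P. 0 \<le> g \<omega>"
      unfolding g_def by (intro Fb.real_cond_exp_pos) auto
    moreover have "AE \<omega> in P. g \<omega> \<le> 1"
      unfolding g_def by (intro Fb.real_cond_exp_le_c intD) auto
    ultimately have g1: "AE \<omega> in P. \<bar>g \<omega>\<bar> \<le> 1" by eventually_elim auto
    have D1: "AE \<omega> in P. \<bar>indicator D \<omega> :: real\<bar> \<le> 1" by auto
    have "(\<integral>\<omega>. indicator D \<omega> * Z \<omega> \<partial>P) = (\<integral>s. (\<integral>\<omega>. indicator D \<omega> * \<phi> s \<omega> \<partial>P) \<partial>?L)"
      by (rule swap(1)) (auto simp: D1)
    also have "\<dots> = (\<integral>s. (\<integral>\<omega>. g \<omega> * \<phi> s \<omega> \<partial>P) \<partial>?L)"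
    proof (rule integral_cong_AE)
      have i: "integrable (?L \<Otimes>\<^sub>M P) (\<lambda>(s, \<omega>). indicator D \<omega> * \<phi> s \<omega>)"
        by (rule weighted) (auto simp: D1)
      show "(\<lambda>s. \<integral>\<omega>. indicator D \<omega> * \<phi> s \<omega> \<partial>P) \<in> borel_measurable ?L"
        using LP.integrable_fst[OF i] by auto
      show "(\<lambda>s. \<integral>\<omega>. g \<omega> * \<phi> s \<omega> \<partial>P) \<in> borel_measurable ?L"
        using LP.integrable_fst[OF weighted[OF gP g1]] by auto
      have sA: "AE s in ?L. s \<in> A" using A by (intro AE_I2) (auto simp: space_restrict_space)
      show "AE s in ?L. (\<integral>\<omega>. indicator D \<omega> * \<phi> s \<omega> \<partial>P) = (\<integral>\<omega>. g \<omega> * \<phi> s \<omega> \<partial>P)"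
        using LP.AE_integrable_fst[OF i] sA
      proof eventually_elim
        case (elim s)
        then have "integrable P (\<lambda>\<omega>. \<phi> s \<omega> * indicator D \<omega>)" by (simp add: mult.commute)
        from Fb.real_cond_exp_intg(2)[OF this adapted] elim show ?case
          by (simp add: g_def mult.commute)
      qed
    qed
    also have "\<dots> = (\<integral>\<omega>. g \<omega> * Z \<omega> \<partial>P)"
      by (rule swap(1)[symmetric, OF gP g1])
    also have "\<dots> = (\<integral>\<omega>. g \<omega> * Y \<omega> \<partial>P)"
      unfolding Y_def using swap(2)[OF gP g1] intZ
      by (intro Fb.real_cond_exp_intg(2)[symmetric] gF) auto
    also have "\<dots> = (\<integral>\<omega>. Y \<omega> * g \<omega> \<partial>P)" by (simp add: mult.commute)
    also have "\<dots> = (\<integral>\<omega>. Y \<omega> * indicator D \<omega> \<partial>P)"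
      unfolding g_def using integrable_mult_indicator[OF D intY]
      by (intro Fb.real_cond_exp_intg(2) Y) (auto simp: mult.commute)
    finally show ?thesis by (simp add: mult.commute)
  qed
  \<comment> \<open>Conditioning on all of \<open>P\<close> expresses uniqueness of a variable with given integrals over events.\<close>
  have "AE \<omega> in P. real_cond_exp P P Z \<omega> = Y \<omega>"
    using test intZ intY
    by (intro PP.real_cond_exp_charact) (auto simp: set_lebesgue_integral_def)
  moreover have "AE \<omega> in P. real_cond_exp P P Z \<omega> = Z \<omega>"
    using intZ by (intro PP.real_cond_exp_F_meas) auto
  ultimately have "AE \<omega> in P. Y \<omega> = Z \<omega>" by eventually_elim simp
  from measurable_F_AE_cong[OF b Y this] show ?thesis by (simp add: Z_def)
qed

lemma adapted_time_integral:
  fixes \<phi> :: "real \<Rightarrow> 'w \<Rightarrow> 'a::euclidean_space"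
  assumes b: "b \<in> {0..T}" and A: "A \<in> sets borel" "A \<subseteq> {0..b}"
    and int: "integrable (restrict_space lborel A \<Otimes>\<^sub>M P) (case_prod \<phi>)"
    and adapted: "\<And>s. s \<in> A \<Longrightarrow> \<phi> s \<in> borel_measurable (F b)"
  shows "(\<lambda>\<omega>. LBINT s:A. \<phi> s \<omega>) \<in> borel_measurable (F b)"
proof -
  let ?L = "restrict_space lborel A"
  have "emeasure lborel A \<le> emeasure lborel {0..b}" using A by (intro emeasure_mono) auto
  then interpret L: finite_measure ?L
    using A b by (intro finite_measureI) (auto simp: emeasure_restrict_space space_restrict_space top_unique)
  interpret LP: pair_sigma_finite ?L P ..
  have eq: "(LBINT s:A. \<phi> s \<omega>) = (\<integral>s. \<phi> s \<omega> \<partial>?L)" for \<omega>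
    using A by (simp add: set_lebesgue_integral_def integral_restrict_space)
  have "AE \<omega> in P. integrable ?L (\<lambda>s. \<phi> s \<omega>)" using LP.AE_integrable_snd[OF int] .
  then have ae: "AE \<omega> in P. (\<Sum>i\<in>Basis. (\<integral>s. \<phi> s \<omega> \<bullet> i \<partial>?L) *\<^sub>R i) = (\<integral>s. \<phi> s \<omega> \<partial>?L)"
    by eventually_elim (simp add: euclidean_representation)
  have "(\<lambda>\<omega>. \<integral>s. \<phi> s \<omega> \<bullet> i \<partial>?L) \<in> borel_measurable (F b)" if "i \<in> Basis" for i
  proof (rule adapted_time_integral_real[OF b A])
    show "integrable (?L \<Otimes>\<^sub>M P) (\<lambda>(s, \<omega>). \<phi> s \<omega> \<bullet> i)"
      using integrable_inner_left[of i, OF int] by (simp add: case_prod_beta')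
  qed (use adapted in auto)
  then have "(\<lambda>\<omega>. \<Sum>i\<in>Basis. (\<integral>s. \<phi> s \<omega> \<bullet> i \<partial>?L) *\<^sub>R i) \<in> borel_measurable (F b)"
    by (intro borel_measurable_sum borel_measurable_scaleR) auto
  from measurable_F_AE_cong[OF b this ae] show ?thesis by (simp add: eq)
qed

lemma M2_integrable:
  assumes "\<phi> \<in> M2" "A \<in> sets borel" "A \<subseteq> {0..T}"
  shows "integrable (restrict_space lborel A \<Otimes>\<^sub>M P) (case_prod \<phi>)"
proof -
  let ?L = "restrict_space lborel A"
  have "emeasure lborel A \<le> emeasure lborel {0..T}" using assms by (intro emeasure_mono) auto
  then interpret L: finite_measure ?L
    using assms T_pos by (intro finite_measureI) (auto simp: emeasure_restrict_space space_restrict_space top_unique)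
  interpret L': finite_measure "lborel_upto T" by (rule finite_measure_lborel_upto)
  interpret LP: pair_sigma_finite ?L P ..
  have fm: "finite_measure (?L \<Otimes>\<^sub>M P)"
    by (rule finite_measure_pair_measure) unfold_locales
  have m: "case_prod \<phi> \<in> borel_measurable (?L \<Otimes>\<^sub>M P)"
  proof -
    have "(\<lambda>x. x) \<in> measurable ?L (lborel_upto T)"
      using assms by (intro measurable_restrict_space3) auto
    then have "(\<lambda>z. (fst z, snd z)) \<in> measurable (?L \<Otimes>\<^sub>M P) (lborel_upto T \<Otimes>\<^sub>M P)"
      by (intro measurable_Pair measurable_compose[OF measurable_fst] measurable_snd)
    from measurable_compose[OF this] M2D(1)[OF assms(1)] show ?thesis
      unfolding joint_measurable_def by simp
  qed
  have "l2sq (?L \<Otimes>\<^sub>M P) (case_prod \<phi>) = (\<integral>\<^sup>+s. l2sq P (\<phi> s) \<partial>?L)"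
    unfolding l2sq_def using m by (subst nn_integral_fst[symmetric]) auto
  also have "\<dots> \<le> energy P T \<phi>"
    unfolding energy_def using assms
    by (auto simp: nn_integral_restrict_space indicator_def intro!: nn_integral_mono)
  also have "\<dots> < \<infinity>" using M2D(3)[OF assms(1)] .
  finally show ?thesis by (intro l2_imp_integrable fm m)
qed

lemma M2_adapted_time_integral:
  assumes "\<phi> \<in> M2" "b \<in> {0..T}" "A \<in> sets borel" "A \<subseteq> {0..b}"
  shows "(\<lambda>\<omega>. LBINT s:A. \<phi> s \<omega>) \<in> borel_measurable (F b)"
proof (rule adapted_time_integral[OF assms(2-4)])
  show "integrable (restrict_space lborel A \<Otimes>\<^sub>M P) (case_prod \<phi>)"
    using assms by (intro M2_integrable) auto
  show "\<phi> s \<in> borel_measurable (F b)" if "s \<in> A" for s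
    using assms that by (intro measurable_F_mono[OF _ _ _ M2D(2)[OF assms(1), of s]]) auto
qed

lemma AE_path_integrable:
  assumes "\<phi> \<in> M2"
  shows "AE \<omega> in P. set_integrable lborel {0..T} (\<lambda>s. \<phi> s \<omega>)"
proof -
  have "AE \<omega> in P. l2sq (lborel_upto T) (\<lambda>s. \<phi> s \<omega>) < \<infinity>"
    using M2D(1,3)[OF assms] by (rule AE_path_l2)
  then show ?thesis
  proof (rule AE_mp, intro AE_I2 impI)
    fix \<omega> assume "\<omega> \<in> space P" "l2sq (lborel_upto T) (\<lambda>s. \<phi> s \<omega>) < \<infinity>"
    then have "integrable (lborel_upto T) (\<lambda>s. \<phi> s \<omega>)"
      using joint_measurable_path[OF M2D(1)[OF assms]]
      by (intro l2_imp_integrable finite_measure_lborel_upto) auto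
    then show "set_integrable lborel {0..T} (\<lambda>s. \<phi> s \<omega>)"
      by (simp add: set_integrable_def integrable_restrict_space)
  qed
qed

lemma l2sq_time_integral_le:
  assumes "joint_measurable P T \<phi>" "t \<in> {0..T}"
  shows "l2sq P (\<lambda>\<omega>. LBINT s:{0..t}. \<phi> s \<omega>) \<le> ennreal T * energy P t \<phi>"
proof -
  interpret L: finite_measure "lborel_upto t" by (rule finite_measure_lborel_upto)
  have j: "joint_measurable P t \<phi>" using joint_measurable_upto assms by auto
  then have [measurable]: "case_prod \<phi> \<in> borel_measurable (lborel_upto t \<Otimes>\<^sub>M P)"
    by (simp add: joint_measurable_def)
  interpret LP: pair_sigma_finite P "lborel_upto t" ..
  have [measurable]: "(\<lambda>\<omega>. l2sq (lborel_upto t) (\<lambda>s. \<phi> s \<omega>)) \<in> borel_measurable P"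
  proof -
    have "(\<lambda>\<omega>. l2sq (lborel_upto t) (\<lambda>s. case_prod \<phi> (s, \<omega>))) \<in> borel_measurable P"
      unfolding l2sq_def by (rule L.borel_measurable_nn_integral) measurable
    then show ?thesis by simp
  qed
  have "l2sq P (\<lambda>\<omega>. LBINT s:{0..t}. \<phi> s \<omega>)
    \<le> (\<integral>\<^sup>+\<omega>. ennreal T * l2sq (lborel_upto t) (\<lambda>s. \<phi> s \<omega>) \<partial>P)"
    unfolding l2sq_def[of P]
  proof (intro nn_integral_mono)
    fix \<omega>
    have "ennreal ((norm (LBINT s:{0..t}. \<phi> s \<omega>))\<^sup>2) \<le> ennreal t * l2sq (lborel_upto t) (\<lambda>s. \<phi> s \<omega>)"
      using norm_set_integral_sq_le[of "{0..t}" lborel "\<lambda>s. \<phi> s \<omega>"] assms by (simp add: l2sq_lborel_upto)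
    also have "\<dots> \<le> ennreal T * l2sq (lborel_upto t) (\<lambda>s. \<phi> s \<omega>)"
      using assms by (intro mult_right_mono ennreal_leI) auto
    finally show "ennreal ((norm (LBINT s:{0..t}. \<phi> s \<omega>))\<^sup>2) \<le> ennreal T * l2sq (lborel_upto t) (\<lambda>s. \<phi> s \<omega>)" .
  qed
  also have "\<dots> = ennreal T * energy P t \<phi>"
    by (simp add: nn_integral_cmult energy_swap[OF j])
  finally show ?thesis .
qed

lemma joint_measurable_time_integral:
  assumes "joint_measurable P T \<phi>"
  shows "joint_measurable P T (\<lambda>t \<omega>. LBINT s:{0..t}. \<phi> s \<omega>)"
proof -
  interpret L: finite_measure "lborel_upto T" by (rule finite_measure_lborel_upto)
  have [measurable]: "case_prod \<phi> \<in> borel_measurable (lborel_upto T \<Otimes>\<^sub>M P)"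
    using assms by (simp add: joint_measurable_def)
  have [measurable]: "(\<lambda>t. t) \<in> borel_measurable (lborel_upto T)"
    by (intro measurable_restrict_space1) simp
  have "(\<lambda>z. \<integral>s. (if s \<le> fst z then case_prod \<phi> (s, snd z) else 0) \<partial>lborel_upto T)
      \<in> borel_measurable (lborel_upto T \<Otimes>\<^sub>M P)"
    by (rule L.borel_measurable_lebesgue_integral) measurable
  then show ?thesis
    unfolding joint_measurable_def
    by (rule measurable_cong[THEN iffD1, rotated])
       (auto simp: space_pair_measure space_restrict_space set_integral_upto[where T = T] cong: if_cong)
qed

lemma AE_continuous_time_integral:
  assumes "\<phi> \<in> M2"
  shows "AE \<omega> in P. continuous_on {0..T} (\<lambda>t. LBINT s:{0..t}. \<phi> s \<omega>)"
  using AE_path_integrable[OF assms]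
proof eventually_elim
  case (elim \<omega>)
  have "continuous_on {0..T} (\<lambda>t. integral {0..t} (\<lambda>s. \<phi> s \<omega>))"
    by (intro indefinite_integral_continuous_1 set_borel_integral_eq_integral(1) elim)
  moreover have "integral {0..t} (\<lambda>s. \<phi> s \<omega>) = (LBINT s:{0..t}. \<phi> s \<omega>)" if "t \<in> {0..T}" for t
    using that by (intro set_borel_integral_eq_integral(2)[symmetric] set_integrable_subset[OF elim]) auto
  ultimately show ?case by (rule continuous_on_eq)
qed

end

section \<open>Brownian motion relative to a filtration\<close>

lemma l2_inner_integrable:
  fixes f g :: "'b \<Rightarrow> 'a::euclidean_space"
  assumes [measurable]: "f \<in> borel_measurable M" "g \<in> borel_measurable M"
    and int: "integrable M (\<lambda>x. (norm (f x))\<^sup>2)" "integrable M (\<lambda>x. (norm (g x))\<^sup>2)"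
  shows "integrable M (\<lambda>x. f x \<bullet> g x)"
proof (rule Bochner_Integration.integrable_bound)
  show "integrable M (\<lambda>x. (norm (f x))\<^sup>2 + (norm (g x))\<^sup>2)" using int by simp
  show "AE x in M. norm (f x \<bullet> g x) \<le> norm ((norm (f x))\<^sup>2 + (norm (g x))\<^sup>2)"
  proof (rule AE_I2)
    fix x
    have "norm (f x \<bullet> g x) \<le> norm (f x) * norm (g x)" by (simp add: Cauchy_Schwarz_ineq2)
    also have "\<dots> \<le> (norm (f x))\<^sup>2 + (norm (g x))\<^sup>2"
      using sum_squares_bound[of "norm (f x)" "norm (g x)"]
        zero_le_mult_iff[of "norm (f x)" "norm (g x)"] norm_ge_zero[of "f x"] norm_ge_zero[of "g x"]
      by linarith
    finally show "norm (f x \<bullet> g x) \<le> norm ((norm (f x))\<^sup>2 + (norm (g x))\<^sup>2)" by simp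
  qed
qed simp

text \<open>The filtration may be larger than the one generated by \<open>B\<close>, such as the joint filtration of two
  motions; what makes stochastic integrals martingales is independence from the whole past \<open>F s\<close>.\<close>

locale brownian_filtration = filtered_prob_space P F T
  for P :: "'w measure" and F T +
  fixes B :: "real \<Rightarrow> 'w \<Rightarrow> real"
  assumes B_adapted: "t \<in> {0..T} \<Longrightarrow> B t \<in> borel_measurable (F t)"
    and B_indep: "0 \<le> s \<Longrightarrow> s < t \<Longrightarrow> t \<le> T \<Longrightarrow> (Z :: 'w \<Rightarrow> real) \<in> borel_measurable (F s) \<Longrightarrow>
        indep_var borel (\<lambda>\<omega>. B t \<omega> - B s \<omega>) borel Z"
    and B_normal: "0 \<le> s \<Longrightarrow> s < t \<Longrightarrow> t \<le> T \<Longrightarrow>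
        distributed P lborel (\<lambda>\<omega>. B t \<omega> - B s \<omega>) (normal_density 0 (sqrt (t - s)))"
begin

lemma B_measurable: "t \<in> {0..T} \<Longrightarrow> B t \<in> borel_measurable P"
  using measurable_F_imp_P B_adapted by blast

lemma B_adapted_mono: "0 \<le> s \<Longrightarrow> s \<le> t \<Longrightarrow> t \<le> T \<Longrightarrow> B s \<in> borel_measurable (F t)"
  by (rule measurable_F_mono[OF _ _ _ B_adapted]) auto

lemma increment_moments:
  assumes "0 \<le> s" "s < t" "t \<le> T"
  shows "integrable P (\<lambda>\<omega>. B t \<omega> - B s \<omega>)" "expectation (\<lambda>\<omega>. B t \<omega> - B s \<omega>) = 0"
    and "integrable P (\<lambda>\<omega>. (B t \<omega> - B s \<omega>)\<^sup>2)" "expectation (\<lambda>\<omega>. (B t \<omega> - B s \<omega>)\<^sup>2) = t - s"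
proof -
  let ?X = "\<lambda>\<omega>. B t \<omega> - B s \<omega>" and ?\<sigma> = "sqrt (t - s)"
  note D = B_normal[OF assms]
  have \<sigma>: "0 < ?\<sigma>" using assms by simp
  have [measurable]: "?X \<in> borel_measurable P"
    using B_measurable[of s] B_measurable[of t] assms by auto
  show sq: "integrable P (\<lambda>\<omega>. (?X \<omega>)\<^sup>2)"
    using distributed_integrable[OF D, of "\<lambda>x. x\<^sup>2"] integrable_normal_moment[OF \<sigma>, of 0 2] by simp
  then show "integrable P ?X"
    by (rule square_integrable_imp_integrable[rotated]) measurable
  show mean: "expectation ?X = 0" using normal_distributed_expectation[OF \<sigma> D] .
  have "variance ?X = ?\<sigma>\<^sup>2" by (rule normal_distributed_variance[OF \<sigma> D])
  then show "expectation (\<lambda>\<omega>. (?X \<omega>)\<^sup>2) = t - s" using assms unfolding mean by simp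
qed

text \<open>A variable known at time \<open>s\<close> is independent of the increment, so expectations of products factor.\<close>

lemma increment_times:
  fixes Z :: "'w \<Rightarrow> real"
  assumes st: "0 \<le> s" "s \<le> t" "t \<le> T" and Z: "Z \<in> borel_measurable (F s)" "integrable P Z"
  shows "integrable P (\<lambda>\<omega>. (B t \<omega> - B s \<omega>) * Z \<omega>)" "expectation (\<lambda>\<omega>. (B t \<omega> - B s \<omega>) * Z \<omega>) = 0"
    and "integrable P (\<lambda>\<omega>. (B t \<omega> - B s \<omega>)\<^sup>2 * Z \<omega>)"
    and "expectation (\<lambda>\<omega>. (B t \<omega> - B s \<omega>)\<^sup>2 * Z \<omega>) = (t - s) * expectation Z"
proof -
  have "(integrable P (\<lambda>\<omega>. (B t \<omega> - B s \<omega>) * Z \<omega>) \<and> expectation (\<lambda>\<omega>. (B t \<omega> - B s \<omega>) * Z \<omega>) = 0) \<and>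
    (integrable P (\<lambda>\<omega>. (B t \<omega> - B s \<omega>)\<^sup>2 * Z \<omega>) \<and>
     expectation (\<lambda>\<omega>. (B t \<omega> - B s \<omega>)\<^sup>2 * Z \<omega>) = (t - s) * expectation Z)"
  proof (cases "s = t")
    case True
    then show ?thesis by simp
  next
    case False
    then have "s < t" using st by simp
    note m = increment_moments[OF st(1) this st(3)]
    have ind: "indep_var borel (\<lambda>\<omega>. B t \<omega> - B s \<omega>) borel Z"
      by (rule B_indep[OF st(1) \<open>s < t\<close> st(3) Z(1)])
    have "indep_var borel ((\<lambda>x. x\<^sup>2) \<circ> (\<lambda>\<omega>. B t \<omega> - B s \<omega>)) borel ((\<lambda>x. x) \<circ> Z)"
      by (rule indep_var_compose[OF ind]) auto
    then have ind2: "indep_var borel (\<lambda>\<omega>. (B t \<omega> - B s \<omega>)\<^sup>2) borel Z" by (simp add: comp_def)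
    show ?thesis
      using indep_var_integrable[OF ind m(1) Z(2)] indep_var_lebesgue_integral[OF ind m(1) Z(2)]
        indep_var_integrable[OF ind2 m(3) Z(2)] indep_var_lebesgue_integral[OF ind2 m(3) Z(2)] m
      by simp
  qed
  then show "integrable P (\<lambda>\<omega>. (B t \<omega> - B s \<omega>) * Z \<omega>)" "expectation (\<lambda>\<omega>. (B t \<omega> - B s \<omega>) * Z \<omega>) = 0"
    and "integrable P (\<lambda>\<omega>. (B t \<omega> - B s \<omega>)\<^sup>2 * Z \<omega>)"
    and "expectation (\<lambda>\<omega>. (B t \<omega> - B s \<omega>)\<^sup>2 * Z \<omega>) = (t - s) * expectation Z"
    by auto
qed

definition partition_sum :: "(nat \<Rightarrow> real) \<Rightarrow> (nat \<Rightarrow> 'w \<Rightarrow> 'a::euclidean_space) \<Rightarrow> nat \<Rightarrow> 'w \<Rightarrow> 'a" where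
  "partition_sum \<sigma> \<xi> l \<omega> = (\<Sum>i<l. (B (\<sigma> (Suc i)) \<omega> - B (\<sigma> i) \<omega>) *\<^sub>R \<xi> i \<omega>)"

context
  fixes \<sigma> :: "nat \<Rightarrow> real" and m :: nat and \<xi> :: "nat \<Rightarrow> 'w \<Rightarrow> 'a::euclidean_space"
  assumes \<sigma>_mono: "\<And>i. i < m \<Longrightarrow> \<sigma> i \<le> \<sigma> (Suc i)" and \<sigma>_0: "0 \<le> \<sigma> 0" and \<sigma>_m: "\<sigma> m \<le> T"
    and \<xi>_adapted: "\<And>i. i < m \<Longrightarrow> \<xi> i \<in> borel_measurable (F (\<sigma> i))"
    and \<xi>_l2: "\<And>i. i < m \<Longrightarrow> integrable P (\<lambda>\<omega>. (norm (\<xi> i \<omega>))\<^sup>2)"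
begin

lemma \<sigma>_le: "i \<le> k \<Longrightarrow> k \<le> m \<Longrightarrow> \<sigma> i \<le> \<sigma> k"
  using partition_mono[of m \<sigma> i k] \<sigma>_mono by blast

lemma \<sigma>_in: "i \<le> m \<Longrightarrow> \<sigma> i \<in> {0..T}"
  using \<sigma>_le[of 0 i] \<sigma>_le[of i m] \<sigma>_0 \<sigma>_m by auto

lemma partition_sum_adapted: "l \<le> m \<Longrightarrow> partition_sum \<sigma> \<xi> l \<in> borel_measurable (F (\<sigma> l))"
  unfolding partition_sum_def
proof (intro borel_measurable_sum borel_measurable_scaleR borel_measurable_diff)
  fix i assume "l \<le> m" "i \<in> {..<l}"
  then have i: "i < l" "l \<le> m" "i < m" by auto
  show "B (\<sigma> (Suc i)) \<in> borel_measurable (F (\<sigma> l))" "B (\<sigma> i) \<in> borel_measurable (F (\<sigma> l))"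
    using i \<sigma>_in[of i] \<sigma>_in[of "Suc i"] \<sigma>_in[of l] \<sigma>_le[of "Suc i" l] \<sigma>_le[of i l]
    by (auto intro!: B_adapted_mono)
  show "\<xi> i \<in> borel_measurable (F (\<sigma> l))"
    using i \<sigma>_in[of i] \<sigma>_in[of l] \<sigma>_le[of i l] by (intro measurable_F_mono[OF _ _ _ \<xi>_adapted[of i]]) auto
qed

text \<open>The new summand is orthogonal to everything known at time \<open>\<sigma> l\<close>, also after restriction to an
  event \<open>D\<close> of that time. The freedom in \<open>D\<close> is what the maximal inequality needs.\<close>

lemma partition_sum_step:
  assumes l: "l < m" and int: "integrable P (\<lambda>\<omega>. (norm (partition_sum \<sigma> \<xi> l \<omega>))\<^sup>2)"
    and D: "D \<in> sets (F (\<sigma> l))"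
  shows "integrable P (\<lambda>\<omega>. indicator D \<omega> * (norm (partition_sum \<sigma> \<xi> (Suc l) \<omega>))\<^sup>2)"
    and "expectation (\<lambda>\<omega>. indicator D \<omega> * (norm (partition_sum \<sigma> \<xi> (Suc l) \<omega>))\<^sup>2)
      = expectation (\<lambda>\<omega>. indicator D \<omega> * (norm (partition_sum \<sigma> \<xi> l \<omega>))\<^sup>2)
        + (\<sigma> (Suc l) - \<sigma> l) * expectation (\<lambda>\<omega>. indicator D \<omega> * (norm (\<xi> l \<omega>))\<^sup>2)"
proof -
  let ?S = "partition_sum \<sigma> \<xi> l" and ?b = "\<lambda>\<omega>. B (\<sigma> (Suc l)) \<omega> - B (\<sigma> l) \<omega>"
  have t: "0 \<le> \<sigma> l" "\<sigma> l \<le> \<sigma> (Suc l)" "\<sigma> (Suc l) \<le> T" and tl: "\<sigma> l \<in> {0..T}"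
    using \<sigma>_in[of l] \<sigma>_in[of "Suc l"] \<sigma>_mono[OF l] l by auto
  have DP: "D \<in> sets P" using sets_F[OF tl] D by auto
  have SF: "?S \<in> borel_measurable (F (\<sigma> l))" using partition_sum_adapted l by simp
  have SP: "?S \<in> borel_measurable P" and \<xi>P: "\<xi> l \<in> borel_measurable P"
    using measurable_F_imp_P[OF tl] SF \<xi>_adapted[OF l] by auto
  have DF: "(indicator D :: 'w \<Rightarrow> real) \<in> borel_measurable (F (\<sigma> l))" using D by simp
  let ?Z1 = "\<lambda>\<omega>. indicator D \<omega> * (?S \<omega> \<bullet> \<xi> l \<omega>)" and ?Z2 = "\<lambda>\<omega>. indicator D \<omega> * (norm (\<xi> l \<omega>))\<^sup>2"
  have Z1: "?Z1 \<in> borel_measurable (F (\<sigma> l))" "integrable P ?Z1"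
    using SF \<xi>_adapted[OF l] DF integrable_mult_indicator[OF DP l2_inner_integrable[OF SP \<xi>P int \<xi>_l2[OF l]]]
    by auto
  have Z2: "?Z2 \<in> borel_measurable (F (\<sigma> l))" "integrable P ?Z2"
    using \<xi>_adapted[OF l] DF integrable_mult_indicator[OF DP \<xi>_l2[OF l]] by auto
  have SD: "integrable P (\<lambda>\<omega>. indicator D \<omega> * (norm (?S \<omega>))\<^sup>2)"
    using integrable_mult_indicator[OF DP int] by simp
  have eq: "indicator D \<omega> * (norm (partition_sum \<sigma> \<xi> (Suc l) \<omega>))\<^sup>2
      = indicator D \<omega> * (norm (?S \<omega>))\<^sup>2 + 2 * (?b \<omega> * ?Z1 \<omega>) + (?b \<omega>)\<^sup>2 * ?Z2 \<omega>" for \<omega>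
  proof -
    have "(norm (?S \<omega> + ?b \<omega> *\<^sub>R \<xi> l \<omega>))\<^sup>2
      = (norm (?S \<omega>))\<^sup>2 + 2 * (?b \<omega> * (?S \<omega> \<bullet> \<xi> l \<omega>)) + (?b \<omega>)\<^sup>2 * (norm (\<xi> l \<omega>))\<^sup>2"
      by (simp add: power2_norm_eq_inner inner_add_left inner_add_right inner_commute)
         (simp add: power2_eq_square)
    moreover have "partition_sum \<sigma> \<xi> (Suc l) \<omega> = ?S \<omega> + ?b \<omega> *\<^sub>R \<xi> l \<omega>"
      by (simp add: partition_sum_def)
    ultimately show ?thesis by (cases "\<omega> \<in> D") simp_all
  qed
  note i1 = increment_times[OF t Z1] and i2 = increment_times[OF t Z2]
  have split: "integrable P f \<and> expectation f = expectation a + 2 * expectation b + expectation c"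
    if "f = (\<lambda>\<omega>. a \<omega> + 2 * b \<omega> + c \<omega>)" "integrable P a" "integrable P b" "integrable P c"
    for f a b c :: "'w \<Rightarrow> real"
    using that by simp
  note sp = split[OF ext[OF eq] SD i1(1) i2(3)]
  show "integrable P (\<lambda>\<omega>. indicator D \<omega> * (norm (partition_sum \<sigma> \<xi> (Suc l) \<omega>))\<^sup>2)"
    using sp by (rule conjunct1)
  show "expectation (\<lambda>\<omega>. indicator D \<omega> * (norm (partition_sum \<sigma> \<xi> (Suc l) \<omega>))\<^sup>2)
      = expectation (\<lambda>\<omega>. indicator D \<omega> * (norm (?S \<omega>))\<^sup>2) + (\<sigma> (Suc l) - \<sigma> l) * expectation ?Z2"
    using conjunct2[OF sp] unfolding i1(2) i2(4) by (simp only: mult_zero_right add_0_right)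
qed

lemma partition_sum_l2:
  "l \<le> m \<Longrightarrow> integrable P (\<lambda>\<omega>. (norm (partition_sum \<sigma> \<xi> l \<omega>))\<^sup>2) \<and>
    expectation (\<lambda>\<omega>. (norm (partition_sum \<sigma> \<xi> l \<omega>))\<^sup>2)
      = (\<Sum>i<l. (\<sigma> (Suc i) - \<sigma> i) * expectation (\<lambda>\<omega>. (norm (\<xi> i \<omega>))\<^sup>2))"
proof (induction l)
  case 0
  then show ?case by (simp add: partition_sum_def)
next
  case (Suc l)
  then have l: "l < m" and int: "integrable P (\<lambda>\<omega>. (norm (partition_sum \<sigma> \<xi> l \<omega>))\<^sup>2)" by auto
  have "space P \<in> sets (F (\<sigma> l))"
    using sets.top[of "F (\<sigma> l)"] space_F[OF \<sigma>_in[of l]] l by simp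
  note st = partition_sum_step[OF l int this]
  have ind: "integrable P (\<lambda>\<omega>. indicator (space P) \<omega> * f \<omega>) = integrable P f"
    "expectation (\<lambda>\<omega>. indicator (space P) \<omega> * f \<omega>) = expectation f" for f :: "'w \<Rightarrow> real"
    by (rule Bochner_Integration.integrable_cong[OF refl], simp,
        rule Bochner_Integration.integral_cong[OF refl], simp)
  have "integrable P (\<lambda>\<omega>. (norm (partition_sum \<sigma> \<xi> (Suc l) \<omega>))\<^sup>2)"
    using st(1) by (simp only: ind(1))
  moreover have "expectation (\<lambda>\<omega>. (norm (partition_sum \<sigma> \<xi> (Suc l) \<omega>))\<^sup>2)
      = expectation (\<lambda>\<omega>. (norm (partition_sum \<sigma> \<xi> l \<omega>))\<^sup>2)
        + (\<sigma> (Suc l) - \<sigma> l) * expectation (\<lambda>\<omega>. (norm (\<xi> l \<omega>))\<^sup>2)"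
    using st(2) by (simp only: ind(2))
  ultimately show ?case using Suc by simp
qed

text \<open>Kolmogorov's proof of the maximal inequality: \<open>D (Suc l)\<close> is split into \<open>D l\<close> and the event
  that level \<open>c\<close> is first reached at step \<open>Suc l\<close>. On the former the second moment can only have
  grown, by \<open>partition_sum_step\<close>; on the latter the squared norm is at least \<open>c\<^sup>2\<close>.\<close>

lemma partition_sum_maximal_aux:
  assumes "0 \<le> c" "l \<le> m"
  defines "D \<equiv> \<lambda>l. {\<omega>\<in>space P. \<exists>i\<le>l. c \<le> norm (partition_sum \<sigma> \<xi> i \<omega>)}"
  shows "c\<^sup>2 * prob (D l) \<le> expectation (\<lambda>\<omega>. indicator (D l) \<omega> * (norm (partition_sum \<sigma> \<xi> l \<omega>))\<^sup>2)
    \<and> D l \<in> sets (F (\<sigma> l))"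
proof -
  let ?N = "\<lambda>l. {\<omega>\<in>space P. c \<le> norm (partition_sum \<sigma> \<xi> l \<omega>)}"
  have N: "?N l \<in> sets (F (\<sigma> l))" if "l \<le> m" for l
    using borel_measurable_le[OF borel_measurable_const[of c] measurable_compose[OF partition_sum_adapted[OF that] borel_measurable_norm]]
      space_F[OF \<sigma>_in[OF that]] by simp
  have bound: "c\<^sup>2 * prob E \<le> expectation (\<lambda>\<omega>. indicator E \<omega> * (norm (partition_sum \<sigma> \<xi> l \<omega>))\<^sup>2)"
    if "l \<le> m" "E \<subseteq> ?N l" "E \<in> sets P" for l E
  proof -
    have "c\<^sup>2 * prob E = expectation (\<lambda>\<omega>. indicator E \<omega> * c\<^sup>2)"
      using that by simp
    also have "\<dots> \<le> expectation (\<lambda>\<omega>. indicator E \<omega> * (norm (partition_sum \<sigma> \<xi> l \<omega>))\<^sup>2)"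
    proof (rule integral_mono)
      show "integrable P (\<lambda>\<omega>. indicator E \<omega> * c\<^sup>2)"
        using that by (intro integrable_mult_left integrable_real_indicator) (auto simp: less_top[symmetric])
      show "integrable P (\<lambda>\<omega>. indicator E \<omega> * (norm (partition_sum \<sigma> \<xi> l \<omega>))\<^sup>2)"
        using integrable_mult_indicator[OF that(3) conjunct1[OF partition_sum_l2[OF that(1)]]] by simp
      show "indicator E \<omega> * c\<^sup>2 \<le> indicator E \<omega> * (norm (partition_sum \<sigma> \<xi> l \<omega>))\<^sup>2" for \<omega>
        using that assms(1) by (auto simp: indicator_def intro!: power_mono)
    qed
    finally show ?thesis .
  qed
  show ?thesis
    using assms(2)
  proof (induction l)
    case 0
    have "D 0 = ?N 0" by (auto simp: D_def)
    then show ?case using bound[of 0 "D 0"] N[of 0] sets_F[OF \<sigma>_in[of 0]] by auto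
  next
    case (Suc l)
    then have l: "l < m" and DF: "D l \<in> sets (F (\<sigma> l))"
      and IH: "c\<^sup>2 * prob (D l) \<le> expectation (\<lambda>\<omega>. indicator (D l) \<omega> * (norm (partition_sum \<sigma> \<xi> l \<omega>))\<^sup>2)" by auto
    have "sets (F (\<sigma> l)) \<subseteq> sets (F (\<sigma> (Suc l)))"
      using \<sigma>_in[of l] \<sigma>_in[of "Suc l"] \<sigma>_mono[OF l] l by (intro F_mono) auto
    then have DF': "D l \<in> sets (F (\<sigma> (Suc l)))" using DF by auto
    let ?E = "?N (Suc l) - D l"
    have EF: "?E \<in> sets (F (\<sigma> (Suc l)))" using N[of "Suc l"] l DF' by auto
    have DP: "D l \<in> sets P" and EP: "?E \<in> sets P"
      using DF' EF sets_F[OF \<sigma>_in[of "Suc l"]] l by auto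
    have eq: "D (Suc l) = D l \<union> ?E" by (auto simp: D_def le_Suc_eq)
    have disj: "D l \<inter> ?E = {}" by auto
    note l2 = conjunct1[OF partition_sum_l2]
    note st = partition_sum_step[OF l l2[OF less_imp_le[OF l]] DF]
    have intE: "integrable P (\<lambda>\<omega>. indicator ?E \<omega> * (norm (partition_sum \<sigma> \<xi> (Suc l) \<omega>))\<^sup>2)"
      using integrable_mult_indicator[OF EP l2[of "Suc l"]] l by simp
    have "c\<^sup>2 * prob (D (Suc l)) = c\<^sup>2 * prob (D l) + c\<^sup>2 * prob ?E"
      unfolding eq using finite_measure_Union[OF DP EP disj] by (simp add: distrib_left)
    also have "\<dots> \<le> expectation (\<lambda>\<omega>. indicator (D l) \<omega> * (norm (partition_sum \<sigma> \<xi> (Suc l) \<omega>))\<^sup>2)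
        + expectation (\<lambda>\<omega>. indicator ?E \<omega> * (norm (partition_sum \<sigma> \<xi> (Suc l) \<omega>))\<^sup>2)"
    proof (rule add_mono)
      have "0 \<le> (\<sigma> (Suc l) - \<sigma> l) * expectation (\<lambda>\<omega>. indicator (D l) \<omega> * (norm (\<xi> l \<omega>))\<^sup>2)"
        using \<sigma>_mono[OF l] by (intro mult_nonneg_nonneg Bochner_Integration.integral_nonneg) auto
      then show "c\<^sup>2 * prob (D l) \<le> expectation (\<lambda>\<omega>. indicator (D l) \<omega> * (norm (partition_sum \<sigma> \<xi> (Suc l) \<omega>))\<^sup>2)"
        using IH st(2) l by simp
      show "c\<^sup>2 * prob ?E \<le> expectation (\<lambda>\<omega>. indicator ?E \<omega> * (norm (partition_sum \<sigma> \<xi> (Suc l) \<omega>))\<^sup>2)"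
        using l EP by (intro bound) auto
    qed
    also have "\<dots> = expectation (\<lambda>\<omega>. indicator (D l) \<omega> * (norm (partition_sum \<sigma> \<xi> (Suc l) \<omega>))\<^sup>2
        + indicator ?E \<omega> * (norm (partition_sum \<sigma> \<xi> (Suc l) \<omega>))\<^sup>2)"
      by (rule Bochner_Integration.integral_add[OF st(1) intE, symmetric])
    also have "\<dots> = expectation (\<lambda>\<omega>. indicator (D (Suc l)) \<omega> * (norm (partition_sum \<sigma> \<xi> (Suc l) \<omega>))\<^sup>2)"
    proof -
      have "indicator (D (Suc l)) \<omega> = (indicator (D l) \<omega> + indicator ?E \<omega> :: real)" for \<omega>
        unfolding eq by (cases "\<omega> \<in> D l") (simp_all add: indicator_def)
      then show ?thesis by (simp only: distrib_right)
    qed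
    finally have "c\<^sup>2 * prob (D (Suc l))
      \<le> expectation (\<lambda>\<omega>. indicator (D (Suc l)) \<omega> * (norm (partition_sum \<sigma> \<xi> (Suc l) \<omega>))\<^sup>2)" .
    moreover have "D (Suc l) \<in> sets (F (\<sigma> (Suc l)))"
      unfolding eq using DF' EF by (rule sets.Un)
    ultimately show ?case by (rule conjI)
  qed
qed

lemma partition_sum_maximal:
  assumes "0 \<le> c"
  shows "c\<^sup>2 * prob {\<omega>\<in>space P. \<exists>i\<le>m. c \<le> norm (partition_sum \<sigma> \<xi> i \<omega>)}
      \<le> expectation (\<lambda>\<omega>. (norm (partition_sum \<sigma> \<xi> m \<omega>))\<^sup>2)"
    and "{\<omega>\<in>space P. \<exists>i\<le>m. c \<le> norm (partition_sum \<sigma> \<xi> i \<omega>)} \<in> sets P"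
proof -
  let ?D = "{\<omega>\<in>space P. \<exists>i\<le>m. c \<le> norm (partition_sum \<sigma> \<xi> i \<omega>)}"
  let ?f = "\<lambda>\<omega>. (norm (partition_sum \<sigma> \<xi> m \<omega>))\<^sup>2"
  show D: "?D \<in> sets P"
    using conjunct2[OF partition_sum_maximal_aux[OF assms order_refl]]
    by (rule subsetD[OF sets_F[OF \<sigma>_in[OF order_refl]]])
  have "c\<^sup>2 * prob ?D \<le> expectation (\<lambda>\<omega>. indicator ?D \<omega> * ?f \<omega>)"
    by (rule conjunct1[OF partition_sum_maximal_aux[OF assms order_refl]])
  also have "\<dots> \<le> expectation ?f"
  proof (rule integral_mono)
    show int: "integrable P ?f" by (rule conjunct1[OF partition_sum_l2[OF order_refl]])
    show "integrable P (\<lambda>\<omega>. indicator ?D \<omega> * ?f \<omega>)"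
      using integrable_mult_indicator[OF D int] by (simp only: real_scaleR_def)
    show "indicator ?D \<omega> * ?f \<omega> \<le> ?f \<omega>" for \<omega>
      by (rule mult_left_le_one_le[OF zero_le_power2 indicator_pos_le indicator_le_1])
  qed
  finally show "c\<^sup>2 * prob ?D \<le> expectation ?f" .
qed

end

end

section \<open>The Ito integral of simple processes\<close>

context filtered_prob_space
begin

lemma simple_integrandD:
  assumes "simple_integrand P F T m \<tau> \<xi>"
  shows "\<tau> 0 = 0" "\<tau> m = T" "\<And>i. i < m \<Longrightarrow> \<tau> i < \<tau> (Suc i)" "\<And>i. i < m \<Longrightarrow> \<tau> i \<le> \<tau> (Suc i)"
    "\<And>i. i \<le> m \<Longrightarrow> \<tau> i \<in> {0..T}"
    "\<And>i. i < m \<Longrightarrow> \<xi> i \<in> borel_measurable (F (\<tau> i))"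
    "\<And>i. i < m \<Longrightarrow> integrable P (\<lambda>\<omega>. (norm (\<xi> i \<omega>))\<^sup>2)"
    "\<And>i. i < m \<Longrightarrow> \<xi> i \<in> borel_measurable P"
proof -
  show *: "\<tau> 0 = 0" "\<tau> m = T" "\<And>i. i < m \<Longrightarrow> \<tau> i < \<tau> (Suc i)"
    "\<And>i. i < m \<Longrightarrow> \<xi> i \<in> borel_measurable (F (\<tau> i))"
    "\<And>i. i < m \<Longrightarrow> integrable P (\<lambda>\<omega>. (norm (\<xi> i \<omega>))\<^sup>2)"
    using assms unfolding simple_integrand_def by auto
  show mono: "\<And>i. i < m \<Longrightarrow> \<tau> i \<le> \<tau> (Suc i)" using *(3) less_imp_le by blast
  show in_T: "\<tau> i \<in> {0..T}" if "i \<le> m" for i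
    using partition_mono[of m \<tau> 0 i] partition_mono[of m \<tau> i m] mono that *(1,2) by auto
  show "\<xi> i \<in> borel_measurable P" if "i < m" for i
    using measurable_F_imp_P[OF in_T *(4)[OF that]] that by simp
qed

lemma simple_integrand_diff:
  assumes "simple_integrand P F T m \<tau> \<xi>" "simple_integrand P F T m \<tau> \<eta>"
  shows "simple_integrand P F T m \<tau> (\<lambda>i \<omega>. \<xi> i \<omega> - \<eta> i \<omega>)"
proof -
  note x = simple_integrandD[OF assms(1)] and y = simple_integrandD[OF assms(2)]
  have "integrable P (\<lambda>\<omega>. (norm (\<xi> i \<omega> - \<eta> i \<omega>))\<^sup>2)" if i: "i < m" for i
  proof -
    have [measurable]: "\<xi> i \<in> borel_measurable P" "\<eta> i \<in> borel_measurable P" using x(8) y(8) i by auto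
    have "l2sq P (\<lambda>\<omega>. \<xi> i \<omega> - \<eta> i \<omega>) < \<infinity>"
      using x(7)[OF i] y(7)[OF i] by (intro l2sq_finite_diff) (auto simp: l2sq_finite_iff[unfolded infinity_ennreal_def])
    then show ?thesis using l2sq_finite_iff[of "\<lambda>\<omega>. \<xi> i \<omega> - \<eta> i \<omega>" P] by simp
  qed
  then show ?thesis
    using x y unfolding simple_integrand_def by (auto intro!: borel_measurable_diff)
qed

lemma joint_measurable_simple_process:
  assumes "simple_integrand P F T m \<tau> \<xi>"
  shows "joint_measurable P T (simple_process m \<tau> \<xi>)"
proof -
  have [measurable]: "(\<lambda>t. t) \<in> borel_measurable (lborel_upto T)"
    by (intro measurable_restrict_space1) simp
  have "(\<lambda>z. indicator {\<tau> i<..\<tau> (Suc i)} (fst z) *\<^sub>R \<xi> i (snd z)) \<in> borel_measurable (lborel_upto T \<Otimes>\<^sub>M P)"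
    if "i < m" for i
  proof -
    have [measurable]: "\<xi> i \<in> borel_measurable P" using simple_integrandD(8)[OF assms that] .
    have [measurable]: "fst \<in> borel_measurable (lborel_upto T \<Otimes>\<^sub>M P)"
      by (rule measurable_compose[OF measurable_fst, of "\<lambda>t. t" "lborel_upto T"]) measurable
    show ?thesis by measurable
  qed
  then have "(\<lambda>z. \<Sum>i<m. indicator {\<tau> i<..\<tau> (Suc i)} (fst z) *\<^sub>R \<xi> i (snd z))
      \<in> borel_measurable (lborel_upto T \<Otimes>\<^sub>M P)"
    by (intro borel_measurable_sum) auto
  then show ?thesis
    unfolding joint_measurable_def simple_process_def by (simp add: case_prod_beta')
qed

lemma energy_simple_process:
  assumes "simple_integrand P F T m \<tau> \<xi>" "t \<in> {0..T}"
  shows "energy P t (simple_process m \<tau> \<xi>)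
    = (\<Sum>i<m. ennreal (min (\<tau> (Suc i)) t - min (\<tau> i) t) * l2sq P (\<xi> i))"
proof -
  note x = simple_integrandD[OF assms(1)]
  have "energy P t (simple_process m \<tau> \<xi>)
     = (\<integral>\<^sup>+\<omega>. l2sq (lborel_upto t) (\<lambda>s. simple_process m \<tau> \<xi> s \<omega>) \<partial>P)"
    using assms(2) by (intro energy_swap[symmetric] joint_measurable_upto[OF joint_measurable_simple_process[OF assms(1)]]) auto
  also have "\<dots> = (\<integral>\<^sup>+\<omega>. (\<Sum>i<m. ennreal (min (\<tau> (Suc i)) t - min (\<tau> i) t) * ennreal ((norm (\<xi> i \<omega>))\<^sup>2)) \<partial>P)"
    unfolding simple_process_def using x(1,4) by (subst nn_integral_step_sq) auto
  also have "\<dots> = (\<Sum>i<m. ennreal (min (\<tau> (Suc i)) t - min (\<tau> i) t) * l2sq P (\<xi> i))"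
    unfolding l2sq_def using x(8)
    by (subst nn_integral_sum) (auto intro!: sum.cong nn_integral_cmult)
  finally show ?thesis .
qed

end

context brownian_filtration
begin

text \<open>The integral up to \<open>t\<close> is a sum over the partition stopped at \<open>t\<close>, whose last cells are
  degenerate. The coefficients of these cells are set to 0 because they need not be known at
  time \<open>t\<close>.\<close>

lemma simple_ito_as_partition_sum:
  fixes \<xi> :: "nat \<Rightarrow> 'w \<Rightarrow> 'a::euclidean_space"
  assumes "simple_integrand P F T m \<tau> \<xi>"
  shows "simple_ito_integral B m \<tau> \<xi> t = partition_sum (\<lambda>i. min (\<tau> i) t) (\<lambda>i \<omega>. if \<tau> i < t then \<xi> i \<omega> else 0) m"
proof
  fix \<omega>
  show "simple_ito_integral B m \<tau> \<xi> t \<omega> = partition_sum (\<lambda>i. min (\<tau> i) t) (\<lambda>i \<omega>. if \<tau> i < t then \<xi> i \<omega> else 0) m \<omega>"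
    unfolding simple_ito_integral_def partition_sum_def
  proof (intro sum.cong refl)
    fix i assume "i \<in> {..<m}"
    then have "\<tau> i < \<tau> (Suc i)" using simple_integrandD(3)[OF assms] by simp
    then show "(B (min (\<tau> (Suc i)) t) \<omega> - B (min (\<tau> i) t) \<omega>) *\<^sub>R \<xi> i \<omega>
       = (B (min (\<tau> (Suc i)) t) \<omega> - B (min (\<tau> i) t) \<omega>) *\<^sub>R (if \<tau> i < t then \<xi> i \<omega> else 0)"
      by (cases "\<tau> i < t") (simp_all add: min_def)
  qed
qed

lemma stopped_partition:
  fixes \<xi> :: "nat \<Rightarrow> 'w \<Rightarrow> 'a::euclidean_space"
  assumes "simple_integrand P F T m \<tau> \<xi>" and t: "t \<in> {0..T}"
  defines "\<sigma> \<equiv> \<lambda>i. min (\<tau> i) t" and "\<zeta> \<equiv> \<lambda>i \<omega>. if \<tau> i < t then \<xi> i \<omega> else 0"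
  shows "\<And>i. i < m \<Longrightarrow> \<sigma> i \<le> \<sigma> (Suc i)" "0 \<le> \<sigma> 0" "\<sigma> m \<le> T"
    and "\<And>i. i < m \<Longrightarrow> \<zeta> i \<in> borel_measurable (F (\<sigma> i))"
    and "\<And>i. i < m \<Longrightarrow> integrable P (\<lambda>\<omega>. (norm (\<zeta> i \<omega>))\<^sup>2)"
proof -
  note x = simple_integrandD[OF assms(1)]
  show "\<And>i. i < m \<Longrightarrow> \<sigma> i \<le> \<sigma> (Suc i)" "0 \<le> \<sigma> 0" "\<sigma> m \<le> T"
    unfolding \<sigma>_def using x(1,2) t by (auto intro!: min.mono x(4) simp del: min.bounded_iff)
  show "\<zeta> i \<in> borel_measurable (F (\<sigma> i))" if "i < m" for i
    using x(6)[OF that] by (cases "\<tau> i < t") (auto simp: \<sigma>_def \<zeta>_def)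
  show "integrable P (\<lambda>\<omega>. (norm (\<zeta> i \<omega>))\<^sup>2)" if "i < m" for i
    using x(7)[OF that] by (cases "\<tau> i < t") (auto simp: \<zeta>_def)
qed

lemma simple_ito_adapted:
  fixes \<xi> :: "nat \<Rightarrow> 'w \<Rightarrow> 'a::euclidean_space"
  assumes s: "simple_integrand P F T m \<tau> \<xi>" and t: "t \<in> {0..T}"
  shows "simple_ito_integral B m \<tau> \<xi> t \<in> borel_measurable (F t)"
proof -
  have "\<tau> m = T" using simple_integrandD(2)[OF s] .
  then have "min (\<tau> m) t = t" using t by simp
  then show ?thesis
    unfolding simple_ito_as_partition_sum[OF s]
    using partition_sum_adapted[OF stopped_partition[OF s t] order_refl] by simp
qed

theorem simple_ito_isometry:
  fixes \<xi> :: "nat \<Rightarrow> 'w \<Rightarrow> 'a::euclidean_space"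
  assumes s: "simple_integrand P F T m \<tau> \<xi>" and t: "t \<in> {0..T}"
  shows "l2sq P (simple_ito_integral B m \<tau> \<xi> t) = energy P t (simple_process m \<tau> \<xi>)"
proof -
  note x = simple_integrandD[OF s]
  note sp = stopped_partition[OF s t]
  let ?d = "\<lambda>i. min (\<tau> (Suc i)) t - min (\<tau> i) t"
  let ?\<zeta> = "\<lambda>i \<omega>. if \<tau> i < t then \<xi> i \<omega> else 0"
  let ?S = "partition_sum (\<lambda>i. min (\<tau> i) t) ?\<zeta> m"
  have int: "integrable P (\<lambda>\<omega>. (norm (?S \<omega>))\<^sup>2)"
    and sum: "expectation (\<lambda>\<omega>. (norm (?S \<omega>))\<^sup>2) = (\<Sum>i<m. ?d i * expectation (\<lambda>\<omega>. (norm (?\<zeta> i \<omega>))\<^sup>2))"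
    using partition_sum_l2[OF sp order_refl] by blast+
  have "l2sq P (simple_ito_integral B m \<tau> \<xi> t)
     = ennreal (\<Sum>i<m. ?d i * expectation (\<lambda>\<omega>. (norm (?\<zeta> i \<omega>))\<^sup>2))"
    unfolding simple_ito_as_partition_sum[OF s]
    using l2sq_eq_integral[OF int] unfolding sum .
  also have "\<dots> = (\<Sum>i<m. ennreal (?d i) * l2sq P (\<xi> i))"
  proof (subst sum_ennreal[symmetric])
    show "0 \<le> ?d i * expectation (\<lambda>\<omega>. (norm (?\<zeta> i \<omega>))\<^sup>2)" if "i \<in> {..<m}" for i
      using sp(1)[of i] that by (intro mult_nonneg_nonneg Bochner_Integration.integral_nonneg) auto
    show "(\<Sum>i<m. ennreal (?d i * expectation (\<lambda>\<omega>. (norm (?\<zeta> i \<omega>))\<^sup>2))) = (\<Sum>i<m. ennreal (?d i) * l2sq P (\<xi> i))"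
    proof (intro sum.cong refl)
      fix i assume "i \<in> {..<m}"
      then have i: "i < m" by simp
      show "ennreal (?d i * expectation (\<lambda>\<omega>. (norm (?\<zeta> i \<omega>))\<^sup>2)) = ennreal (?d i) * l2sq P (\<xi> i)"
      proof (cases "\<tau> i < t")
        case True
        then show ?thesis
          using l2sq_eq_integral[OF x(7)[OF i]] sp(1)[OF i] by (simp add: ennreal_mult')
      next
        case False
        then have "?d i = 0" using x(4)[OF i] by simp
        then show ?thesis by simp
      qed
    qed
  qed
  also have "\<dots> = energy P t (simple_process m \<tau> \<xi>)" by (rule energy_simple_process[OF s t, symmetric])
  finally show ?thesis .
qed

lemma simple_ito_mean:
  fixes \<xi> :: "nat \<Rightarrow> 'w \<Rightarrow> 'a::euclidean_space"
  assumes s: "simple_integrand P F T m \<tau> \<xi>" and t: "t \<in> {0..T}"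
  shows "integrable P (simple_ito_integral B m \<tau> \<xi> t)" "expectation (simple_ito_integral B m \<tau> \<xi> t) = 0"
proof -
  note sp = stopped_partition[OF s t]
  let ?\<zeta> = "\<lambda>i \<omega>. if \<tau> i < t then \<xi> i \<omega> else 0"
  have *: "simple_ito_integral B m \<tau> \<xi> t \<in> borel_measurable P"
    by (rule measurable_F_imp_P[OF t simple_ito_adapted[OF s t]])
  have "l2sq P (simple_ito_integral B m \<tau> \<xi> t) < \<infinity>"
    using partition_sum_l2[OF sp order_refl] * unfolding simple_ito_as_partition_sum[OF s]
    by (auto simp: l2sq_finite_iff[unfolded infinity_ennreal_def])
  then show int: "integrable P (simple_ito_integral B m \<tau> \<xi> t)"
    using * by (intro l2_imp_integrable) unfold_locales
  have in_T: "min (\<tau> i) t \<in> {0..T}" if "i \<le> m" for i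
    using simple_integrandD(5)[OF s that] t by auto
  have comp: "expectation (\<lambda>\<omega>. simple_ito_integral B m \<tau> \<xi> t \<omega> \<bullet> b) = 0" for b
  proof -
    have "expectation (\<lambda>\<omega>. (B (min (\<tau> (Suc i)) t) \<omega> - B (min (\<tau> i) t) \<omega>) * (?\<zeta> i \<omega> \<bullet> b)) = 0 \<and>
      integrable P (\<lambda>\<omega>. (B (min (\<tau> (Suc i)) t) \<omega> - B (min (\<tau> i) t) \<omega>) * (?\<zeta> i \<omega> \<bullet> b))" if i: "i < m" for i
    proof -
      have F: "(\<lambda>\<omega>. ?\<zeta> i \<omega> \<bullet> b) \<in> borel_measurable (F (min (\<tau> i) t))"
        by (rule borel_measurable_inner[OF sp(4)[OF i] borel_measurable_const])
      have \<zeta>P: "?\<zeta> i \<in> borel_measurable P" using measurable_F_imp_P[OF in_T sp(4)[OF i]] i by simp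
      have I: "integrable P (\<lambda>\<omega>. ?\<zeta> i \<omega> \<bullet> b)"
        by (rule l2_inner_integrable[OF \<zeta>P _ sp(5)[OF i]]) simp_all
      show ?thesis
        using increment_times(1,2)[OF _ sp(1)[OF i] _ F I] in_T[of i] in_T[of "Suc i"] i by auto
    qed
    then show ?thesis
      unfolding simple_ito_as_partition_sum[OF s] partition_sum_def inner_sum_left inner_scaleR_left
      by (subst Bochner_Integration.integral_sum) auto
  qed
  have "expectation (simple_ito_integral B m \<tau> \<xi> t) \<bullet> b = 0" for b
    using comp[of b] integral_inner_left[of b P "simple_ito_integral B m \<tau> \<xi> t"] int by simp
  then show "expectation (simple_ito_integral B m \<tau> \<xi> t) = 0"
    by (metis inner_eq_zero_iff)
qed

text \<open>The mean vanishes for simple integrands since each increment has mean zero given the past, and it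
  is continuous in \<open>L\<^sup>2\<close>. This is what eliminates the noise from the equation for the mean of the
  state.\<close>

theorem has_ito_integral_mean:
  fixes \<phi> :: "real \<Rightarrow> 'w \<Rightarrow> 'a::euclidean_space"
  assumes "has_ito_integral P F T B \<phi> I" and t: "t \<in> {0..T}"
  shows "integrable P (I t)" "expectation (I t) = 0" "l2sq P (I t) < \<infinity>"
proof -
  obtain m \<tau> \<xi> where s: "\<And>j. simple_integrand P F T (m j) (\<tau> j) (\<xi> j)"
    and lim: "(\<lambda>j. l2sq P (\<lambda>\<omega>. simple_ito_integral B (m j) (\<tau> j) (\<xi> j) t \<omega> - I t \<omega>)) \<longlonglongrightarrow> 0"
    and I[measurable]: "I t \<in> borel_measurable P"
    using assms unfolding has_ito_integral_def l2sq_def by blast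
  let ?S = "\<lambda>j. simple_ito_integral B (m j) (\<tau> j) (\<xi> j) t"
  have [measurable]: "?S j \<in> borel_measurable P" for j
    by (rule measurable_F_imp_P[OF t simple_ito_adapted[OF s t]])
  have Sfin: "l2sq P (?S j) < \<infinity>" for j
    using simple_ito_isometry[OF s t, of j] energy_simple_process[OF s t, of j] simple_integrandD(7,8)[OF s, of _ j]
    by (auto simp: ennreal_mult_less_top ennreal_sum_less_top l2sq_finite_iff[unfolded infinity_ennreal_def])
  obtain j where j: "l2sq P (\<lambda>\<omega>. ?S j \<omega> - I t \<omega>) \<le> ennreal 1"
    using ennreal_tendsto_0D[OF lim, of 1] by (auto simp: eventually_sequentially)
  then have "l2sq P (\<lambda>\<omega>. ?S j \<omega> - I t \<omega>) < \<infinity>" by (simp add: order_le_less_trans)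
  from l2sq_finite_diff[OF _ _ Sfin[of j] this] show fin: "l2sq P (I t) < \<infinity>" by simp
  then show int: "integrable P (I t)" by (intro l2_imp_integrable I) unfold_locales
  have "ennreal ((norm (expectation (I t)))\<^sup>2) \<le> l2sq P (\<lambda>\<omega>. ?S j \<omega> - I t \<omega>)" for j
  proof -
    have "expectation (\<lambda>\<omega>. ?S j \<omega> - I t \<omega>) = - expectation (I t)"
      using int simple_ito_mean[OF s t, of j] by simp
    then show ?thesis
      using norm_integral_sq_le[of P "\<lambda>\<omega>. ?S j \<omega> - I t \<omega>"] by (simp add: emeasure_space_1)
  qed
  then have "ennreal ((norm (expectation (I t)))\<^sup>2) \<le> 0"
    using lim by (intro LIMSEQ_le_const) auto
  then show "expectation (I t) = 0" by (simp add: ennreal_eq_0_iff)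
qed

end

section \<open>Dyadic approximation of integrands\<close>

lemma dyadic_refine:
  assumes "j \<le> N"
  shows "dyadic T N (k * 2 ^ (N - j)) = dyadic T j k"
proof -
  obtain d where "N = j + d" using assms le_Suc_ex by blast
  then show ?thesis by (simp add: dyadic_def power_add)
qed

text \<open>Each cell of level \<open>j\<close> is the union of \<open>2 ^ (N - j)\<close> cells of level \<open>N\<close>, and the increments of
  \<open>G\<close> over these telescope.\<close>

lemma dyadic_refine_sum:
  fixes x :: "nat \<Rightarrow> 'a::real_vector" and G :: "real \<Rightarrow> real"
  assumes "j \<le> N"
  shows "(\<Sum>i<2 ^ N. (G (dyadic T N (Suc i)) - G (dyadic T N i)) *\<^sub>R x (i div 2 ^ (N - j)))
    = (\<Sum>k<2 ^ j. (G (dyadic T j (Suc k)) - G (dyadic T j k)) *\<^sub>R x k)"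
proof -
  define c :: nat where "c = 2 ^ (N - j)"
  have c: "0 < c" "(2::nat) ^ N = 2 ^ j * c" using assms by (simp_all add: c_def flip: power_add)
  let ?f = "\<lambda>i. (G (dyadic T N (Suc i)) - G (dyadic T N i)) *\<^sub>R x (i div c)"
  have "(\<Sum>i<2 ^ N. ?f i) = (\<Sum>k<2 ^ j. sum ?f {k * c..<k * c + c})"
    unfolding c(2) by (rule sum.nat_group[symmetric])
  also have "\<dots> = (\<Sum>k<2 ^ j. (G (dyadic T j (Suc k)) - G (dyadic T j k)) *\<^sub>R x k)"
  proof (intro sum.cong refl)
    fix k
    have "sum ?f {k * c..<k * c + c} = (\<Sum>i = k * c..<k * c + c. (G (dyadic T N (Suc i)) - G (dyadic T N i)) *\<^sub>R x k)"
    proof (intro sum.cong refl)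
      fix i assume "i \<in> {k * c..<k * c + c}"
      then have "i div c = k" using c(1) by (intro div_nat_eqI) (auto simp: algebra_simps)
      then show "?f i = (G (dyadic T N (Suc i)) - G (dyadic T N i)) *\<^sub>R x k" by simp
    qed
    also have "\<dots> = (\<Sum>i = k * c..<k * c + c. G (dyadic T N (Suc i)) - G (dyadic T N i)) *\<^sub>R x k"
      by (rule scaleR_sum_left[symmetric])
    also have "(\<Sum>i = k * c..<k * c + c. G (dyadic T N (Suc i)) - G (dyadic T N i))
       = G (dyadic T N (Suc k * c)) - G (dyadic T N (k * c))"
      using sum_Suc_diff'[of "k * c" "k * c + c" "\<lambda>i. G (dyadic T N i)"] by (simp add: add.commute)
    finally show "sum ?f {k * c..<k * c + c} = (G (dyadic T j (Suc k)) - G (dyadic T j k)) *\<^sub>R x k"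
      using dyadic_refine[OF assms, of T k] dyadic_refine[OF assms, of T "Suc k"] by (simp only: c_def)
  qed
  finally show ?thesis by (simp add: c_def)
qed

definition dyadic_floor :: "real \<Rightarrow> nat \<Rightarrow> real \<Rightarrow> nat" where
  "dyadic_floor T N t = nat \<lfloor>t * 2 ^ N / T\<rfloor>"

lemma dyadic_floor_le:
  assumes "0 < T" "t \<in> {0..T}"
  shows "dyadic_floor T N t \<le> 2 ^ N"
proof -
  have "t * 2 ^ N / T \<le> 2 ^ N" using assms by (simp add: divide_le_eq mult.commute)
  then have "\<lfloor>t * 2 ^ N / T\<rfloor> \<le> \<lfloor>2 ^ N :: real\<rfloor>" by (rule floor_mono)
  then show ?thesis unfolding dyadic_floor_def by (simp add: nat_le_iff)
qed

lemma dyadic_floor_tendsto: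
  assumes T: "0 < T" and t: "t \<in> {0..T}"
  shows "(\<lambda>N. dyadic T N (dyadic_floor T N t)) \<longlonglongrightarrow> t"
proof -
  have b: "\<bar>dyadic T N (dyadic_floor T N t) - t\<bar> \<le> T / 2 ^ N" for N
  proof -
    let ?y = "t * 2 ^ N / T"
    have y: "0 \<le> ?y" using T t by simp
    have "real (dyadic_floor T N t) = of_int \<lfloor>?y\<rfloor>" using y by (simp add: dyadic_floor_def)
    then have "\<bar>real (dyadic_floor T N t) - ?y\<bar> \<le> 1" by linarith
    then have "T / 2 ^ N * \<bar>real (dyadic_floor T N t) - ?y\<bar> \<le> T / 2 ^ N * 1"
      using T by (intro mult_left_mono) auto
    moreover have "T / 2 ^ N * \<bar>real (dyadic_floor T N t) - ?y\<bar> = \<bar>dyadic T N (dyadic_floor T N t) - t\<bar>"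
    proof -
      have "T / 2 ^ N * (real (dyadic_floor T N t) - ?y) = dyadic T N (dyadic_floor T N t) - t"
        using T by (simp add: dyadic_def right_diff_distrib)
      then have "\<bar>T / 2 ^ N\<bar> * \<bar>real (dyadic_floor T N t) - ?y\<bar> = \<bar>dyadic T N (dyadic_floor T N t) - t\<bar>"
        by (simp only: abs_mult[symmetric])
      moreover have "\<bar>T / 2 ^ N\<bar> = T / 2 ^ N" using T by simp
      ultimately show ?thesis by (simp only:)
    qed
    ultimately show ?thesis by simp
  qed
  have "(\<lambda>N. T / 2 ^ N) \<longlonglongrightarrow> 0" using LIMSEQ_divide_realpow_zero[of 2 T] by simp
  then have "(\<lambda>N. dyadic T N (dyadic_floor T N t) - t) \<longlonglongrightarrow> 0"
    by (rule Lim_null_comparison[rotated]) (simp add: b)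
  then show ?thesis by (simp add: LIM_zero_iff)
qed

lemma bounded_on_dyadics_imp:
  fixes f :: "real \<Rightarrow> 'a::real_normed_vector"
  assumes "0 < T" "continuous_on {0..T} f" "\<And>N i. i \<le> 2 ^ N \<Longrightarrow> norm (f (dyadic T N i)) \<le> c" "t \<in> {0..T}"
  shows "norm (f t) \<le> c"
proof -
  have "(\<lambda>N. f (dyadic T N (dyadic_floor T N t))) \<longlonglongrightarrow> f t"
    using dyadic_in[OF assms(1) dyadic_floor_le[OF assms(1,4)]]
    by (intro continuous_on_tendsto_compose[OF assms(2) dyadic_floor_tendsto[OF assms(1,4)] assms(4)]) auto
  then have "(\<lambda>N. norm (f (dyadic T N (dyadic_floor T N t)))) \<longlonglongrightarrow> norm (f t)" by (rule tendsto_norm)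
  then show ?thesis
    by (rule LIMSEQ_le_const2) (auto intro: assms(3) dyadic_floor_le[OF assms(1,4)])
qed

context filtered_prob_space
begin

abbreviation dyadic_simple :: "nat \<Rightarrow> (nat \<Rightarrow> 'w \<Rightarrow> 'a::euclidean_space) \<Rightarrow> bool" where
  "dyadic_simple j \<xi> \<equiv> simple_integrand P F T (2 ^ j) (dyadic T j) \<xi>"

lemma dyadic_simple_refine:
  assumes "dyadic_simple j \<xi>" "j \<le> N"
  shows "dyadic_simple N (\<lambda>i. \<xi> (i div 2 ^ (N - j)))"
    and "simple_process (2 ^ N) (dyadic T N) (\<lambda>i. \<xi> (i div 2 ^ (N - j))) = simple_process (2 ^ j) (dyadic T j) \<xi>"
    and "simple_ito_integral b (2 ^ N) (dyadic T N) (\<lambda>i. \<xi> (i div 2 ^ (N - j))) = simple_ito_integral b (2 ^ j) (dyadic T j) \<xi>"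
proof -
  note x = simple_integrandD[OF assms(1)]
  have "\<xi> (i div 2 ^ (N - j)) \<in> borel_measurable (F (dyadic T N i)) \<and>
      integrable P (\<lambda>\<omega>. (norm (\<xi> (i div 2 ^ (N - j)) \<omega>))\<^sup>2)" if i: "i < 2 ^ N" for i
  proof -
    let ?q = "i div 2 ^ (N - j)"
    have "(2::nat) ^ N = 2 ^ j * 2 ^ (N - j)" using assms(2) by (simp flip: power_add)
    then have q: "?q < 2 ^ j" using i by (intro less_mult_imp_div_less) simp
    have "dyadic T j ?q = dyadic T N (?q * 2 ^ (N - j))" using dyadic_refine[OF assms(2)] by simp
    also have "\<dots> \<le> dyadic T N i" by (intro dyadic_le T_pos) simp
    finally have le: "dyadic T j ?q \<le> dyadic T N i" .
    have "\<xi> ?q \<in> borel_measurable (F (dyadic T N i))"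
      using le x(5)[of ?q] q dyadic_in[OF T_pos, of i N] i
      by (intro measurable_F_mono[OF _ le _ x(6)[OF q]]) auto
    then show ?thesis using x(7)[OF q] by simp
  qed
  then show "dyadic_simple N (\<lambda>i. \<xi> (i div 2 ^ (N - j)))"
    unfolding simple_integrand_def using dyadic_less[OF T_pos] by auto
  show "simple_process (2 ^ N) (dyadic T N) (\<lambda>i. \<xi> (i div 2 ^ (N - j))) = simple_process (2 ^ j) (dyadic T j) \<xi>"
  proof (intro ext)
    fix t \<omega>
    have ind: "indicator {dyadic T M i<..dyadic T M (Suc i)} t
      = (- indicator {..<t} (dyadic T M (Suc i)) - (- indicator {..<t} (dyadic T M i)) :: real)" for M i
      using dyadic_less[OF T_pos, of i "Suc i" M] by (auto simp: indicator_def)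
    show "simple_process (2 ^ N) (dyadic T N) (\<lambda>i. \<xi> (i div 2 ^ (N - j))) t \<omega> = simple_process (2 ^ j) (dyadic T j) \<xi> t \<omega>"
      unfolding simple_process_def ind
      by (rule dyadic_refine_sum[OF assms(2), of "\<lambda>s. - indicator {..<t} s"])
  qed
  show "simple_ito_integral b (2 ^ N) (dyadic T N) (\<lambda>i. \<xi> (i div 2 ^ (N - j))) = simple_ito_integral b (2 ^ j) (dyadic T j) \<xi>"
  proof (intro ext)
    fix t \<omega>
    show "simple_ito_integral b (2 ^ N) (dyadic T N) (\<lambda>i. \<xi> (i div 2 ^ (N - j))) t \<omega> = simple_ito_integral b (2 ^ j) (dyadic T j) \<xi> t \<omega>"
      unfolding simple_ito_integral_def
      by (rule dyadic_refine_sum[OF assms(2), of "\<lambda>s. b (min s t) \<omega>"])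
  qed
qed

text \<open>Two simple processes on dyadic partitions of different levels become comparable on a common
  refinement, where their difference is again simple.\<close>

lemma dyadic_simple_common:
  assumes "dyadic_simple j \<xi>" "dyadic_simple k \<eta>" "max j k \<le> N"
  obtains \<zeta> where "dyadic_simple N \<zeta>"
    "\<And>t \<omega>. simple_process (2 ^ N) (dyadic T N) \<zeta> t \<omega>
       = simple_process (2 ^ j) (dyadic T j) \<xi> t \<omega> - simple_process (2 ^ k) (dyadic T k) \<eta> t \<omega>"
    "\<And>b t \<omega>. simple_ito_integral b (2 ^ N) (dyadic T N) \<zeta> t \<omega>
       = simple_ito_integral b (2 ^ j) (dyadic T j) \<xi> t \<omega> - simple_ito_integral b (2 ^ k) (dyadic T k) \<eta> t \<omega>"
proof -
  have jk: "j \<le> N" "k \<le> N" using assms(3) by auto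
  note x = dyadic_simple_refine[OF assms(1) jk(1)] and y = dyadic_simple_refine[OF assms(2) jk(2)]
  let ?\<xi> = "\<lambda>i. \<xi> (i div 2 ^ (N - j))" and ?\<eta> = "\<lambda>i. \<eta> (i div 2 ^ (N - k))"
  show ?thesis
  proof (rule that)
    show "dyadic_simple N (\<lambda>i \<omega>. ?\<xi> i \<omega> - ?\<eta> i \<omega>)" by (rule simple_integrand_diff[OF x(1) y(1)])
    show "simple_process (2 ^ N) (dyadic T N) (\<lambda>i \<omega>. ?\<xi> i \<omega> - ?\<eta> i \<omega>) t \<omega>
       = simple_process (2 ^ j) (dyadic T j) \<xi> t \<omega> - simple_process (2 ^ k) (dyadic T k) \<eta> t \<omega>" for t \<omega>
      unfolding x(2)[symmetric] y(2)[symmetric] simple_process_def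
      by (simp add: scaleR_diff_right sum_subtractf)
    show "simple_ito_integral b (2 ^ N) (dyadic T N) (\<lambda>i \<omega>. ?\<xi> i \<omega> - ?\<eta> i \<omega>) t \<omega>
       = simple_ito_integral b (2 ^ j) (dyadic T j) \<xi> t \<omega> - simple_ito_integral b (2 ^ k) (dyadic T k) \<eta> t \<omega>" for b t \<omega>
      unfolding x(3)[of b, symmetric] y(3)[of b, symmetric] simple_ito_integral_def
      by (simp add: scaleR_diff_right sum_subtractf)
  qed
qed

definition lagged_coeff :: "(real \<Rightarrow> 'w \<Rightarrow> 'a::euclidean_space) \<Rightarrow> nat \<Rightarrow> nat \<Rightarrow> 'w \<Rightarrow> 'a" where
  "lagged_coeff \<phi> j i \<omega> = lagged_mean T j (\<lambda>s. \<phi> s \<omega>) i"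

definition lagged_process :: "(real \<Rightarrow> 'w \<Rightarrow> 'a::euclidean_space) \<Rightarrow> nat \<Rightarrow> real \<Rightarrow> 'w \<Rightarrow> 'a" where
  "lagged_process \<phi> j = simple_process (2 ^ j) (dyadic T j) (lagged_coeff \<phi> j)"

lemma lagged_process_eq: "lagged_process \<phi> j t \<omega> = lagged_step T j (\<lambda>s. \<phi> s \<omega>) t"
  by (simp add: lagged_process_def simple_process_def lagged_coeff_def lagged_step_def)

text \<open>The mean over the preceding interval is known at the left end point by
  \<open>M2_adapted_time_integral\<close>, and its second moment is bounded by the energy of \<open>\<phi>\<close>.\<close>

lemma dyadic_simple_lagged:
  assumes \<phi>: "\<phi> \<in> M2"
  shows "dyadic_simple j (lagged_coeff \<phi> j)"
proof -
  have "lagged_coeff \<phi> j i \<in> borel_measurable (F (dyadic T j i)) \<and>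
      integrable P (\<lambda>\<omega>. (norm (lagged_coeff \<phi> j i \<omega>))\<^sup>2)" if i: "i < 2 ^ j" for i
  proof (cases "i = 0")
    case True
    then show ?thesis unfolding lagged_coeff_def lagged_mean_def by simp
  next
    case False
    let ?A = "{dyadic T j (i - 1)<..dyadic T j i}"
    have in_T: "dyadic T j i \<in> {0..T}" using dyadic_in[OF T_pos] i by simp
    have A: "?A \<subseteq> {0..dyadic T j i}" using dyadic_le[OF T_pos, of 0 "i - 1" j] by auto
    have eq: "lagged_coeff \<phi> j i = (\<lambda>\<omega>. (2 ^ j / T) *\<^sub>R (LBINT s:?A. \<phi> s \<omega>))"
      using False by (auto simp: lagged_coeff_def lagged_mean_def)
    have m: "lagged_coeff \<phi> j i \<in> borel_measurable (F (dyadic T j i))"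
      unfolding eq by (intro borel_measurable_scaleR M2_adapted_time_integral[OF \<phi> in_T _ A]) auto
    have [measurable]: "lagged_coeff \<phi> j i \<in> borel_measurable P" by (rule measurable_F_imp_P[OF in_T m])
    have [measurable]: "(\<lambda>\<omega>. l2sq (lborel_upto T) (\<lambda>s. \<phi> s \<omega>)) \<in> borel_measurable P"
    proof -
      interpret L: finite_measure "lborel_upto T" by (rule finite_measure_lborel_upto)
      interpret LP: pair_sigma_finite P "lborel_upto T" ..
      have [measurable]: "case_prod \<phi> \<in> borel_measurable (lborel_upto T \<Otimes>\<^sub>M P)"
        using M2D(1)[OF \<phi>] by (simp add: joint_measurable_def)
      have "(\<lambda>\<omega>. l2sq (lborel_upto T) (\<lambda>s. case_prod \<phi> (s, \<omega>))) \<in> borel_measurable P"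
        unfolding l2sq_def by (rule L.borel_measurable_nn_integral) measurable
      then show ?thesis by simp
    qed
    have "l2sq P (lagged_coeff \<phi> j i)
       \<le> (\<integral>\<^sup>+\<omega>. (ennreal ((2 ^ j / T)\<^sup>2) * emeasure lborel ?A) * l2sq (lborel_upto T) (\<lambda>s. \<phi> s \<omega>) \<partial>P)"
      unfolding l2sq_def[of P]
    proof (intro nn_integral_mono)
      fix \<omega>
      have "ennreal ((norm (lagged_coeff \<phi> j i \<omega>))\<^sup>2)
         = ennreal ((2 ^ j / T)\<^sup>2) * ennreal ((norm (LBINT s:?A. \<phi> s \<omega>))\<^sup>2)"
        unfolding eq norm_scaleR power_mult_distrib power2_abs by (rule ennreal_mult') simp
      also have "\<dots> \<le> ennreal ((2 ^ j / T)\<^sup>2) * (emeasure lborel ?A * (\<integral>\<^sup>+s\<in>?A. ennreal ((norm (\<phi> s \<omega>))\<^sup>2) \<partial>lborel))"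
        by (intro mult_left_mono norm_set_integral_sq_le) auto
      also have "\<dots> \<le> ennreal ((2 ^ j / T)\<^sup>2) * (emeasure lborel ?A * l2sq (lborel_upto T) (\<lambda>s. \<phi> s \<omega>))"
        unfolding l2sq_lborel_upto using A in_T
        by (intro mult_left_mono nn_integral_mono) (auto simp: indicator_def)
      finally show "ennreal ((norm (lagged_coeff \<phi> j i \<omega>))\<^sup>2)
        \<le> (ennreal ((2 ^ j / T)\<^sup>2) * emeasure lborel ?A) * l2sq (lborel_upto T) (\<lambda>s. \<phi> s \<omega>)"
        by (simp add: mult.assoc)
    qed
    also have "\<dots> = (ennreal ((2 ^ j / T)\<^sup>2) * emeasure lborel ?A) * energy P T \<phi>"
      using energy_swap[OF M2D(1)[OF \<phi>]] by (simp add: nn_integral_cmult)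
    also have "\<dots> < \<infinity>"
      using M2D(3)[OF \<phi>] dyadic_le[OF T_pos, of "i - 1" i j] by (simp add: ennreal_mult_less_top)
    finally show ?thesis using m l2sq_finite_iff[of "lagged_coeff \<phi> j i" P] by simp
  qed
  then show ?thesis unfolding simple_integrand_def using dyadic_less[OF T_pos] by auto
qed

lemma joint_measurable_lagged: "\<phi> \<in> M2 \<Longrightarrow> joint_measurable P T (lagged_process \<phi> j)"
  unfolding lagged_process_def by (rule joint_measurable_simple_process[OF dyadic_simple_lagged])

text \<open>On almost every path this is \<open>lagged_step_tendsto\<close>; the contraction property bounds the error by
  4 times the squared norm of the path, so dominated convergence applies over \<open>\<Omega>\<close>.\<close>

lemma lagged_process_tendsto:
  assumes \<phi>: "\<phi> \<in> M2"
  shows "(\<lambda>j. energy P T (\<lambda>t \<omega>. lagged_process \<phi> j t \<omega> - \<phi> t \<omega>)) \<longlonglongrightarrow> 0"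
proof -
  interpret L: finite_measure "lborel_upto T" by (rule finite_measure_lborel_upto)
  interpret LP: pair_sigma_finite P "lborel_upto T" ..
  have j: "joint_measurable P T (\<lambda>t \<omega>. lagged_process \<phi> j t \<omega> - \<phi> t \<omega>)" for j
    by (intro joint_measurable_add(2) joint_measurable_lagged[OF \<phi>] M2D(1)[OF \<phi>])
  have meas: "(\<lambda>\<omega>. l2sq (lborel_upto T) (\<lambda>s. \<psi> s \<omega>)) \<in> borel_measurable P" if "joint_measurable P T \<psi>"
    for \<psi> :: "real \<Rightarrow> 'w \<Rightarrow> 'a"
  proof -
    have [measurable]: "case_prod \<psi> \<in> borel_measurable (lborel_upto T \<Otimes>\<^sub>M P)"
      using that by (simp add: joint_measurable_def)
    have "(\<lambda>\<omega>. l2sq (lborel_upto T) (\<lambda>s. case_prod \<psi> (s, \<omega>))) \<in> borel_measurable P"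
      unfolding l2sq_def by (rule L.borel_measurable_nn_integral) measurable
    then show ?thesis by simp
  qed
  let ?N = "l2sq (lborel_upto T)"
  have path: "?N (\<lambda>s. lagged_process \<phi> j s \<omega> - \<phi> s \<omega>) \<le> 4 * ?N (\<lambda>s. \<phi> s \<omega>) \<and>
    (?N (\<lambda>s. \<phi> s \<omega>) < \<infinity> \<longrightarrow> (\<lambda>j. ?N (\<lambda>s. lagged_process \<phi> j s \<omega> - \<phi> s \<omega>)) \<longlonglongrightarrow> 0)"
    if \<omega>: "\<omega> \<in> space P" for \<omega> j
  proof -
    let ?f = "\<lambda>s. indicator {0..T} s *\<^sub>R \<phi> s \<omega>"
    have "(\<lambda>s. \<phi> s \<omega>) \<in> borel_measurable (restrict_space borel {0..T})"
      using joint_measurable_path[OF M2D(1)[OF \<phi>] \<omega>]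
      by (subst measurable_cong_sets[OF sets_restrict_space_cong[OF sets_lborel[symmetric]] refl])
    then have f: "?f \<in> borel_measurable borel"
      by (subst (asm) borel_measurable_restrict_space_iff) auto
    have eq: "lagged_process \<phi> j s \<omega> = lagged_step T j ?f s" for j s
      unfolding lagged_process_eq by (rule lagged_step_cong[OF T_pos]) simp
    have eqf: "?N (\<lambda>s. \<phi> s \<omega>) = ?N ?f"
      by (rule l2sq_cong) (simp add: space_restrict_space)
    have eqd: "?N (\<lambda>s. lagged_process \<phi> j s \<omega> - \<phi> s \<omega>) = ?N (\<lambda>s. lagged_step T j ?f s - ?f s)" for j
      by (rule l2sq_cong) (simp add: space_restrict_space eq)
    note [measurable] = borel_measurable_lborel_upto[OF f] borel_measurable_lborel_upto[OF lagged_step_measurable]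
    have "?N (\<lambda>s. lagged_step T j ?f s + - ?f s) \<le> 2 * ?N (lagged_step T j ?f) + 2 * ?N (\<lambda>s. - ?f s)"
      by (intro l2sq_add) measurable
    also have "\<dots> \<le> 2 * ?N ?f + 2 * ?N ?f"
      unfolding l2sq_uminus by (intro add_mono mult_left_mono l2sq_lagged_step_le T_pos f) auto
    also have "\<dots> = 4 * ?N ?f"
      by (simp add: distrib_right[symmetric])
    finally have "?N (\<lambda>s. lagged_step T j ?f s - ?f s) \<le> 4 * ?N ?f" by simp
    then show ?thesis unfolding eqd eqf using lagged_step_tendsto[OF T_pos f] by auto
  qed
  have "(\<lambda>j. \<integral>\<^sup>+\<omega>. ?N (\<lambda>s. lagged_process \<phi> j s \<omega> - \<phi> s \<omega>) \<partial>P) \<longlonglongrightarrow> (\<integral>\<^sup>+\<omega>. 0 \<partial>P)"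
  proof (rule nn_integral_dominated_convergence[where w = "\<lambda>\<omega>. 4 * ?N (\<lambda>s. \<phi> s \<omega>)"])
    show "(\<integral>\<^sup>+\<omega>. 4 * ?N (\<lambda>s. \<phi> s \<omega>) \<partial>P) < \<infinity>"
      using meas[OF M2D(1)[OF \<phi>]] M2D(3)[OF \<phi>] energy_swap[OF M2D(1)[OF \<phi>]]
      by (simp add: nn_integral_cmult ennreal_mult_less_top)
    show "AE \<omega> in P. (\<lambda>j. ?N (\<lambda>s. lagged_process \<phi> j s \<omega> - \<phi> s \<omega>)) \<longlonglongrightarrow> 0"
      using AE_path_l2[OF M2D(1,3)[OF \<phi>]] AE_space by eventually_elim (use path in auto)
    show "AE \<omega> in P. ?N (\<lambda>s. lagged_process \<phi> j s \<omega> - \<phi> s \<omega>) \<le> 4 * ?N (\<lambda>s. \<phi> s \<omega>)" for j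
      using path by (intro AE_I2) auto
  qed (use meas j M2D(1)[OF \<phi>] in auto)
  then show ?thesis by (simp add: energy_swap[OF j])
qed

end

section \<open>Existence of a continuous Ito integral\<close>

context brownian_filtration
begin

lemma dyadic_ito_isometry:
  assumes "dyadic_simple j \<xi>" "dyadic_simple k \<eta>" "t \<in> {0..T}"
  shows "l2sq P (\<lambda>\<omega>. simple_ito_integral B (2 ^ j) (dyadic T j) \<xi> t \<omega> - simple_ito_integral B (2 ^ k) (dyadic T k) \<eta> t \<omega>)
    = energy P t (\<lambda>s \<omega>. simple_process (2 ^ j) (dyadic T j) \<xi> s \<omega> - simple_process (2 ^ k) (dyadic T k) \<eta> s \<omega>)"
proof -
  obtain \<zeta> where z: "dyadic_simple (max j k) \<zeta>"
    "\<And>t \<omega>. simple_process (2 ^ max j k) (dyadic T (max j k)) \<zeta> t \<omega>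
       = simple_process (2 ^ j) (dyadic T j) \<xi> t \<omega> - simple_process (2 ^ k) (dyadic T k) \<eta> t \<omega>"
    "\<And>b t \<omega>. simple_ito_integral b (2 ^ max j k) (dyadic T (max j k)) \<zeta> t \<omega>
       = simple_ito_integral b (2 ^ j) (dyadic T j) \<xi> t \<omega> - simple_ito_integral b (2 ^ k) (dyadic T k) \<eta> t \<omega>"
    by (rule dyadic_simple_common[OF assms(1,2) order_refl]) blast
  show ?thesis using simple_ito_isometry[OF z(1) assms(3)] unfolding z(2,3)[symmetric] .
qed

lemma simple_ito_at_partition_point:
  assumes s: "simple_integrand P F T m \<tau> \<xi>" and i: "i \<le> m"
  shows "simple_ito_integral B m \<tau> \<xi> (\<tau> i) \<omega> = partition_sum \<tau> \<xi> i \<omega>"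
proof -
  have mono: "\<tau> k \<le> \<tau> l" if "k \<le> l" "l \<le> m" for k l
    using partition_mono[of m \<tau> k l] simple_integrandD(4)[OF s] that by blast
  have "simple_ito_integral B m \<tau> \<xi> (\<tau> i) \<omega>
     = (\<Sum>l<m. if l < i then (B (\<tau> (Suc l)) \<omega> - B (\<tau> l) \<omega>) *\<^sub>R \<xi> l \<omega> else 0)"
    unfolding simple_ito_integral_def
  proof (intro sum.cong refl)
    fix l assume "l \<in> {..<m}"
    then have l: "l < m" by simp
    show "(B (min (\<tau> (Suc l)) (\<tau> i)) \<omega> - B (min (\<tau> l) (\<tau> i)) \<omega>) *\<^sub>R \<xi> l \<omega>
       = (if l < i then (B (\<tau> (Suc l)) \<omega> - B (\<tau> l) \<omega>) *\<^sub>R \<xi> l \<omega> else 0)"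
    proof (cases "l < i")
      case True
      then show ?thesis using mono[of "Suc l" i] mono[of l i] i by (simp add: min_absorb1)
    next
      case False
      then show ?thesis using mono[of i l] mono[of i "Suc l"] l by (simp add: min_absorb2)
    qed
  qed
  also have "\<dots> = partition_sum \<tau> \<xi> i \<omega>"
    unfolding partition_sum_def using i
    by (subst sum.inter_filter[symmetric]) (auto intro!: sum.cong)
  finally show ?thesis .
qed

text \<open>At the dyadic points of level \<open>N\<close> the integral is a partition sum, to which the maximal
  inequality applies with a bound that does not depend on \<open>N\<close>. The events increase with \<open>N\<close>, so the
  bound persists for all dyadic points together, and by continuity of paths this is a bound for all
  times.\<close>

lemma dyadic_ito_maximal:
  fixes \<xi> \<eta> :: "nat \<Rightarrow> 'w \<Rightarrow> 'a::euclidean_space"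
  assumes s: "dyadic_simple j \<xi>" "dyadic_simple k \<eta>" and "0 < c" "0 \<le> a"
    and le: "energy P T (\<lambda>s \<omega>. simple_process (2 ^ j) (dyadic T j) \<xi> s \<omega> - simple_process (2 ^ k) (dyadic T k) \<eta> s \<omega>) \<le> ennreal a"
  defines "d \<equiv> \<lambda>t \<omega>. simple_ito_integral B (2 ^ j) (dyadic T j) \<xi> t \<omega> - simple_ito_integral B (2 ^ k) (dyadic T k) \<eta> t \<omega>"
  shows "{\<omega>\<in>space P. \<exists>N. \<exists>i\<le>2^N. c \<le> norm (d (dyadic T N i) \<omega>)} \<in> sets P"
    and "prob {\<omega>\<in>space P. \<exists>N. \<exists>i\<le>2^N. c \<le> norm (d (dyadic T N i) \<omega>)} \<le> a / c\<^sup>2"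
proof -
  define A where "A N = {\<omega>\<in>space P. \<exists>i\<le>2^N. c \<le> norm (d (dyadic T N i) \<omega>)}" for N :: nat
  have T: "T \<in> {0..T}" using T_pos by simp
  have A: "A N \<in> sets P \<and> prob (A N) \<le> a / c\<^sup>2" if N: "max j k \<le> N" for N
  proof -
    obtain \<zeta> where z: "dyadic_simple N \<zeta>"
      "\<And>t \<omega>. simple_process (2 ^ N) (dyadic T N) \<zeta> t \<omega>
         = simple_process (2 ^ j) (dyadic T j) \<xi> t \<omega> - simple_process (2 ^ k) (dyadic T k) \<eta> t \<omega>"
      "\<And>b t \<omega>. simple_ito_integral b (2 ^ N) (dyadic T N) \<zeta> t \<omega>
         = simple_ito_integral b (2 ^ j) (dyadic T j) \<xi> t \<omega> - simple_ito_integral b (2 ^ k) (dyadic T k) \<eta> t \<omega>"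
      by (rule dyadic_simple_common[OF s N]) blast
    note x = simple_integrandD[OF z(1)]
    have ps: "d (dyadic T N i) \<omega> = partition_sum (dyadic T N) \<zeta> i \<omega>" if "i \<le> 2 ^ N" for i \<omega>
      unfolding d_def using simple_ito_at_partition_point[OF z(1) that] z(3)[of B] by simp
    have A_eq: "A N = {\<omega>\<in>space P. \<exists>i\<le>2^N. c \<le> norm (partition_sum (dyadic T N) \<zeta> i \<omega>)}"
      unfolding A_def using ps by (intro Collect_cong conj_cong refl ex_cong1) auto
    have pr: "\<And>i. i < 2 ^ N \<Longrightarrow> dyadic T N i \<le> dyadic T N (Suc i)" "0 \<le> dyadic T N 0" "dyadic T N (2 ^ N) \<le> T"
      using x(4) by auto
    note mx = partition_sum_maximal[of "2 ^ N" "dyadic T N" \<zeta> c, OF pr x(6,7) less_imp_le[OF \<open>0 < c\<close>]]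
    note l2 = partition_sum_l2[of "2 ^ N" "dyadic T N" \<zeta>, OF pr x(6,7) order_refl]
    have pe: "partition_sum (dyadic T N) \<zeta> (2 ^ N) = simple_ito_integral B (2 ^ N) (dyadic T N) \<zeta> T"
      using simple_ito_at_partition_point[OF z(1) order_refl] by (intro ext) simp
    have "ennreal (expectation (\<lambda>\<omega>. (norm (partition_sum (dyadic T N) \<zeta> (2 ^ N) \<omega>))\<^sup>2))
       = l2sq P (partition_sum (dyadic T N) \<zeta> (2 ^ N))"
      by (rule l2sq_eq_integral[OF conjunct1[OF l2], symmetric])
    also have "\<dots> = energy P T (simple_process (2 ^ N) (dyadic T N) \<zeta>)"
      unfolding pe by (rule simple_ito_isometry[OF z(1) T])
    also have "\<dots> \<le> ennreal a" using le unfolding z(2)[symmetric] .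
    finally have "expectation (\<lambda>\<omega>. (norm (partition_sum (dyadic T N) \<zeta> (2 ^ N) \<omega>))\<^sup>2) \<le> a"
      using \<open>0 \<le> a\<close> by simp
    with mx(1) have "c\<^sup>2 * prob (A N) \<le> a" unfolding A_eq by (rule order_trans)
    then have "prob (A N) \<le> a / c\<^sup>2" using \<open>0 < c\<close> by (simp add: le_divide_eq mult.commute)
    then show ?thesis using mx(2) unfolding A_eq by blast
  qed
  have A': "A (N + max j k) \<in> sets P" "prob (A (N + max j k)) \<le> a / c\<^sup>2" for N
    using A[of "N + max j k"] by simp_all
  have mono: "A N \<subseteq> A M" if "N \<le> M" for N M
  proof
    fix \<omega> assume "\<omega> \<in> A N"
    then obtain i where i: "\<omega> \<in> space P" "i \<le> 2 ^ N" "c \<le> norm (d (dyadic T N i) \<omega>)" by (auto simp: A_def)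
    have "i * 2 ^ (M - N) \<le> 2 ^ N * 2 ^ (M - N)" using i by (intro mult_right_mono) auto
    also have "\<dots> = (2::nat) ^ M" using that by (simp flip: power_add)
    finally show "\<omega> \<in> A M" using i dyadic_refine[OF that, of T i] unfolding A_def by (auto intro!: exI[of _ "i * 2 ^ (M - N)"])
  qed
  let ?K = "max j k"
  have eq: "{\<omega>\<in>space P. \<exists>N. \<exists>i\<le>2^N. c \<le> norm (d (dyadic T N i) \<omega>)} = (\<Union>N. A (N + ?K))"
  proof -
    have "{\<omega>\<in>space P. \<exists>N. \<exists>i\<le>2^N. c \<le> norm (d (dyadic T N i) \<omega>)} = (\<Union>N. A N)"
      unfolding A_def by auto
    also have "\<dots> = (\<Union>N. A (N + ?K))"
      using mono[of _ "_ + ?K"] by (intro equalityI UN_least) (auto 0 3 intro: subsetD[OF mono[OF le_add1]])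
    finally show ?thesis .
  qed
  show "{\<omega>\<in>space P. \<exists>N. \<exists>i\<le>2^N. c \<le> norm (d (dyadic T N i) \<omega>)} \<in> sets P"
    unfolding eq using A' by (intro sets.countable_UN) auto
  have "(\<lambda>N. prob (A (N + ?K))) \<longlonglongrightarrow> prob (\<Union>N. A (N + ?K))"
    using A' by (intro finite_Lim_measure_incseq) (auto simp: incseq_def intro!: mono)
  then show "prob {\<omega>\<in>space P. \<exists>N. \<exists>i\<le>2^N. c \<le> norm (d (dyadic T N i) \<omega>)} \<le> a / c\<^sup>2"
    unfolding eq by (rule LIMSEQ_le_const2) (use A' in auto)
qed

definition dyadic_ito :: "(real \<Rightarrow> 'w \<Rightarrow> 'a::euclidean_space) \<Rightarrow> nat \<Rightarrow> real \<Rightarrow> 'w \<Rightarrow> 'a" where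
  "dyadic_ito \<phi> j = simple_ito_integral B (2 ^ j) (dyadic T j) (lagged_coeff \<phi> j)"

lemma dyadic_ito_adapted: "\<phi> \<in> M2 \<Longrightarrow> t \<in> {0..T} \<Longrightarrow> dyadic_ito \<phi> j t \<in> borel_measurable (F t)"
  unfolding dyadic_ito_def by (rule simple_ito_adapted[OF dyadic_simple_lagged])

lemma dyadic_ito_diff:
  assumes "\<phi> \<in> M2" "\<psi> \<in> M2" "t \<in> {0..T}"
  shows "l2sq P (\<lambda>\<omega>. dyadic_ito \<phi> j t \<omega> - dyadic_ito \<psi> k t \<omega>)
    = energy P t (\<lambda>s \<omega>. lagged_process \<phi> j s \<omega> - lagged_process \<psi> k s \<omega>)"
  unfolding dyadic_ito_def lagged_process_def
  by (rule dyadic_ito_isometry[OF dyadic_simple_lagged[OF assms(1)] dyadic_simple_lagged[OF assms(2)] assms(3)])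

lemma lagged_process_Cauchy:
  assumes "\<phi> \<in> M2" "t \<le> T"
  shows "energy P t (\<lambda>s \<omega>. lagged_process \<phi> j s \<omega> - lagged_process \<phi> k s \<omega>)
    \<le> 2 * energy P T (\<lambda>s \<omega>. lagged_process \<phi> j s \<omega> - \<phi> s \<omega>) + 2 * energy P T (\<lambda>s \<omega>. lagged_process \<phi> k s \<omega> - \<phi> s \<omega>)"
proof -
  note j = joint_measurable_lagged[OF assms(1)]
  have "energy P t (\<lambda>s \<omega>. lagged_process \<phi> j s \<omega> - lagged_process \<phi> k s \<omega>)
    \<le> 2 * energy P t (\<lambda>s \<omega>. lagged_process \<phi> j s \<omega> - \<phi> s \<omega>) + 2 * energy P t (\<lambda>s \<omega>. \<phi> s \<omega> - lagged_process \<phi> k s \<omega>)"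
    by (rule energy_diff_triangle[OF j j M2D(1)[OF assms(1)] assms(2)])
  also have "\<dots> \<le> 2 * energy P T (\<lambda>s \<omega>. lagged_process \<phi> j s \<omega> - \<phi> s \<omega>) + 2 * energy P T (\<lambda>s \<omega>. lagged_process \<phi> k s \<omega> - \<phi> s \<omega>)"
    unfolding energy_minus_commute[of P t \<phi>] by (intro add_mono mult_left_mono energy_mono assms(2)) auto
  finally show ?thesis .
qed

text \<open>The isometry holds for the approximations, and the limits inherit it up to the constant that
  results from bounding squares of sums; Lipschitz estimates tolerate this constant.\<close>

lemma dyadic_ito_limit_diff:
  fixes \<phi> \<psi> :: "real \<Rightarrow> 'w \<Rightarrow> 'a::euclidean_space"
  assumes \<phi>: "\<phi> \<in> M2" and \<psi>: "\<psi> \<in> M2" and t: "t \<in> {0..T}"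
    and I: "I \<in> borel_measurable P" "(\<lambda>j. l2sq P (\<lambda>\<omega>. dyadic_ito \<phi> j t \<omega> - I \<omega>)) \<longlonglongrightarrow> 0"
    and K: "K \<in> borel_measurable P" "(\<lambda>j. l2sq P (\<lambda>\<omega>. dyadic_ito \<psi> j t \<omega> - K \<omega>)) \<longlonglongrightarrow> 0"
  shows "l2sq P (\<lambda>\<omega>. I \<omega> - K \<omega>) \<le> 16 * energy P t (\<lambda>s \<omega>. \<phi> s \<omega> - \<psi> s \<omega>)"
proof -
  note [measurable] = I(1) K(1)
  have [measurable]: "dyadic_ito \<phi> j t \<in> borel_measurable P" "dyadic_ito \<psi> j t \<in> borel_measurable P" for j
    using measurable_F_imp_P[OF t] dyadic_ito_adapted \<phi> \<psi> t by auto
  let ?a = "\<lambda>j. l2sq P (\<lambda>\<omega>. dyadic_ito \<phi> j t \<omega> - I \<omega>)" and ?b = "\<lambda>j. l2sq P (\<lambda>\<omega>. dyadic_ito \<psi> j t \<omega> - K \<omega>)"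
  let ?e = "\<lambda>j. energy P T (\<lambda>s \<omega>. lagged_process \<phi> j s \<omega> - \<phi> s \<omega>)"
    and ?g = "\<lambda>j. energy P T (\<lambda>s \<omega>. lagged_process \<psi> j s \<omega> - \<psi> s \<omega>)"
  let ?E = "energy P t (\<lambda>s \<omega>. \<phi> s \<omega> - \<psi> s \<omega>)"
  note jm = joint_measurable_lagged[OF \<phi>] joint_measurable_lagged[OF \<psi>] M2D(1)[OF \<phi>] M2D(1)[OF \<psi>]
  have tT: "t \<le> T" using t by simp
  have "l2sq P (\<lambda>\<omega>. I \<omega> - K \<omega>) \<le> 2 * ?a j + 2 * (2 * (2 * ?e j + 2 * (2 * ?E + 2 * ?g j)) + 2 * ?b j)" for j
  proof -
    have 1: "energy P t (\<lambda>s \<omega>. lagged_process \<phi> j s \<omega> - lagged_process \<psi> j s \<omega>)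
       \<le> 2 * energy P t (\<lambda>s \<omega>. lagged_process \<phi> j s \<omega> - \<phi> s \<omega>) + 2 * energy P t (\<lambda>s \<omega>. \<phi> s \<omega> - lagged_process \<psi> j s \<omega>)"
      by (rule energy_diff_triangle[OF jm(1) jm(2) jm(3) tT])
    have 2: "energy P t (\<lambda>s \<omega>. \<phi> s \<omega> - lagged_process \<psi> j s \<omega>)
       \<le> 2 * ?E + 2 * energy P t (\<lambda>s \<omega>. \<psi> s \<omega> - lagged_process \<psi> j s \<omega>)"
      by (rule energy_diff_triangle[OF jm(3) jm(2) jm(4) tT])
    have 3: "energy P t (\<lambda>s \<omega>. lagged_process \<phi> j s \<omega> - \<phi> s \<omega>) \<le> ?e j"
      "energy P t (\<lambda>s \<omega>. \<psi> s \<omega> - lagged_process \<psi> j s \<omega>) \<le> ?g j"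
      unfolding energy_minus_commute[of P t \<psi>] by (rule energy_mono[OF tT])+
    have 4: "l2sq P (\<lambda>\<omega>. dyadic_ito \<phi> j t \<omega> - dyadic_ito \<psi> j t \<omega>) \<le> 2 * ?e j + 2 * (2 * ?E + 2 * ?g j)"
      unfolding dyadic_ito_diff[OF \<phi> \<psi> t]
      by (rule order_trans[OF 1]) (intro add_mono mult_left_mono 3 order_trans[OF 2] order_refl; simp)
    have "l2sq P (\<lambda>\<omega>. I \<omega> - K \<omega>)
      \<le> 2 * l2sq P (\<lambda>\<omega>. I \<omega> - dyadic_ito \<phi> j t \<omega>) + 2 * l2sq P (\<lambda>\<omega>. dyadic_ito \<phi> j t \<omega> - K \<omega>)"
      by (rule l2sq_diff_triangle) measurable
    also have "l2sq P (\<lambda>\<omega>. I \<omega> - dyadic_ito \<phi> j t \<omega>) = ?a j" by (rule l2sq_minus_commute)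
    finally have 5: "l2sq P (\<lambda>\<omega>. I \<omega> - K \<omega>) \<le> 2 * ?a j + 2 * l2sq P (\<lambda>\<omega>. dyadic_ito \<phi> j t \<omega> - K \<omega>)" .
    have "l2sq P (\<lambda>\<omega>. dyadic_ito \<phi> j t \<omega> - K \<omega>)
      \<le> 2 * l2sq P (\<lambda>\<omega>. dyadic_ito \<phi> j t \<omega> - dyadic_ito \<psi> j t \<omega>) + 2 * ?b j"
      by (rule l2sq_diff_triangle) measurable
    also have "\<dots> \<le> 2 * (2 * ?e j + 2 * (2 * ?E + 2 * ?g j)) + 2 * ?b j"
      by (intro add_mono mult_left_mono 4 order_refl) simp
    finally show ?thesis by (intro order_trans[OF 5] add_left_mono mult_left_mono) simp_all
  qed
  moreover have "(\<lambda>j. 2 * ?a j + 2 * (2 * (2 * ?e j + 2 * (2 * ?E + 2 * ?g j)) + 2 * ?b j))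
      \<longlonglongrightarrow> 2 * 0 + 2 * (2 * (2 * 0 + 2 * (2 * ?E + 2 * 0)) + 2 * 0)"
    by (intro tendsto_add ennreal_tendsto_cmult tendsto_const I(2) K(2) lagged_process_tendsto \<phi> \<psi>) simp_all
  ultimately have "l2sq P (\<lambda>\<omega>. I \<omega> - K \<omega>) \<le> 2 * 0 + 2 * (2 * (2 * 0 + 2 * (2 * ?E + 2 * 0)) + 2 * 0)"
    by (intro LIMSEQ_le_const[of _ _ "l2sq P (\<lambda>\<omega>. I \<omega> - K \<omega>)"]) blast+
  also have "\<dots> = 16 * ?E" by (simp add: mult.assoc[symmetric])
  finally show ?thesis .
qed

lemma has_ito_integral_dyadicI:
  assumes \<phi>: "\<phi> \<in> M2" and "\<And>t. t \<in> {0..T} \<Longrightarrow> I t \<in> borel_measurable P"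
    and "\<And>t. t \<in> {0..T} \<Longrightarrow> (\<lambda>j. l2sq P (\<lambda>\<omega>. dyadic_ito \<phi> j t \<omega> - I t \<omega>)) \<longlonglongrightarrow> 0"
  shows "has_ito_integral P F T B \<phi> I"
  unfolding has_ito_integral_def
proof (intro conjI exI[of _ "\<lambda>j. 2 ^ j"] exI[of _ "dyadic T"] exI[of _ "lagged_coeff \<phi>"] ballI allI)
  have j: "joint_measurable P T (\<lambda>t \<omega>. lagged_process \<phi> j t \<omega> - \<phi> t \<omega>)" for j
    by (intro joint_measurable_add(2) joint_measurable_lagged[OF \<phi>] M2D(1)[OF \<phi>])
  show "(\<lambda>j. \<integral>\<^sup>+\<omega>. (\<integral>\<^sup>+t\<in>{0..T}. ennreal ((norm (simple_process (2 ^ j) (dyadic T j) (lagged_coeff \<phi> j) t \<omega> - \<phi> t \<omega>))\<^sup>2) \<partial>lborel) \<partial>P)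
          \<longlonglongrightarrow> 0"
  proof -
    have "(\<lambda>j. \<integral>\<^sup>+\<omega>. l2sq (lborel_upto T) (\<lambda>t. lagged_process \<phi> j t \<omega> - \<phi> t \<omega>) \<partial>P) \<longlonglongrightarrow> 0"
      using lagged_process_tendsto[OF \<phi>] by (simp only: energy_swap[OF j])
    then show ?thesis by (simp only: l2sq_lborel_upto lagged_process_def)
  qed
qed (use assms dyadic_simple_lagged in \<open>auto simp: l2sq_def dyadic_ito_def\<close>)

end

locale continuous_brownian_filtration = brownian_filtration P F T B
  for P :: "'w measure" and F T B +
  assumes B_continuous: "\<omega> \<in> space P \<Longrightarrow> continuous_on {0..T} (\<lambda>t. B t \<omega>)"
begin

text \<open>By continuity of paths the motion is the limit of its values at the dyadic points below \<open>t\<close>.\<close>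

lemma joint_measurable_B: "joint_measurable P T B"
  unfolding joint_measurable_def
proof (rule borel_measurable_LIMSEQ_metric)
  let ?k = "\<lambda>N z. min (dyadic_floor T N (fst z)) (2 ^ N)"
  let ?f = "\<lambda>N z. B (dyadic T N (?k N z)) (snd z)"
  have [measurable]: "(\<lambda>t. t) \<in> borel_measurable (lborel_upto T)"
    by (intro measurable_restrict_space1) simp
  have [measurable]: "fst \<in> borel_measurable (lborel_upto T \<Otimes>\<^sub>M P)"
    by (rule measurable_compose[OF measurable_fst, of "\<lambda>t. t" "lborel_upto T"]) measurable
  show "?f N \<in> borel_measurable (lborel_upto T \<Otimes>\<^sub>M P)" for N
  proof (rule measurable_compose_countable[where f = "\<lambda>i z. B (dyadic T N (min i (2 ^ N))) (snd z)" and g = "\<lambda>z. dyadic_floor T N (fst z)"])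
    show "(\<lambda>z. B (dyadic T N (min i (2 ^ N))) (snd z)) \<in> borel_measurable (lborel_upto T \<Otimes>\<^sub>M P)" for i
      by (rule measurable_compose[OF measurable_snd B_measurable]) (rule dyadic_in[OF T_pos], simp)
    show "(\<lambda>z. dyadic_floor T N (fst z)) \<in> measurable (lborel_upto T \<Otimes>\<^sub>M P) (count_space UNIV)"
      unfolding dyadic_floor_def by measurable
  qed
  show "(\<lambda>N. ?f N z) \<longlonglongrightarrow> case_prod B z" if z: "z \<in> space (lborel_upto T \<Otimes>\<^sub>M P)" for z
  proof -
    obtain t \<omega> where z_eq: "z = (t, \<omega>)" and t: "t \<in> {0..T}" and \<omega>: "\<omega> \<in> space P"
      using z by (auto simp: space_pair_measure space_restrict_space)
    have k: "?k N z = dyadic_floor T N t" for N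
      using dyadic_floor_le[OF T_pos t] by (simp add: z_eq min_absorb1)
    have "(\<lambda>N. B (dyadic T N (dyadic_floor T N t)) \<omega>) \<longlonglongrightarrow> B t \<omega>"
      using dyadic_in[OF T_pos dyadic_floor_le[OF T_pos t]]
      by (intro continuous_on_tendsto_compose[OF B_continuous[OF \<omega>] dyadic_floor_tendsto[OF T_pos t] t]) auto
    then show ?thesis by (simp only: k) (simp add: z_eq)
  qed
qed

lemma continuous_dyadic_ito:
  assumes "\<omega> \<in> space P"
  shows "continuous_on {0..T} (\<lambda>t. dyadic_ito \<phi> j t \<omega>)"
proof -
  have B: "continuous_on {0..T} (\<lambda>t. B (min a t) \<omega>)" if "0 \<le> a" for a
    by (rule continuous_on_compose2[OF B_continuous[OF assms]])
       (use that in \<open>auto intro!: continuous_intros\<close>)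
  have "0 \<le> dyadic T j i" for i using T_pos by (simp add: dyadic_def)
  then show ?thesis
    unfolding dyadic_ito_def simple_ito_integral_def by (intro continuous_intros B)
qed

lemma joint_measurable_dyadic_ito:
  assumes \<phi>: "\<phi> \<in> M2"
  shows "joint_measurable P T (dyadic_ito \<phi> j)"
proof -
  have [measurable]: "(\<lambda>t. t) \<in> borel_measurable (lborel_upto T)"
    by (intro measurable_restrict_space1) simp
  have B: "(\<lambda>z. B (min a (fst z)) (snd z)) \<in> borel_measurable (lborel_upto T \<Otimes>\<^sub>M P)" if a: "0 \<le> a" for a
  proof -
    have "(\<lambda>t. min a t) \<in> measurable (lborel_upto T) (lborel_upto T)"
      using a by (intro measurable_restrict_space3) auto
    then have "(\<lambda>z. (min a (fst z), snd z)) \<in> measurable (lborel_upto T \<Otimes>\<^sub>M P) (lborel_upto T \<Otimes>\<^sub>M P)"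
      by (intro measurable_Pair measurable_compose[OF measurable_fst] measurable_snd)
    from measurable_compose[OF this joint_measurable_B[unfolded joint_measurable_def]] show ?thesis by simp
  qed
  have pos: "0 \<le> dyadic T j i" for i using T_pos by (simp add: dyadic_def)
  have c: "(\<lambda>z. lagged_coeff \<phi> j i (snd z)) \<in> borel_measurable (lborel_upto T \<Otimes>\<^sub>M P)" if "i < 2 ^ j" for i
    by (rule measurable_compose[OF measurable_snd simple_integrandD(8)[OF dyadic_simple_lagged[OF \<phi>] that]])
  have "(\<lambda>z. \<Sum>i<2 ^ j. (B (min (dyadic T j (Suc i)) (fst z)) (snd z) - B (min (dyadic T j i) (fst z)) (snd z))
        *\<^sub>R lagged_coeff \<phi> j i (snd z)) \<in> borel_measurable (lborel_upto T \<Otimes>\<^sub>M P)"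
    by (intro borel_measurable_sum borel_measurable_scaleR borel_measurable_diff B pos c) auto
  then show ?thesis
    unfolding joint_measurable_def dyadic_ito_def simple_ito_integral_def by (simp add: case_prod_beta')
qed

text \<open>Along a subsequence \<open>r\<close> the error is at most \<open>(1/8) ^ k\<close>, and by the maximal inequality consecutive
  integrals differ by \<open>(1/2) ^ k\<close> somewhere with probability at most
  \<open>4 * (1/8) ^ k / (1/2) ^ (2 * k) = 4 * (1/2) ^ k\<close>. This is summable, so by the Borel-Cantelli lemma almost
  every path converges uniformly, and the limit is continuous in time.\<close>

theorem ito_integral_exists:
  fixes \<phi> :: "real \<Rightarrow> 'w \<Rightarrow> 'a::euclidean_space"
  assumes \<phi>: "\<phi> \<in> M2"
  obtains I where "\<And>t. t \<in> {0..T} \<Longrightarrow> I t \<in> borel_measurable (F t)" "joint_measurable P T I"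
    "AE \<omega> in P. continuous_on {0..T} (\<lambda>t. I t \<omega>)"
    "\<And>t. t \<in> {0..T} \<Longrightarrow> (\<lambda>j. l2sq P (\<lambda>\<omega>. dyadic_ito \<phi> j t \<omega> - I t \<omega>)) \<longlonglongrightarrow> 0"
proof -
  define e where "e j = energy P T (\<lambda>s \<omega>. lagged_process \<phi> j s \<omega> - \<phi> s \<omega>)" for j
  have e_lim: "e \<longlonglongrightarrow> 0" unfolding e_def by (rule lagged_process_tendsto[OF \<phi>])
  have "\<exists>j. \<forall>i\<ge>j. e i \<le> ennreal ((1/8) ^ k)" for k :: nat
    using ennreal_tendsto_0D[OF e_lim, of "(1/8) ^ k"] by (auto simp: eventually_sequentially)
  then obtain r where "\<And>k i. i \<ge> r k \<Longrightarrow> e i \<le> ennreal ((1/8) ^ k)" by metis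
  then have r: "e (r k) \<le> ennreal ((1/8) ^ k)" for k by blast
  have Cauchy: "energy P t (\<lambda>s \<omega>. lagged_process \<phi> j s \<omega> - lagged_process \<phi> k s \<omega>) \<le> 2 * e j + 2 * e k"
    if "t \<le> T" for t j k
    unfolding e_def by (rule lagged_process_Cauchy[OF \<phi> that])
  let ?J = "\<lambda>k t \<omega>. dyadic_ito \<phi> (r k) t \<omega>"
  let ?d = "\<lambda>k t \<omega>. ?J (Suc k) t \<omega> - ?J k t \<omega>"
  define A where "A k = {\<omega>\<in>space P. \<exists>N. \<exists>i\<le>2^N. (1/2) ^ k \<le> norm (?d k (dyadic T N i) \<omega>)}" for k
  have A: "A k \<in> sets P" "prob (A k) \<le> 4 * (1/2) ^ k" for k
  proof -
    have le: "energy P T (\<lambda>s \<omega>. lagged_process \<phi> (r (Suc k)) s \<omega> - lagged_process \<phi> (r k) s \<omega>) \<le> ennreal (4 * (1/8) ^ k)"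
    proof -
      have "2 * e (r (Suc k)) + 2 * e (r k) \<le> 2 * ennreal ((1/8) ^ Suc k) + 2 * ennreal ((1/8) ^ k)"
        by (intro add_mono mult_left_mono r) auto
      also have "\<dots> = ennreal (2 * (1/8) ^ Suc k + 2 * (1/8) ^ k)"
      proof -
        have "2 * ennreal x + 2 * ennreal y = ennreal (2 * x + 2 * y)" if "0 \<le> x" "0 \<le> y" for x y
          using that by (simp add: ennreal_mult')
        from this[of "(1/8) ^ Suc k" "(1/8) ^ k"] show ?thesis by (simp only: zero_le_power zero_le_divide_1_iff zero_le_numeral)
      qed
      also have "\<dots> \<le> ennreal (4 * (1/8) ^ k)" by (intro ennreal_leI) simp
      finally show ?thesis by (rule order_trans[OF Cauchy[OF order_refl]])
    qed
    show "A k \<in> sets P"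
      unfolding A_def dyadic_ito_def
      by (rule dyadic_ito_maximal(1)[OF dyadic_simple_lagged[OF \<phi>] dyadic_simple_lagged[OF \<phi>],
            where a = "4 * (1/8) ^ k"]) (use le in \<open>simp_all add: lagged_process_def\<close>)
    have "prob (A k) \<le> 4 * (1/8) ^ k / ((1/2) ^ k)\<^sup>2"
      unfolding A_def dyadic_ito_def
      by (rule dyadic_ito_maximal(2)[OF dyadic_simple_lagged[OF \<phi>] dyadic_simple_lagged[OF \<phi>],
            where a = "4 * (1/8) ^ k"]) (use le in \<open>simp_all add: lagged_process_def\<close>)
    also have "(1/8::real) ^ k = ((1/2) ^ 3) ^ k" by (simp add: power_divide)
    also have "\<dots> = ((1/2) ^ k) ^ 3" by (simp only: power_mult[symmetric] mult.commute)
    also have "4 * ((1/2::real) ^ k) ^ 3 / ((1/2) ^ k)\<^sup>2 = 4 * (1/2) ^ k"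
      using zero_less_power[of "1/2::real" k] by (simp add: power3_eq_cube power2_eq_square)
    finally show "prob (A k) \<le> 4 * (1/2) ^ k" .
  qed
  have "AE \<omega> in P. eventually (\<lambda>k. \<omega> \<in> space P - A k) sequentially"
  proof (rule borel_cantelli_AE1)
    show "summable (\<lambda>k. prob (A k))"
      by (rule summable_comparison_test'[of "\<lambda>k. 4 * (1/2) ^ k" 0]) (use A in \<open>auto intro!: summable_mult\<close>)
  qed (use A in \<open>auto simp: less_top[symmetric]\<close>)
  then have unif: "AE \<omega> in P. \<exists>L. uniform_limit {0..T} (\<lambda>k t. ?J k t \<omega>) L sequentially"
    using AE_space
  proof eventually_elim
    case (elim \<omega>)
    have "eventually (\<lambda>k. \<forall>t\<in>{0..T}. norm (?d k t \<omega>) \<le> (1/2) ^ k) sequentially"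
      using elim(1)
    proof eventually_elim
      case (elim k)
      show ?case
      proof
        fix t assume t: "t \<in> {0..T}"
        show "norm (?d k t \<omega>) \<le> (1/2) ^ k"
        proof (rule bounded_on_dyadics_imp[OF T_pos _ _ t])
          show "continuous_on {0..T} (\<lambda>t. ?d k t \<omega>)"
            using \<open>\<omega> \<in> space P\<close> by (intro continuous_on_diff continuous_dyadic_ito)
          show "norm (?d k (dyadic T N i) \<omega>) \<le> (1/2) ^ k" if "i \<le> 2 ^ N" for N i
          proof -
            have "\<not> (1/2) ^ k \<le> norm (?d k (dyadic T N i) \<omega>)"
              using elim that \<open>\<omega> \<in> space P\<close> unfolding A_def by blast
            then show ?thesis by (simp only: not_le less_imp_le)
          qed
        qed
      qed
    qed
    then have "uniform_limit {0..T} (\<lambda>n t. \<Sum>k<n. ?d k t \<omega>) (\<lambda>t. \<Sum>k. ?d k t \<omega>) sequentially"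
      by (rule Weierstrass_m_test_ev) (simp add: summable_geometric)
    then have "uniform_limit {0..T} (\<lambda>n t. (\<Sum>k<n. ?d k t \<omega>) + ?J 0 t \<omega>) (\<lambda>t. (\<Sum>k. ?d k t \<omega>) + ?J 0 t \<omega>) sequentially"
      by (intro uniform_limit_add uniform_limit_const)
    moreover have "(\<Sum>k<n. ?d k t \<omega>) + ?J 0 t \<omega> = ?J n t \<omega>" for n t
      by (simp add: sum_lessThan_telescope[of "\<lambda>k. ?J k t \<omega>"])
    ultimately show ?case by auto
  qed
  define I where "I t \<omega> = lim (\<lambda>k. ?J k t \<omega>)" for t \<omega>
  have J_P: "?J k t \<in> borel_measurable P" "dyadic_ito \<phi> k t \<in> borel_measurable P" if "t \<in> {0..T}" for k t
    using dyadic_ito_adapted[OF \<phi> that] measurable_F_imp_P[OF that] by auto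
  have I_F: "I t \<in> borel_measurable (F t)" if "t \<in> {0..T}" for t
    unfolding I_def using dyadic_ito_adapted[OF \<phi> that] by (rule borel_measurable_lim_metric)
  have I_P: "I t \<in> borel_measurable P" if "t \<in> {0..T}" for t
    by (rule measurable_F_imp_P[OF that I_F[OF that]])
  have joint: "joint_measurable P T I"
  proof -
    have "(\<lambda>z. lim (\<lambda>k. case_prod (?J k) z)) \<in> borel_measurable (lborel_upto T \<Otimes>\<^sub>M P)"
      using joint_measurable_dyadic_ito[OF \<phi>] unfolding joint_measurable_def
      by (rule borel_measurable_lim_metric)
    then show ?thesis unfolding joint_measurable_def I_def by (simp add: case_prod_beta')
  qed
  have cont: "AE \<omega> in P. continuous_on {0..T} (\<lambda>t. I t \<omega>)"
    using unif AE_space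
  proof eventually_elim
    case (elim \<omega>)
    then obtain L where L: "uniform_limit {0..T} (\<lambda>k t. ?J k t \<omega>) L sequentially" by blast
    have "continuous_on {0..T} L"
      using elim(2) by (intro uniform_limit_theorem[OF _ L] always_eventually allI continuous_dyadic_ito) auto
    moreover have "L t = I t \<omega>" if "t \<in> {0..T}" for t
      unfolding I_def using tendsto_uniform_limitI[OF L that] by (simp add: limI)
    ultimately show ?case by (rule continuous_on_eq)
  qed
  have lim: "(\<lambda>j. l2sq P (\<lambda>\<omega>. dyadic_ito \<phi> j t \<omega> - I t \<omega>)) \<longlonglongrightarrow> 0" if t: "t \<in> {0..T}" for t
  proof -
    note [measurable] = J_P[OF t] I_P[OF t]
    have pw: "AE \<omega> in P. (\<lambda>k. ?J k t \<omega>) \<longlonglongrightarrow> I t \<omega>"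
      using unif by eventually_elim (auto simp: I_def limI dest!: tendsto_uniform_limitI[OF _ t])
    have bound: "l2sq P (\<lambda>\<omega>. dyadic_ito \<phi> j t \<omega> - I t \<omega>) \<le> 2 * e j + 2 * ennreal ((1/8) ^ K)" for j K
    proof (rule l2sq_Fatou[where u = "\<lambda>k \<omega>. dyadic_ito \<phi> j t \<omega> - ?J k t \<omega>" and K = K])
      show "AE \<omega> in P. (\<lambda>k. dyadic_ito \<phi> j t \<omega> - ?J k t \<omega>) \<longlonglongrightarrow> dyadic_ito \<phi> j t \<omega> - I t \<omega>"
        using pw by eventually_elim (intro tendsto_intros)
      fix k assume "K \<le> k"
      then have "(1/8::real) ^ k \<le> (1/8) ^ K" by (intro power_decreasing) auto
      then have "e (r k) \<le> ennreal ((1/8) ^ K)" by (intro order_trans[OF r] ennreal_leI)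
      then have "2 * e j + 2 * e (r k) \<le> 2 * e j + 2 * ennreal ((1/8) ^ K)"
        by (intro add_mono mult_left_mono) auto
      then show "l2sq P (\<lambda>\<omega>. dyadic_ito \<phi> j t \<omega> - ?J k t \<omega>) \<le> 2 * e j + 2 * ennreal ((1/8) ^ K)"
        unfolding dyadic_ito_diff[OF \<phi> \<phi> t] using t by (intro order_trans[OF Cauchy]) auto
    qed measurable
    have pow: "(\<lambda>K. ennreal ((1/8) ^ K)) \<longlonglongrightarrow> 0"
      using tendsto_ennrealI[OF LIMSEQ_power_zero[of "1/8::real"]] by simp
    have "l2sq P (\<lambda>\<omega>. dyadic_ito \<phi> j t \<omega> - I t \<omega>) \<le> 2 * e j" for j
    proof (rule LIMSEQ_le_const)
      have "(\<lambda>K. 2 * e j + 2 * ennreal ((1/8) ^ K)) \<longlonglongrightarrow> 2 * e j + 2 * 0"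
        by (intro tendsto_add tendsto_const ennreal_tendsto_cmult pow) simp
      then show "(\<lambda>K. 2 * e j + 2 * ennreal ((1/8) ^ K)) \<longlonglongrightarrow> 2 * e j" by simp
    qed (use bound in auto)
    moreover have "(\<lambda>j. 2 * e j) \<longlonglongrightarrow> 0"
      using ennreal_tendsto_cmult[OF _ e_lim, of 2] by simp
    ultimately show ?thesis by (rule ennreal_tendsto_0_le)
  qed
  show ?thesis by (rule that[OF I_F joint cont lim])
qed

end

section \<open>Picard iteration\<close>

lemma nn_integral_monomial:
  assumes "0 \<le> c" "0 \<le> t"
  shows "(\<integral>\<^sup>+s. ennreal (c * s ^ k) \<partial>lborel_upto t) = ennreal (c * t ^ Suc k / real (Suc k))"
proof -
  have "(\<integral>\<^sup>+s. ennreal (c * s ^ k) \<partial>lborel_upto t) = (\<integral>\<^sup>+s. ennreal (c * s ^ k) * indicator {0..t} s \<partial>lborel)"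
    by (simp add: nn_integral_restrict_space)
  also have "\<dots> = ennreal (c * t ^ Suc k / real (Suc k) - c * 0 ^ Suc k / real (Suc k))"
  proof (rule nn_integral_FTC_Icc)
    show "DERIV (\<lambda>s. c * s ^ Suc k / real (Suc k)) s :> c * s ^ k" for s
      by (rule derivative_eq_intros refl | simp)+
  qed (use assms in auto)
  finally show ?thesis by simp
qed

context filtered_prob_space
begin

text \<open>Picard iteration takes place among processes whose second moments are bounded uniformly in time,
  so that successive iterates can be compared at every single time and not only on average.\<close>

definition S2 :: "(real \<Rightarrow> 'w \<Rightarrow> 'a::euclidean_space) set" where
  "S2 = {X \<in> M2. \<exists>C. \<forall>t\<in>{0..T}. l2sq P (X t) \<le> ennreal C}"

lemma energy_bounded:
  assumes "\<And>s. s \<in> {0..t} \<Longrightarrow> l2sq P (X s) \<le> c" "0 \<le> t"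
  shows "energy P t X \<le> ennreal t * c"
proof -
  have "energy P t X \<le> (\<integral>\<^sup>+s. c \<partial>lborel_upto t)" using assms(1) by (rule energy_le)
  also have "\<dots> = ennreal t * c" using emeasure_lborel_upto[OF assms(2)] by (simp add: mult.commute)
  finally show ?thesis .
qed

lemma S2I:
  assumes "joint_measurable P T X" "\<And>t. t \<in> {0..T} \<Longrightarrow> X t \<in> borel_measurable (F t)"
    "\<And>t. t \<in> {0..T} \<Longrightarrow> l2sq P (X t) \<le> c" "c < \<infinity>"
  shows "X \<in> S2"
proof -
  have "energy P T X \<le> ennreal T * c" using assms(3) T_pos by (intro energy_bounded) auto
  also have "\<dots> < \<infinity>" using assms(4) by (simp add: ennreal_mult_less_top)
  finally have "X \<in> M2" using assms(1,2) by (simp add: M2_iff)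
  moreover have "\<forall>t\<in>{0..T}. l2sq P (X t) \<le> ennreal (enn2real c)" using assms(3,4) by simp
  ultimately show ?thesis unfolding S2_def by blast
qed

lemma S2_M2: "X \<in> S2 \<Longrightarrow> X \<in> M2" by (simp add: S2_def)

text \<open>Volterra structure: the distance at time \<open>t\<close> is bounded by the integral of the distance up to
  \<open>t\<close>, so the squared distance of consecutive iterates is at most \<open>C * (K * t) ^ k / fact k\<close>.
  The factorial beats the weights \<open>2 ^ k\<close> of \<open>l2_fast_Cauchy\<close>.\<close>

theorem picard_fixed_point:
  fixes \<Phi> :: "(real \<Rightarrow> 'w \<Rightarrow> 'a::euclidean_space) \<Rightarrow> real \<Rightarrow> 'w \<Rightarrow> 'a"
  assumes \<Phi>: "\<And>X. X \<in> S2 \<Longrightarrow> \<Phi> X \<in> S2" and K: "0 \<le> K"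
    and lip: "\<And>X Y t. X \<in> S2 \<Longrightarrow> Y \<in> S2 \<Longrightarrow> t \<in> {0..T} \<Longrightarrow>
      l2sq P (\<lambda>\<omega>. \<Phi> X t \<omega> - \<Phi> Y t \<omega>) \<le> ennreal K * energy P t (\<lambda>s \<omega>. X s \<omega> - Y s \<omega>)"
  obtains X where "X \<in> S2" "\<And>t. t \<in> {0..T} \<Longrightarrow> AE \<omega> in P. \<Phi> X t \<omega> = X t \<omega>"
proof -
  define Z where "Z k = (\<Phi> ^^ k) (\<lambda>t \<omega>. 0)" for k
  have Z_Suc: "Z (Suc k) = \<Phi> (Z k)" for k by (simp add: Z_def)
  have zero: "(\<lambda>t \<omega>. 0) \<in> (S2 :: (real \<Rightarrow> 'w \<Rightarrow> 'a) set)"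
    by (rule S2I[of _ 0]) (auto simp: joint_measurable_def case_prod_beta')
  have Z_S2: "Z k \<in> S2" for k
    by (induction k) (use zero \<Phi> in \<open>auto simp: Z_def\<close>)
  note Z_M2 = S2_M2[OF Z_S2]
  obtain C0 where "\<forall>t\<in>{0..T}. l2sq P (Z 1 t) \<le> ennreal C0" using Z_S2[of 1] by (auto simp: S2_def)
  define C where "C = max C0 0"
  have C: "0 \<le> C" "l2sq P (Z 1 t) \<le> ennreal C" if "t \<in> {0..T}" for t
    using \<open>\<forall>t\<in>{0..T}. l2sq P (Z 1 t) \<le> ennreal C0\<close> that
    by (auto simp: C_def intro: order_trans[OF _ ennreal_leI])
  have C0: "0 \<le> C" by (simp add: C_def)
  have step: "l2sq P (\<lambda>\<omega>. Z (Suc k) t \<omega> - Z k t \<omega>) \<le> ennreal (C * K ^ k / fact k * t ^ k)" if "t \<in> {0..T}" for k t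
    using that
  proof (induction k arbitrary: t)
    case 0
    then show ?case using C(2)[of t] by (simp add: Z_def)
  next
    case (Suc k)
    have "l2sq P (\<lambda>\<omega>. Z (Suc (Suc k)) t \<omega> - Z (Suc k) t \<omega>) \<le> ennreal K * energy P t (\<lambda>s \<omega>. Z (Suc k) s \<omega> - Z k s \<omega>)"
      unfolding Z_Suc[of "Suc k"] Z_Suc[of k, symmetric]
      using lip[OF Z_S2[of "Suc k"] Z_S2[of k] Suc.prems] by (simp add: Z_Suc)
    also have "\<dots> \<le> ennreal K * (\<integral>\<^sup>+s. ennreal (C * K ^ k / fact k * s ^ k) \<partial>lborel_upto t)"
      using Suc by (intro mult_left_mono energy_le) auto
    also have "\<dots> = ennreal (K * (C * K ^ k / fact k * t ^ Suc k / real (Suc k)))"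
      unfolding ennreal_mult'[OF K] using Suc.prems K C0 by (subst nn_integral_monomial) auto
    also have "K * (C * K ^ k / fact k * t ^ Suc k / real (Suc k)) = C * K ^ Suc k / fact (Suc k) * t ^ Suc k"
      by (simp add: field_simps)
    finally show ?case .
  qed
  define a where "a k = C * (K * T) ^ k / fact k" for k
  have a_nonneg: "0 \<le> a k" for k using C0 K T_pos by (simp add: a_def)
  have le_a: "l2sq P (\<lambda>\<omega>. Z (Suc k) t \<omega> - Z k t \<omega>) \<le> ennreal (a k)" if "t \<in> {0..T}" for k t
  proof (rule order_trans[OF step[OF that]], rule ennreal_leI)
    have "C * K ^ k / fact k * t ^ k \<le> C * K ^ k / fact k * T ^ k"
      using that C0 K by (intro mult_left_mono power_mono) auto
    then show "C * K ^ k / fact k * t ^ k \<le> a k" by (simp add: a_def power_mult_distrib)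
  qed
  have sum: "summable (\<lambda>k. 2 ^ k * a k)"
  proof -
    have "summable (\<lambda>k. C * (inverse (fact k) * (2 * (K * T)) ^ k))"
      by (intro summable_mult summable_exp)
    then show ?thesis by (rule summable_cong[THEN iffD1, rotated]) (simp add: a_def field_simps power_mult_distrib)
  qed
  define b where "b k = 2 * (\<Sum>i. 2 ^ (i + k) * a (i + k))" for k
  have b_lim: "b \<longlonglongrightarrow> 0"
    unfolding b_def using tendsto_mult[OF tendsto_const[of 2] suminf_exist_split2[OF sum]] by simp
  define X where "X t \<omega> = lim (\<lambda>k. Z k t \<omega>)" for t \<omega>
  have Z_P: "Z k t \<in> borel_measurable P" if "t \<in> {0..T}" for k t using M2D(4)[OF Z_M2 that] .
  have close: "l2sq P (\<lambda>\<omega>. X t \<omega> - Z k t \<omega>) \<le> ennreal (b k)" if "t \<in> {0..T}" for k t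
    unfolding X_def b_def by (rule l2_fast_Cauchy(2)[OF Z_P[OF that] le_a[OF that] a_nonneg sum])
  have X_S2: "X \<in> S2"
  proof (rule S2I)
    have "(\<lambda>z. lim (\<lambda>k. case_prod (Z k) z)) \<in> borel_measurable (lborel_upto T \<Otimes>\<^sub>M P)"
      using M2D(1)[OF Z_M2] unfolding joint_measurable_def by (rule borel_measurable_lim_metric)
    then show "joint_measurable P T X" unfolding joint_measurable_def X_def by (simp add: case_prod_beta')
    show "X t \<in> borel_measurable (F t)" if "t \<in> {0..T}" for t
      unfolding X_def using M2D(2)[OF Z_M2 that] by (rule borel_measurable_lim_metric)
    show "l2sq P (X t) \<le> ennreal (b 0)" if "t \<in> {0..T}" for t
      using close[OF that, of 0] by (simp add: Z_def)
  qed simp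
  have "AE \<omega> in P. \<Phi> X t \<omega> = X t \<omega>" if t: "t \<in> {0..T}" for t
  proof -
    note [measurable] = M2D(4)[OF S2_M2[OF X_S2] t] M2D(4)[OF S2_M2[OF \<Phi>[OF X_S2]] t] Z_P[OF t]
    have "l2sq P (\<lambda>\<omega>. \<Phi> X t \<omega> - X t \<omega>) \<le> 2 * (ennreal K * (ennreal t * ennreal (b k))) + 2 * ennreal (b (Suc k))" for k
    proof -
      have "l2sq P (\<lambda>\<omega>. \<Phi> X t \<omega> - X t \<omega>)
        \<le> 2 * l2sq P (\<lambda>\<omega>. \<Phi> X t \<omega> - Z (Suc k) t \<omega>) + 2 * l2sq P (\<lambda>\<omega>. Z (Suc k) t \<omega> - X t \<omega>)"
        by (rule l2sq_diff_triangle) measurable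
      also have "\<dots> \<le> 2 * (ennreal K * (ennreal t * ennreal (b k))) + 2 * ennreal (b (Suc k))"
      proof (intro add_mono mult_left_mono)
        have "l2sq P (\<lambda>\<omega>. \<Phi> X t \<omega> - Z (Suc k) t \<omega>) \<le> ennreal K * energy P t (\<lambda>s \<omega>. X s \<omega> - Z k s \<omega>)"
          unfolding Z_Suc by (rule lip[OF X_S2 Z_S2 t])
        also have "\<dots> \<le> ennreal K * (ennreal t * ennreal (b k))"
          using t close by (intro mult_left_mono energy_bounded) auto
        finally show "l2sq P (\<lambda>\<omega>. \<Phi> X t \<omega> - Z (Suc k) t \<omega>) \<le> ennreal K * (ennreal t * ennreal (b k))" .
        show "l2sq P (\<lambda>\<omega>. Z (Suc k) t \<omega> - X t \<omega>) \<le> ennreal (b (Suc k))"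
          using close[OF t, of "Suc k"] by (simp only: l2sq_minus_commute)
      qed simp_all
      finally show ?thesis .
    qed
    moreover have "(\<lambda>k. 2 * (ennreal K * (ennreal t * ennreal (b k))) + 2 * ennreal (b (Suc k)))
       \<longlonglongrightarrow> 2 * (ennreal K * (ennreal t * ennreal 0)) + 2 * ennreal 0"
      by (intro tendsto_add ennreal_tendsto_cmult tendsto_ennrealI b_lim LIMSEQ_Suc) auto
    ultimately have "l2sq P (\<lambda>\<omega>. \<Phi> X t \<omega> - X t \<omega>) \<le> 2 * (ennreal K * (ennreal t * ennreal 0)) + 2 * ennreal 0"
      by (intro LIMSEQ_le_const[of _ _ "l2sq P (\<lambda>\<omega>. \<Phi> X t \<omega> - X t \<omega>)"]) blast+
    then have "l2sq P (\<lambda>\<omega>. \<Phi> X t \<omega> - X t \<omega>) = 0" by simp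
    then have "AE \<omega> in P. \<Phi> X t \<omega> - X t \<omega> = 0" by (subst l2sq_eq_0_iff[symmetric]) auto
    then show ?thesis by eventually_elim simp
  qed
  then show ?thesis using that X_S2 by blast
qed

lemma S2_time_integral:
  assumes "\<phi> \<in> M2"
  shows "(\<lambda>t \<omega>. LBINT s:{0..t}. \<phi> s \<omega>) \<in> S2"
proof (rule S2I)
  show "joint_measurable P T (\<lambda>t \<omega>. LBINT s:{0..t}. \<phi> s \<omega>)"
    by (rule joint_measurable_time_integral[OF M2D(1)[OF assms]])
  show "(\<lambda>\<omega>. LBINT s:{0..t}. \<phi> s \<omega>) \<in> borel_measurable (F t)" if "t \<in> {0..T}" for t
    by (rule M2_adapted_time_integral[OF assms that]) auto
  show "l2sq P (\<lambda>\<omega>. LBINT s:{0..t}. \<phi> s \<omega>) \<le> ennreal T * energy P T \<phi>" if t: "t \<in> {0..T}" for t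
    by (rule order_trans[OF l2sq_time_integral_le[OF M2D(1)[OF assms] t]])
       (use t in \<open>auto intro!: mult_left_mono energy_mono\<close>)
  show "ennreal T * energy P T \<phi> < \<infinity>" using M2D(3)[OF assms] by (simp add: ennreal_mult_less_top)
qed

lemma time_integral_diff:
  assumes "\<phi> \<in> M2" "\<psi> \<in> M2" and t: "t \<in> {0..T}"
  shows "AE \<omega> in P. (LBINT s:{0..t}. \<phi> s \<omega>) - (LBINT s:{0..t}. \<psi> s \<omega>) = (LBINT s:{0..t}. \<phi> s \<omega> - \<psi> s \<omega>)"
    and "l2sq P (\<lambda>\<omega>. (LBINT s:{0..t}. \<phi> s \<omega>) - (LBINT s:{0..t}. \<psi> s \<omega>)) \<le> ennreal T * energy P t (\<lambda>s \<omega>. \<phi> s \<omega> - \<psi> s \<omega>)"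
proof -
  show ae: "AE \<omega> in P. (LBINT s:{0..t}. \<phi> s \<omega>) - (LBINT s:{0..t}. \<psi> s \<omega>) = (LBINT s:{0..t}. \<phi> s \<omega> - \<psi> s \<omega>)"
    using AE_path_integrable[OF assms(1)] AE_path_integrable[OF assms(2)]
  proof eventually_elim
    case (elim \<omega>)
    have "set_integrable lborel {0..t} (\<lambda>s. \<phi> s \<omega>)" "set_integrable lborel {0..t} (\<lambda>s. \<psi> s \<omega>)"
      using elim t by (auto intro: set_integrable_subset)
    then show ?case by (rule set_integral_diff(2)[symmetric])
  qed
  show "l2sq P (\<lambda>\<omega>. (LBINT s:{0..t}. \<phi> s \<omega>) - (LBINT s:{0..t}. \<psi> s \<omega>)) \<le> ennreal T * energy P t (\<lambda>s \<omega>. \<phi> s \<omega> - \<psi> s \<omega>)"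
    unfolding l2sq_cong_AE[OF ae]
    by (rule l2sq_time_integral_le[OF joint_measurable_add(2)[OF M2D(1)[OF assms(1)] M2D(1)[OF assms(2)]] t])
qed

lemma has_ito_integral_cong:
  assumes I: "has_ito_integral P F T b \<phi> I" and \<psi>: "\<psi> \<in> M2" and eq: "energy P T (\<lambda>s \<omega>. \<phi> s \<omega> - \<psi> s \<omega>) = 0"
  shows "has_ito_integral P F T b \<psi> I"
proof -
  have \<phi>: "\<phi> \<in> M2" and Im: "\<forall>t\<in>{0..T}. I t \<in> borel_measurable P" using I by (auto simp: has_ito_integral_def)
  obtain m \<tau> \<xi> where s: "\<And>j. simple_integrand P F T (m j) (\<tau> j) (\<xi> j)"
    and 1: "(\<lambda>j. \<integral>\<^sup>+\<omega>. (\<integral>\<^sup>+t\<in>{0..T}. ennreal ((norm (simple_process (m j) (\<tau> j) (\<xi> j) t \<omega> - \<phi> t \<omega>))\<^sup>2) \<partial>lborel) \<partial>P) \<longlonglongrightarrow> 0"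
    and 2: "\<forall>t\<in>{0..T}. (\<lambda>j. \<integral>\<^sup>+\<omega>. ennreal ((norm (simple_ito_integral b (m j) (\<tau> j) (\<xi> j) t \<omega> - I t \<omega>))\<^sup>2) \<partial>P) \<longlonglongrightarrow> 0"
    using I unfolding has_ito_integral_def by blast
  let ?S = "\<lambda>j. simple_process (m j) (\<tau> j) (\<xi> j)"
  note jm = joint_measurable_simple_process[OF s]
  have sw: "(\<integral>\<^sup>+\<omega>. (\<integral>\<^sup>+t\<in>{0..T}. ennreal ((norm (?S j t \<omega> - \<theta> t \<omega>))\<^sup>2) \<partial>lborel) \<partial>P)
     = energy P T (\<lambda>t \<omega>. ?S j t \<omega> - \<theta> t \<omega>)" if "\<theta> \<in> M2" for j \<theta>
    unfolding l2sq_lborel_upto[symmetric]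
    by (rule energy_swap[OF joint_measurable_add(2)[OF jm M2D(1)[OF that]]])
  have "(\<lambda>j. energy P T (\<lambda>t \<omega>. ?S j t \<omega> - \<psi> t \<omega>)) \<longlonglongrightarrow> 0"
  proof (rule ennreal_tendsto_0_le)
    show "energy P T (\<lambda>t \<omega>. ?S j t \<omega> - \<psi> t \<omega>) \<le> 2 * energy P T (\<lambda>t \<omega>. ?S j t \<omega> - \<phi> t \<omega>)" for j
      using energy_diff_triangle[OF jm[of j] M2D(1)[OF \<psi>] M2D(1)[OF \<phi>] order_refl] by (simp add: eq)
    show "(\<lambda>j. 2 * energy P T (\<lambda>t \<omega>. ?S j t \<omega> - \<phi> t \<omega>)) \<longlonglongrightarrow> 0"
      using ennreal_tendsto_cmult[OF _ 1[unfolded sw[OF \<phi>]], of 2] by simp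
  qed
  then show ?thesis
    unfolding has_ito_integral_def using s 2 Im \<psi> sw[OF \<psi>] by (intro conjI exI[of _ m] exI[of _ \<tau>] exI[of _ \<xi>]) auto
qed

end

section \<open>Stochastic differential equations with Lipschitz coefficients\<close>

context continuous_brownian_filtration
begin

text \<open>A choice of a version of the integral for every integrand, which turns the right-hand side of a
  stochastic differential equation into a map on processes.\<close>

definition ito :: "(real \<Rightarrow> 'w \<Rightarrow> 'a::euclidean_space) \<Rightarrow> real \<Rightarrow> 'w \<Rightarrow> 'a" where
  "ito \<phi> = (SOME I. (\<forall>t\<in>{0..T}. I t \<in> borel_measurable (F t)) \<and> joint_measurable P T I \<and>
     (AE \<omega> in P. continuous_on {0..T} (\<lambda>t. I t \<omega>)) \<and>
     (\<forall>t\<in>{0..T}. (\<lambda>j. l2sq P (\<lambda>\<omega>. dyadic_ito \<phi> j t \<omega> - I t \<omega>)) \<longlonglongrightarrow> 0))"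

lemma ito:
  assumes "\<phi> \<in> M2"
  shows "\<And>t. t \<in> {0..T} \<Longrightarrow> ito \<phi> t \<in> borel_measurable (F t)" "joint_measurable P T (ito \<phi>)"
    "AE \<omega> in P. continuous_on {0..T} (\<lambda>t. ito \<phi> t \<omega>)"
    "\<And>t. t \<in> {0..T} \<Longrightarrow> (\<lambda>j. l2sq P (\<lambda>\<omega>. dyadic_ito \<phi> j t \<omega> - ito \<phi> t \<omega>)) \<longlonglongrightarrow> 0"
    "\<And>t. t \<in> {0..T} \<Longrightarrow> ito \<phi> t \<in> borel_measurable P"
    "has_ito_integral P F T B \<phi> (ito \<phi>)"
proof -
  have "\<exists>I. (\<forall>t\<in>{0..T}. I t \<in> borel_measurable (F t)) \<and> joint_measurable P T I \<and>
     (AE \<omega> in P. continuous_on {0..T} (\<lambda>t. I t \<omega>)) \<and>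
     (\<forall>t\<in>{0..T}. (\<lambda>j. l2sq P (\<lambda>\<omega>. dyadic_ito \<phi> j t \<omega> - I t \<omega>)) \<longlonglongrightarrow> 0)"
    by (rule ito_integral_exists[OF assms]) blast
  from someI_ex[OF this] show *: "\<And>t. t \<in> {0..T} \<Longrightarrow> ito \<phi> t \<in> borel_measurable (F t)" "joint_measurable P T (ito \<phi>)"
    "AE \<omega> in P. continuous_on {0..T} (\<lambda>t. ito \<phi> t \<omega>)"
    "\<And>t. t \<in> {0..T} \<Longrightarrow> (\<lambda>j. l2sq P (\<lambda>\<omega>. dyadic_ito \<phi> j t \<omega> - ito \<phi> t \<omega>)) \<longlonglongrightarrow> 0"
    unfolding ito_def[symmetric] by blast+
  show P: "\<And>t. t \<in> {0..T} \<Longrightarrow> ito \<phi> t \<in> borel_measurable P"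
    using joint_measurable_section[OF *(2)] .
  show "has_ito_integral P F T B \<phi> (ito \<phi>)"
    by (rule has_ito_integral_dyadicI[OF assms P *(4)])
qed

lemma l2sq_ito_diff:
  assumes "\<phi> \<in> M2" "\<psi> \<in> M2" "t \<in> {0..T}"
  shows "l2sq P (\<lambda>\<omega>. ito \<phi> t \<omega> - ito \<psi> t \<omega>) \<le> 16 * energy P t (\<lambda>s \<omega>. \<phi> s \<omega> - \<psi> s \<omega>)"
  by (rule dyadic_ito_limit_diff[OF assms ito(5)[OF assms(1,3)] ito(4)[OF assms(1,3)]
        ito(5)[OF assms(2,3)] ito(4)[OF assms(2,3)]])

lemma S2_ito:
  assumes "\<phi> \<in> M2"
  shows "ito \<phi> \<in> S2"
proof (rule S2I)
  have zero: "(\<lambda>t \<omega>. 0 :: 'a) \<in> M2"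
    by (simp add: M2_iff joint_measurable_def case_prod_beta' energy_def)
  have "dyadic_ito (\<lambda>t \<omega>. 0 :: 'a) j t \<omega> = 0" for j t \<omega>
  proof -
    have "(LBINT s:A. (0::'a)) = 0" for A by (simp add: set_lebesgue_integral_def)
    then have "lagged_coeff (\<lambda>t \<omega>. 0 :: 'a) j i \<omega> = 0" for i
      unfolding lagged_coeff_def lagged_mean_def by auto
    then show ?thesis by (simp only: dyadic_ito_def simple_ito_integral_def scaleR_zero_right sum.neutral_const)
  qed
  then have z: "(\<lambda>j. l2sq P (\<lambda>\<omega>. dyadic_ito (\<lambda>t \<omega>. 0 :: 'a) j t \<omega> - 0)) \<longlonglongrightarrow> 0" for t
    by simp
  show "l2sq P (ito \<phi> t) \<le> 16 * energy P T \<phi>" if t: "t \<in> {0..T}" for t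
  proof -
    have "l2sq P (\<lambda>\<omega>. ito \<phi> t \<omega> - 0) \<le> 16 * energy P t (\<lambda>s \<omega>. \<phi> s \<omega> - 0)"
      by (rule dyadic_ito_limit_diff[OF assms zero t ito(5)[OF assms t] ito(4)[OF assms t] _ z]) simp
    also have "\<dots> \<le> 16 * energy P T (\<lambda>s \<omega>. \<phi> s \<omega> - 0)"
      using t by (intro mult_left_mono energy_mono) auto
    finally show ?thesis by simp
  qed
  show "16 * energy P T \<phi> < \<infinity>" using M2D(3)[OF assms] by (simp add: ennreal_mult_less_top)
qed (use ito[OF assms] in auto)

end

context filtered_prob_space
begin

lemma S2_const: "(\<lambda>t \<omega>. x) \<in> S2"
proof (rule S2I[of _ "ennreal ((norm x)\<^sup>2)"])
  show "l2sq P (\<lambda>\<omega>. x) \<le> ennreal ((norm x)\<^sup>2)" by (simp add: l2sq_def emeasure_space_1)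
qed (auto simp: joint_measurable_def case_prod_beta')

lemma S2_add:
  assumes "X \<in> S2" "Y \<in> S2"
  shows "(\<lambda>t \<omega>. X t \<omega> + Y t \<omega>) \<in> S2"
proof -
  obtain C D where C: "\<forall>t\<in>{0..T}. l2sq P (X t) \<le> ennreal C" and D: "\<forall>t\<in>{0..T}. l2sq P (Y t) \<le> ennreal D"
    using assms unfolding S2_def by blast
  note X = M2D[OF S2_M2[OF assms(1)]] and Y = M2D[OF S2_M2[OF assms(2)]]
  show ?thesis
  proof (rule S2I[of _ "2 * ennreal C + 2 * ennreal D"])
    show "l2sq P (\<lambda>\<omega>. X t \<omega> + Y t \<omega>) \<le> 2 * ennreal C + 2 * ennreal D" if "t \<in> {0..T}" for t
      by (rule order_trans[OF l2sq_add[OF X(4)[OF that] Y(4)[OF that]]])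
         (use C D that in \<open>auto intro!: add_mono mult_left_mono\<close>)
  qed (use X(1,2) Y(1,2) joint_measurable_add(1) in \<open>auto simp: ennreal_mult_less_top\<close>)
qed

end

locale two_driver_system = filtered_prob_space P F T +
  W: continuous_brownian_filtration P F T W + Y: continuous_brownian_filtration P F T Y
  for P :: "'w measure" and F T W Y
begin

text \<open>The solution is taken to be the image \<open>\<Phi> X\<close> of the fixed point \<open>X\<close>: the two agree almost surely at
  every time, but \<open>\<Phi> X\<close> is a sum of integrals with continuous paths, which is not known of \<open>X\<close>. The
  Lipschitz bounds make the coefficients at \<open>X\<close> and at \<open>\<Phi> X\<close> indistinguishable in \<open>L\<^sup>2\<close>, so the
  integrals along \<open>X\<close> are also integrals along \<open>\<Phi> X\<close>.\<close>

theorem sde_solution_exists: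
  fixes b s1 s2 :: "(real \<Rightarrow> 'w \<Rightarrow> 'a::euclidean_space) \<Rightarrow> real \<Rightarrow> 'w \<Rightarrow> 'a" and x0 :: 'a
  assumes M2: "\<And>X. X \<in> M2 \<Longrightarrow> b X \<in> M2" "\<And>X. X \<in> M2 \<Longrightarrow> s1 X \<in> M2" "\<And>X. X \<in> M2 \<Longrightarrow> s2 X \<in> M2"
    and L: "0 \<le> L"
    and lip: "\<And>X Z t. X \<in> S2 \<Longrightarrow> Z \<in> S2 \<Longrightarrow> t \<in> {0..T} \<Longrightarrow>
        energy P t (\<lambda>s \<omega>. b X s \<omega> - b Z s \<omega>) \<le> ennreal L * energy P t (\<lambda>s \<omega>. X s \<omega> - Z s \<omega>)"
      "\<And>X Z t. X \<in> S2 \<Longrightarrow> Z \<in> S2 \<Longrightarrow> t \<in> {0..T} \<Longrightarrow>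
        energy P t (\<lambda>s \<omega>. s1 X s \<omega> - s1 Z s \<omega>) \<le> ennreal L * energy P t (\<lambda>s \<omega>. X s \<omega> - Z s \<omega>)"
      "\<And>X Z t. X \<in> S2 \<Longrightarrow> Z \<in> S2 \<Longrightarrow> t \<in> {0..T} \<Longrightarrow>
        energy P t (\<lambda>s \<omega>. s2 X s \<omega> - s2 Z s \<omega>) \<le> ennreal L * energy P t (\<lambda>s \<omega>. X s \<omega> - Z s \<omega>)"
  obtains X I_W I_Y where "X \<in> M2" "AE \<omega> in P. continuous_on {0..T} (\<lambda>t. X t \<omega>)"
    "has_ito_integral P F T W (s1 X) I_W" "has_ito_integral P F T Y (s2 X) I_Y"
    "\<And>t. t \<in> {0..T} \<Longrightarrow> AE \<omega> in P. X t \<omega> = x0 + (LBINT s:{0..t}. b X s \<omega>) + I_W t \<omega> + I_Y t \<omega>"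
proof -
  define D where "D X t \<omega> = (LBINT s:{0..t}. b X s \<omega>)" for X t \<omega>
  define \<Phi> where "\<Phi> X t \<omega> = x0 + D X t \<omega> + W.ito (s1 X) t \<omega> + Y.ito (s2 X) t \<omega>" for X t \<omega>
  have \<Phi>_S2: "\<Phi> X \<in> S2" if "X \<in> M2" for X
    unfolding \<Phi>_def[abs_def] D_def
    by (intro S2_add S2_const S2_time_integral W.S2_ito Y.S2_ito M2 that)
  have \<Phi>_lip: "l2sq P (\<lambda>\<omega>. \<Phi> X t \<omega> - \<Phi> Z t \<omega>) \<le> ennreal (4 * T * L + 64 * L + 32 * L) * energy P t (\<lambda>s \<omega>. X s \<omega> - Z s \<omega>)"
    if X: "X \<in> S2" and Z: "Z \<in> S2" and t: "t \<in> {0..T}" for X Z t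
  proof -
    let ?E = "energy P t (\<lambda>s \<omega>. X s \<omega> - Z s \<omega>)"
    note XM = S2_M2[OF X] and ZM = S2_M2[OF Z]
    let ?d = "\<lambda>\<omega>. D X t \<omega> - D Z t \<omega>" and ?w = "\<lambda>\<omega>. W.ito (s1 X) t \<omega> - W.ito (s1 Z) t \<omega>"
      and ?y = "\<lambda>\<omega>. Y.ito (s2 X) t \<omega> - Y.ito (s2 Z) t \<omega>"
    have [measurable]: "D X t \<in> borel_measurable P" "D Z t \<in> borel_measurable P"
      using M2D(4)[OF S2_M2[OF S2_time_integral[OF M2(1)[OF XM]]] t] M2D(4)[OF S2_M2[OF S2_time_integral[OF M2(1)[OF ZM]]] t]
      by (auto simp: D_def[abs_def])
    note [measurable] = W.ito(5)[OF M2(2)[OF XM] t] W.ito(5)[OF M2(2)[OF ZM] t]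
      Y.ito(5)[OF M2(3)[OF XM] t] Y.ito(5)[OF M2(3)[OF ZM] t]
    have d: "l2sq P ?d \<le> ennreal T * (ennreal L * ?E)"
      unfolding D_def by (rule order_trans[OF time_integral_diff(2)[OF M2(1)[OF XM] M2(1)[OF ZM] t]])
        (intro mult_left_mono lip X Z t, simp)
    have w: "l2sq P ?w \<le> 16 * (ennreal L * ?E)"
      by (rule order_trans[OF W.l2sq_ito_diff[OF M2(2)[OF XM] M2(2)[OF ZM] t]])
        (intro mult_left_mono lip X Z t, simp)
    have y: "l2sq P ?y \<le> 16 * (ennreal L * ?E)"
      by (rule order_trans[OF Y.l2sq_ito_diff[OF M2(3)[OF XM] M2(3)[OF ZM] t]])
        (intro mult_left_mono lip X Z t, simp)
    have "l2sq P (\<lambda>\<omega>. \<Phi> X t \<omega> - \<Phi> Z t \<omega>) = l2sq P (\<lambda>\<omega>. (?d \<omega> + ?w \<omega>) + ?y \<omega>)"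
      unfolding \<Phi>_def by (simp add: algebra_simps)
    also have "\<dots> \<le> 2 * l2sq P (\<lambda>\<omega>. ?d \<omega> + ?w \<omega>) + 2 * l2sq P ?y"
      by (rule l2sq_add) measurable
    also have "\<dots> \<le> 2 * (2 * l2sq P ?d + 2 * l2sq P ?w) + 2 * l2sq P ?y"
      by (intro add_mono mult_left_mono l2sq_add order_refl) measurable
    also have "\<dots> \<le> 2 * (2 * (ennreal T * (ennreal L * ?E)) + 2 * (16 * (ennreal L * ?E))) + 2 * (16 * (ennreal L * ?E))"
      by (intro add_mono mult_left_mono d w y) simp_all
    also have "\<dots> = (4 * (ennreal T * ennreal L) + 64 * ennreal L + 32 * ennreal L) * ?E"
      by (simp add: distrib_right distrib_left mult.assoc[symmetric])
    also have "4 * (ennreal T * ennreal L) + 64 * ennreal L + 32 * ennreal L = ennreal (4 * T * L + 64 * L + 32 * L)"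
    proof -
      have "ennreal (4 * T * L + 64 * L + 32 * L) = ennreal (4 * (T * L)) + ennreal (64 * L) + ennreal (32 * L)"
        using L T_pos by (simp add: mult.assoc ennreal_plus[symmetric] del: ennreal_plus)
      then show ?thesis using T_pos by (simp only: ennreal_mult' zero_le_numeral less_imp_le ennreal_numeral)
    qed
    finally show ?thesis .
  qed
  have K: "0 \<le> 4 * T * L + 64 * L + 32 * L" using L T_pos by simp
  obtain X where X: "X \<in> S2" and fixed: "\<And>t. t \<in> {0..T} \<Longrightarrow> AE \<omega> in P. \<Phi> X t \<omega> = X t \<omega>"
    by (rule picard_fixed_point[of \<Phi>, OF \<Phi>_S2[OF S2_M2] K \<Phi>_lip]) blast+
  note XM = S2_M2[OF X]
  define X' where "X' = \<Phi> X"
  have X': "X' \<in> S2" unfolding X'_def by (rule \<Phi>_S2[OF XM])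
  note XM' = S2_M2[OF X']
  have E0: "energy P t (\<lambda>s \<omega>. X s \<omega> - X' s \<omega>) = 0" if "t \<in> {0..T}" for t
  proof -
    have "l2sq P (\<lambda>\<omega>. X s \<omega> - X' s \<omega>) = l2sq P (\<lambda>\<omega>. 0 :: 'a)" if s: "s \<in> {0..t}" for s
      using fixed[of s] s \<open>t \<in> {0..T}\<close> unfolding X'_def by (intro l2sq_cong_AE) auto
    then have "energy P t (\<lambda>s \<omega>. X s \<omega> - X' s \<omega>) = energy P t (\<lambda>s \<omega>. 0 :: 'a)" by (rule energy_cong)
    then show ?thesis by (simp add: energy_def)
  qed
  have T: "T \<in> {0..T}" using T_pos by simp
  have s1: "energy P T (\<lambda>s \<omega>. s1 X s \<omega> - s1 X' s \<omega>) = 0" using lip(2)[OF X X' T] E0[OF T] by simp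
  have s2: "energy P T (\<lambda>s \<omega>. s2 X s \<omega> - s2 X' s \<omega>) = 0" using lip(3)[OF X X' T] E0[OF T] by simp
  show ?thesis
  proof (rule that[of X' "W.ito (s1 X)" "Y.ito (s2 X)"])
    show "X' \<in> M2" by (rule XM')
    show "AE \<omega> in P. continuous_on {0..T} (\<lambda>t. X' t \<omega>)"
      using AE_continuous_time_integral[OF M2(1)[OF XM]] W.ito(3)[OF M2(2)[OF XM]] Y.ito(3)[OF M2(3)[OF XM]]
      by eventually_elim (auto simp: X'_def \<Phi>_def D_def intro!: continuous_intros)
    show "has_ito_integral P F T W (s1 X') (W.ito (s1 X))"
      by (rule has_ito_integral_cong[OF W.ito(6)[OF M2(2)[OF XM]] M2(2)[OF XM'] s1])
    show "has_ito_integral P F T Y (s2 X') (Y.ito (s2 X))"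
      by (rule has_ito_integral_cong[OF Y.ito(6)[OF M2(3)[OF XM]] M2(3)[OF XM'] s2])
    show "AE \<omega> in P. X' t \<omega> = x0 + (LBINT s:{0..t}. b X' s \<omega>) + W.ito (s1 X) t \<omega> + Y.ito (s2 X) t \<omega>"
      if t: "t \<in> {0..T}" for t
    proof -
      have [measurable]: "(\<lambda>\<omega>. LBINT s:{0..t}. b X s \<omega>) \<in> borel_measurable P" "(\<lambda>\<omega>. LBINT s:{0..t}. b X' s \<omega>) \<in> borel_measurable P"
        using M2D(4)[OF S2_M2[OF S2_time_integral[OF M2(1)[OF XM]]] t] M2D(4)[OF S2_M2[OF S2_time_integral[OF M2(1)[OF XM']]] t]
        by auto
      have "l2sq P (\<lambda>\<omega>. (LBINT s:{0..t}. b X s \<omega>) - (LBINT s:{0..t}. b X' s \<omega>)) \<le> ennreal T * (ennreal L * 0)"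
        unfolding E0[OF t, symmetric]
        by (rule order_trans[OF time_integral_diff(2)[OF M2(1)[OF XM] M2(1)[OF XM'] t]])
          (intro mult_left_mono lip X X' t, simp)
      then have "l2sq P (\<lambda>\<omega>. (LBINT s:{0..t}. b X s \<omega>) - (LBINT s:{0..t}. b X' s \<omega>)) = 0" by simp
      then have "AE \<omega> in P. (LBINT s:{0..t}. b X s \<omega>) - (LBINT s:{0..t}. b X' s \<omega>) = 0"
        by (subst (asm) l2sq_eq_0_iff) measurable
      then show ?thesis
        by eventually_elim (simp add: X'_def \<Phi>_def D_def)
    qed
  qed
qed

end

section \<open>Brownian increments and the joint filtration\<close>

text \<open>A generator of the past of \<open>B\<close> that is closed under intersection, as required to extend
  independence to the generated sigma-algebra.\<close>

definition cylinders :: "'w measure \<Rightarrow> (real \<Rightarrow> 'w \<Rightarrow> real) \<Rightarrow> real \<Rightarrow> 'w set set" where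
  "cylinders P B s = {{\<omega>\<in>space P. \<forall>r\<in>R. B r \<omega> \<in> E r} | R E.
     finite R \<and> R \<subseteq> {0..s} \<and> (\<forall>r\<in>R. E r \<in> sets borel)}"

lemma cylindersI:
  "finite R \<Longrightarrow> R \<subseteq> {0..s} \<Longrightarrow> (\<And>r. r \<in> R \<Longrightarrow> E r \<in> sets borel) \<Longrightarrow> {\<omega>\<in>space P. \<forall>r\<in>R. B r \<omega> \<in> E r} \<in> cylinders P B s"
  unfolding cylinders_def by blast

lemma Int_stable_cylinders: "Int_stable (cylinders P B s)"
proof (rule Int_stableI)
  fix a b assume "a \<in> cylinders P B s" "b \<in> cylinders P B s"
  then obtain R E R' E' where a: "a = {\<omega>\<in>space P. \<forall>r\<in>R. B r \<omega> \<in> E r}" "finite R" "R \<subseteq> {0..s}" "\<forall>r\<in>R. E r \<in> sets borel"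
    and b: "b = {\<omega>\<in>space P. \<forall>r\<in>R'. B r \<omega> \<in> E' r}" "finite R'" "R' \<subseteq> {0..s}" "\<forall>r\<in>R'. E' r \<in> sets borel"
    unfolding cylinders_def by blast
  let ?E = "\<lambda>r. (if r \<in> R then E r else UNIV) \<inter> (if r \<in> R' then E' r else UNIV)"
  have "a \<inter> b = {\<omega>\<in>space P. \<forall>r\<in>R \<union> R'. B r \<omega> \<in> ?E r}"
    unfolding a(1) b(1) by auto
  also have "\<dots> \<in> cylinders P B s"
    using a b by (intro cylindersI) (auto split: if_splits)
  finally show "a \<inter> b \<in> cylinders P B s" .
qed

lemma brownian_motion_onD:
  assumes "brownian_motion_on P T B"
  shows "\<And>t. t \<in> {0..T} \<Longrightarrow> B t \<in> borel_measurable P" "AE \<omega> in P. B 0 \<omega> = 0"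
    "AE \<omega> in P. continuous_on {0..T} (\<lambda>t. B t \<omega>)"
    "\<And>s t. 0 \<le> s \<Longrightarrow> s < t \<Longrightarrow> t \<le> T \<Longrightarrow> distributed P lborel (\<lambda>\<omega>. B t \<omega> - B s \<omega>) (normal_density 0 (sqrt (t - s)))"
    "\<And>m \<tau>. (\<And>i. i \<le> m \<Longrightarrow> \<tau> i \<in> {0..T}) \<Longrightarrow> (\<And>i. i < m \<Longrightarrow> \<tau> i < \<tau> (Suc i)) \<Longrightarrow>
        prob_space.indep_vars P (\<lambda>_. borel) (\<lambda>i \<omega>. B (\<tau> (Suc i)) \<omega> - B (\<tau> i) \<omega>) {..<m}"
  using assms unfolding brownian_motion_on_def by auto

context prob_space
begin

lemma cylinder_event:
  assumes "\<And>t. t \<in> {0..T} \<Longrightarrow> B t \<in> borel_measurable M" "s \<le> T" "A \<in> cylinders M B s"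
  shows "A \<in> events"
proof -
  obtain R E where A: "A = {\<omega>\<in>space M. \<forall>r\<in>R. B r \<omega> \<in> E r}" "finite R" "R \<subseteq> {0..s}" "\<forall>r\<in>R. E r \<in> sets borel"
    using assms(3) unfolding cylinders_def by blast
  have "{\<omega>\<in>space M. B r \<omega> \<in> E r} \<in> events" if "r \<in> R" for r
  proof -
    have "B r -` E r \<inter> space M \<in> events"
      using that A assms(1)[of r] assms(2) by (intro measurable_sets) auto
    then show ?thesis by (rule back_subst[of "\<lambda>S. S \<in> events"]) auto
  qed
  then show ?thesis unfolding A(1) using A(2) by (intro sets.sets_Collect_finite_All) auto
qed

text \<open>The times of the cylinder, together with 0 and \<open>s\<close>, form a partition of \<open>[0,s]\<close>, extended by \<open>t\<close>. Since
  \<open>B 0 = 0\<close> almost surely, the values of \<open>B\<close> at these times are sums of increments before \<open>s\<close>, and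
  these are independent of the increment from \<open>s\<close> to \<open>t\<close>.\<close>

lemma increment_indep_cylinder:
  assumes B: "brownian_motion_on M T B" and st: "0 \<le> s" "s < t" "t \<le> T"
    and A: "A \<in> cylinders M B s" and D: "D \<in> sets borel"
  shows "prob ({\<omega>\<in>space M. B t \<omega> - B s \<omega> \<in> D} \<inter> A) = prob {\<omega>\<in>space M. B t \<omega> - B s \<omega> \<in> D} * prob A"
proof -
  note bm = brownian_motion_onD[OF B]
  obtain R E where A_eq: "A = {\<omega>\<in>space M. \<forall>r\<in>R. B r \<omega> \<in> E r}" and R: "finite R" "R \<subseteq> {0..s}" and E: "\<forall>r\<in>R. E r \<in> sets borel"
    using A unfolding cylinders_def by blast
  \<comment> \<open>The sequence \<open>\<tau>\<close> enumerates \<open>0 = \<tau> 0 < \<dots> < \<tau> n = s\<close>, followed by \<open>\<tau> (Suc n) = t\<close>.\<close>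
  define L where "L = sorted_list_of_set (insert 0 (insert s R))"
  have L: "set L = insert 0 (insert s R)" "sorted_wrt (<) L"
    unfolding L_def using R(1) by (simp_all only: set_sorted_list_of_set finite_insert strict_sorted_list_of_set)
  define n where "n = length L - 1"
  have len: "length L = Suc n" using L(1) by (cases L) (auto simp: n_def)
  define \<tau> where "\<tau> i = (if i \<le> n then L ! i else t)" for i
  have in_L: "\<tau> i \<in> set L" if "i \<le> n" for i using that len by (simp add: \<tau>_def)
  have sub: "set L \<subseteq> {0..s}" using L(1) R(2) st by auto
  have \<tau>_less: "\<tau> i < \<tau> (Suc i)" if "i < Suc n" for i
  proof (cases "i < n")
    case True
    then show ?thesis using L(2) len by (simp add: \<tau>_def sorted_wrt_nth_less)
  next
    case False
    then have "i = n" using that by simp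
    then show ?thesis using in_L[of n] sub st by (auto simp: \<tau>_def)
  qed
  have \<tau>_in: "\<tau> i \<in> {0..T}" for i
    using in_L[of i] sub st by (cases "i \<le> n") (auto simp: \<tau>_def)
  have idx: "\<exists>i\<le>n. \<tau> i = r" if "r \<in> set L" for r
    using that len by (auto simp: in_set_conv_nth \<tau>_def less_Suc_eq_le)
  have \<tau>_mono: "\<tau> i \<le> \<tau> k" if "i \<le> k" "k \<le> Suc n" for i k
    by (rule partition_mono[of "Suc n" \<tau>, OF less_imp_le[OF \<tau>_less] that])
  have \<tau>_0: "\<tau> 0 = 0"
  proof -
    obtain i where "i \<le> n" "\<tau> i = 0" using idx[of 0] L(1) by auto
    then have "\<tau> 0 \<le> 0" using \<tau>_mono[of 0 i] by simp
    then show ?thesis using \<tau>_in[of 0] by simp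
  qed
  have \<tau>_n: "\<tau> n = s"
  proof -
    obtain i where "i \<le> n" "\<tau> i = s" using idx[of s] L(1) by auto
    then have "s \<le> \<tau> n" using \<tau>_mono[of i n] by simp
    then show ?thesis using in_L[of n] sub by force
  qed
  have \<tau>_Suc: "\<tau> (Suc n) = t" by (simp add: \<tau>_def)
  obtain k where k: "\<And>r. r \<in> R \<Longrightarrow> k r \<le> n \<and> \<tau> (k r) = r" using idx L(1) by (metis insertCI)
  let ?Z = "\<lambda>i \<omega>. B (\<tau> (Suc i)) \<omega> - B (\<tau> i) \<omega>"
  have ind: "indep_vars (\<lambda>_. borel) ?Z {..<Suc n}"
    by (rule bm(5)) (use \<tau>_in \<tau>_less in auto)
  have iv: "indep_var (PiM {..<n} (\<lambda>_. borel)) (\<lambda>\<omega>. restrict (\<lambda>i. ?Z i \<omega>) {..<n})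
      (PiM {n} (\<lambda>_. borel)) (\<lambda>\<omega>. restrict (\<lambda>i. ?Z i \<omega>) {n})"
    by (rule indep_var_restrict[OF ind]) auto
  define V where "V = {x\<in>space (PiM {..<n} (\<lambda>_. borel :: real measure)). \<forall>r\<in>R. (\<Sum>l<k r. x l) \<in> E r}"
  have V: "V \<in> sets (PiM {..<n} (\<lambda>_. borel))"
    unfolding V_def
  proof (rule sets.sets_Collect_finite_All[OF _ R(1)])
    fix r assume r: "r \<in> R"
    have "(\<lambda>x. \<Sum>l<k r. x l) \<in> borel_measurable (PiM {..<n} (\<lambda>_. borel :: real measure))"
      using k[OF r] by (intro borel_measurable_sum measurable_component_singleton) auto
    from measurable_sets[OF this, of "E r"] E r
    have "(\<lambda>x. \<Sum>l<k r. x l) -` E r \<inter> space (PiM {..<n} (\<lambda>_. borel :: real measure)) \<in> sets (PiM {..<n} (\<lambda>_. borel))" by auto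
    then show "{x\<in>space (PiM {..<n} (\<lambda>_. borel :: real measure)). (\<Sum>l<k r. x l) \<in> E r} \<in> sets (PiM {..<n} (\<lambda>_. borel))"
      by (rule back_subst[of "\<lambda>S. S \<in> sets _"]) auto
  qed
  define U where "U = {x\<in>space (PiM {n} (\<lambda>_. borel :: real measure)). x n \<in> D}"
  have U: "U \<in> sets (PiM {n} (\<lambda>_. borel))"
  proof -
    have "(\<lambda>x. x n) \<in> borel_measurable (PiM {n} (\<lambda>_. borel :: real measure))"
      by (rule measurable_component_singleton) simp
    from measurable_sets[OF this D] show ?thesis
      unfolding U_def by (rule back_subst[of "\<lambda>S. S \<in> sets _"]) auto
  qed
  let ?X = "\<lambda>\<omega>. restrict (\<lambda>i. ?Z i \<omega>) {..<n}" and ?Y = "\<lambda>\<omega>. restrict (\<lambda>i. ?Z i \<omega>) {n}"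
  have Y_eq: "?Y -` U \<inter> space M = {\<omega>\<in>space M. B t \<omega> - B s \<omega> \<in> D}"
    unfolding U_def by (auto simp: space_PiM \<tau>_n \<tau>_Suc)
  have AE_A: "AE \<omega> in M. (\<omega> \<in> ?X -` V \<inter> space M) = (\<omega> \<in> A)"
    using bm(2) AE_space
  proof eventually_elim
    case (elim \<omega>)
    have tele: "(\<Sum>l<k r. ?X \<omega> l) = B r \<omega>" if "r \<in> R" for r
    proof -
      have "(\<Sum>l<k r. ?X \<omega> l) = (\<Sum>l<k r. ?Z l \<omega>)"
        using k[OF that] by (intro sum.cong) auto
      also have "\<dots> = B (\<tau> (k r)) \<omega> - B (\<tau> 0) \<omega>" by (rule sum_lessThan_telescope)
      also have "\<dots> = B r \<omega>" using k[OF that] elim \<tau>_0 by simp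
      finally show ?thesis .
    qed
    show ?case unfolding V_def A_eq using elim tele by (auto simp: space_PiM)
  qed
  have ev: "?X -` V \<inter> space M \<in> events" "?Y -` U \<inter> space M \<in> events"
    using indep_var_rv1[OF iv] indep_var_rv2[OF iv] V U by (auto intro: measurable_sets)
  have A_ev: "A \<in> events" by (rule cylinder_event[OF bm(1) _ A]) (use st in auto)
  have "prob ({\<omega>\<in>space M. B t \<omega> - B s \<omega> \<in> D} \<inter> A) = prob ((?X -` V \<inter> space M) \<inter> (?Y -` U \<inter> space M))"
    unfolding Y_eq[symmetric] using AE_A ev A_ev by (intro measure_eq_AE) (auto elim!: AE_mp)
  also have "(?X -` V \<inter> space M) \<inter> (?Y -` U \<inter> space M) = (\<lambda>\<omega>. (?X \<omega>, ?Y \<omega>)) -` (V \<times> U) \<inter> space M" by auto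
  also have "prob \<dots> = prob (?X -` V \<inter> space M) * prob (?Y -` U \<inter> space M)"
    by (rule indep_varD[OF iv V U])
  also have "prob (?X -` V \<inter> space M) = prob A"
    using AE_A ev A_ev by (intro measure_eq_AE) auto
  finally show ?thesis unfolding Y_eq by simp
qed

text \<open>Independence of the motions separates the part of the event that concerns \<open>C\<close>; the remaining part
  is \<open>increment_indep_cylinder\<close>.\<close>

lemma increment_indep_joint_cylinders:
  fixes B C :: "real \<Rightarrow> 'a \<Rightarrow> real"
  assumes B: "brownian_motion_on M T B" and C: "brownian_motion_on M T C"
    and ind: "\<And>V U. V \<in> sets (Pi\<^sub>M {0..T} (\<lambda>_. borel)) \<Longrightarrow> U \<in> sets (Pi\<^sub>M {0..T} (\<lambda>_. borel)) \<Longrightarrow>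
      prob (((\<lambda>\<omega>. \<lambda>t\<in>{0..T}. B t \<omega>) -` V \<inter> space M) \<inter> ((\<lambda>\<omega>. \<lambda>t\<in>{0..T}. C t \<omega>) -` U \<inter> space M))
        = prob ((\<lambda>\<omega>. \<lambda>t\<in>{0..T}. B t \<omega>) -` V \<inter> space M) * prob ((\<lambda>\<omega>. \<lambda>t\<in>{0..T}. C t \<omega>) -` U \<inter> space M)"
    and st: "0 \<le> s" "s < t" "t \<le> T"
    and a: "a \<in> cylinders M B s" and c: "c \<in> cylinders M C s" and D: "D \<in> sets borel"
  shows "prob ({\<omega>\<in>space M. B t \<omega> - B s \<omega> \<in> D} \<inter> (a \<inter> c)) = prob {\<omega>\<in>space M. B t \<omega> - B s \<omega> \<in> D} * prob (a \<inter> c)"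
proof -
  let ?PM = "Pi\<^sub>M {0..T} (\<lambda>_. borel :: real measure)"
  let ?pB = "\<lambda>\<omega>. \<lambda>t\<in>{0..T}. B t \<omega>" and ?pC = "\<lambda>\<omega>. \<lambda>t\<in>{0..T}. C t \<omega>"
  have cyl: "\<exists>V\<in>sets ?PM. \<forall>Z. {\<omega>\<in>space M. \<forall>r\<in>R. Z r \<omega> \<in> E r} = (\<lambda>\<omega>. \<lambda>t\<in>{0..T}. Z t \<omega>) -` V \<inter> space M"
    if R: "finite R" "R \<subseteq> {0..s}" "\<forall>r\<in>R. E r \<in> sets borel" for R E
  proof (intro bexI allI)
    let ?V = "{x\<in>space ?PM. \<forall>r\<in>R. x r \<in> E r}"
    have RT: "R \<subseteq> {0..T}" using R(2) st by auto
    show "{\<omega>\<in>space M. \<forall>r\<in>R. Z r \<omega> \<in> E r} = (\<lambda>\<omega>. \<lambda>t\<in>{0..T}. Z t \<omega>) -` ?V \<inter> space M" for Z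
      using RT by (auto simp: space_PiM subset_eq)
    show "?V \<in> sets ?PM"
    proof (rule sets.sets_Collect_finite_All[OF _ R(1)])
      fix r assume r: "r \<in> R"
      then have "(\<lambda>x. x r) \<in> borel_measurable ?PM" using RT by (intro measurable_component_singleton) auto
      from measurable_sets[OF this, of "E r"] R(3) r
      have "(\<lambda>x. x r) -` E r \<inter> space ?PM \<in> sets ?PM" by auto
      then show "{x\<in>space ?PM. x r \<in> E r} \<in> sets ?PM" by (rule back_subst[of "\<lambda>S. S \<in> sets _"]) auto
    qed
  qed
  have path: "\<exists>V\<in>sets ?PM. e = (\<lambda>\<omega>. \<lambda>t\<in>{0..T}. Z t \<omega>) -` V \<inter> space M" if mem: "e \<in> cylinders M Z s" for e Z
  proof -
    obtain R E where e: "e = {\<omega>\<in>space M. \<forall>r\<in>R. Z r \<omega> \<in> E r}" "finite R" "R \<subseteq> {0..s}" "\<forall>r\<in>R. E r \<in> sets borel"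
      using mem unfolding cylinders_def by blast
    obtain V where "V \<in> sets ?PM" "\<forall>Z. {\<omega>\<in>space M. \<forall>r\<in>R. Z r \<omega> \<in> E r} = (\<lambda>\<omega>. \<lambda>t\<in>{0..T}. Z t \<omega>) -` V \<inter> space M"
      using cyl[OF e(2-4)] by (elim bexE)
    then show ?thesis unfolding e(1) by (intro bexI[of _ V]) (simp_all only:)
  qed
  obtain V where V: "V \<in> sets ?PM" "a = ?pB -` V \<inter> space M" using path[OF a] by (elim bexE)
  obtain U where U: "U \<in> sets ?PM" "c = ?pC -` U \<inter> space M" using path[OF c] by (elim bexE)
  let ?D = "{x\<in>space ?PM. x t - x s \<in> D}"
  have Dm: "?D \<in> sets ?PM"
  proof -
    have "(\<lambda>x. x t - x s) \<in> borel_measurable ?PM"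
      using st by (intro borel_measurable_diff measurable_component_singleton) auto
    from measurable_sets[OF this D] show ?thesis by (rule back_subst[of "\<lambda>S. S \<in> sets _"]) auto
  qed
  have inc: "{\<omega>\<in>space M. B t \<omega> - B s \<omega> \<in> D} = ?pB -` ?D \<inter> space M"
    using st by (auto simp: space_PiM)
  have "prob ({\<omega>\<in>space M. B t \<omega> - B s \<omega> \<in> D} \<inter> (a \<inter> c)) = prob ((?pB -` (?D \<inter> V) \<inter> space M) \<inter> (?pC -` U \<inter> space M))"
    unfolding inc V(2) U(2) by (rule arg_cong[where f = prob]) auto
  also have "\<dots> = prob (?pB -` (?D \<inter> V) \<inter> space M) * prob (?pC -` U \<inter> space M)"
    using Dm V(1) U(1) by (intro ind) auto
  also have "?pB -` (?D \<inter> V) \<inter> space M = {\<omega>\<in>space M. B t \<omega> - B s \<omega> \<in> D} \<inter> a"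
    unfolding inc V(2) by auto
  also have "prob \<dots> = prob {\<omega>\<in>space M. B t \<omega> - B s \<omega> \<in> D} * prob a"
    by (rule increment_indep_cylinder[OF B st a D])
  also have "\<dots> * prob (?pC -` U \<inter> space M) = prob {\<omega>\<in>space M. B t \<omega> - B s \<omega> \<in> D} * (prob (?pB -` V \<inter> space M) * prob (?pC -` U \<inter> space M))"
    unfolding V(2) by simp
  also have "prob (?pB -` V \<inter> space M) * prob (?pC -` U \<inter> space M) = prob (a \<inter> c)"
    unfolding V(2) U(2) by (rule ind[OF V(1) U(1), symmetric])
  finally show ?thesis .
qed

end

lemma sets_completed_natural_filtration:
  assumes "\<And>s. s \<in> {0..t} \<Longrightarrow> B s \<in> borel_measurable P"
  shows "sets (completed_natural_filtration P B t) = sigma_sets (space P)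
       ((\<Union>s\<in>{0..t}. {B s -` E \<inter> space P | E. E \<in> sets borel}) \<union> null_sets P)"
    and "sets (completed_natural_filtration P B t) \<subseteq> sets P"
    and "space (completed_natural_filtration P B t) = space P"
proof -
  let ?G = "(\<Union>s\<in>{0..t}. {B s -` E \<inter> space P | E. E \<in> sets borel}) \<union> null_sets P"
  have sub: "?G \<subseteq> sets P" using assms by (auto intro: measurable_sets)
  then have pow: "?G \<subseteq> Pow (space P)" using sets.sets_into_space by blast
  show *: "sets (completed_natural_filtration P B t) = sigma_sets (space P) ?G"
    unfolding completed_natural_filtration_def by (rule sets_measure_of[OF pow])
  show "sets (completed_natural_filtration P B t) \<subseteq> sets P"
    unfolding * by (rule sets.sigma_sets_subset[OF sub])
  show "space (completed_natural_filtration P B t) = space P"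
    unfolding completed_natural_filtration_def by (rule space_measure_of[OF pow])
qed

lemma sets_joint_filtration:
  assumes "\<And>s. s \<in> {0..t} \<Longrightarrow> B s \<in> borel_measurable P" "\<And>s. s \<in> {0..t} \<Longrightarrow> C s \<in> borel_measurable P"
  shows "sets (joint_filtration P B C t) = sigma_sets (space P)
       (sets (completed_natural_filtration P B t) \<union> sets (completed_natural_filtration P C t))"
    and "sets (joint_filtration P B C t) \<subseteq> sets P"
    and "space (joint_filtration P B C t) = space P"
    and "sets (completed_natural_filtration P B t) \<subseteq> sets (joint_filtration P B C t)"
    and "sets (completed_natural_filtration P C t) \<subseteq> sets (joint_filtration P B C t)"
proof -
  note b = sets_completed_natural_filtration[OF assms(1)] and c = sets_completed_natural_filtration[OF assms(2)]
  let ?G = "sets (completed_natural_filtration P B t) \<union> sets (completed_natural_filtration P C t)"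
  have sub: "?G \<subseteq> sets P" using b(2) c(2) by auto
  then have pow: "?G \<subseteq> Pow (space P)" using sets.sets_into_space by blast
  show *: "sets (joint_filtration P B C t) = sigma_sets (space P) ?G"
    unfolding joint_filtration_def by (rule sets_measure_of[OF pow])
  show "sets (joint_filtration P B C t) \<subseteq> sets P"
    unfolding * by (rule sets.sigma_sets_subset[OF sub])
  show "space (joint_filtration P B C t) = space P"
    unfolding joint_filtration_def by (rule space_measure_of[OF pow])
  show "sets (completed_natural_filtration P B t) \<subseteq> sets (joint_filtration P B C t)"
    "sets (completed_natural_filtration P C t) \<subseteq> sets (joint_filtration P B C t)"
    unfolding * by auto
qed

lemma completed_natural_filtration_mono:
  assumes "s \<le> t" "\<And>r. r \<in> {0..t} \<Longrightarrow> B r \<in> borel_measurable P"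
  shows "sets (completed_natural_filtration P B s) \<subseteq> sets (completed_natural_filtration P B t)"
proof -
  have "sets (completed_natural_filtration P B s) = sigma_sets (space P)
       ((\<Union>r\<in>{0..s}. {B r -` E \<inter> space P | E. E \<in> sets borel}) \<union> null_sets P)"
    using assms by (intro sets_completed_natural_filtration(1)) auto
  also have "\<dots> \<subseteq> sigma_sets (space P)
       ((\<Union>r\<in>{0..t}. {B r -` E \<inter> space P | E. E \<in> sets borel}) \<union> null_sets P)"
    using assms(1) by (intro sigma_sets_mono' Un_mono UN_mono) auto
  also have "\<dots> = sets (completed_natural_filtration P B t)"
    using assms by (intro sets_completed_natural_filtration(1)[symmetric]) auto
  finally show ?thesis .
qed

lemma joint_filtration_commute: "joint_filtration P B C t = joint_filtration P C B t"
  by (simp add: joint_filtration_def Un_commute)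

lemma measurable_completed_natural_filtration:
  assumes "\<And>r. r \<in> {0..t} \<Longrightarrow> B r \<in> borel_measurable P" "s \<in> {0..t}"
  shows "B s \<in> borel_measurable (completed_natural_filtration P B t)"
proof (rule measurableI)
  fix A :: "real set" assume A: "A \<in> sets borel"
  show "B s -` A \<inter> space (completed_natural_filtration P B t) \<in> sets (completed_natural_filtration P B t)"
  proof -
    have "B s -` A \<inter> space P \<in> sigma_sets (space P)
       ((\<Union>s\<in>{0..t}. {B s -` E \<inter> space P | E. E \<in> sets borel}) \<union> null_sets P)"
      using A assms(2) by (intro sigma_sets.Basic) blast
    moreover have "space (completed_natural_filtration P B t) = space P"
      using assms(1) by (rule sets_completed_natural_filtration(3))
    moreover have "sets (completed_natural_filtration P B t) = sigma_sets (space P)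
       ((\<Union>s\<in>{0..t}. {B s -` E \<inter> space P | E. E \<in> sets borel}) \<union> null_sets P)"
      using assms(1) by (rule sets_completed_natural_filtration(1))
    ultimately show ?thesis by (simp only:)
  qed
qed simp

lemma (in complete_measure) null_sets_subset_completed:
  assumes "\<And>s. s \<in> {0..t} \<Longrightarrow> B s \<in> borel_measurable M"
  shows "null_sets M \<subseteq> sets (completed_natural_filtration M B t)"
  using sets_completed_natural_filtration(1)[of t B M] assms by auto

lemma filtered_prob_space_joint:
  assumes "prob_space P" "complete_measure P" "0 < T"
    and B: "\<And>t. t \<in> {0..T} \<Longrightarrow> B t \<in> borel_measurable P" and C: "\<And>t. t \<in> {0..T} \<Longrightarrow> C t \<in> borel_measurable P"
  shows "filtered_prob_space P (joint_filtration P B C) T"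
proof -
  interpret prob_space P by fact
  interpret complete_measure P by fact
  have Bt: "\<And>s. s \<in> {0..t} \<Longrightarrow> B s \<in> borel_measurable P" and Ct: "\<And>s. s \<in> {0..t} \<Longrightarrow> C s \<in> borel_measurable P"
    if "t \<le> T" for t
    using that B C by auto
  show ?thesis
  proof
    show "0 < T" by fact
    show "space (joint_filtration P B C t) = space P" if "t \<in> {0..T}" for t
      using that by (intro sets_joint_filtration(3) Bt[of t] Ct[of t]) auto
    show "sets (joint_filtration P B C t) \<subseteq> sets P" if "t \<in> {0..T}" for t
      using that by (intro sets_joint_filtration(2) Bt[of t] Ct[of t]) auto
    show "sets (joint_filtration P B C s) \<subseteq> sets (joint_filtration P B C t)" if "0 \<le> s" "s \<le> t" "t \<le> T" for s t
    proof -
      have "sets (joint_filtration P B C s) = sigma_sets (space P)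
         (sets (completed_natural_filtration P B s) \<union> sets (completed_natural_filtration P C s))"
        using that by (intro sets_joint_filtration(1) Bt[of s] Ct[of s]) auto
      also have "\<dots> \<subseteq> sigma_sets (space P)
         (sets (completed_natural_filtration P B t) \<union> sets (completed_natural_filtration P C t))"
        using that by (intro sigma_sets_mono' Un_mono completed_natural_filtration_mono Bt[of t] Ct[of t]) auto
      also have "\<dots> = sets (joint_filtration P B C t)"
        using that by (intro sets_joint_filtration(1)[symmetric] Bt[of t] Ct[of t]) auto
      finally show ?thesis .
    qed
    show "null_sets P \<subseteq> sets (joint_filtration P B C t)" if "t \<in> {0..T}" for t
    proof -
      have "null_sets P \<subseteq> sets (completed_natural_filtration P B t)"
        using that by (intro null_sets_subset_completed Bt[of t]) auto
      also have "\<dots> \<subseteq> sets (joint_filtration P B C t)"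
        using that by (intro sets_joint_filtration(4) Bt[of t] Ct[of t]) auto
      finally show ?thesis .
    qed
  qed
qed

text \<open>Intersections of a cylinder for \<open>B\<close> with one for \<open>C\<close>, together with the sets of measure zero, form a
  generator of the joint past that is closed under intersection. The increment is independent of each
  such event, hence of the whole past.\<close>

lemma brownian_filtration_joint:
  assumes P: "prob_space P" "complete_measure P" "0 < T"
    and B: "brownian_motion_on P T B" and C: "brownian_motion_on P T C"
    and ind: "\<And>V U. V \<in> sets (Pi\<^sub>M {0..T} (\<lambda>_. borel)) \<Longrightarrow> U \<in> sets (Pi\<^sub>M {0..T} (\<lambda>_. borel)) \<Longrightarrow>
      measure P (((\<lambda>\<omega>. \<lambda>t\<in>{0..T}. B t \<omega>) -` V \<inter> space P) \<inter> ((\<lambda>\<omega>. \<lambda>t\<in>{0..T}. C t \<omega>) -` U \<inter> space P))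
        = measure P ((\<lambda>\<omega>. \<lambda>t\<in>{0..T}. B t \<omega>) -` V \<inter> space P) * measure P ((\<lambda>\<omega>. \<lambda>t\<in>{0..T}. C t \<omega>) -` U \<inter> space P)"
  shows "brownian_filtration P (joint_filtration P B C) T B"
proof -
  note b = brownian_motion_onD[OF B] and c = brownian_motion_onD[OF C]
  interpret filtered_prob_space P "joint_filtration P B C" T
    by (rule filtered_prob_space_joint[OF P b(1) c(1)])
  let ?F = "joint_filtration P B C"
  show ?thesis
  proof
    fix t assume t: "t \<in> {0..T}"
    have B: "B t \<in> borel_measurable (completed_natural_filtration P B t)"
      using t b(1) by (intro measurable_completed_natural_filtration) auto
    have "subalgebra (?F t) (completed_natural_filtration P B t)"
      unfolding subalgebra_def using t b(1) c(1) sets_joint_filtration(4)[of t B P C]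
        space_F[OF t] sets_completed_natural_filtration(3)[of t B P] by auto
    from measurable_from_subalg[OF this B] show "B t \<in> borel_measurable (?F t)" .
  next
    fix s t :: real assume "0 \<le> s" "s < t" "t \<le> T"
    then show "distributed P lborel (\<lambda>\<omega>. B t \<omega> - B s \<omega>) (normal_density 0 (sqrt (t - s)))" by (rule b(4))
  next
    fix s t :: real and Z :: "_ \<Rightarrow> real"
    assume st: "0 \<le> s" "s < t" "t \<le> T" and Z: "Z \<in> borel_measurable (?F s)"
    have s: "s \<in> {0..T}" using st by simp
    let ?d = "\<lambda>\<omega>. B t \<omega> - B s \<omega>"
    have d[measurable]: "?d \<in> borel_measurable P" using b(1)[of s] b(1)[of t] st by auto
    let ?D = "{?d -` D \<inter> space P | D. D \<in> sets borel}"
    let ?Pi = "{x \<inter> y | x y. x \<in> cylinders P B s \<and> y \<in> cylinders P C s} \<union> null_sets P"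
    have cyl_ev: "x \<in> sets P" if "x \<in> cylinders P B s \<or> x \<in> cylinders P C s" for x
      using that
    proof
      assume "x \<in> cylinders P B s"
      then show ?thesis using st by (intro cylinder_event[of T B s x] b(1)) auto
    next
      assume "x \<in> cylinders P C s"
      then show ?thesis using st by (intro cylinder_event[of T C s x] c(1)) auto
    qed
    have "indep_set ?D ?Pi"
    proof (rule indep_setI)
      show "?D \<subseteq> sets P" using d by (auto intro: measurable_sets)
      show "?Pi \<subseteq> sets P" using cyl_ev by auto
      fix x y assume x: "x \<in> ?D" and y: "y \<in> ?Pi"
      obtain D where D: "D \<in> sets borel" "x = ?d -` D \<inter> space P" using x by blast
      have x_eq: "x = {\<omega>\<in>space P. ?d \<omega> \<in> D}" using D by auto
      show "prob (x \<inter> y) = prob x * prob y"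
      proof (cases "y \<in> null_sets P")
        case True
        then have "x \<inter> y \<in> null_sets P"
          using D d by (intro null_set_Int1) (auto intro: measurable_sets)
        then show ?thesis using True by (simp add: measure_def null_setsD1)
      next
        case False
        then obtain u v where uv: "y = u \<inter> v" "u \<in> cylinders P B s" "v \<in> cylinders P C s" using y by blast
        show ?thesis
          unfolding x_eq uv(1) by (rule increment_indep_joint_cylinders[OF B C ind st uv(2,3) D(1)])
      qed
    qed
    moreover have "Int_stable ?D"
    proof (rule Int_stableI)
      fix x y assume "x \<in> ?D" "y \<in> ?D"
      then obtain D E where "D \<in> sets borel" "x = ?d -` D \<inter> space P" "E \<in> sets borel" "y = ?d -` E \<inter> space P" by blast
      then show "x \<inter> y \<in> ?D" by (intro CollectI exI[of _ "D \<inter> E"]) auto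
    qed
    moreover have "Int_stable ?Pi"
    proof (rule Int_stableI)
      fix x y assume x: "x \<in> ?Pi" and y: "y \<in> ?Pi"
      have ev: "x \<in> sets P" "y \<in> sets P" using x y cyl_ev by auto
      show "x \<inter> y \<in> ?Pi"
      proof (cases "x \<in> null_sets P \<or> y \<in> null_sets P")
        case True
        then have "x \<inter> y \<in> null_sets P"
          using ev null_set_Int1[of y P x] null_set_Int2[of x P y] by auto
        then show ?thesis by blast
      next
        case False
        obtain u v where uv: "x = u \<inter> v" "u \<in> cylinders P B s" "v \<in> cylinders P C s" using x False by blast
        obtain u' v' where uv': "y = u' \<inter> v'" "u' \<in> cylinders P B s" "v' \<in> cylinders P C s" using y False by blast
        have "x \<inter> y = (u \<inter> u') \<inter> (v \<inter> v')" unfolding uv(1) uv'(1) by blast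
        moreover have "u \<inter> u' \<in> cylinders P B s" "v \<inter> v' \<in> cylinders P C s"
          using uv uv' Int_stableD[OF Int_stable_cylinders] by blast+
        ultimately show ?thesis by blast
      qed
    qed
    ultimately have ind: "indep_set (sigma_sets (space P) ?D) (sigma_sets (space P) ?Pi)"
      by (rule indep_set_sigma_sets)
    have F_sub: "sets (?F s) \<subseteq> sigma_sets (space P) ?Pi"
    proof -
      have Pi_pow: "?Pi \<subseteq> Pow (space P)" using cyl_ev sets.sets_into_space by fastforce
      have full: "space P \<in> cylinders P Z s" for Z
        using cylindersI[of "{}" s "\<lambda>_. UNIV" P Z] by simp
      have one: "X r -` E \<inter> space P \<in> cylinders P X s" if "r \<in> {0..s}" "E \<in> sets borel" for X :: "real \<Rightarrow> 'a \<Rightarrow> real" and r E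
      proof -
        have "{\<omega>\<in>space P. \<forall>q\<in>{r}. X q \<omega> \<in> E} \<in> cylinders P X s"
          by (rule cylindersI) (use that in auto)
        then show ?thesis by (rule back_subst[of "\<lambda>S. S \<in> cylinders P X s"]) auto
      qed
      have cyl: "cylinders P B s \<subseteq> ?Pi" "cylinders P C s \<subseteq> ?Pi"
      proof -
        show "cylinders P B s \<subseteq> ?Pi"
        proof (intro subsetI UnI1)
          fix x assume x: "x \<in> cylinders P B s"
          have "x = x \<inter> space P" using sets.sets_into_space[OF cyl_ev[OF disjI1[OF x]]] by (simp only: Int_absorb2)
          then show "x \<in> {x \<inter> y | x y. x \<in> cylinders P B s \<and> y \<in> cylinders P C s}"
            by (intro CollectI exI[of _ x] exI[of _ "space P"] conjI x full)
        qed
        show "cylinders P C s \<subseteq> ?Pi"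
        proof (intro subsetI UnI1)
          fix x assume x: "x \<in> cylinders P C s"
          have "x = space P \<inter> x" using sets.sets_into_space[OF cyl_ev[OF disjI2[OF x]]] by (simp only: Int_absorb1)
          then show "x \<in> {x \<inter> y | x y. x \<in> cylinders P B s \<and> y \<in> cylinders P C s}"
            by (intro CollectI exI[of _ "space P"] exI[of _ x] conjI x full)
        qed
      qed
      have B_sub: "sets (completed_natural_filtration P B s) \<subseteq> sigma_sets (space P) ?Pi"
      proof -
        have "sets (completed_natural_filtration P B s) = sigma_sets (space P)
          ((\<Union>r\<in>{0..s}. {B r -` E \<inter> space P | E. E \<in> sets borel}) \<union> null_sets P)"
          using b(1) st by (intro sets_completed_natural_filtration(1)) auto
        also have "\<dots> \<subseteq> sigma_sets (space P) ?Pi"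
          using one[of _ _ B] cyl(1) by (intro sigma_sets_mono') blast
        finally show ?thesis .
      qed
      have C_sub: "sets (completed_natural_filtration P C s) \<subseteq> sigma_sets (space P) ?Pi"
      proof -
        have "sets (completed_natural_filtration P C s) = sigma_sets (space P)
          ((\<Union>r\<in>{0..s}. {C r -` E \<inter> space P | E. E \<in> sets borel}) \<union> null_sets P)"
          using c(1) st by (intro sets_completed_natural_filtration(1)) auto
        also have "\<dots> \<subseteq> sigma_sets (space P) ?Pi"
          using one[of _ _ C] cyl(2) by (intro sigma_sets_mono') blast
        finally show ?thesis .
      qed
      have "sets (?F s) = sigma_sets (space P)
         (sets (completed_natural_filtration P B s) \<union> sets (completed_natural_filtration P C s))"
        using b(1) c(1) st by (intro sets_joint_filtration(1)) auto
      also have "\<dots> \<subseteq> sigma_sets (space P) ?Pi"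
        using B_sub C_sub by (intro sigma_sets_mono) blast
      finally show ?thesis .
    qed
    have ZP: "Z \<in> borel_measurable P" by (rule measurable_F_imp_P[OF s Z])
    have "{Z -` A \<inter> space P | A. A \<in> sets borel} \<subseteq> sigma_sets (space P) ?Pi"
      using F_sub measurable_sets[OF Z] space_F[OF s] by auto
    then have Z_sub: "sigma_sets (space P) {Z -` A \<inter> space P | A. A \<in> sets borel} \<subseteq> sigma_sets (space P) ?Pi"
      by (rule sigma_sets_mono)
    have "indep_set (sigma_sets (space P) ?D) (sigma_sets (space P) {Z -` A \<inter> space P | A. A \<in> sets borel})"
      unfolding indep_set_def
      by (rule indep_sets_mono_sets[OF ind[unfolded indep_set_def]]) (use Z_sub in \<open>auto split: bool.split\<close>)
    then show "indep_var borel ?d borel Z"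
      unfolding indep_var_eq using d ZP by blast
  qed
qed

text \<open>Paths are continuous only almost surely; on an exceptional set of measure zero, which belongs to
  every sigma-algebra of the filtration, the motion is replaced by 0.\<close>

lemma (in brownian_filtration) continuous_modification:
  assumes cont: "AE \<omega> in P. continuous_on {0..T} (\<lambda>t. B t \<omega>)"
  obtains B' where "continuous_brownian_filtration P F T B'" "AE \<omega> in P. \<forall>t. B' t \<omega> = B t \<omega>"
proof -
  obtain N where N: "N \<in> null_sets P" "{\<omega>\<in>space P. \<not> continuous_on {0..T} (\<lambda>t. B t \<omega>)} \<subseteq> N"
    using cont by (auto elim!: AE_E simp: null_sets_def)
  define B' where "B' t \<omega> = (if \<omega> \<in> N then 0 else B t \<omega>)" for t \<omega>
  have ae: "AE \<omega> in P. \<forall>t. B' t \<omega> = B t \<omega>"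
    using AE_not_in[OF N(1)] by eventually_elim (simp add: B'_def)
  have B'_F: "B' t \<in> borel_measurable (F t)" if "t \<in> {0..T}" for t
    by (rule measurable_F_AE_cong[OF that B_adapted[OF that]]) (use ae in \<open>auto elim: AE_mp\<close>)
  have inc_ae: "AE \<omega> in P. B t \<omega> - B s \<omega> = B' t \<omega> - B' s \<omega>" for s t
    using ae by eventually_elim simp
  have "continuous_brownian_filtration P F T B'"
  proof
    show "B' t \<in> borel_measurable (F t)" if "t \<in> {0..T}" for t by (rule B'_F[OF that])
    fix s t :: real assume st: "0 \<le> s" "s < t" "t \<le> T"
    have m: "(\<lambda>\<omega>. B' t \<omega> - B' s \<omega>) \<in> borel_measurable P" "(\<lambda>\<omega>. B t \<omega> - B s \<omega>) \<in> borel_measurable P"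
      using measurable_F_imp_P[OF _ B'_F] B_measurable st by auto
    have dist: "distr P borel (\<lambda>\<omega>. B t \<omega> - B s \<omega>) = distr P borel (\<lambda>\<omega>. B' t \<omega> - B' s \<omega>)"
      by (rule distr_cong_AE[OF refl refl inc_ae m(2) m(1)])
    have dist': "distr P lborel (\<lambda>\<omega>. B t \<omega> - B s \<omega>) = distr P lborel (\<lambda>\<omega>. B' t \<omega> - B' s \<omega>)"
      using m by (intro distr_cong_AE[OF refl refl inc_ae]) auto
    show "distributed P lborel (\<lambda>\<omega>. B' t \<omega> - B' s \<omega>) (normal_density 0 (sqrt (t - s)))"
      using B_normal[OF st] m unfolding distributed_def dist' by simp
    fix Z :: "'w \<Rightarrow> real" assume Z: "Z \<in> borel_measurable (F s)"
    have ZP: "Z \<in> borel_measurable P" using measurable_F_imp_P[OF _ Z] st by auto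
    have "distr P (borel \<Otimes>\<^sub>M borel) (\<lambda>\<omega>. (B t \<omega> - B s \<omega>, Z \<omega>)) = distr P (borel \<Otimes>\<^sub>M borel) (\<lambda>\<omega>. (B' t \<omega> - B' s \<omega>, Z \<omega>))"
      using inc_ae[of t s] m ZP by (intro distr_cong_AE refl) (auto elim!: AE_mp)
    then show "indep_var borel (\<lambda>\<omega>. B' t \<omega> - B' s \<omega>) borel Z"
      using B_indep[OF st Z] m ZP unfolding indep_var_distribution_eq dist by simp
  next
    show "continuous_on {0..T} (\<lambda>t. B' t \<omega>)" if "\<omega> \<in> space P" for \<omega>
      using that N(2) by (cases "\<omega> \<in> N") (auto simp: B'_def)
  qed
  then show ?thesis using that ae by blast
qed

lemma has_ito_integral_modification:
  assumes ae: "AE \<omega> in P. \<forall>t. b' t \<omega> = b t \<omega>" and I: "has_ito_integral P F T b' \<phi> I"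
  shows "has_ito_integral P F T b \<phi> I"
proof -
  have eq: "(\<integral>\<^sup>+\<omega>. ennreal ((norm (simple_ito_integral b m \<tau> \<xi> t \<omega> - I t \<omega>))\<^sup>2) \<partial>P)
    = (\<integral>\<^sup>+\<omega>. ennreal ((norm (simple_ito_integral b' m \<tau> \<xi> t \<omega> - I t \<omega>))\<^sup>2) \<partial>P)" for m \<tau> \<xi> t
    by (intro nn_integral_cong_AE, use ae in eventually_elim) (simp add: simple_ito_integral_def)
  show ?thesis using I unfolding has_ito_integral_def eq .
qed

sublocale two_brownian_basis \<subseteq> filtered_prob_space P "joint_filtration P W Y" T
  using brownian_motion_onD(1)[OF brownian_W] brownian_motion_onD(1)[OF brownian_Y]
  by (intro filtered_prob_space_joint prob_space_axioms complete_measure_axioms T_pos)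

context two_brownian_basis
begin

lemma paths_independent:
  assumes "V \<in> sets (Pi\<^sub>M {0..T} (\<lambda>_. borel))" "U \<in> sets (Pi\<^sub>M {0..T} (\<lambda>_. borel))"
  shows "prob (((\<lambda>\<omega>. \<lambda>t\<in>{0..T}. W t \<omega>) -` V \<inter> space P) \<inter> ((\<lambda>\<omega>. \<lambda>t\<in>{0..T}. Y t \<omega>) -` U \<inter> space P))
        = prob ((\<lambda>\<omega>. \<lambda>t\<in>{0..T}. W t \<omega>) -` V \<inter> space P) * prob ((\<lambda>\<omega>. \<lambda>t\<in>{0..T}. Y t \<omega>) -` U \<inter> space P)"
proof -
  have "((\<lambda>\<omega>. \<lambda>t\<in>{0..T}. W t \<omega>) -` V \<inter> space P) \<inter> ((\<lambda>\<omega>. \<lambda>t\<in>{0..T}. Y t \<omega>) -` U \<inter> space P)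
    = (\<lambda>\<omega>. (\<lambda>t\<in>{0..T}. W t \<omega>, \<lambda>t\<in>{0..T}. Y t \<omega>)) -` (V \<times> U) \<inter> space P" by auto
  then show ?thesis using indep_varD[OF indep_WY assms] by (simp only:)
qed

lemma brownian_filtration_W: "brownian_filtration P (joint_filtration P W Y) T W"
  by (rule brownian_filtration_joint[OF prob_space_axioms complete_measure_axioms T_pos brownian_W brownian_Y paths_independent])

lemma brownian_filtration_Y: "brownian_filtration P (joint_filtration P W Y) T Y"
  unfolding joint_filtration_commute[of P W Y, abs_def]
proof (rule brownian_filtration_joint[OF prob_space_axioms complete_measure_axioms T_pos brownian_Y brownian_W])
  let ?pW = "\<lambda>\<omega>. \<lambda>t\<in>{0..T}. W t \<omega>" and ?pY = "\<lambda>\<omega>. \<lambda>t\<in>{0..T}. Y t \<omega>"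
  fix V U :: "(real \<Rightarrow> real) set"
  assume V: "V \<in> sets (Pi\<^sub>M {0..T} (\<lambda>_. borel))" and U: "U \<in> sets (Pi\<^sub>M {0..T} (\<lambda>_. borel))"
  have "prob ((?pY -` V \<inter> space P) \<inter> (?pW -` U \<inter> space P)) = prob ((?pW -` U \<inter> space P) \<inter> (?pY -` V \<inter> space P))"
    by (rule arg_cong[where f = prob]) (rule Int_commute)
  also have "\<dots> = prob (?pW -` U \<inter> space P) * prob (?pY -` V \<inter> space P)"
    by (rule paths_independent[OF U V])
  finally show "prob ((?pY -` V \<inter> space P) \<inter> (?pW -` U \<inter> space P)) = prob (?pY -` V \<inter> space P) * prob (?pW -` U \<inter> space P)"
    by (simp only: mult.commute)
qed

lemma continuous_versions:
  obtains W' Y' where "two_driver_system P (joint_filtration P W Y) T W' Y'"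
    "AE \<omega> in P. \<forall>t. W' t \<omega> = W t \<omega>" "AE \<omega> in P. \<forall>t. Y' t \<omega> = Y t \<omega>"
proof -
  interpret W: brownian_filtration P "joint_filtration P W Y" T W by (rule brownian_filtration_W)
  interpret Y: brownian_filtration P "joint_filtration P W Y" T Y by (rule brownian_filtration_Y)
  obtain W' where W': "continuous_brownian_filtration P (joint_filtration P W Y) T W'" "AE \<omega> in P. \<forall>t. W' t \<omega> = W t \<omega>"
    by (rule W.continuous_modification[OF brownian_motion_onD(3)[OF brownian_W]])
  obtain Y' where Y': "continuous_brownian_filtration P (joint_filtration P W Y) T Y'" "AE \<omega> in P. \<forall>t. Y' t \<omega> = Y t \<omega>"
    by (rule Y.continuous_modification[OF brownian_motion_onD(3)[OF brownian_Y]])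
  interpret W': continuous_brownian_filtration P "joint_filtration P W Y" T W' by (rule W'(1))
  interpret Y': continuous_brownian_filtration P "joint_filtration P W Y" T Y' by (rule Y'(1))
  have "two_driver_system P (joint_filtration P W Y) T W' Y'" ..
  then show ?thesis using W'(2) Y'(2) that by blast
qed

end

section \<open>Existence of the state\<close>

lemma bounded_bilinear_matrix_vector_mult:
  "bounded_bilinear ((*v) :: real ^ 'k ^ 'n \<Rightarrow> real ^ 'k \<Rightarrow> real ^ 'n)"
  unfolding bilinear_conv_bounded_bilinear[symmetric] bilinear_def
  by (auto intro!: linearI simp: matrix_vector_mult_add_rdistrib matrix_vector_right_distrib
      scaleR_matrix_vector_assoc matrix_vector_mult_scaleR)

lemma bounded_measurable_onD:
  fixes k :: "real \<Rightarrow> 'b::euclidean_space"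
  assumes "bounded_measurable_on T k"
  shows "k \<in> borel_measurable (lborel_upto T)" "\<exists>C\<ge>0. \<forall>t\<in>{0..T}. norm (k t) \<le> C"
proof -
  show "k \<in> borel_measurable (lborel_upto T)"
    using assms unfolding bounded_measurable_on_def
    by (subst measurable_cong_sets[OF sets_restrict_space_cong[OF sets_lborel] refl]) simp
  obtain C where "\<forall>x\<in>k ` {0..T}. norm x \<le> C"
    using assms unfolding bounded_measurable_on_def bounded_iff by blast
  then have "\<forall>t\<in>{0..T}. norm (k t) \<le> max C 0" by (auto simp: le_max_iff_disj)
  then show "\<exists>C\<ge>0. \<forall>t\<in>{0..T}. norm (k t) \<le> C" by (intro exI[of _ "max C 0"]) simp
qed

text \<open>A bounded coefficient acts on vectors with a bound uniform in time. The bilinear map is left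
  arbitrary because coefficients act as matrices, as transposed matrices, as scalars and by inner
  products.\<close>

lemma bilinear_uniform_bound:
  fixes k :: "real \<Rightarrow> 'b::euclidean_space" and prod :: "'b \<Rightarrow> 'c::euclidean_space \<Rightarrow> 'd::euclidean_space"
  assumes "bounded_bilinear prod" "bounded_measurable_on T k"
  obtains C where "0 \<le> C" "\<And>t x. t \<in> {0..T} \<Longrightarrow> norm (prod (k t) x) \<le> C * norm x"
proof -
  obtain K where K: "0 \<le> K" "\<And>a b. norm (prod a b) \<le> norm a * norm b * K"
    using bounded_bilinear.nonneg_bounded[OF assms(1)] by blast
  obtain C where C: "0 \<le> C" "\<forall>t\<in>{0..T}. norm (k t) \<le> C" using bounded_measurable_onD(2)[OF assms(2)] by blast
  show ?thesis
  proof (rule that[of "C * K"])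
    show "0 \<le> C * K" using K(1) C(1) by simp
    fix t :: real and x :: 'c assume "t \<in> {0..T}"
    then have "norm (k t) * norm x * K \<le> C * norm x * K"
      using C K(1) by (intro mult_right_mono) auto
    then show "norm (prod (k t) x) \<le> C * K * norm x" using K(2)[of "k t" x] by (simp add: mult_ac)
  qed
qed

lemma borel_measurable_bilinear:
  fixes prod :: "'b::euclidean_space \<Rightarrow> 'c::euclidean_space \<Rightarrow> 'd::euclidean_space"
  assumes "bounded_bilinear prod" "f \<in> borel_measurable M" "g \<in> borel_measurable M"
  shows "(\<lambda>x. prod (f x) (g x)) \<in> borel_measurable M"
  by (rule borel_measurable_continuous_Pair[OF assms(2,3)])
     (intro bounded_bilinear.continuous_on[OF assms(1)] continuous_intros)

lemma l2sq_le_mult: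
  fixes f :: "'b \<Rightarrow> 'a::euclidean_space" and g :: "'b \<Rightarrow> 'c::euclidean_space"
  assumes [measurable]: "g \<in> borel_measurable M" and le: "\<And>x. x \<in> space M \<Longrightarrow> norm (f x) \<le> C * norm (g x)" and "0 \<le> C"
  shows "l2sq M f \<le> ennreal (C\<^sup>2) * l2sq M g"
proof -
  have "l2sq M f \<le> l2sq M (\<lambda>x. C *\<^sub>R g x)"
    using le \<open>0 \<le> C\<close> by (intro l2sq_mono_AE AE_I2) simp
  then show ?thesis by (simp add: l2sq_scaleR)
qed

context filtered_prob_space
begin

lemma energy_le_mult:
  assumes "joint_measurable P T \<psi>" "t \<le> T" "\<And>s. s \<in> {0..t} \<Longrightarrow> l2sq P (\<phi> s) \<le> c * l2sq P (\<psi> s)"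
  shows "energy P t \<phi> \<le> c * energy P t \<psi>"
proof -
  have "energy P t \<phi> \<le> (\<integral>\<^sup>+s. c * l2sq P (\<psi> s) \<partial>lborel_upto t)" using assms(3) by (rule energy_le)
  also have "\<dots> = c * energy P t \<psi>"
    unfolding energy_def
    by (rule nn_integral_cmult[OF l2sq_section_measurable[OF joint_measurable_upto[OF assms(1,2)]]])
  finally show ?thesis .
qed

lemma M2_bilinear:
  fixes k :: "real \<Rightarrow> 'b::euclidean_space" and prod :: "'b \<Rightarrow> 'c::euclidean_space \<Rightarrow> 'd::euclidean_space"
  assumes prod: "bounded_bilinear prod" and k: "bounded_measurable_on T k" and \<phi>: "\<phi> \<in> M2"
  shows "(\<lambda>t \<omega>. prod (k t) (\<phi> t \<omega>)) \<in> M2"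
proof -
  obtain C where C: "0 \<le> C" "\<And>t x. t \<in> {0..T} \<Longrightarrow> norm (prod (k t) x) \<le> C * norm x"
    by (rule bilinear_uniform_bound[OF prod k]) blast
  have "(\<lambda>z. prod (k (fst z)) (case_prod \<phi> z)) \<in> borel_measurable (lborel_upto T \<Otimes>\<^sub>M P)"
    using M2D(1)[OF \<phi>] bounded_measurable_onD(1)[OF k] unfolding joint_measurable_def
    by (intro borel_measurable_bilinear[OF prod] measurable_compose[OF measurable_fst]) auto
  then have j: "joint_measurable P T (\<lambda>t \<omega>. prod (k t) (\<phi> t \<omega>))"
    unfolding joint_measurable_def by (simp add: case_prod_beta')
  have "energy P T (\<lambda>t \<omega>. prod (k t) (\<phi> t \<omega>)) \<le> ennreal (C\<^sup>2) * energy P T \<phi>"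
    using M2D(4)[OF \<phi>] C by (intro energy_le_mult M2D(1)[OF \<phi>] l2sq_le_mult) auto
  also have "\<dots> < \<infinity>" using M2D(3)[OF \<phi>] by (simp add: ennreal_mult_less_top)
  finally show ?thesis
    unfolding M2_iff using j M2D(2)[OF \<phi>] by (auto intro!: borel_measurable_bilinear[OF prod])
qed

lemma l2sq_expectation_le: "l2sq P (\<lambda>\<omega>. expectation f) \<le> l2sq P (f :: 'w \<Rightarrow> 'a::euclidean_space)"
  using norm_integral_sq_le[of P f] by (simp add: l2sq_def emeasure_space_1)

lemma expectation_measurable:
  assumes "joint_measurable P T \<phi>"
  shows "(\<lambda>t. expectation (\<phi> t)) \<in> borel_measurable (lborel_upto T)"
proof -
  have [measurable]: "case_prod \<phi> \<in> borel_measurable (lborel_upto T \<Otimes>\<^sub>M P)"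
    using assms by (simp add: joint_measurable_def)
  have "(\<lambda>t. expectation (\<lambda>\<omega>. case_prod \<phi> (t, \<omega>))) \<in> borel_measurable (lborel_upto T)"
    by (rule borel_measurable_lebesgue_integral) measurable
  then show ?thesis by simp
qed

lemma M2_expectation:
  assumes \<phi>: "\<phi> \<in> M2"
  shows "(\<lambda>t \<omega>. expectation (\<phi> t)) \<in> M2"
proof -
  have "energy P T (\<lambda>t \<omega>. expectation (\<phi> t)) \<le> 1 * energy P T \<phi>"
    using l2sq_expectation_le by (intro energy_le_mult M2D(1)[OF \<phi>]) auto
  then have "energy P T (\<lambda>t \<omega>. expectation (\<phi> t)) < \<infinity>" using M2D(3)[OF \<phi>] by simp
  then show ?thesis
    unfolding M2_iff using joint_measurable_deterministic[OF expectation_measurable[OF M2D(1)[OF \<phi>]]] by auto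
qed

lemma M2_matrix:
  fixes K :: "real \<Rightarrow> real ^ 'k::finite ^ 'n::finite"
  shows "bounded_measurable_on T K \<Longrightarrow> \<phi> \<in> M2 \<Longrightarrow> (\<lambda>t \<omega>. K t *v \<phi> t \<omega>) \<in> M2"
  by (rule M2_bilinear[OF bounded_bilinear_matrix_vector_mult])

lemma M2_mf_linear:
  assumes "bounded_measurable_on T K1" "bounded_measurable_on T K2" "bounded_measurable_on T L11"
    "bounded_measurable_on T L12" "bounded_measurable_on T L21" "bounded_measurable_on T L22"
    and "X \<in> M2" "u1 \<in> M2" "u2 \<in> M2"
  shows "mf_linear P K1 K2 L11 L12 L21 L22 X u1 u2 \<in> M2"
  unfolding mf_linear_def[abs_def] using assms
  by (intro M2_add M2_matrix M2_expectation)

lemma S2_integrable: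
  assumes "X \<in> S2" "t \<in> {0..T}"
  shows "integrable P (X t)"
proof -
  obtain C where "l2sq P (X t) \<le> ennreal C" using assms unfolding S2_def by blast
  then have "l2sq P (X t) < \<infinity>" by (rule order_le_less_trans) simp
  then show ?thesis using M2D(4)[OF S2_M2[OF assms(1)] assms(2)] by (intro l2_imp_integrable) unfold_locales
qed

text \<open>The control terms cancel in the difference, and the mean of a random vector is dominated by its
  second moment, so mean-field terms are no worse than ordinary ones.\<close>

lemma mf_linear_Lipschitz:
  fixes K1 K2 :: "real \<Rightarrow> real ^ 'n::finite ^ 'n"
    and L11 L12 :: "real \<Rightarrow> real ^ 'k1::finite ^ 'n" and L21 L22 :: "real \<Rightarrow> real ^ 'k2::finite ^ 'n"
  assumes "bounded_measurable_on T K1" "bounded_measurable_on T K2"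
  obtains L where "0 \<le> L" "\<And>X Z t. X \<in> S2 \<Longrightarrow> Z \<in> S2 \<Longrightarrow> t \<in> {0..T} \<Longrightarrow>
    energy P t (\<lambda>s \<omega>. mf_linear P K1 K2 L11 L12 L21 L22 X u1 u2 s \<omega> - mf_linear P K1 K2 L11 L12 L21 L22 Z u1 u2 s \<omega>)
      \<le> ennreal L * energy P t (\<lambda>s \<omega>. X s \<omega> - Z s \<omega>)"
proof -
  obtain C1 where C1: "0 \<le> C1" "\<And>t x. t \<in> {0..T} \<Longrightarrow> norm (K1 t *v x) \<le> C1 * norm x"
    by (rule bilinear_uniform_bound[OF bounded_bilinear_matrix_vector_mult assms(1)]) blast
  obtain C2 where C2: "0 \<le> C2" "\<And>t x. t \<in> {0..T} \<Longrightarrow> norm (K2 t *v x) \<le> C2 * norm x"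
    by (rule bilinear_uniform_bound[OF bounded_bilinear_matrix_vector_mult assms(2)]) blast
  show ?thesis
  proof (rule that[of "2 * C1\<^sup>2 + 2 * C2\<^sup>2"])
    fix X Z :: "real \<Rightarrow> 'w \<Rightarrow> real ^ 'n" and t assume X: "X \<in> S2" and Z: "Z \<in> S2" and t: "t \<in> {0..T}"
    note j = joint_measurable_add(2)[OF M2D(1)[OF S2_M2[OF X]] M2D(1)[OF S2_M2[OF Z]]]
    show "energy P t (\<lambda>s \<omega>. mf_linear P K1 K2 L11 L12 L21 L22 X u1 u2 s \<omega> - mf_linear P K1 K2 L11 L12 L21 L22 Z u1 u2 s \<omega>)
      \<le> ennreal (2 * C1\<^sup>2 + 2 * C2\<^sup>2) * energy P t (\<lambda>s \<omega>. X s \<omega> - Z s \<omega>)"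
    proof (rule energy_le_mult[OF j])
      show "t \<le> T" using t by simp
      fix s assume "s \<in> {0..t}"
      then have s: "s \<in> {0..T}" using t by auto
      let ?d = "\<lambda>\<omega>. X s \<omega> - Z s \<omega>"
      have d[measurable]: "?d \<in> borel_measurable P" using joint_measurable_section[OF j s] .
      have E: "expectation (X s) - expectation (Z s) = expectation ?d"
        using S2_integrable[OF X s] S2_integrable[OF Z s] by simp
      have "mf_linear P K1 K2 L11 L12 L21 L22 X u1 u2 s \<omega> - mf_linear P K1 K2 L11 L12 L21 L22 Z u1 u2 s \<omega>
         = K1 s *v ?d \<omega> + K2 s *v expectation ?d" for \<omega>
        unfolding mf_linear_def E[symmetric] by (simp add: matrix_vector_mult_diff_distrib)
      then have "l2sq P (\<lambda>\<omega>. mf_linear P K1 K2 L11 L12 L21 L22 X u1 u2 s \<omega> - mf_linear P K1 K2 L11 L12 L21 L22 Z u1 u2 s \<omega>)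
         = l2sq P (\<lambda>\<omega>. K1 s *v ?d \<omega> + K2 s *v expectation ?d)" by simp
      also have "\<dots> \<le> 2 * l2sq P (\<lambda>\<omega>. K1 s *v ?d \<omega>) + 2 * l2sq P (\<lambda>\<omega>. K2 s *v expectation ?d)"
        by (intro l2sq_add borel_measurable_bilinear[OF bounded_bilinear_matrix_vector_mult]) auto
      also have "\<dots> \<le> 2 * (ennreal (C1\<^sup>2) * l2sq P ?d) + 2 * (ennreal (C2\<^sup>2) * l2sq P ?d)"
      proof (intro add_mono mult_left_mono)
        show "l2sq P (\<lambda>\<omega>. K1 s *v ?d \<omega>) \<le> ennreal (C1\<^sup>2) * l2sq P ?d"
          using C1(2)[OF s] C1(1) by (intro l2sq_le_mult) auto
        have "l2sq P (\<lambda>\<omega>. K2 s *v expectation ?d) \<le> ennreal (C2\<^sup>2) * l2sq P (\<lambda>\<omega>. expectation ?d)"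
          using C2(2)[OF s] C2(1) by (intro l2sq_le_mult) auto
        also have "\<dots> \<le> ennreal (C2\<^sup>2) * l2sq P ?d" by (intro mult_left_mono l2sq_expectation_le) simp
        finally show "l2sq P (\<lambda>\<omega>. K2 s *v expectation ?d) \<le> ennreal (C2\<^sup>2) * l2sq P ?d" .
      qed simp_all
      also have "\<dots> = ennreal (2 * C1\<^sup>2 + 2 * C2\<^sup>2) * l2sq P ?d"
        by (simp add: ennreal_mult' distrib_right mult.assoc)
      finally show "l2sq P (\<lambda>\<omega>. mf_linear P K1 K2 L11 L12 L21 L22 X u1 u2 s \<omega> - mf_linear P K1 K2 L11 L12 L21 L22 Z u1 u2 s \<omega>)
        \<le> ennreal (2 * C1\<^sup>2 + 2 * C2\<^sup>2) * l2sq P ?d" .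
    qed
  qed simp
qed

end

lemma assumption_L1D:
  assumes "assumption_L1 T c"
  shows "bounded_measurable_on T (A1 c)" "bounded_measurable_on T (A2 c)"
     "bounded_measurable_on T (C1 c)" "bounded_measurable_on T (C2 c)"
     "bounded_measurable_on T (F1 c)" "bounded_measurable_on T (F2 c)"
     "bounded_measurable_on T (B11 c)" "bounded_measurable_on T (B12 c)"
     "bounded_measurable_on T (D11 c)" "bounded_measurable_on T (D12 c)"
     "bounded_measurable_on T (G11 c)" "bounded_measurable_on T (G12 c)"
     "bounded_measurable_on T (B21 c)" "bounded_measurable_on T (B22 c)"
     "bounded_measurable_on T (D21 c)" "bounded_measurable_on T (D22 c)"
     "bounded_measurable_on T (G21 c)" "bounded_measurable_on T (G22 c)"
     "bounded_measurable_on T (N11 c)" "bounded_measurable_on T (N12 c)"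
     "bounded_measurable_on T (N21 c)" "bounded_measurable_on T (N22 c)"
     "bounded_measurable_on T (Q_run c)" "bounded_measurable_on T (h_obs c)"
  using assms unfolding assumption_L1_def by blast+

context two_brownian_basis
begin

lemma admissible_M2: "u \<in> admissible P T Y \<Longrightarrow> u \<in> M2"
proof -
  assume u: "u \<in> admissible P T Y"
  have "u t \<in> borel_measurable (joint_filtration P W Y t)" if t: "t \<in> {0..T}" for t
  proof -
    have b: "\<And>s. s \<in> {0..t} \<Longrightarrow> W s \<in> borel_measurable P" "\<And>s. s \<in> {0..t} \<Longrightarrow> Y s \<in> borel_measurable P"
      using brownian_motion_onD(1)[OF brownian_W] brownian_motion_onD(1)[OF brownian_Y] t by auto
    have "sets (completed_natural_filtration P Y t) \<subseteq> sets (joint_filtration P W Y t)"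
      by (rule sets_joint_filtration(5)) (use b in auto)
    moreover have "space (completed_natural_filtration P Y t) = space P"
      by (rule sets_completed_natural_filtration(3)) (use b in auto)
    ultimately have "subalgebra (joint_filtration P W Y t) (completed_natural_filtration P Y t)"
      using space_F[OF t] by (simp add: subalgebra_def)
    moreover have "u t \<in> borel_measurable (completed_natural_filtration P Y t)"
      using u t by (simp add: admissible_def M2_space_def)
    ultimately show ?thesis by (rule measurable_from_subalg)
  qed
  then show "u \<in> M2" using u unfolding admissible_def M2_space_def by blast
qed

text \<open>The observation noise is \<open>dY - h dt\<close>, so the state equation is an equation driven by \<open>W\<close> and \<open>Y\<close>
  whose drift is \<open>drift - h * diffusion_obs\<close>. It is solved for continuous versions of the two motions;
  altering a motion on a set of measure zero does not affect the integrals.\<close>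

theorem state_exists:
  fixes c :: "('n::finite, 'k1::finite, 'k2::finite) lq_data"
  assumes c: "assumption_L1 T c" and u: "u1 \<in> M2" "u2 \<in> M2"
  shows "\<exists>X. is_state P T W Y c u1 u2 X"
proof -
  obtain W' Y' where sys: "two_driver_system P (joint_filtration P W Y) T W' Y'"
    and W': "AE \<omega> in P. \<forall>t. W' t \<omega> = W t \<omega>" and Y': "AE \<omega> in P. \<forall>t. Y' t \<omega> = Y t \<omega>"
    by (rule continuous_versions)
  interpret sys: two_driver_system P "joint_filtration P W Y" T W' Y' by (rule sys)
  note c = assumption_L1D[OF c]
  let ?dr = "\<lambda>X. drift P c X u1 u2" and ?s1 = "\<lambda>X. diffusion_W P c X u1 u2" and ?s2 = "\<lambda>X. diffusion_obs P c X u1 u2"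
  let ?h = "\<lambda>\<phi> t \<omega>. h_obs c t *\<^sub>R (\<phi> t \<omega> :: real ^ 'n)"
  let ?b = "\<lambda>X t \<omega>. ?dr X t \<omega> - ?h (?s2 X) t \<omega>"
  have dr: "?dr X \<in> M2" and s1: "?s1 X \<in> M2" and s2: "?s2 X \<in> M2" if "X \<in> M2" for X
    unfolding drift_def diffusion_W_def diffusion_obs_def using that u c by (auto intro!: M2_mf_linear)
  have h: "?h \<phi> \<in> M2" if "\<phi> \<in> M2" for \<phi>
    by (rule M2_bilinear[OF bounded_bilinear_scaleR c(24) that])
  have b: "?b X \<in> M2" if "X \<in> M2" for X by (intro M2_diff dr h s2 that)
  obtain La where La: "0 \<le> La" "\<And>X Z t. X \<in> S2 \<Longrightarrow> Z \<in> S2 \<Longrightarrow> t \<in> {0..T} \<Longrightarrow>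
    energy P t (\<lambda>s \<omega>. ?dr X s \<omega> - ?dr Z s \<omega>) \<le> ennreal La * energy P t (\<lambda>s \<omega>. X s \<omega> - Z s \<omega>)"
    unfolding drift_def by (rule mf_linear_Lipschitz[OF c(1,2)]) blast
  obtain Lb where Lb: "0 \<le> Lb" "\<And>X Z t. X \<in> S2 \<Longrightarrow> Z \<in> S2 \<Longrightarrow> t \<in> {0..T} \<Longrightarrow>
    energy P t (\<lambda>s \<omega>. ?s1 X s \<omega> - ?s1 Z s \<omega>) \<le> ennreal Lb * energy P t (\<lambda>s \<omega>. X s \<omega> - Z s \<omega>)"
    unfolding diffusion_W_def by (rule mf_linear_Lipschitz[OF c(3,4)]) blast
  obtain Lc where Lc: "0 \<le> Lc" "\<And>X Z t. X \<in> S2 \<Longrightarrow> Z \<in> S2 \<Longrightarrow> t \<in> {0..T} \<Longrightarrow>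
    energy P t (\<lambda>s \<omega>. ?s2 X s \<omega> - ?s2 Z s \<omega>) \<le> ennreal Lc * energy P t (\<lambda>s \<omega>. X s \<omega> - Z s \<omega>)"
    unfolding diffusion_obs_def by (rule mf_linear_Lipschitz[OF c(5,6)]) blast
  obtain H where H: "0 \<le> H" "\<And>t x. t \<in> {0..T} \<Longrightarrow> norm (h_obs c t *\<^sub>R (x :: real ^ 'n)) \<le> H * norm x"
    by (rule bilinear_uniform_bound[OF bounded_bilinear_scaleR c(24)]) blast
  \<comment> \<open>A common Lipschitz constant for the drift, which involves \<open>h * diffusion_obs\<close>, and both diffusions.\<close>
  define L where "L = (2 * La + 2 * H\<^sup>2 * Lc) + Lb + Lc"
  have L: "0 \<le> L" "2 * La + 2 * H\<^sup>2 * Lc \<le> L" "Lb \<le> L" "Lc \<le> L"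
    using La(1) Lb(1) Lc(1) by (simp_all add: L_def)
  have mono: "x \<le> ennreal L * y" if "x \<le> ennreal L' * y" "L' \<le> L" for x y L'
    using that by (meson ennreal_leI mult_right_mono order_trans zero_le)
  obtain X I_W I_Y where X: "X \<in> M2" "AE \<omega> in P. continuous_on {0..T} (\<lambda>t. X t \<omega>)"
    "has_ito_integral P (joint_filtration P W Y) T W' (?s1 X) I_W"
    "has_ito_integral P (joint_filtration P W Y) T Y' (?s2 X) I_Y"
    "\<And>t. t \<in> {0..T} \<Longrightarrow> AE \<omega> in P. X t \<omega> = x_init c + (LBINT s:{0..t}. ?b X s \<omega>) + I_W t \<omega> + I_Y t \<omega>"
  proof (rule sys.sde_solution_exists[where b = ?b and ?s1.0 = ?s1 and ?s2.0 = ?s2 and L = L and ?x0.0 = "x_init c"])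
    fix X Z :: "real \<Rightarrow> 'w \<Rightarrow> real ^ 'n" and t assume XZ: "X \<in> S2" "Z \<in> S2" and t: "t \<in> {0..T}"
    let ?E = "energy P t (\<lambda>s \<omega>. X s \<omega> - Z s \<omega>)"
    note XM = S2_M2[OF XZ(1)] and ZM = S2_M2[OF XZ(2)]
    show "energy P t (\<lambda>s \<omega>. ?s1 X s \<omega> - ?s1 Z s \<omega>) \<le> ennreal L * ?E"
      by (rule mono[OF Lb(2)[OF XZ t] L(3)])
    show "energy P t (\<lambda>s \<omega>. ?s2 X s \<omega> - ?s2 Z s \<omega>) \<le> ennreal L * ?E"
      by (rule mono[OF Lc(2)[OF XZ t] L(4)])
    have jd: "joint_measurable P T (\<lambda>s \<omega>. ?dr X s \<omega> - ?dr Z s \<omega>)"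
      by (rule M2D(1)[OF M2_diff[OF dr[OF XM] dr[OF ZM]]])
    note s2d = M2_diff[OF s2[OF XM] s2[OF ZM]]
    have js: "joint_measurable P T (\<lambda>s \<omega>. ?s2 X s \<omega> - ?s2 Z s \<omega>)" by (rule M2D(1)[OF s2d])
    have jh: "joint_measurable P T (\<lambda>s \<omega>. - (h_obs c s *\<^sub>R (?s2 X s \<omega> - ?s2 Z s \<omega>)))"
      by (rule M2D(1)[OF M2_uminus[OF h[OF s2d]]])
    have "energy P t (\<lambda>s \<omega>. ?b X s \<omega> - ?b Z s \<omega>)
       = energy P t (\<lambda>s \<omega>. (?dr X s \<omega> - ?dr Z s \<omega>) + - (h_obs c s *\<^sub>R (?s2 X s \<omega> - ?s2 Z s \<omega>)))"
      by (simp add: algebra_simps)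
    also have "\<dots> \<le> 2 * energy P t (\<lambda>s \<omega>. ?dr X s \<omega> - ?dr Z s \<omega>)
        + 2 * energy P t (\<lambda>s \<omega>. - (h_obs c s *\<^sub>R (?s2 X s \<omega> - ?s2 Z s \<omega>)))"
      by (rule energy_add[OF jd jh]) (use t in simp)
    also have "\<dots> \<le> 2 * (ennreal La * ?E) + 2 * (ennreal (H\<^sup>2) * (ennreal Lc * ?E))"
      unfolding energy_uminus
    proof (intro add_mono mult_left_mono)
      show "energy P t (\<lambda>s \<omega>. ?dr X s \<omega> - ?dr Z s \<omega>) \<le> ennreal La * ?E" by (rule La(2)[OF XZ t])
      have "energy P t (\<lambda>s \<omega>. h_obs c s *\<^sub>R (?s2 X s \<omega> - ?s2 Z s \<omega>)) \<le> ennreal (H\<^sup>2) * energy P t (\<lambda>s \<omega>. ?s2 X s \<omega> - ?s2 Z s \<omega>)"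
        using H t joint_measurable_section[OF js] by (intro energy_le_mult[OF js] l2sq_le_mult) auto
      also have "\<dots> \<le> ennreal (H\<^sup>2) * (ennreal Lc * ?E)"
        by (intro mult_left_mono Lc(2)[OF XZ t]) simp
      finally show "energy P t (\<lambda>s \<omega>. h_obs c s *\<^sub>R (?s2 X s \<omega> - ?s2 Z s \<omega>)) \<le> ennreal (H\<^sup>2) * (ennreal Lc * ?E)" .
    qed simp_all
    also have "\<dots> = ennreal (2 * La + 2 * H\<^sup>2 * Lc) * ?E"
      using La(1) Lc(1) by (simp add: ennreal_mult' distrib_right mult.assoc)
    finally show "energy P t (\<lambda>s \<omega>. ?b X s \<omega> - ?b Z s \<omega>) \<le> ennreal L * ?E"
      by (rule mono[OF _ L(2)])
  qed (use b s1 s2 L(1) in blast)+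
  have eq: "AE \<omega> in P. X t \<omega> = x_init c + (LBINT s:{0..t}. ?dr X s \<omega>) + I_W t \<omega>
      + (I_Y t \<omega> - (LBINT s:{0..t}. h_obs c s *\<^sub>R ?s2 X s \<omega>))" if t: "t \<in> {0..T}" for t
    using X(5)[OF t] time_integral_diff(1)[OF dr[OF X(1)] h[OF s2[OF X(1)]] t]
    by eventually_elim simp
  let ?O = "\<lambda>t \<omega>. I_Y t \<omega> - (LBINT s:{0..t}. h_obs c s *\<^sub>R ?s2 X s \<omega>)"
  have W: "has_ito_integral P (joint_filtration P W Y) T W (?s1 X) I_W"
    by (rule has_ito_integral_modification[OF W' X(3)])
  have "has_ito_integral P (joint_filtration P W Y) T Y (?s2 X) I_Y"
    by (rule has_ito_integral_modification[OF Y' X(4)])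
  then have obs: "has_obs_noise_integral P (joint_filtration P W Y) T Y (h_obs c) (?s2 X) ?O"
    unfolding has_obs_noise_integral_def by (intro exI[of _ I_Y] conjI ballI) simp_all
  have "is_state P T W Y c u1 u2 X"
    unfolding is_state_def
    by (rule conjI[OF X(1) conjI[OF X(2)]], rule exI[of _ I_W], rule exI[of _ ?O]) (intro conjI W obs ballI eq)
  then show ?thesis by blast
qed

end

section \<open>Duality with the adjoint equation\<close>

lemma bounded_measurable_onI:
  fixes k :: "real \<Rightarrow> 'b::euclidean_space"
  assumes "k \<in> borel_measurable (lborel_upto T)" "\<And>t. t \<in> {0..T} \<Longrightarrow> norm (k t) \<le> C"
  shows "bounded_measurable_on T k"
  unfolding bounded_measurable_on_def
proof
  show "k \<in> borel_measurable (restrict_space borel {0..T})"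
    using assms(1) by (subst measurable_cong_sets[OF sets_restrict_space_cong[OF sets_lborel[symmetric]] refl])
  show "bounded (k ` {0..T})" using assms(2) by (auto simp: bounded_iff intro!: exI[of _ C])
qed

lemma bounded_measurable_on_bilinear:
  fixes f :: "real \<Rightarrow> 'b::euclidean_space" and g :: "real \<Rightarrow> 'c::euclidean_space" and prod :: "'b \<Rightarrow> 'c \<Rightarrow> 'd::euclidean_space"
  assumes "bounded_bilinear prod" "bounded_measurable_on T f" "bounded_measurable_on T g"
  shows "bounded_measurable_on T (\<lambda>t. prod (f t) (g t))"
proof -
  obtain C where C: "0 \<le> C" "\<And>t x. t \<in> {0..T} \<Longrightarrow> norm (prod (f t) x) \<le> C * norm x"
    by (rule bilinear_uniform_bound[OF assms(1,2)]) blast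
  obtain D where D: "0 \<le> D" "\<forall>t\<in>{0..T}. norm (g t) \<le> D" using bounded_measurable_onD(2)[OF assms(3)] by blast
  show ?thesis
  proof (rule bounded_measurable_onI[where C = "C * D"])
    show "(\<lambda>t. prod (f t) (g t)) \<in> borel_measurable (lborel_upto T)"
      by (rule borel_measurable_bilinear[OF assms(1) bounded_measurable_onD(1)[OF assms(2)] bounded_measurable_onD(1)[OF assms(3)]])
    show "norm (prod (f t) (g t)) \<le> C * D" if "t \<in> {0..T}" for t
      using C D that by (intro order_trans[OF C(2)[OF that]] mult_left_mono) auto
  qed
qed

lemma bounded_measurable_on_add:
  fixes f g :: "real \<Rightarrow> 'b::euclidean_space"
  assumes "bounded_measurable_on T f" "bounded_measurable_on T g"
  shows "bounded_measurable_on T (\<lambda>t. f t + g t)" "bounded_measurable_on T (\<lambda>t. f t - g t)"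
proof -
  obtain C where C: "\<forall>t\<in>{0..T}. norm (f t) \<le> C" using bounded_measurable_onD(2)[OF assms(1)] by blast
  obtain D where D: "\<forall>t\<in>{0..T}. norm (g t) \<le> D" using bounded_measurable_onD(2)[OF assms(2)] by blast
  note m = bounded_measurable_onD(1)[OF assms(1)] bounded_measurable_onD(1)[OF assms(2)]
  show "bounded_measurable_on T (\<lambda>t. f t + g t)"
    by (rule bounded_measurable_onI[where C = "C + D"])
       (use m C D in \<open>auto intro!: borel_measurable_add order_trans[OF norm_triangle_ineq] add_mono\<close>)
  show "bounded_measurable_on T (\<lambda>t. f t - g t)"
    by (rule bounded_measurable_onI[where C = "C + D"])
       (use m C D in \<open>auto intro!: borel_measurable_diff order_trans[OF norm_triangle_ineq4] add_mono\<close>)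
qed

lemma bounded_measurable_on_reflect:
  fixes f :: "real \<Rightarrow> 'b::euclidean_space"
  assumes "bounded_measurable_on T f"
  shows "bounded_measurable_on T (\<lambda>t. f (T - t))"
proof -
  obtain C where C: "\<forall>t\<in>{0..T}. norm (f t) \<le> C" using bounded_measurable_onD(2)[OF assms] by blast
  show ?thesis
  proof (rule bounded_measurable_onI[where C = C])
    have "(\<lambda>t. T - t) \<in> measurable (lborel_upto T) (lborel_upto T)"
      by (rule measurable_restrict_space3) auto
    then show "(\<lambda>t. f (T - t)) \<in> borel_measurable (lborel_upto T)"
      by (rule measurable_compose[OF _ bounded_measurable_onD(1)[OF assms]])
  qed (use C in auto)
qed

lemma bounded_bilinear_transpose_mult:
  "bounded_bilinear (\<lambda>(A :: real ^ 'k ^ 'n) x. transpose A *v x)"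
  unfolding bilinear_conv_bounded_bilinear[symmetric] bilinear_def
  by (auto intro!: linearI simp: matrix_vector_mult_def transpose_def vec_eq_iff sum.distrib sum_distrib_left algebra_simps)

lemma set_integral_from:
  fixes f :: "real \<Rightarrow> 'a::euclidean_space"
  assumes "0 \<le> t"
  shows "(LBINT s:{t..T}. f s) = (\<integral>s. (if t \<le> s then f s else 0) \<partial>lborel_upto T)"
  using assms
  by (auto simp: set_lebesgue_integral_def integral_restrict_space indicator_def intro!: Bochner_Integration.integral_cong)

lemma set_integral_reflect:
  fixes f :: "real \<Rightarrow> 'a::euclidean_space"
  shows "(LBINT s:{0..T - t}. f (T - s)) = (LBINT s:{t..T}. f s)"
proof -
  have "(LBINT s:{t..T}. f s) = (\<integral>s. indicator {t..T} (T + - 1 * s) *\<^sub>R f (T + - 1 * s) \<partial>lborel)"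
    unfolding set_lebesgue_integral_def
    by (subst lborel_integral_real_affine[where c = "-1" and t = T]) simp_all
  also have "\<dots> = (LBINT s:{0..T - t}. f (T - s))"
    unfolding set_lebesgue_integral_def by (intro Bochner_Integration.integral_cong) (auto simp: indicator_def)
  finally show ?thesis ..
qed

text \<open>Fubini's theorem on the triangle \<open>0 \<le> s \<le> t \<le> T\<close>; for absolutely continuous functions this is
  integration by parts.\<close>

lemma double_integral_swap:
  fixes G H :: "real \<Rightarrow> 'a::euclidean_space"
  assumes G: "integrable (lborel_upto T) G" and H: "integrable (lborel_upto T) H"
  shows "(\<integral>t. H t \<bullet> (LBINT s:{0..t}. G s) \<partial>lborel_upto T) = (\<integral>s. G s \<bullet> (LBINT t:{s..T}. H t) \<partial>lborel_upto T)"
proof -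
  let ?L = "lborel_upto T"
  interpret L: finite_measure ?L by (rule finite_measure_lborel_upto)
  interpret LL: pair_sigma_finite ?L ?L ..
  note [measurable] = borel_measurable_integrable[OF G] borel_measurable_integrable[OF H]
  have id[measurable]: "(\<lambda>t. t) \<in> borel_measurable ?L" by (intro measurable_restrict_space1) simp
  have [measurable]: "fst \<in> borel_measurable (?L \<Otimes>\<^sub>M ?L)" "snd \<in> borel_measurable (?L \<Otimes>\<^sub>M ?L)"
    by (rule measurable_compose[OF measurable_fst id] measurable_compose[OF measurable_snd id])+
  let ?f = "\<lambda>t s. if s \<le> t then H t \<bullet> G s else 0"
  have m: "case_prod ?f \<in> borel_measurable (?L \<Otimes>\<^sub>M ?L)"
    unfolding case_prod_beta' by measurable
  have "integrable (?L \<Otimes>\<^sub>M ?L) (\<lambda>z. norm (H (fst z)) * norm (G (snd z)))"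
  proof (rule LL.Fubini_integrable)
    show "integrable ?L (\<lambda>x. \<integral>y. norm (norm (H (fst (x, y))) * norm (G (snd (x, y)))) \<partial>?L)"
      using H by simp
    show "AE x in ?L. integrable ?L (\<lambda>y. norm (H (fst (x, y))) * norm (G (snd (x, y))))"
      using G by simp
  qed measurable
  then have int: "integrable (?L \<Otimes>\<^sub>M ?L) (case_prod ?f)"
    by (rule Bochner_Integration.integrable_bound[OF _ m]) (auto simp: Cauchy_Schwarz_ineq2)
  have "(\<integral>t. H t \<bullet> (LBINT s:{0..t}. G s) \<partial>?L) = (\<integral>t. (\<integral>s. ?f t s \<partial>?L) \<partial>?L)"
  proof (intro Bochner_Integration.integral_cong refl)
    fix t assume "t \<in> space ?L"
    then have t: "0 \<le> t" "t \<le> T" by (auto simp: space_restrict_space)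
    have i: "integrable ?L (\<lambda>s. if s \<le> t then G s else 0)"
      by (rule Bochner_Integration.integrable_bound[OF G]) auto
    have "H t \<bullet> (\<integral>s. (if s \<le> t then G s else 0) \<partial>?L) = (\<integral>s. H t \<bullet> (if s \<le> t then G s else 0) \<partial>?L)"
      by (rule integral_inner_right[symmetric]) (rule i)
    also have "\<dots> = (\<integral>s. ?f t s \<partial>?L)" by (intro Bochner_Integration.integral_cong) auto
    finally show "H t \<bullet> (LBINT s:{0..t}. G s) = (\<integral>s. ?f t s \<partial>?L)"
      using set_integral_upto[OF t(2), of G] by simp
  qed
  also have "\<dots> = (\<integral>s. (\<integral>t. ?f t s \<partial>?L) \<partial>?L)" by (rule LL.Fubini_integral[OF int, symmetric])
  also have "\<dots> = (\<integral>s. G s \<bullet> (LBINT t:{s..T}. H t) \<partial>?L)"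
  proof (intro Bochner_Integration.integral_cong refl)
    fix s assume "s \<in> space ?L"
    then have s: "0 \<le> s" by (auto simp: space_restrict_space)
    have i: "integrable ?L (\<lambda>t. if s \<le> t then H t else 0)"
      by (rule Bochner_Integration.integrable_bound[OF H]) auto
    have "G s \<bullet> (\<integral>t. (if s \<le> t then H t else 0) \<partial>?L) = (\<integral>t. G s \<bullet> (if s \<le> t then H t else 0) \<partial>?L)"
      by (rule integral_inner_right[symmetric]) (rule i)
    also have "\<dots> = (\<integral>t. ?f t s \<partial>?L)" by (intro Bochner_Integration.integral_cong) (auto simp: inner_commute)
    finally show "(\<integral>t. ?f t s \<partial>?L) = G s \<bullet> (LBINT t:{s..T}. H t)"
      using set_integral_from[OF s, of T H] by simp
  qed
  finally show ?thesis .
qed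

lemma set_integral_lborel_upto: "(LBINT s:{0..T}. f s) = (\<integral>s. f s \<partial>lborel_upto T)"
  for f :: "real \<Rightarrow> 'a::euclidean_space"
  by (simp add: set_lebesgue_integral_def integral_restrict_space)

lemma integrable_lborel_upto_bounded:
  fixes f g :: "real \<Rightarrow> 'a::euclidean_space"
  assumes "bounded_measurable_on T f" "integrable (lborel_upto T) g"
  shows "integrable (lborel_upto T) (\<lambda>t. f t \<bullet> g t)"
proof -
  obtain C where C: "\<forall>t\<in>{0..T}. norm (f t) \<le> C" using bounded_measurable_onD(2)[OF assms(1)] by blast
  show ?thesis
  proof (rule Bochner_Integration.integrable_bound)
    show "integrable (lborel_upto T) (\<lambda>t. C * norm (g t))" using assms(2) by simp
    show "(\<lambda>t. f t \<bullet> g t) \<in> borel_measurable (lborel_upto T)"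
      using bounded_measurable_onD(1)[OF assms(1)] assms(2) by auto
    show "AE t in lborel_upto T. norm (f t \<bullet> g t) \<le> norm (C * norm (g t))"
    proof (rule AE_I2)
      fix t assume "t \<in> space (lborel_upto T)"
      then have "norm (f t) \<le> C" using C by (auto simp: space_restrict_space)
      then have "norm (f t) * norm (g t) \<le> \<bar>C * norm (g t)\<bar>"
        by (intro order_trans[OF mult_right_mono[of "norm (f t)" C] abs_ge_self]) auto
      then show "norm (f t \<bullet> g t) \<le> norm (C * norm (g t))"
        using Cauchy_Schwarz_ineq2[of "f t" "g t"] by simp
    qed
  qed
qed

text \<open>In differential form, \<open>d(p \<bullet> m)\<close> is \<open>- Q \<bullet> m + p \<bullet> v\<close>, because the terms with \<open>A\<close> cancel. As \<open>m\<close> and \<open>p\<close> are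
  given by integral equations, integration by parts is replaced by \<open>double_integral_swap\<close>.\<close>

lemma linear_duality:
  fixes A :: "real \<Rightarrow> real ^ 'n::finite ^ 'n" and m p G Q v :: "real \<Rightarrow> real ^ 'n"
  assumes "0 \<le> T" and A: "bounded_measurable_on T A" and Q: "bounded_measurable_on T Q" and p_bd: "bounded_measurable_on T p"
    and G: "integrable (lborel_upto T) G"
    and m: "\<And>t. t \<in> {0..T} \<Longrightarrow> m t = x0 + (LBINT s:{0..t}. G s)"
    and m_int: "integrable (lborel_upto T) m" and v_int: "integrable (lborel_upto T) v"
    and G_eq: "AE t in lborel_upto T. G t = A t *v m t + v t"
    and p: "\<And>t. t \<in> {0..T} \<Longrightarrow> p t = M + (LBINT s:{t..T}. transpose (A s) *v p s + Q s)"
  shows "M \<bullet> m T + (\<integral>t. Q t \<bullet> m t \<partial>lborel_upto T) = x0 \<bullet> p 0 + (\<integral>t. p t \<bullet> v t \<partial>lborel_upto T)"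
proof -
  let ?L = "lborel_upto T" and ?H = "\<lambda>s. transpose (A s) *v p s + Q s"
  interpret L: finite_measure ?L by (rule finite_measure_lborel_upto)
  have Ap: "bounded_measurable_on T (\<lambda>s. transpose (A s) *v p s)"
    by (rule bounded_measurable_on_bilinear[OF bounded_bilinear_transpose_mult A p_bd])
  have H_bd: "bounded_measurable_on T ?H" by (rule bounded_measurable_on_add(1)[OF Ap Q])
  have bd_int: "integrable ?L f" if bd: "bounded_measurable_on T f" for f :: "real \<Rightarrow> real ^ 'n"
  proof -
    obtain C where "\<forall>t\<in>{0..T}. norm (f t) \<le> C" using bounded_measurable_onD(2)[OF bd] by blast
    then show ?thesis
      using bounded_measurable_onD(1)[OF bd]
      by (intro L.integrable_const_bound[where B = C] AE_I2) (auto simp: space_restrict_space)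
  qed
  note H_int = bd_int[OF H_bd]
  have spc: "t \<in> space ?L \<longleftrightarrow> t \<in> {0..T}" for t by (simp add: space_restrict_space)
  have "(\<integral>t. ?H t \<bullet> (LBINT s:{0..t}. G s) \<partial>?L) = (\<integral>t. ?H t \<bullet> m t - ?H t \<bullet> x0 \<partial>?L)"
    by (intro Bochner_Integration.integral_cong refl) (simp add: spc m inner_diff_right[symmetric])
  also have "\<dots> = (\<integral>t. ?H t \<bullet> m t \<partial>?L) - (\<integral>t. ?H t \<bullet> x0 \<partial>?L)"
    using integrable_lborel_upto_bounded[OF H_bd m_int] H_int by simp
  also have "(\<integral>t. ?H t \<bullet> x0 \<partial>?L) = (p 0 - M) \<bullet> x0"
  proof -
    have "(\<integral>t. ?H t \<bullet> x0 \<partial>?L) = (\<integral>t. ?H t \<partial>?L) \<bullet> x0" using H_int by simp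
    then show ?thesis using p[of 0] \<open>0 \<le> T\<close> set_integral_lborel_upto[of T ?H] by simp
  qed
  also have "(\<integral>t. ?H t \<bullet> m t \<partial>?L) = (\<integral>t. (transpose (A t) *v p t) \<bullet> m t \<partial>?L) + (\<integral>t. Q t \<bullet> m t \<partial>?L)"
    using integrable_lborel_upto_bounded[OF Ap m_int] integrable_lborel_upto_bounded[OF Q m_int]
    by (simp add: inner_add_left)
  finally have left: "(\<integral>t. ?H t \<bullet> (LBINT s:{0..t}. G s) \<partial>?L)
    = (\<integral>t. (transpose (A t) *v p t) \<bullet> m t \<partial>?L) + (\<integral>t. Q t \<bullet> m t \<partial>?L) - (p 0 - M) \<bullet> x0" .
  have "(\<integral>s. G s \<bullet> (LBINT t:{s..T}. ?H t) \<partial>?L) = (\<integral>s. p s \<bullet> G s - M \<bullet> G s \<partial>?L)"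
  proof (intro Bochner_Integration.integral_cong refl)
    fix s assume "s \<in> space ?L"
    then have "(LBINT t:{s..T}. ?H t) = p s - M" using p[of s] by (simp add: spc)
    then show "G s \<bullet> (LBINT t:{s..T}. ?H t) = p s \<bullet> G s - M \<bullet> G s"
      by (simp add: inner_diff_right inner_commute)
  qed
  also have "\<dots> = (\<integral>s. p s \<bullet> G s \<partial>?L) - (\<integral>s. M \<bullet> G s \<partial>?L)"
    using integrable_lborel_upto_bounded[OF p_bd G] G by simp
  also have "(\<integral>s. M \<bullet> G s \<partial>?L) = M \<bullet> (m T - x0)"
    using m[of T] \<open>0 \<le> T\<close> G set_integral_lborel_upto[of T G] by simp
  also have "(\<integral>s. p s \<bullet> G s \<partial>?L) = (\<integral>s. (transpose (A s) *v p s) \<bullet> m s + p s \<bullet> v s \<partial>?L)"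
  proof (rule integral_cong_AE)
    show "AE s in ?L. p s \<bullet> G s = (transpose (A s) *v p s) \<bullet> m s + p s \<bullet> v s"
      using G_eq
    proof eventually_elim
      case (elim s)
      have "p s \<bullet> (A s *v m s) = (transpose (A s) *v p s) \<bullet> m s"
        by (simp add: transpose_matrix_vector dot_lmul_matrix)
      then show ?case by (simp add: elim inner_add_right)
    qed
    show "(\<lambda>s. p s \<bullet> G s) \<in> borel_measurable ?L"
      using integrable_lborel_upto_bounded[OF p_bd G] by auto
    show "(\<lambda>s. (transpose (A s) *v p s) \<bullet> m s + p s \<bullet> v s) \<in> borel_measurable ?L"
      using integrable_lborel_upto_bounded[OF Ap m_int] integrable_lborel_upto_bounded[OF p_bd v_int] by auto
  qed
  also have "\<dots> = (\<integral>s. (transpose (A s) *v p s) \<bullet> m s \<partial>?L) + (\<integral>s. p s \<bullet> v s \<partial>?L)"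
    using integrable_lborel_upto_bounded[OF Ap m_int] integrable_lborel_upto_bounded[OF p_bd v_int] by simp
  finally have right: "(\<integral>s. G s \<bullet> (LBINT t:{s..T}. ?H t) \<partial>?L)
     = (\<integral>s. (transpose (A s) *v p s) \<bullet> m s \<partial>?L) + (\<integral>s. p s \<bullet> v s \<partial>?L) - M \<bullet> (m T - x0)" .
  show ?thesis
    using left right double_integral_swap[OF G H_int]
    by (simp add: inner_diff_left inner_diff_right inner_commute)
qed

context filtered_prob_space
begin

lemma M2_deterministic:
  assumes "bounded_measurable_on T f"
  shows "(\<lambda>t \<omega>. f t) \<in> M2"
proof -
  obtain C where C: "0 \<le> C" "\<forall>t\<in>{0..T}. norm (f t) \<le> C" using bounded_measurable_onD(2)[OF assms] by blast
  have "(\<lambda>t \<omega>. f t) \<in> S2"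
  proof (rule S2I[of _ "ennreal (C\<^sup>2)"])
    show "joint_measurable P T (\<lambda>t \<omega>. f t)"
      by (rule joint_measurable_deterministic[OF bounded_measurable_onD(1)[OF assms]])
    show "l2sq P (\<lambda>\<omega>. f t) \<le> ennreal (C\<^sup>2)" if "t \<in> {0..T}" for t
      using C that by (auto simp: l2sq_def emeasure_space_1 intro!: ennreal_leI power_mono)
  qed simp_all
  then show ?thesis by (rule S2_M2)
qed

text \<open>After reversal of time this is a linear initial value problem. The fixed-point theorem for processes
  applies to it as well: the right-hand side is formed with the mean of the process, and the mean of
  the fixed point is the solution.\<close>

lemma adjoint_exists:
  fixes A :: "real \<Rightarrow> real ^ 'n::finite ^ 'n" and Q :: "real \<Rightarrow> real ^ 'n"
  assumes A: "bounded_measurable_on T A" and Q: "bounded_measurable_on T Q"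
  obtains p where "bounded_measurable_on T p"
    "\<And>t. t \<in> {0..T} \<Longrightarrow> p t = M + (LBINT s:{t..T}. transpose (A s) *v p s + Q s)"
proof -
  note A' = bounded_measurable_on_reflect[OF A] and Q' = bounded_measurable_on_reflect[OF Q]
  define g where "g X s \<omega> = transpose (A (T - s)) *v expectation (X s) + Q (T - s)" for X :: "real \<Rightarrow> 'w \<Rightarrow> real ^ 'n" and s and \<omega> :: 'w
  define \<Phi> where "\<Phi> X t \<omega> = M + (LBINT s:{0..t}. g X s \<omega>)" for X t \<omega>
  have g_M2: "g X \<in> M2" if "X \<in> M2" for X
    unfolding g_def[abs_def]
    by (intro M2_add M2_bilinear[OF bounded_bilinear_transpose_mult A' M2_expectation[OF that]] M2_deterministic Q')
  obtain C where C: "0 \<le> C" "\<And>t x. t \<in> {0..T} \<Longrightarrow> norm (transpose (A (T - t)) *v x) \<le> C * norm x"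
    by (rule bilinear_uniform_bound[OF bounded_bilinear_transpose_mult A']) blast
  have S2: "\<Phi> X \<in> S2" if "X \<in> S2" for X
    unfolding \<Phi>_def[abs_def] by (intro S2_add S2_const S2_time_integral g_M2 S2_M2 that)
  have lip: "l2sq P (\<lambda>\<omega>. \<Phi> X t \<omega> - \<Phi> Z t \<omega>) \<le> ennreal (T * C\<^sup>2) * energy P t (\<lambda>s \<omega>. X s \<omega> - Z s \<omega>)"
    if X: "X \<in> S2" and Z: "Z \<in> S2" and t: "t \<in> {0..T}" for X Z t
  proof -
    note XM = S2_M2[OF X] and ZM = S2_M2[OF Z]
    note j = M2D(1)[OF M2_diff[OF XM ZM]]
    have "l2sq P (\<lambda>\<omega>. \<Phi> X t \<omega> - \<Phi> Z t \<omega>) \<le> ennreal T * energy P t (\<lambda>s \<omega>. g X s \<omega> - g Z s \<omega>)"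
      unfolding \<Phi>_def using time_integral_diff(2)[OF g_M2[OF XM] g_M2[OF ZM] t] by simp
    also have "\<dots> \<le> ennreal T * (ennreal (C\<^sup>2) * energy P t (\<lambda>s \<omega>. X s \<omega> - Z s \<omega>))"
    proof (intro mult_left_mono energy_le_mult[OF j])
      fix s assume "s \<in> {0..t}"
      then have s: "s \<in> {0..T}" using t by auto
      let ?d = "\<lambda>\<omega>. X s \<omega> - Z s \<omega>"
      have E: "g X s \<omega> - g Z s \<omega> = transpose (A (T - s)) *v expectation ?d" for \<omega>
        using S2_integrable[OF X s] S2_integrable[OF Z s]
        by (simp add: g_def matrix_vector_mult_diff_distrib)
      have "l2sq P (\<lambda>\<omega>. g X s \<omega> - g Z s \<omega>) \<le> ennreal (C\<^sup>2) * l2sq P (\<lambda>\<omega>. expectation ?d)"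
        unfolding E using C s by (intro l2sq_le_mult) auto
      also have "\<dots> \<le> ennreal (C\<^sup>2) * l2sq P ?d" by (intro mult_left_mono l2sq_expectation_le) simp
      finally show "l2sq P (\<lambda>\<omega>. g X s \<omega> - g Z s \<omega>) \<le> ennreal (C\<^sup>2) * l2sq P ?d" .
    qed (use t in auto)
    finally show ?thesis using T_pos by (simp add: ennreal_mult' mult.assoc)
  qed
  have K: "0 \<le> T * C\<^sup>2" using T_pos by simp
  obtain X where X: "X \<in> S2" and fixed: "\<And>t. t \<in> {0..T} \<Longrightarrow> AE \<omega> in P. \<Phi> X t \<omega> = X t \<omega>"
    by (rule picard_fixed_point[of \<Phi>, OF S2 K lip]) blast+
  define q where "q t = expectation (X t)" for t
  have q: "q t = M + (LBINT s:{0..t}. transpose (A (T - s)) *v q s + Q (T - s))" if t: "t \<in> {0..T}" for t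
  proof -
    let ?c = "M + (LBINT s:{0..t}. transpose (A (T - s)) *v q s + Q (T - s))"
    have "AE \<omega> in P. X t \<omega> = ?c"
      using fixed[OF t] by eventually_elim (simp add: \<Phi>_def g_def q_def)
    then have "q t = expectation (\<lambda>\<omega>. ?c)"
      unfolding q_def using M2D(4)[OF S2_M2[OF X] t] by (intro integral_cong_AE) auto
    then show ?thesis by (simp add: prob_space)
  qed
  obtain D where D: "\<forall>t\<in>{0..T}. l2sq P (X t) \<le> ennreal D" using X unfolding S2_def by blast
  have q_bd: "bounded_measurable_on T q"
  proof (rule bounded_measurable_onI[where C = "sqrt (max D 0)"])
    show "q \<in> borel_measurable (lborel_upto T)"
      unfolding q_def by (rule expectation_measurable[OF M2D(1)[OF S2_M2[OF X]]])
    fix t assume t: "t \<in> {0..T}"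
    have "ennreal ((norm (q t))\<^sup>2) \<le> l2sq P (X t)"
      using norm_integral_sq_le[of P "X t"] by (simp add: q_def emeasure_space_1)
    also have "\<dots> \<le> ennreal (max D 0)" using D t by (auto intro: order_trans ennreal_leI)
    finally have "(norm (q t))\<^sup>2 \<le> max D 0" by (rule ennreal_le_iff[THEN iffD1, rotated]) simp
    then show "norm (q t) \<le> sqrt (max D 0)" by (rule real_le_rsqrt)
  qed
  show ?thesis
  proof (rule that[of "\<lambda>t. q (T - t)"])
    show "bounded_measurable_on T (\<lambda>t. q (T - t))" by (rule bounded_measurable_on_reflect[OF q_bd])
    fix t assume "t \<in> {0..T}"
    then have "T - t \<in> {0..T}" by auto
    from q[OF this] show "q (T - t) = M + (LBINT s:{t..T}. transpose (A s) *v q (T - s) + Q s)"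
      using set_integral_reflect[of T t "\<lambda>s. transpose (A s) *v q (T - s) + Q s"] by simp
  qed
qed

end

section \<open>The cost of one player\<close>

context filtered_prob_space
begin

lemma AE_integrable_section:
  assumes "\<phi> \<in> M2"
  shows "AE s in lborel_upto T. integrable P (\<phi> s)"
    and "AE s in lborel_upto T. l2sq P (\<phi> s) < \<infinity>"
proof -
  have m: "(\<lambda>s. l2sq P (\<phi> s)) \<in> borel_measurable (lborel_upto T)"
    by (rule l2sq_section_measurable[OF M2D(1)[OF assms]])
  have "AE s in lborel_upto T. l2sq P (\<phi> s) \<noteq> \<infinity>"
    using M2D(3)[OF assms] unfolding energy_def by (intro nn_integral_PInf_AE m) simp
  then show l2: "AE s in lborel_upto T. l2sq P (\<phi> s) < \<infinity>"
    by eventually_elim (simp add: top.not_eq_extremum)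
  have "AE s in lborel_upto T. s \<in> {0..T}" by (rule AE_I2) (simp add: space_restrict_space)
  with l2 show "AE s in lborel_upto T. integrable P (\<phi> s)"
  proof eventually_elim
    case (elim s)
    then show ?case using M2D(4)[OF assms] by (intro l2_imp_integrable) (auto intro: finite_measure_axioms)
  qed
qed

lemma expectation_time_integral:
  fixes \<phi> :: "real \<Rightarrow> 'w \<Rightarrow> 'a::euclidean_space"
  assumes int: "integrable (lborel_upto t \<Otimes>\<^sub>M P) (case_prod \<phi>)"
  shows "expectation (\<lambda>\<omega>. LBINT s:{0..t}. \<phi> s \<omega>) = (LBINT s:{0..t}. expectation (\<phi> s))"
    and "integrable P (\<lambda>\<omega>. LBINT s:{0..t}. \<phi> s \<omega>)" "integrable (lborel_upto t) (\<lambda>s. expectation (\<phi> s))"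
proof -
  interpret L: finite_measure "lborel_upto t" by (rule finite_measure_lborel_upto)
  interpret LP: pair_sigma_finite "lborel_upto t" P ..
  show "expectation (\<lambda>\<omega>. LBINT s:{0..t}. \<phi> s \<omega>) = (LBINT s:{0..t}. expectation (\<phi> s))"
    unfolding set_integral_lborel_upto by (rule LP.Fubini_integral[OF int])
  show "integrable P (\<lambda>\<omega>. LBINT s:{0..t}. \<phi> s \<omega>)"
    unfolding set_integral_lborel_upto by (rule LP.integrable_snd[OF int])
  show "integrable (lborel_upto t) (\<lambda>s. expectation (\<phi> s))" by (rule LP.integrable_fst[OF int])
qed

lemma M2_integrable_upto: "\<phi> \<in> M2 \<Longrightarrow> t \<in> {0..T} \<Longrightarrow> integrable (lborel_upto t \<Otimes>\<^sub>M P) (case_prod \<phi>)"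
  by (rule M2_integrable) auto

lemma M2_inner_integrable:
  fixes \<phi> \<psi> :: "real \<Rightarrow> 'w \<Rightarrow> 'a::euclidean_space"
  assumes "\<phi> \<in> M2" "\<psi> \<in> M2"
  shows "integrable (lborel_upto T \<Otimes>\<^sub>M P) (\<lambda>(s, \<omega>). \<phi> s \<omega> \<bullet> \<psi> s \<omega>)"
proof -
  interpret L: finite_measure "lborel_upto T" by (rule finite_measure_lborel_upto)
  have sq: "integrable (lborel_upto T \<Otimes>\<^sub>M P) (\<lambda>z. (norm (case_prod \<theta> z))\<^sup>2)" if \<theta>: "\<theta> \<in> M2" for \<theta> :: "real \<Rightarrow> 'w \<Rightarrow> 'a"
  proof -
    have m: "case_prod \<theta> \<in> borel_measurable (lborel_upto T \<Otimes>\<^sub>M P)"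
      using M2D(1)[OF \<theta>] by (simp add: joint_measurable_def)
    have "l2sq (lborel_upto T \<Otimes>\<^sub>M P) (case_prod \<theta>) = energy P T \<theta>"
      unfolding l2sq_def energy_def using m by (subst nn_integral_fst[symmetric]) auto
    then show ?thesis using M2D(3)[OF \<theta>] l2sq_finite_iff[OF m] by simp
  qed
  have m: "case_prod \<phi> \<in> borel_measurable (lborel_upto T \<Otimes>\<^sub>M P)" "case_prod \<psi> \<in> borel_measurable (lborel_upto T \<Otimes>\<^sub>M P)"
    using M2D(1)[OF assms(1)] M2D(1)[OF assms(2)] by (simp_all add: joint_measurable_def)
  have "integrable (lborel_upto T \<Otimes>\<^sub>M P) (\<lambda>z. case_prod \<phi> z \<bullet> case_prod \<psi> z)"
    by (rule l2_inner_integrable[OF m sq[OF assms(1)] sq[OF assms(2)]])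
  then show ?thesis by (simp add: case_prod_beta')
qed

lemma expectation_matrix:
  fixes K :: "real ^ 'k::finite ^ 'n::finite"
  assumes "integrable P X"
  shows "integrable P (\<lambda>\<omega>. K *v X \<omega>)" "expectation (\<lambda>\<omega>. K *v X \<omega>) = K *v expectation X"
  using integrable_bounded_linear[OF matrix_vector_mul_bounded_linear assms, of K]
    integral_bounded_linear[OF matrix_vector_mul_bounded_linear assms, of K] by auto

lemma expectation_mf_linear:
  assumes "integrable P (X s)" "integrable P (u1 s)" "integrable P (u2 s)"
  shows "expectation (mf_linear P K1 K2 L11 L12 L21 L22 X u1 u2 s)
    = (K1 s + K2 s) *v expectation (X s) + (L11 s + L12 s) *v expectation (u1 s) + (L21 s + L22 s) *v expectation (u2 s)"
proof -
  note i = expectation_matrix[OF assms(1), of "K1 s"] expectation_matrix[OF assms(2), of "L11 s"] expectation_matrix[OF assms(3), of "L21 s"]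
  have "expectation (mf_linear P K1 K2 L11 L12 L21 L22 X u1 u2 s)
    = expectation (\<lambda>\<omega>. (K1 s *v X s \<omega> + L11 s *v u1 s \<omega> + L21 s *v u2 s \<omega>)
       + (K2 s *v expectation (X s) + L12 s *v expectation (u1 s) + L22 s *v expectation (u2 s)))"
    unfolding mf_linear_def by (intro Bochner_Integration.integral_cong refl) (simp add: algebra_simps)
  also have "\<dots> = (K1 s *v expectation (X s) + L11 s *v expectation (u1 s) + L21 s *v expectation (u2 s))
     + (K2 s *v expectation (X s) + L12 s *v expectation (u1 s) + L22 s *v expectation (u2 s))"
    using i by (simp add: prob_space)
  finally show ?thesis by (simp add: matrix_vector_mult_add_rdistrib algebra_simps)
qed

definition quad_cost :: "(real \<Rightarrow> real ^ 'k ^ 'k) \<Rightarrow> (real \<Rightarrow> real ^ 'k ^ 'k) \<Rightarrow> (real \<Rightarrow> 'w \<Rightarrow> real ^ 'k) \<Rightarrow> real \<Rightarrow> 'w \<Rightarrow> real" where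
  "quad_cost N1 N2 u s \<omega> = (N1 s *v u s \<omega>) \<bullet> u s \<omega> + (N2 s *v expectation (u s)) \<bullet> expectation (u s)"

lemma quad_cost_integrable:
  fixes N1 N2 :: "real \<Rightarrow> real ^ 'k::finite ^ 'k"
  assumes "bounded_measurable_on T N1" "bounded_measurable_on T N2" "u \<in> M2"
  shows "integrable (lborel_upto T \<Otimes>\<^sub>M P) (case_prod (quad_cost N1 N2 u))"
  using Bochner_Integration.integrable_add[OF M2_inner_integrable[OF M2_matrix[OF assms(1,3)] assms(3)]
      M2_inner_integrable[OF M2_matrix[OF assms(2) M2_expectation[OF assms(3)]] M2_expectation[OF assms(3)]]]
  by (simp add: quad_cost_def case_prod_beta')

text \<open>The part of the cost controlled by one player, after elimination of the state.\<close>

definition player_cost :: "(real \<Rightarrow> real ^ 'k) \<Rightarrow> (real \<Rightarrow> real ^ 'k ^ 'k) \<Rightarrow> (real \<Rightarrow> real ^ 'k ^ 'k) \<Rightarrow> (real \<Rightarrow> 'w \<Rightarrow> real ^ 'k) \<Rightarrow> real" where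
  "player_cost \<beta> N1 N2 u = (\<integral>s. \<beta> s \<bullet> expectation (u s) + expectation (quad_cost N1 N2 u s) \<partial>lborel_upto T)"

lemma expectation_integrable_upto: "u \<in> M2 \<Longrightarrow> integrable (lborel_upto T) (\<lambda>s. expectation (u s))"
  by (rule expectation_time_integral(3)[OF M2_integrable_upto]) (use T_pos in auto)

lemma player_cost_integrable:
  fixes N1 N2 :: "real \<Rightarrow> real ^ 'k::finite ^ 'k"
  assumes "bounded_measurable_on T \<beta>" "bounded_measurable_on T N1" "bounded_measurable_on T N2" "u \<in> M2"
  shows "integrable (lborel_upto T) (\<lambda>s. \<beta> s \<bullet> expectation (u s))"
    "integrable (lborel_upto T) (\<lambda>s. expectation (quad_cost N1 N2 u s))"
  using integrable_lborel_upto_bounded[OF assms(1) expectation_integrable_upto[OF assms(4)]]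
    expectation_time_integral(3)[OF quad_cost_integrable[OF assms(2-4)]] by auto

lemma player_cost_uminus:
  "player_cost (\<lambda>s. - \<beta> s) (\<lambda>s. - N1 s) (\<lambda>s. - N2 s) u = - player_cost \<beta> N1 N2 u"
proof -
  have m: "(- A) *v x = - (A *v x)" for A :: "real ^ 'b ^ 'b" and x
    by (simp add: matrix_vector_mult_def vec_eq_iff sum_negf)
  have "quad_cost (\<lambda>s. - N1 s) (\<lambda>s. - N2 s) u s = (\<lambda>\<omega>. - quad_cost N1 N2 u s \<omega>)" for s
    by (rule ext) (simp add: quad_cost_def m)
  then have "expectation (quad_cost (\<lambda>s. - N1 s) (\<lambda>s. - N2 s) u s) = - expectation (quad_cost N1 N2 u s)" for s
    by simp
  then have "player_cost (\<lambda>s. - \<beta> s) (\<lambda>s. - N1 s) (\<lambda>s. - N2 s) u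
     = (\<integral>s. - (\<beta> s \<bullet> expectation (u s) + expectation (quad_cost N1 N2 u s)) \<partial>lborel_upto T)"
    unfolding player_cost_def by simp
  then show ?thesis unfolding player_cost_def by (simp only: Bochner_Integration.integral_minus)
qed

text \<open>First \<open>E[(N\<^sub>1 u) \<bullet> u] \<ge> (N\<^sub>1 e) \<bullet> e\<close> with \<open>e = E[u]\<close>, since the difference is
  \<open>E[(N\<^sub>1 (u - e)) \<bullet> (u - e)]\<close>. Then completion of the square: with \<open>R = N\<^sub>1 + N\<^sub>2\<close>, the quadratic
  \<open>\<beta> \<bullet> e + (R e) \<bullet> e\<close> exceeds its value at \<open>x\<close> by \<open>(R (e - x)) \<bullet> (e - x)\<close>, the linear term being zero
  by the choice of \<open>x\<close>. Only the symmetric part of \<open>R\<close> enters the condition on \<open>x\<close>, hence the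
  transpose.\<close>

lemma pointwise_minimum:
  fixes N1 N2 :: "real ^ 'k::finite ^ 'k" and \<beta> x :: "real ^ 'k" and u :: "'w \<Rightarrow> real ^ 'k"
  assumes pos: "\<And>v. 0 \<le> (N1 *v v) \<bullet> v" "\<And>v. 0 \<le> ((N1 + N2) *v v) \<bullet> v"
    and x: "((N1 + N2) + transpose (N1 + N2)) *v x = - \<beta>"
    and u[measurable]: "u \<in> borel_measurable P" and fin: "l2sq P u < \<infinity>"
  shows "\<beta> \<bullet> x + ((N1 + N2) *v x) \<bullet> x
    \<le> \<beta> \<bullet> expectation u + expectation (\<lambda>\<omega>. (N1 *v u \<omega>) \<bullet> u \<omega> + (N2 *v expectation u) \<bullet> expectation u)"
proof -
  let ?m = "expectation u" and ?R = "N1 + N2"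
  have int: "integrable P u" using fin by (intro l2_imp_integrable finite_measure_axioms u)
  have sq: "integrable P (\<lambda>\<omega>. (norm (u \<omega>))\<^sup>2)" using fin l2sq_finite_iff[OF u] by simp
  note N1u = expectation_matrix[OF int, of N1]
  have [measurable]: "(\<lambda>\<omega>. N1 *v u \<omega>) \<in> borel_measurable P" using N1u(1) by auto
  have sq': "integrable P (\<lambda>\<omega>. (norm (N1 *v u \<omega>))\<^sup>2)"
  proof -
    obtain K where K: "\<And>v. norm (N1 *v v) \<le> norm v * K"
      using bounded_linear.bounded[OF matrix_vector_mul_bounded_linear[of N1]] by blast
    have "norm (N1 *v v) \<le> max K 0 * norm v" for v
      using K[of v] mult_left_mono[of K "max K 0" "norm v"] by (simp add: mult.commute)
    then have "l2sq P (\<lambda>\<omega>. N1 *v u \<omega>) \<le> ennreal ((max K 0)\<^sup>2) * l2sq P u" by (intro l2sq_le_mult u) auto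
    also have "\<dots> < \<infinity>" using fin by (simp add: ennreal_mult_less_top)
    finally show ?thesis using l2sq_finite_iff[of "\<lambda>\<omega>. N1 *v u \<omega>" P] by simp
  qed
  have quad: "integrable P (\<lambda>\<omega>. (N1 *v u \<omega>) \<bullet> u \<omega>)" by (rule l2_inner_integrable[OF _ u sq' sq]) measurable
  have "0 \<le> expectation (\<lambda>\<omega>. (N1 *v (u \<omega> - ?m)) \<bullet> (u \<omega> - ?m))"
    by (intro Bochner_Integration.integral_nonneg pos)
  also have "\<dots> = expectation (\<lambda>\<omega>. (N1 *v u \<omega>) \<bullet> u \<omega> - (N1 *v u \<omega>) \<bullet> ?m - (N1 *v ?m) \<bullet> u \<omega> + (N1 *v ?m) \<bullet> ?m)"
    by (intro Bochner_Integration.integral_cong refl)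
       (simp add: matrix_vector_mult_diff_distrib inner_diff_left inner_diff_right)
  also have "\<dots> = expectation (\<lambda>\<omega>. (N1 *v u \<omega>) \<bullet> u \<omega>) - (N1 *v ?m) \<bullet> ?m"
    using quad N1u int by (simp add: prob_space)
  finally have jensen: "(N1 *v ?m) \<bullet> ?m \<le> expectation (\<lambda>\<omega>. (N1 *v u \<omega>) \<bullet> u \<omega>)" by simp
  let ?w = "?m - x"
  have "\<beta> \<bullet> ?m + (?R *v ?m) \<bullet> ?m = \<beta> \<bullet> x + (?R *v x) \<bullet> x + (\<beta> + (?R + transpose ?R) *v x) \<bullet> ?w + (?R *v ?w) \<bullet> ?w"
  proof -
    have "(transpose ?R *v x) \<bullet> ?w = x \<bullet> (?R *v ?w)" by (simp only: transpose_matrix_vector dot_lmul_matrix)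
    then have t: "(transpose ?R *v x) \<bullet> ?w = (?R *v ?w) \<bullet> x" by (simp only: inner_commute)
    show ?thesis
      unfolding matrix_vector_mult_add_rdistrib[of ?R] inner_add_left t
      by (simp add: matrix_vector_mult_diff_distrib inner_diff_left inner_diff_right algebra_simps)
  qed
  then have "\<beta> \<bullet> x + (?R *v x) \<bullet> x \<le> \<beta> \<bullet> ?m + (?R *v ?m) \<bullet> ?m"
    using pos(2)[of ?w] x by simp
  also have "\<dots> \<le> \<beta> \<bullet> ?m + (expectation (\<lambda>\<omega>. (N1 *v u \<omega>) \<bullet> u \<omega>) + (N2 *v ?m) \<bullet> ?m)"
    using jensen by (simp add: matrix_vector_mult_add_rdistrib inner_add_left)
  also have "expectation (\<lambda>\<omega>. (N1 *v u \<omega>) \<bullet> u \<omega>) + (N2 *v ?m) \<bullet> ?m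
     = expectation (\<lambda>\<omega>. (N1 *v u \<omega>) \<bullet> u \<omega> + (N2 *v ?m) \<bullet> ?m)"
    using quad by (simp add: prob_space)
  finally show ?thesis .
qed

end

text \<open>Cramer's rule, so that the solution depends measurably on the data.\<close>

definition cramer_solution :: "real ^ 'k ^ 'k \<Rightarrow> real ^ 'k \<Rightarrow> real ^ 'k::finite" where
  "cramer_solution A b = (\<chi> k. det (\<chi> i j. if j = k then b $ i else A $ i $ j) / det A)"

lemma borel_measurable_vec_nth:
  fixes f :: "'x \<Rightarrow> 'a::euclidean_space ^ 'k::finite"
  shows "f \<in> borel_measurable M \<Longrightarrow> (\<lambda>x. f x $ i) \<in> borel_measurable M"
  by (rule measurable_compose[where g = "\<lambda>v :: 'a ^ 'k. v $ i", OF _ borel_measurable_continuous_onI])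
     (auto intro!: continuous_on_component continuous_on_id)

lemma borel_measurable_vecI:
  fixes f :: "'x \<Rightarrow> 'a::euclidean_space ^ 'k::finite"
  assumes "\<And>i. (\<lambda>x. f x $ i) \<in> borel_measurable M"
  shows "f \<in> borel_measurable M"
proof (subst borel_measurable_euclidean_space, intro ballI)
  fix b :: "'a ^ 'k" assume "b \<in> Basis"
  then obtain i e where "b = axis i e" by (auto simp: Basis_vec_def)
  then show "(\<lambda>x. f x \<bullet> b) \<in> borel_measurable M" using assms[of i] by (simp add: inner_axis)
qed

lemma borel_measurable_det:
  fixes f :: "'x \<Rightarrow> real ^ 'k::finite ^ 'k"
  assumes "\<And>i j. (\<lambda>x. f x $ i $ j) \<in> borel_measurable M"
  shows "(\<lambda>x. det (f x)) \<in> borel_measurable M"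
  unfolding det_def using assms by (intro borel_measurable_sum borel_measurable_times borel_measurable_prod) auto

lemma borel_measurable_cramer_solution:
  assumes A: "A \<in> borel_measurable M" and b: "b \<in> borel_measurable M"
  shows "(\<lambda>x. cramer_solution (A x) (b x)) \<in> borel_measurable M"
proof (rule borel_measurable_vecI)
  fix k
  have "(\<lambda>x. det (\<chi> i j. if j = k then b x $ i else A x $ i $ j)) \<in> borel_measurable M"
  proof (rule borel_measurable_det)
    fix i j
    show "(\<lambda>x. (\<chi> i j. if j = k then b x $ i else A x $ i $ j) $ i $ j) \<in> borel_measurable M"
      by (cases "j = k") (simp_all add: borel_measurable_vec_nth[OF b] borel_measurable_vec_nth[OF borel_measurable_vec_nth[OF A]])
  qed
  moreover have "(\<lambda>x. det (A x)) \<in> borel_measurable M"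
    by (rule borel_measurable_det) (intro borel_measurable_vec_nth A)
  ultimately show "(\<lambda>x. cramer_solution (A x) (b x) $ k) \<in> borel_measurable M"
    unfolding cramer_solution_def by simp
qed

text \<open>The quadratic form of \<open>S\<close> is twice that of \<open>R\<close>, so \<open>S\<close> is injective, and pairing
  \<open>S x = b\<close> with \<open>x\<close> bounds \<open>x\<close>.\<close>

lemma coercive_solution:
  fixes R :: "real ^ 'k::finite ^ 'k"
  assumes "0 < \<delta>" and co: "\<And>v. \<delta> * (norm v)\<^sup>2 \<le> (R *v v) \<bullet> v"
  defines "S \<equiv> R + transpose R"
  shows "S *v cramer_solution S b = b" "norm (cramer_solution S b) \<le> norm b / (2 * \<delta>)"
proof -
  have S: "2 * \<delta> * (norm v)\<^sup>2 \<le> (S *v v) \<bullet> v" for v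
  proof -
    have "(transpose R *v v) \<bullet> v = v \<bullet> (R *v v)" by (simp only: transpose_matrix_vector dot_lmul_matrix)
    then have "(transpose R *v v) \<bullet> v = (R *v v) \<bullet> v" by (simp only: inner_commute)
    then show ?thesis using co[of v] by (simp add: S_def matrix_vector_mult_add_rdistrib inner_add_left)
  qed
  have "\<forall>v. S *v v = 0 \<longrightarrow> v = 0"
  proof (intro allI impI)
    fix v assume "S *v v = 0"
    then have "2 * \<delta> * (norm v)\<^sup>2 \<le> 0" using S[of v] by simp
    then show "v = 0" using \<open>0 < \<delta>\<close> by (simp add: mult_le_0_iff)
  qed
  then have "det S \<noteq> 0"
    using matrix_left_invertible_ker[of S] invertible_left_inverse[of S] invertible_det_nz[of S] by blast
  then show eq: "S *v cramer_solution S b = b"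
    using cramer[of S "cramer_solution S b" b] by (simp add: cramer_solution_def)
  let ?x = "cramer_solution S b"
  have "2 * \<delta> * (norm ?x)\<^sup>2 \<le> b \<bullet> ?x" using S[of ?x] eq by simp
  also have "\<dots> \<le> norm b * norm ?x" using Cauchy_Schwarz_ineq2[of b ?x] by simp
  finally have "(2 * \<delta> * norm ?x) * norm ?x \<le> norm b * norm ?x" by (simp add: power2_eq_square mult.assoc)
  then have "2 * \<delta> * norm ?x \<le> norm b"
    by (cases "norm ?x = 0") (auto simp: mult_le_cancel_right)
  then show "norm ?x \<le> norm b / (2 * \<delta>)" using \<open>0 < \<delta>\<close> by (simp add: le_divide_eq mult.commute)
qed

section \<open>Separation of the players\<close>

text \<open>The coefficients of the equation for the mean of the state.\<close>

definition mean_drift :: "('n::finite, 'k1::finite, 'k2::finite) lq_data \<Rightarrow> real \<Rightarrow> real ^ 'n ^ 'n" where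
  "mean_drift c s = A1 c s + A2 c s - h_obs c s *\<^sub>R (F1 c s + F2 c s)"

definition mean_gain_1 :: "('n::finite, 'k1::finite, 'k2::finite) lq_data \<Rightarrow> real \<Rightarrow> real ^ 'k1 ^ 'n" where
  "mean_gain_1 c s = B11 c s + B12 c s - h_obs c s *\<^sub>R (G11 c s + G12 c s)"

definition mean_gain_2 :: "('n::finite, 'k1::finite, 'k2::finite) lq_data \<Rightarrow> real \<Rightarrow> real ^ 'k2 ^ 'n" where
  "mean_gain_2 c s = B21 c s + B22 c s - h_obs c s *\<^sub>R (G21 c s + G22 c s)"

lemma bounded_measurable_mean_coefficients:
  assumes "assumption_L1 T c"
  shows "bounded_measurable_on T (mean_drift c)" "bounded_measurable_on T (mean_gain_1 c)"
    "bounded_measurable_on T (mean_gain_2 c)"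
  unfolding mean_drift_def[abs_def] mean_gain_1_def[abs_def] mean_gain_2_def[abs_def]
  by (intro bounded_measurable_on_add bounded_measurable_on_bilinear[OF bounded_bilinear_scaleR] assumption_L1D[OF assms])+

lemma matrix_vector_mult_diff_rdistrib: "(A - B) *v x = A *v x - B *v (x :: real ^ 'k)"
  for A B :: "real ^ 'k ^ 'n"
  using matrix_vector_mult_add_rdistrib[of "A - B" B x] by simp

context two_brownian_basis
begin

text \<open>The two Ito integrals drop out of the expectation by \<open>has_ito_integral_mean\<close>. The mean is an
  integral of \<open>G\<close>, and \<open>G\<close> has the linear form only at those times at which the controls are
  integrable, that is, at almost all times.\<close>

lemma state_mean:
  fixes c :: "('n::finite, 'k1::finite, 'k2::finite) lq_data"
  assumes c: "assumption_L1 T c" and u1: "u1 \<in> M2" and u2: "u2 \<in> M2" and X: "is_state P T W Y c u1 u2 X"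
  obtains G where "integrable (lborel_upto T) G" "\<And>t. t \<in> {0..T} \<Longrightarrow> integrable P (X t)"
    "\<And>t. t \<in> {0..T} \<Longrightarrow> expectation (X t) = x_init c + (LBINT s:{0..t}. G s)"
    "AE s in lborel_upto T. G s = mean_drift c s *v expectation (X s)
        + (mean_gain_1 c s *v expectation (u1 s) + mean_gain_2 c s *v expectation (u2 s))"
proof -
  interpret W: brownian_filtration P "joint_filtration P W Y" T W by (rule brownian_filtration_W)
  interpret Y: brownian_filtration P "joint_filtration P W Y" T Y by (rule brownian_filtration_Y)
  note L1 = assumption_L1D[OF c]
  let ?dr = "drift P c X u1 u2" and ?obs = "diffusion_obs P c X u1 u2"
  let ?h = "\<lambda>s \<omega>. h_obs c s *\<^sub>R ?obs s \<omega>"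
  have XM: "X \<in> M2" using X by (simp add: is_state_def)
  have dr: "?dr \<in> M2" unfolding drift_def using L1 XM u1 u2 by (intro M2_mf_linear)
  have obs: "?obs \<in> M2" unfolding diffusion_obs_def using L1 XM u1 u2 by (intro M2_mf_linear)
  have h: "?h \<in> M2" by (rule M2_bilinear[OF bounded_bilinear_scaleR L1(24) obs])
  obtain I_W I_obs where IW: "has_ito_integral P (joint_filtration P W Y) T W (diffusion_W P c X u1 u2) I_W"
    and Iobs: "has_obs_noise_integral P (joint_filtration P W Y) T Y (h_obs c) ?obs I_obs"
    and eq: "\<And>t. t \<in> {0..T} \<Longrightarrow> AE \<omega> in P. X t \<omega> = x_init c + (LBINT s:{0..t}. ?dr s \<omega>) + I_W t \<omega> + I_obs t \<omega>"
    using X unfolding is_state_def by blast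
  obtain I_Y where IY: "has_ito_integral P (joint_filtration P W Y) T Y ?obs I_Y"
    and eqY: "\<And>t. t \<in> {0..T} \<Longrightarrow> AE \<omega> in P. I_obs t \<omega> = I_Y t \<omega> - (LBINT s:{0..t}. ?h s \<omega>)"
    using Iobs unfolding has_obs_noise_integral_def by blast
  define G where "G s = expectation (?dr s) - expectation (?h s)" for s
  have XP: "X t \<in> borel_measurable P" if "t \<in> {0..T}" for t using M2D(4)[OF XM that] .
  have mean: "integrable P (X t) \<and> expectation (X t) = x_init c + (LBINT s:{0..t}. G s)" if t: "t \<in> {0..T}" for t
  proof -
    note d = expectation_time_integral[OF M2_integrable_upto[OF dr t]]
    note e = expectation_time_integral[OF M2_integrable_upto[OF h t]]
    note w = W.has_ito_integral_mean[OF IW t] and y = Y.has_ito_integral_mean[OF IY t]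
    let ?r = "\<lambda>\<omega>. x_init c + (LBINT s:{0..t}. ?dr s \<omega>) + I_W t \<omega> + (I_Y t \<omega> - (LBINT s:{0..t}. ?h s \<omega>))"
    have r: "integrable P ?r" using d(2) e(2) w(1) y(1)
      by (intro Bochner_Integration.integrable_add Bochner_Integration.integrable_diff) auto
    have ae: "AE \<omega> in P. X t \<omega> = ?r \<omega>" using eq[OF t] eqY[OF t] by eventually_elim simp
    have i: "integrable P (X t)"
      using r integrable_cong_AE[OF XP[OF t] borel_measurable_integrable[OF r] ae] by blast
    have "expectation (X t) = expectation ?r"
      by (rule integral_cong_AE[OF XP[OF t] borel_measurable_integrable[OF r] ae])
    also have "\<dots> = x_init c + (LBINT s:{0..t}. expectation (?dr s)) - (LBINT s:{0..t}. expectation (?h s))"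
      using d(1,2) e(1,2) w(1,2) y(1,2) by (simp add: prob_space)
    also have "\<dots> = x_init c + (LBINT s:{0..t}. G s)"
      using d(3) e(3) by (simp add: set_integral_lborel_upto G_def)
    finally show ?thesis using i by blast
  qed
  have T: "T \<in> {0..T}" using T_pos by simp
  have Gi: "integrable (lborel_upto T) G"
    unfolding G_def[abs_def] using expectation_integrable_upto[OF dr] expectation_integrable_upto[OF h] by simp
  have ae: "AE s in lborel_upto T. G s = mean_drift c s *v expectation (X s)
        + (mean_gain_1 c s *v expectation (u1 s) + mean_gain_2 c s *v expectation (u2 s))"
    using AE_integrable_section(1)[OF XM] AE_integrable_section(1)[OF u1] AE_integrable_section(1)[OF u2]
  proof eventually_elim
    case (elim s)
    have "expectation (?h s) = h_obs c s *\<^sub>R expectation (?obs s)" by simp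
    then have "G s = expectation (?dr s) - h_obs c s *\<^sub>R expectation (?obs s)" by (simp add: G_def)
    also have "\<dots> = (A1 c s + A2 c s) *v expectation (X s) + (B11 c s + B12 c s) *v expectation (u1 s)
          + (B21 c s + B22 c s) *v expectation (u2 s)
        - h_obs c s *\<^sub>R ((F1 c s + F2 c s) *v expectation (X s) + (G11 c s + G12 c s) *v expectation (u1 s)
          + (G21 c s + G22 c s) *v expectation (u2 s))"
      unfolding drift_def diffusion_obs_def
      by (subst (1 2) expectation_mf_linear; (rule elim)?) (rule refl)
    also have "\<dots> = mean_drift c s *v expectation (X s)
        + (mean_gain_1 c s *v expectation (u1 s) + mean_gain_2 c s *v expectation (u2 s))"
      unfolding mean_drift_def mean_gain_1_def mean_gain_2_def matrix_vector_mult_diff_rdistrib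
        scaleR_matrix_vector_assoc[symmetric]
      by (simp add: scaleR_add_right)
    finally show ?case .
  qed
  show ?thesis by (rule that[OF Gi _ _ ae]) (use mean in blast)+
qed

text \<open>The adjoint \<open>p\<close> is fixed before the controls. The state may be an arbitrary solution of the state
  equation, since only its mean is used.\<close>

theorem cost_separates:
  fixes c :: "('n::finite, 'k1::finite, 'k2::finite) lq_data"
  assumes c: "assumption_L1 T c"
  obtains p where "bounded_measurable_on T p"
    "\<And>u1 u2. u1 \<in> M2 \<Longrightarrow> u2 \<in> M2 \<Longrightarrow> J P T W Y c u1 u2 = x_init c \<bullet> p 0
       + player_cost (\<lambda>s. transpose (mean_gain_1 c s) *v p s) (N11 c) (N12 c) u1
       + player_cost (\<lambda>s. transpose (mean_gain_2 c s) *v p s) (N21 c) (N22 c) u2"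
proof -
  note L1 = assumption_L1D[OF c] and bm = bounded_measurable_mean_coefficients[OF c]
  obtain p where p_bd: "bounded_measurable_on T p"
    and p: "\<And>t. t \<in> {0..T} \<Longrightarrow> p t = M_term c + (LBINT s:{t..T}. transpose (mean_drift c s) *v p s + Q_run c s)"
    by (rule adjoint_exists[OF bm(1) L1(23)]) blast
  note b1 = bounded_measurable_on_bilinear[OF bounded_bilinear_transpose_mult bm(2) p_bd]
  note b2 = bounded_measurable_on_bilinear[OF bounded_bilinear_transpose_mult bm(3) p_bd]
  have "J P T W Y c u1 u2 = x_init c \<bullet> p 0
       + player_cost (\<lambda>s. transpose (mean_gain_1 c s) *v p s) (N11 c) (N12 c) u1
       + player_cost (\<lambda>s. transpose (mean_gain_2 c s) *v p s) (N21 c) (N22 c) u2"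
    if u1: "u1 \<in> M2" and u2: "u2 \<in> M2" for u1 :: "real \<Rightarrow> 'w \<Rightarrow> real ^ 'k1" and u2 :: "real \<Rightarrow> 'w \<Rightarrow> real ^ 'k2"
  proof -
    define X where "X = state P T W Y c u1 u2"
    have st: "is_state P T W Y c u1 u2 X"
      unfolding X_def state_def by (rule someI_ex[OF state_exists[OF c u1 u2]])
    obtain G where G: "integrable (lborel_upto T) G" and Xi: "\<And>t. t \<in> {0..T} \<Longrightarrow> integrable P (X t)"
      and m: "\<And>t. t \<in> {0..T} \<Longrightarrow> expectation (X t) = x_init c + (LBINT s:{0..t}. G s)"
      and G_eq: "AE s in lborel_upto T. G s = mean_drift c s *v expectation (X s)
        + (mean_gain_1 c s *v expectation (u1 s) + mean_gain_2 c s *v expectation (u2 s))"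
      by (rule state_mean[OF c u1 u2 st]) blast
    have XM: "X \<in> M2" using st by (simp add: is_state_def)
    have T: "T \<in> {0..T}" using T_pos by simp
    have gain: "integrable (lborel_upto T) (\<lambda>s. K s *v expectation (u s))"
      if "bounded_measurable_on T K" "u \<in> M2" for K :: "real \<Rightarrow> real ^ 'k::finite ^ 'n" and u
      using expectation_integrable_upto[OF M2_matrix[OF that(1) M2_expectation[OF that(2)]]] by (simp add: prob_space)
    note g1 = gain[OF bm(2) u1] and g2 = gain[OF bm(3) u2]
    have dual: "M_term c \<bullet> expectation (X T) + (\<integral>t. Q_run c t \<bullet> expectation (X t) \<partial>lborel_upto T)
      = x_init c \<bullet> p 0 + (\<integral>t. p t \<bullet> (mean_gain_1 c t *v expectation (u1 t) + mean_gain_2 c t *v expectation (u2 t)) \<partial>lborel_upto T)"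
      by (rule linear_duality[OF _ bm(1) L1(23) p_bd G m expectation_integrable_upto[OF XM] _ G_eq p])
         (use T_pos g1 g2 in auto)
    have tr: "p s \<bullet> (K *v e) = (transpose K *v p s) \<bullet> e" for K :: "real ^ 'k::finite ^ 'n" and e s
      by (simp only: transpose_matrix_vector dot_lmul_matrix)
    note pc1 = player_cost_integrable[OF b1 L1(19,20) u1] and pc2 = player_cost_integrable[OF b2 L1(21,22) u2]
    have split: "(\<integral>t. p t \<bullet> (mean_gain_1 c t *v expectation (u1 t) + mean_gain_2 c t *v expectation (u2 t)) \<partial>lborel_upto T)
      = (\<integral>t. (transpose (mean_gain_1 c t) *v p t) \<bullet> expectation (u1 t) \<partial>lborel_upto T)
      + (\<integral>t. (transpose (mean_gain_2 c t) *v p t) \<bullet> expectation (u2 t) \<partial>lborel_upto T)"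
      unfolding inner_add_right tr by (rule Bochner_Integration.integral_add[OF pc1(1) pc2(1)])
    note QX = expectation_time_integral[OF M2_integrable_upto[OF M2_bilinear[OF bounded_bilinear_inner L1(23) XM] T]]
    note q1 = expectation_time_integral[OF quad_cost_integrable[OF L1(19,20) u1]]
    note q2 = expectation_time_integral[OF quad_cost_integrable[OF L1(21,22) u2]]
    have Q_mean: "(LBINT s:{0..T}. expectation (\<lambda>\<omega>. Q_run c s \<bullet> X s \<omega>)) = (\<integral>t. Q_run c t \<bullet> expectation (X t) \<partial>lborel_upto T)"
      unfolding set_integral_lborel_upto
    proof (rule Bochner_Integration.integral_cong[OF refl])
      fix s assume "s \<in> space (lborel_upto T)"
      then have "integrable P (X s)" by (intro Xi) (simp add: space_restrict_space)
      then show "expectation (\<lambda>\<omega>. Q_run c s \<bullet> X s \<omega>) = Q_run c s \<bullet> expectation (X s)" by simp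
    qed
    have "J P T W Y c u1 u2 = expectation (\<lambda>\<omega>. M_term c \<bullet> X T \<omega> + (LBINT s:{0..T}. Q_run c s \<bullet> X s \<omega>)
       + (LBINT s:{0..T}. quad_cost (N11 c) (N12 c) u1 s \<omega>) + (LBINT s:{0..T}. quad_cost (N21 c) (N22 c) u2 s \<omega>))"
      unfolding J_def cost_of_def quad_cost_def X_def[symmetric] ..
    also have "\<dots> = M_term c \<bullet> expectation (X T) + (LBINT s:{0..T}. expectation (\<lambda>\<omega>. Q_run c s \<bullet> X s \<omega>))
       + (LBINT s:{0..T}. expectation (quad_cost (N11 c) (N12 c) u1 s)) + (LBINT s:{0..T}. expectation (quad_cost (N21 c) (N22 c) u2 s))"
      using Xi[OF T] QX(1,2) q1(1,2) q2(1,2) by simp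
    also have "\<dots> = x_init c \<bullet> p 0
       + player_cost (\<lambda>s. transpose (mean_gain_1 c s) *v p s) (N11 c) (N12 c) u1
       + player_cost (\<lambda>s. transpose (mean_gain_2 c s) *v p s) (N21 c) (N22 c) u2"
      unfolding Q_mean dual split player_cost_def
      unfolding set_integral_lborel_upto Bochner_Integration.integral_add[OF pc1] Bochner_Integration.integral_add[OF pc2]
      by simp
    finally show ?thesis .
  qed
  then show ?thesis by (rule that[OF p_bd])
qed

lemma admissible_deterministic:
  assumes "bounded_measurable_on T v"
  shows "(\<lambda>t \<omega>. v t) \<in> admissible P T Y"
  using M2_deterministic[OF assms] by (simp add: admissible_def M2_space_def)

text \<open>The pointwise minimiser is a deterministic function of time, and such controls are adapted to every
  filtration.\<close>

lemma player_optimum: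
  fixes N1 N2 :: "real \<Rightarrow> real ^ 'k::finite ^ 'k" and \<beta> :: "real \<Rightarrow> real ^ 'k"
  assumes \<beta>: "bounded_measurable_on T \<beta>" and N1: "bounded_measurable_on T N1" and N2: "bounded_measurable_on T N2"
    and \<delta>: "0 < \<delta>"
    and co: "AE s in lborel_upto T. \<forall>v. \<delta> * (norm v)\<^sup>2 \<le> (N1 s *v v) \<bullet> v \<and> \<delta> * (norm v)\<^sup>2 \<le> ((N1 s + N2 s) *v v) \<bullet> v"
  obtains ub where "ub \<in> admissible P T Y" "\<And>u. u \<in> M2 \<Longrightarrow> player_cost \<beta> N1 N2 ub \<le> player_cost \<beta> N1 N2 u"
proof -
  define R where "R s = N1 s + N2 s" for s
  define w where "w s = cramer_solution (R s + transpose (R s)) (- \<beta> s)" for s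
  obtain C where C: "0 \<le> C" "\<forall>t\<in>{0..T}. norm (\<beta> t) \<le> C" using bounded_measurable_onD(2)[OF \<beta>] by blast
  \<comment> \<open>Coercivity, and with it the bound on the minimiser, holds only almost everywhere.\<close>
  define v where "v s = (if norm (w s) \<le> C / (2 * \<delta>) then w s else 0)" for s
  have R: "R \<in> borel_measurable (lborel_upto T)"
    unfolding R_def[abs_def] by (rule bounded_measurable_onD(1)[OF bounded_measurable_on_add(1)[OF N1 N2]])
  have "(\<lambda>s. transpose (R s)) \<in> borel_measurable (lborel_upto T)"
    by (intro borel_measurable_vecI) (simp add: transpose_def borel_measurable_vec_nth[OF borel_measurable_vec_nth[OF R]])
  then have w[measurable]: "w \<in> borel_measurable (lborel_upto T)"
    unfolding w_def[abs_def] using R bounded_measurable_onD(1)[OF \<beta>]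
    by (intro borel_measurable_cramer_solution borel_measurable_add borel_measurable_uminus)
  have v_bd: "bounded_measurable_on T v"
  proof (rule bounded_measurable_onI[where C = "C / (2 * \<delta>)"])
    show "v \<in> borel_measurable (lborel_upto T)" unfolding v_def[abs_def] by measurable
    show "norm (v t) \<le> C / (2 * \<delta>)" for t using C(1) \<delta> by (simp add: v_def)
  qed
  have "player_cost \<beta> N1 N2 (\<lambda>t \<omega>. v t) \<le> player_cost \<beta> N1 N2 u" if u: "u \<in> M2" for u
    unfolding player_cost_def
  proof (rule integral_mono_AE)
    show "integrable (lborel_upto T) (\<lambda>s. \<beta> s \<bullet> expectation (\<lambda>\<omega>. v s) + expectation (quad_cost N1 N2 (\<lambda>t \<omega>. v t) s))"
      by (intro Bochner_Integration.integrable_add player_cost_integrable[OF \<beta> N1 N2 M2_deterministic[OF v_bd]])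
    show "integrable (lborel_upto T) (\<lambda>s. \<beta> s \<bullet> expectation (u s) + expectation (quad_cost N1 N2 u s))"
      by (intro Bochner_Integration.integrable_add player_cost_integrable[OF \<beta> N1 N2 u])
    have "AE s in lborel_upto T. s \<in> {0..T}" by (rule AE_I2) (simp add: space_restrict_space)
    then show "AE s in lborel_upto T. \<beta> s \<bullet> expectation (\<lambda>\<omega>. v s) + expectation (quad_cost N1 N2 (\<lambda>t \<omega>. v t) s)
        \<le> \<beta> s \<bullet> expectation (u s) + expectation (quad_cost N1 N2 u s)"
      using co AE_integrable_section(2)[OF u]
    proof eventually_elim
      case (elim s)
      have coR: "\<delta> * (norm x)\<^sup>2 \<le> (R s *v x) \<bullet> x" for x using elim(2) by (simp add: R_def)
      note sol = coercive_solution[OF \<delta> coR, of "- \<beta> s", folded w_def]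
      have "norm (w s) \<le> C / (2 * \<delta>)"
      proof -
        have "norm (\<beta> s) / (2 * \<delta>) \<le> C / (2 * \<delta>)" using C(2) elim(1) \<delta> by (intro divide_right_mono) auto
        then show ?thesis using sol(2) by simp
      qed
      then have vw: "v s = w s" by (simp add: v_def)
      have nn: "0 \<le> \<delta> * (norm x)\<^sup>2" for x :: "real ^ 'k" using \<delta> by simp
      have "\<beta> s \<bullet> v s + ((N1 s + N2 s) *v v s) \<bullet> v s
        \<le> \<beta> s \<bullet> expectation (u s) + expectation (\<lambda>\<omega>. (N1 s *v u s \<omega>) \<bullet> u s \<omega> + (N2 s *v expectation (u s)) \<bullet> expectation (u s))"
        using elim(2) nn sol(1) M2D(4)[OF u elim(1)] elim(3) unfolding vw R_def
        by (intro pointwise_minimum) (blast intro: order_trans)+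
      then show ?case
        by (simp add: quad_cost_def[abs_def] prob_space matrix_vector_mult_add_rdistrib inner_add_left)
    qed
  qed
  then show ?thesis using admissible_deterministic[OF v_bd] by (rule that[rotated])
qed

end

section \<open>The saddle point\<close>

lemma minimax_of_saddle_point:
  fixes f :: "'x \<Rightarrow> 'y \<Rightarrow> 'z::complete_lattice"
  assumes "a \<in> A" "b \<in> B" "\<And>y. y \<in> B \<Longrightarrow> f a y \<le> f a b" "\<And>x. x \<in> A \<Longrightarrow> f a b \<le> f x b"
  shows "(SUP y\<in>B. INF x\<in>A. f x y) = (INF x\<in>A. SUP y\<in>B. f x y)"
proof (rule antisym)
  show "(SUP y\<in>B. INF x\<in>A. f x y) \<le> (INF x\<in>A. SUP y\<in>B. f x y)"
    by (intro SUP_least INF_greatest) (blast intro: INF_lower SUP_upper order_trans)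
  have "(INF x\<in>A. SUP y\<in>B. f x y) \<le> (SUP y\<in>B. f a y)" using assms(1) by (rule INF_lower)
  also have "\<dots> \<le> f a b" using assms(3) by (rule SUP_least)
  also have "\<dots> \<le> (INF x\<in>A. f x b)" using assms(4) by (rule INF_greatest)
  also have "\<dots> \<le> (SUP y\<in>B. INF x\<in>A. f x y)" using assms(2) by (rule SUP_upper)
  finally show "(INF x\<in>A. SUP y\<in>B. f x y) \<le> (SUP y\<in>B. INF x\<in>A. f x y)" .
qed

theorem theorem5p3:
  fixes P :: "'w measure" and T :: real and W Y :: "real \<Rightarrow> 'w \<Rightarrow> real"
    and c :: "('n::finite, 'k1::finite, 'k2::finite) lq_data"
  assumes "two_brownian_basis P T W Y"
    and "assumption_L1 T c"
    and "assumption_L2 T c"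
  shows "(\<exists>ub1\<in>admissible P T Y. \<exists>ub2\<in>admissible P T Y.
            \<forall>u1\<in>admissible P T Y. \<forall>u2\<in>admissible P T Y.
              J P T W Y c ub1 u2 \<le> J P T W Y c ub1 ub2 \<and>
              J P T W Y c ub1 ub2 \<le> J P T W Y c u1 ub2) \<and>
         (SUP u2\<in>admissible P T Y. INF u1\<in>admissible P T Y. ereal (J P T W Y c u1 u2)) =
         (INF u1\<in>admissible P T Y. SUP u2\<in>admissible P T Y. ereal (J P T W Y c u1 u2))"
proof -
  interpret two_brownian_basis P T W Y by (rule assms(1))
  note L1 = assumption_L1D[OF assms(2)] and bm = bounded_measurable_mean_coefficients[OF assms(2)]
  obtain p where p: "bounded_measurable_on T p"
    and J: "\<And>u1 u2. u1 \<in> M2 \<Longrightarrow> u2 \<in> M2 \<Longrightarrow> J P T W Y c u1 u2 = x_init c \<bullet> p 0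
       + player_cost (\<lambda>s. transpose (mean_gain_1 c s) *v p s) (N11 c) (N12 c) u1
       + player_cost (\<lambda>s. transpose (mean_gain_2 c s) *v p s) (N21 c) (N22 c) u2"
    by (rule cost_separates[OF assms(2)]) blast
  let ?b1 = "\<lambda>s. transpose (mean_gain_1 c s) *v p s" and ?b2 = "\<lambda>s. transpose (mean_gain_2 c s) *v p s"
  note b1 = bounded_measurable_on_bilinear[OF bounded_bilinear_transpose_mult bm(2) p]
  note b2 = bounded_measurable_on_bilinear[OF bounded_bilinear_transpose_mult bm(3) p]
  have neg: "bounded_measurable_on T (\<lambda>s. - f s)" if "bounded_measurable_on T f" for f :: "real \<Rightarrow> 'b::euclidean_space"
  proof -
    have "bounded_measurable_on T (\<lambda>_. 0 :: 'b)" by (rule bounded_measurable_onI[where C = 0]) auto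
    from bounded_measurable_on_add(2)[OF this that] show ?thesis by simp
  qed
  obtain \<delta> where \<delta>: "0 < \<delta>" and co: "AE s in lborel. s \<in> {0..T} \<longrightarrow>
        (\<forall>v. (N11 c s *v v) \<bullet> v \<ge> \<delta> * (norm v)\<^sup>2 \<and> ((N11 c s + N12 c s) *v v) \<bullet> v \<ge> \<delta> * (norm v)\<^sup>2) \<and>
        (\<forall>v. (N21 c s *v v) \<bullet> v \<le> - \<delta> * (norm v)\<^sup>2 \<and> ((N21 c s + N22 c s) *v v) \<bullet> v \<le> - \<delta> * (norm v)\<^sup>2)"
    using assms(3) unfolding assumption_L2_def by blast
  have upto: "AE s in lborel_upto T. Pr s" if "AE s in lborel. s \<in> {0..T} \<longrightarrow> Pr s" for Pr
    using that by (simp add: AE_restrict_space_iff)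
  note co' = upto[OF co]
  have co1: "AE s in lborel_upto T. \<forall>v. \<delta> * (norm v)\<^sup>2 \<le> (N11 c s *v v) \<bullet> v \<and> \<delta> * (norm v)\<^sup>2 \<le> ((N11 c s + N12 c s) *v v) \<bullet> v"
    using co' by eventually_elim blast
  have um: "(- A) *v x = - (A *v x)" for A :: "real ^ 'k2 ^ 'k2" and x
    by (simp add: matrix_vector_mult_def vec_eq_iff sum_negf)
  have um': "(- A - B) *v x = - ((A + B) *v x)" for A B :: "real ^ 'k2 ^ 'k2" and x
    using um[of "A + B" x] by simp
  \<comment> \<open>Player 2 minimises the negated cost, whose data are coercive.\<close>
  have co2: "AE s in lborel_upto T. \<forall>v. \<delta> * (norm v)\<^sup>2 \<le> ((- N21 c s) *v v) \<bullet> v \<and> \<delta> * (norm v)\<^sup>2 \<le> ((- N21 c s + - N22 c s) *v v) \<bullet> v"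
    using co'
  proof eventually_elim
    case (elim s)
    then have "\<forall>v. (N21 c s *v v) \<bullet> v \<le> - \<delta> * (norm v)\<^sup>2 \<and> ((N21 c s + N22 c s) *v v) \<bullet> v \<le> - \<delta> * (norm v)\<^sup>2" by blast
    then show ?case by (simp add: um um' inner_minus_left) (smt (verit))
  qed
  obtain ub1 where ub1: "ub1 \<in> admissible P T Y"
    and opt1: "\<And>u. u \<in> M2 \<Longrightarrow> player_cost ?b1 (N11 c) (N12 c) ub1 \<le> player_cost ?b1 (N11 c) (N12 c) u"
    by (rule player_optimum[OF b1 L1(19,20) \<delta> co1]) blast
  obtain ub2 where ub2: "ub2 \<in> admissible P T Y"
    and opt2: "\<And>u. u \<in> M2 \<Longrightarrow> player_cost ?b2 (N21 c) (N22 c) u \<le> player_cost ?b2 (N21 c) (N22 c) ub2"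
    by (rule player_optimum[OF neg[OF b2] neg[OF L1(21)] neg[OF L1(22)] \<delta> co2]) (auto simp: player_cost_uminus)
  have saddle: "J P T W Y c ub1 u2 \<le> J P T W Y c ub1 ub2" "J P T W Y c ub1 ub2 \<le> J P T W Y c u1 ub2"
    if "u1 \<in> admissible P T Y" "u2 \<in> admissible P T Y" for u1 u2
    using that ub1 ub2 opt1[of u1] opt2[of u2] by (simp_all add: J admissible_M2)
  have "(SUP u2\<in>admissible P T Y. INF u1\<in>admissible P T Y. ereal (J P T W Y c u1 u2)) =
        (INF u1\<in>admissible P T Y. SUP u2\<in>admissible P T Y. ereal (J P T W Y c u1 u2))"
    by (rule minimax_of_saddle_point[OF ub1 ub2]) (use saddle ub1 ub2 in auto)
  then show ?thesis using saddle ub1 ub2 by blast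
qed

end
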